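(* Let $1\le r<n-1$, let $t_0\in(0,T)$, and let $a_0$ and $m_0$ be the associated numbers (with $T$, $a_0$, $m_0$ as defined in the context). Let $M$ be a compact, connected and embedded $r$-minimal hypersurface in $\mathbb{H}^n\times\mathbb{R}$ with boundary contained in $\Pi_{t_0}\cup\Pi_{-t_0}$, with $\partial M_+=\partial M\cap\Pi_{t_0}\neq\emptyset$ and $\partial M_-=\partial M\cap\Pi_{-t_0}\neq\emptyset$. Suppose that $\partial M_+\subset D_+(m_0)$ and $\partial M_-\subset D_-(m_0)$. Then $M$ coincides with the unique $r$-minimal rotational hypersurface with boundary $D_+(m_0)\cup D_-(m_0)$, namely the part of $\mathcal{M}_{a_0}(r)$ contained in $\{|t|\le t_0\}$.
   Context: $\mathbb{H}^n$ is hyperbolic $n$-space in the unit ball model and $\mathbb{H}^n\times\mathbb{R}$ (coordinates $(x,t)$) has the product metric $g_{\mathbb{H}}+dt^2$. For an oriented hypersurface with principal curvatures $k_1,\dots,k_n$, $H_j$ is defined by $\binom{n}{j}H_{j}=\sum_{i_1<\dots<i_{j}}k_{i_1}\cdots k_{i_{j}}$. The hypersurface is $r$-minimal if $H_{r+1}=0$. $\Pi_s=\mathbb{H}^n\times\{s\}$. A rotational hypersurface (about the axis $\{0\}\times\mathbb{R}$) is one parametrized by $(t,\zeta)\mapsto(\tanh(f(t)/2)\zeta,t)$, $\zeta\in S^{n-1}$, $t$ in an interval, with $f$ a positive function. Let $q=\frac{n-r-1}{r+1}$. For $a>0$ let $f(a,\cdot)$ be the maximal solution, defined on $(-L(a),L(a))$,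 of $f_{tt}=q\coth(f)(1+f_t^2)$, $f(0)=a$, $f_t(0)=0$. Set $$\mathcal{M}_a(r)=\{(\tanh(f(a,t)/2)\zeta,t): \zeta\in S^{n-1},\ |t|<L(a)\}.$$ The function $L$ is increasing from $0$ to $\frac{\pi(r+1)}{2(n-r-1)}$ as $a$ goes from $0$ to $\infty$. For $0<a<\rho$ set $$\lambda(a,\rho)=\int_1^{\sinh\rho/\sinh a}(v^{2q}-1)^{-1/2}\sinh(a)\,(1+v^2\sinh^2 a)^{-1/2}\,dv .$$ If $q\ge1$ put $T=\frac{\pi(r+1)}{2(n-r-1)}$. If $q<1$ put $M_q=\operatorname{arcosh}\sqrt{\frac1{1-q}}$ and $T=\lambda(A,M_q)$, where $A$ is the unique maximum point of $a\mapsto\lambda(a,M_q)$ on $(0,M_q)$. For $t_0\in(0,T)$ let $\alpha$ be such that $L(\alpha)=t_0$. The function $\phi^{t_0}(a)=f(a,t_0)$, $a\in(\alpha,\infty)$, attains its minimum value $m_0$ at a unique point $a_0$. $D_+(R)$ and $D_-(R)$ are the two $(n-1)$-spheres of (hyperbolic) radius $R$ contained in the slices $t=t_0$ and $t=-t_0$ respectively, centered on the axis $\{0\}\times\mathbb{R}$. *)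

theory Defs
  imports "HOL-Analysis.Analysis"
begin

section \<open>Smooth maps\<close>

text \<open>The following two notions are meant for open sets \<open>S\<close> only.\<close>

primrec Ck_on :: "nat \<Rightarrow> 'a::real_normed_vector set \<Rightarrow> ('a \<Rightarrow> 'b::real_normed_vector) \<Rightarrow> bool" where
  "Ck_on 0 S f \<longleftrightarrow> continuous_on S f"
| "Ck_on (Suc k) S f \<longleftrightarrow> (\<forall>x\<in>S. f differentiable (at x)) \<and>
     (\<forall>v. Ck_on k S (\<lambda>x. frechet_derivative f (at x) v))"

definition smooth_on :: "'a::real_normed_vector set \<Rightarrow> ('a \<Rightarrow> 'b::real_normed_vector) \<Rightarrow> bool" where
  "smooth_on S f \<longleftrightarrow> (\<forall>k. Ck_on k S f)"

definition diffeo_on :: "'a::real_normed_vector set \<Rightarrow> ('a \<Rightarrow> 'b::real_normed_vector) \<Rightarrow> bool" where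
  "diffeo_on U \<Phi> \<longleftrightarrow> open U \<and> open (\<Phi> ` U) \<and> inj_on \<Phi> U \<and>
     smooth_on U \<Phi> \<and> smooth_on (\<Phi> ` U) (inv_into U \<Phi>)"


section \<open>The product of hyperbolic space and the line\<close>

text \<open>A point \<open>(x, t)\<close> has \<open>x\<close> in the open unit ball of \<open>real^'n\<close>, so that \<open>n = CARD('n)\<close>;
  tangent vectors are identified with elements of \<open>real^'n \<times> real\<close>.\<close>

type_synonym 'n amb = "(real^'n) \<times> real"

definition HxR :: "'n::finite amb set" where
  "HxR = ball 0 1 \<times> UNIV"

definition slice :: "real \<Rightarrow> 'n::finite amb set" where
  "slice s = ball 0 1 \<times> {s}"

definition metric :: "'n::finite amb \<Rightarrow> 'n amb \<Rightarrow> 'n amb \<Rightarrow> real" where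
  "metric p u v = (2 / (1 - (norm (fst p))\<^sup>2))\<^sup>2 * (fst u \<bullet> fst v) + snd u * snd v"

definition hyp_dist :: "real^'n::finite \<Rightarrow> real^'n \<Rightarrow> real" where
  "hyp_dist x y = arcosh (1 + 2 * (norm (x - y))\<^sup>2 / ((1 - (norm x)\<^sup>2) * (1 - (norm y)\<^sup>2)))"

definition axis_sphere :: "real \<Rightarrow> real \<Rightarrow> 'n::finite amb set" where
  "axis_sphere R s = {(x, s) | x. x \<in> ball 0 1 \<and> hyp_dist 0 x = R}"

definition dmetric :: "'n::finite amb \<Rightarrow> 'n amb \<Rightarrow> 'n amb \<Rightarrow> 'n amb \<Rightarrow> real" where
  "dmetric p u v w = frechet_derivative (\<lambda>x. metric x v w) (at p) u"

text \<open>The Christoffel symbols: \<open>christoffel p u v\<close> is the Levi-Civita derivative at \<open>p\<close>, in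
  direction \<open>u\<close>, of the constant vector field \<open>v\<close>, which is determined by the Koszul formula.\<close>

definition christoffel :: "'n::finite amb \<Rightarrow> 'n amb \<Rightarrow> 'n amb \<Rightarrow> 'n amb" where
  "christoffel p u v = (THE z. \<forall>w.
     2 * metric p z w = dmetric p u v w + dmetric p v u w - dmetric p w u v)"

definition cov_deriv :: "('n::finite amb \<Rightarrow> 'n amb) \<Rightarrow> 'n amb \<Rightarrow> 'n amb \<Rightarrow> 'n amb" where
  "cov_deriv Y p u = frechet_derivative Y (at p) u + christoffel p u (Y p)"

lemma dmetric_eq:
  fixes p :: "'n::finite amb"
  assumes "p \<in> HxR"
  shows "dmetric p u v w = 16 * (fst p \<bullet> fst u) / (1 - (norm (fst p))\<^sup>2) ^ 3 * (fst v \<bullet> fst w)"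
proof -
  have "norm (fst p) < 1"
    using assms by (auto simp: HxR_def)
  then have "(norm (fst p))\<^sup>2 < 1"
    by (simp add: power_less_one_iff)
  then have ne: "1 - fst p \<bullet> fst p \<noteq> 0"
    by (simp add: power2_norm_eq_inner)
  have "((\<lambda>x. metric x v w) has_derivative
      (\<lambda>u. 16 * (fst p \<bullet> fst u) / (1 - (norm (fst p))\<^sup>2) ^ 3 * (fst v \<bullet> fst w))) (at p)"
    unfolding metric_def power2_norm_eq_inner using ne
    apply (auto intro!: derivative_eq_intros)
    apply (rule ext)
    apply (simp add: inner_commute divide_simps power2_eq_square power3_eq_cube)
    done
  then show ?thesis
    unfolding dmetric_def by (metis frechet_derivative_at)
qed

lemma christoffel_eq:
  fixes p :: "'n::finite amb"
  assumes "p \<in> HxR"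
  shows "christoffel p u v = ((2 / (1 - (norm (fst p))\<^sup>2)) *\<^sub>R
    ((fst p \<bullet> fst u) *\<^sub>R fst v + (fst p \<bullet> fst v) *\<^sub>R fst u - (fst u \<bullet> fst v) *\<^sub>R fst p), 0)"
    (is "_ = ?z")
proof -
  have "norm (fst p) < 1"
    using assms by (auto simp: HxR_def)
  then have "(norm (fst p))\<^sup>2 < 1"
    by (simp add: power_less_one_iff)
  then have ne: "1 - (norm (fst p))\<^sup>2 \<noteq> 0"
    by simp
  have *: "2 * metric p ?z w = dmetric p u v w + dmetric p v u w - dmetric p w u v" for w
    unfolding dmetric_eq[OF assms] metric_def using ne
    by (simp add: inner_add_left inner_diff_left divide_simps power2_eq_square power3_eq_cube)
  show ?thesis
    unfolding christoffel_def
  proof (rule the_equality)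
    show "\<forall>w. 2 * metric p ?z w = dmetric p u v w + dmetric p v u w - dmetric p w u v"
      using * by blast
  next
    fix z
    assume "\<forall>w. 2 * metric p z w = dmetric p u v w + dmetric p v u w - dmetric p w u v"
    then have eq: "metric p z w = metric p ?z w" for w
      using *[of w] by (metis mult_left_cancel zero_neq_numeral)
    have "fst z \<bullet> y = fst ?z \<bullet> y" for y
    proof -
      have "(2 / (1 - (norm (fst p))\<^sup>2))\<^sup>2 * (fst z \<bullet> y) = (2 / (1 - (norm (fst p))\<^sup>2))\<^sup>2 * (fst ?z \<bullet> y)"
        using eq[of "(y, 0)"] unfolding metric_def by simp
      moreover have "(2 / (1 - (norm (fst p))\<^sup>2))\<^sup>2 \<noteq> 0"
        using ne by simp
      ultimately show ?thesis
        using mult_left_cancel by blast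
    qed
    then have "fst z = fst ?z"
      using vector_eq_rdot by blast
    moreover have "snd z = snd ?z"
      using eq[of "(0, 1)"] by (simp add: metric_def)
    ultimately show "z = ?z"
      by (simp add: prod_eq_iff)
  qed
qed


section \<open>Embedded hypersurfaces with boundary\<close>

definition slice_chart :: "'n::finite amb set \<Rightarrow> 'n amb set \<Rightarrow> ('n amb \<Rightarrow> 'n amb) \<Rightarrow> bool" where
  "slice_chart M U \<Phi> \<longleftrightarrow> diffeo_on U \<Phi> \<and> M \<inter> U = {x\<in>U. snd (\<Phi> x) = 0}"

definition half_slice_chart ::
  "'n::finite amb set \<Rightarrow> 'n amb set \<Rightarrow> ('n amb \<Rightarrow> 'n amb) \<Rightarrow> 'n \<Rightarrow> bool" where
  "half_slice_chart M U \<Phi> i \<longleftrightarrow>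
     diffeo_on U \<Phi> \<and> M \<inter> U = {x\<in>U. snd (\<Phi> x) = 0 \<and> 0 \<le> fst (\<Phi> x) $ i}"

definition hypersurface :: "'n::finite amb set \<Rightarrow> bool" where
  "hypersurface M \<longleftrightarrow> M \<subseteq> HxR \<and>
     (\<forall>p\<in>M. \<exists>U \<Phi>. p \<in> U \<and> (slice_chart M U \<Phi> \<or> (\<exists>i. half_slice_chart M U \<Phi> i)))"

definition boundary :: "'n::finite amb set \<Rightarrow> 'n amb set" where
  "boundary M = {p\<in>M. \<exists>U \<Phi> i. p \<in> U \<and> half_slice_chart M U \<Phi> i \<and> fst (\<Phi> p) $ i = 0}"

text \<open>At a boundary point this is the full \<open>n\<close>-dimensional tangent space.\<close>

definition tangent_space :: "'n::finite amb set \<Rightarrow> 'n amb \<Rightarrow> 'n amb set" where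
  "tangent_space M p = {v. \<exists>U \<Phi>. p \<in> U \<and> (slice_chart M U \<Phi> \<or> (\<exists>i. half_slice_chart M U \<Phi> i)) \<and>
     snd (frechet_derivative \<Phi> (at p) v) = 0}"

text \<open>\<open>N\<close> is defined on an open set of the ambient space, but for tangent directions its covariant
  derivative depends on the restriction of \<open>N\<close> to \<open>M\<close> only.\<close>

definition unit_normal_on :: "'n::finite amb set \<Rightarrow> 'n amb set \<Rightarrow> ('n amb \<Rightarrow> 'n amb) \<Rightarrow> bool" where
  "unit_normal_on M U N \<longleftrightarrow> open U \<and> smooth_on U N \<and>
     (\<forall>x\<in>M \<inter> U. metric x (N x) (N x) = 1 \<and> (\<forall>v\<in>tangent_space M x. metric x (N x) v = 0))"

text \<open>The principal curvatures, with multiplicity, are a family \<open>k\<close> over the \<open>n\<close>-element type \<open>'n\<close>: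
  the eigenvalues of the shape operator for an orthonormal basis \<open>e\<close> of the tangent space.\<close>

definition principal_curvatures ::
  "'n::finite amb set \<Rightarrow> ('n amb \<Rightarrow> 'n amb) \<Rightarrow> 'n amb \<Rightarrow> ('n \<Rightarrow> real) \<Rightarrow> bool" where
  "principal_curvatures M N p k \<longleftrightarrow> (\<exists>e :: 'n \<Rightarrow> 'n amb.
     (\<forall>i. e i \<in> tangent_space M p) \<and>
     (\<forall>i j. metric p (e i) (e j) = (if i = j then 1 else 0)) \<and>
     (\<forall>i. - cov_deriv N p (e i) = k i *\<^sub>R e i))"

definition mean_curvature :: "nat \<Rightarrow> ('n::finite \<Rightarrow> real) \<Rightarrow> real" where
  "mean_curvature j k =
     (\<Sum>I | I \<subseteq> (UNIV :: 'n set) \<and> card I = j. \<Prod>i\<in>I. k i) / real (CARD('n) choose j)"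

text \<open>The equation is invariant under \<open>N \<mapsto> -N\<close>, so that a local choice of orientation suffices.\<close>

definition r_minimal :: "nat \<Rightarrow> 'n::finite amb set \<Rightarrow> bool" where
  "r_minimal r M \<longleftrightarrow> (\<forall>p\<in>M. \<exists>U N k. p \<in> U \<and> unit_normal_on M U N \<and>
     principal_curvatures M N p k \<and> mean_curvature (r + 1) k = 0)"

text \<open>Smoothness of the profile \<open>f\<close> on the (not necessarily open) interval \<open>I\<close> means that it extends
  smoothly to an open set.\<close>

definition rotational :: "'n::finite amb set \<Rightarrow> bool" where
  "rotational S \<longleftrightarrow> (\<exists>I J f. is_interval I \<and> open J \<and> I \<subseteq> J \<and> smooth_on J f \<and> (\<forall>t\<in>I. 0 < f t) \<and>
     S = {(tanh (f t / 2) *\<^sub>R \<zeta>, t) | \<zeta> t. norm \<zeta> = 1 \<and> t \<in> (I :: real set)})"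


section \<open>The rotational r-minimal hypersurfaces\<close>

definition profile_on :: "real \<Rightarrow> real \<Rightarrow> real set \<Rightarrow> (real \<Rightarrow> real) \<Rightarrow> bool" where
  "profile_on q a J f \<longleftrightarrow> (\<forall>t\<in>J. 0 < f t) \<and> f 0 = a \<and>
     (\<exists>f'. f' 0 = 0 \<and> (\<forall>t\<in>J. (f has_real_derivative f' t) (at t) \<and>
        (f' has_real_derivative q * (cosh (f t) / sinh (f t)) * (1 + (f' t)\<^sup>2)) (at t)))"

definition maximal_profile :: "real \<Rightarrow> real \<Rightarrow> real \<Rightarrow> (real \<Rightarrow> real) \<Rightarrow> bool" where
  "maximal_profile q a l f \<longleftrightarrow> 0 < l \<and> profile_on q a {-l<..<l} f \<and>
     (\<forall>J g. open J \<and> is_interval J \<and> 0 \<in> J \<and> profile_on q a J g \<longrightarrow> J \<subseteq> {-l<..<l})"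

definition catenoid :: "real \<Rightarrow> (real \<Rightarrow> real) \<Rightarrow> 'n::finite amb set" where
  "catenoid l f = {(tanh (f t / 2) *\<^sub>R \<zeta>, t) | \<zeta> t. norm \<zeta> = 1 \<and> \<bar>t\<bar> < l}"

definition lam :: "real \<Rightarrow> real \<Rightarrow> real \<Rightarrow> real" where
  "lam q a \<rho> = integral {1..sinh \<rho> / sinh a}
     (\<lambda>v. (v powr (2 * q) - 1) powr (-1/2) * sinh a * (1 + v\<^sup>2 * (sinh a)\<^sup>2) powr (-1/2))"

end

theory Submission
  imports Defs
begin

text \<open>
  The hypersurfaces \<open>\<M>\<^sub>a\<close> sweep out the slab, and \<open>M\<close> is compared with all of them by means of
  the maximum principle. Write \<open>gap (f a)\<close> for the function \<open>cosh d - cosh (f a t)\<close>, where \<open>d\<close> is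
  the hyperbolic distance to the axis: it vanishes on \<open>\<M>\<^sub>a\<close>, is negative on the side of the axis
  and positive outside.

  The maximum principle rests on one comparison at a single point (\<open>one_point_comparison\<close>): where
  the restriction to \<open>M\<close> of a function \<open>F\<close> has an interior local maximum, the covariant Hessian of
  \<open>F\<close> on the tangent space is bounded by a multiple of the second fundamental form of \<open>M\<close>, whose
  elementary symmetric function of degree \<open>r + 1\<close> is zero. For the rotational hypersurfaces the
  principal curvatures are proportional to \<open>1, \<dots>, 1, -q\<close>. This is an isolated kind of zero of the
  symmetric function: a tuple almost bounded below by this one, and with a slightly larger trace,
  cannot be a zero (\<open>esym_nonzero\<close>). Adding \<open>\<epsilon> exp (- K s)\<close> to \<open>gap (f a)\<close>, with \<open>s\<close> any function
  whose gradient is transversal to that of the gap, provides precisely this surplus of trace, so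
  that the sum has no interior local maximum on \<open>M\<close> close to \<open>\<M>\<^sub>a\<close> (\<open>no_local_max_near_profile\<close>).
  With \<open>s\<close> the squared distance from a point this is the strong maximum principle
  (\<open>strong_maximum\<close>), with \<open>s = \<plusminus>t\<close> it is a boundary point estimate in the manner of Hopf
  (\<open>boundary_slope\<close>). No regularity of \<open>M\<close> as a graph over \<open>\<M>\<^sub>a\<close> and no ellipticity of the
  equation on other hypersurfaces is involved.

  Let \<open>E\<close> be the set of all \<open>a\<close> for which \<open>M\<close> contains a point on or outside \<open>\<M>\<^sub>a\<close>. It is
  closed in \<open>{0<..}\<close> and bounded, and it contains arbitrarily small \<open>a\<close>: otherwise \<open>M\<close> would near
  the axis be confined to a double cone \<open>|t| \<ge> c |x|\<close>, and, being connected, would have to pass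
  smoothly through its vertex (\<open>E_small\<close>). If \<open>a \<in> E\<close> is isolated in \<open>E\<close> from the right, then \<open>M\<close>
  lies inside \<open>\<M>\<^sub>a\<close> and touches it. By the strong maximum principle the contact set reaches the
  boundary of the slab, where it must consist of boundary points of \<open>M\<close> (\<open>wedge\<close>, \<open>touching\<close>).
  Hence \<open>f a t\<^sub>0 = m\<^sub>0\<close>, and as \<open>m\<^sub>0\<close> is the minimum of \<open>a \<mapsto> f a t\<^sub>0\<close> and \<open>a\<^sub>0\<close> its only
  minimum point, \<open>a = a\<^sub>0\<close>. In particular \<open>a\<^sub>0\<close> is the maximum of \<open>E\<close>. Suppose that \<open>M\<close> touches
  \<open>\<M>\<close> of parameter \<open>a\<^sub>0\<close> only on the boundary of the slab. By the boundary point estimate \<open>M\<close>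
  separates from it at a positive angle, while the hypersurfaces with slightly smaller parameter
  are wider at \<open>t = \<plusminus>t\<^sub>0\<close> because \<open>m\<^sub>0\<close> is the minimum; so \<open>M\<close> lies strictly inside all of them
  (\<open>parameter_gap\<close>). Then the largest element of \<open>E\<close> below \<open>a\<^sub>0\<close> is isolated from the right, hence
  equal to \<open>a\<^sub>0\<close>, which is absurd. So there is an interior contact point, \<open>M\<close> contains the whole
  part of \<open>\<M>\<close> in the slab, and this part is open and closed in \<open>M\<close> (\<open>unique_hypersurface\<close>).

  Conversely this part is an \<open>r\<close>-minimal hypersurface with the two spheres as its boundary, by
  explicit charts and an explicit unit normal. Any rotational hypersurface with this boundary is
  compact and connected, because an interior point of its interval of heights gives no boundary
  point; so the first part of the theorem applies to it as well.
\<close>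

section \<open>Calculus of smooth maps\<close>

lemma frechet_derivative_eqI:
  "(f has_derivative f') (at x) \<Longrightarrow> frechet_derivative f (at x) = f'"
  using frechet_derivative_at by metis

lemma Ck_on_cong:
  assumes "open S" "\<And>x. x \<in> S \<Longrightarrow> f x = g x" "Ck_on k S f"
  shows "Ck_on k S g"
  using assms(2,3)
proof (induction k arbitrary: f g)
  case 0
  then show ?case by (simp cong: continuous_on_cong)
next
  case (Suc k)
  have D: "(g has_derivative frechet_derivative f (at x)) (at x)" if "x \<in> S" for x
  proof -
    have "(f has_derivative frechet_derivative f (at x)) (at x)"
      using Suc.prems(2) that frechet_derivative_works by auto
    then show ?thesis
      by (rule has_derivative_transform_within_open[OF _ \<open>open S\<close> that]) (use Suc.prems in auto)
  qed
  have "Ck_on k S (\<lambda>x. frechet_derivative g (at x) v)" for v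
    by (rule Suc.IH[of "\<lambda>x. frechet_derivative f (at x) v"])
       (use Suc.prems D frechet_derivative_eqI in \<open>fastforce+\<close>)
  then show ?case
    using D by (auto simp: differentiable_def)
qed

lemma Ck_on_subset: "Ck_on k S f \<Longrightarrow> T \<subseteq> S \<Longrightarrow> Ck_on k T f"
  by (induction k arbitrary: f) (auto intro: continuous_on_subset)

lemma Ck_on_imp_continuous_on: "Ck_on k S f \<Longrightarrow> continuous_on S f"
  by (cases k) (auto intro!: continuous_at_imp_continuous_on differentiable_imp_continuous_within)

lemma Ck_on_decrease: "Ck_on (Suc k) S f \<Longrightarrow> Ck_on k S f"
proof (induction k arbitrary: f)
  case 0
  show ?case using Ck_on_imp_continuous_on[OF 0] by simp
qed simp

text \<open>The definition of \<open>Ck_on\<close> is in terms of \<open>frechet_derivative\<close>, which is given by a description; this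
  rule and its version for real functions allow any explicit formula for the derivative instead.\<close>

lemma Ck_on_SucI:
  assumes "open S" "\<And>x. x \<in> S \<Longrightarrow> (f has_derivative f' x) (at x)"
    "\<And>v. Ck_on k S (\<lambda>x. f' x v)"
  shows "Ck_on (Suc k) S f"
proof -
  have "Ck_on k S (\<lambda>x. frechet_derivative f (at x) v)" for v
    by (rule Ck_on_cong[OF assms(1) _ assms(3)[of v]])
      (use assms(2) frechet_derivative_eqI in fastforce)
  then show ?thesis
    using assms(2) by (auto simp: differentiable_def)
qed

lemma Ck_on_has_derivative:
  "Ck_on (Suc k) S f \<Longrightarrow> x \<in> S \<Longrightarrow> (f has_derivative frechet_derivative f (at x)) (at x)"
  using frechet_derivative_works by auto

lemma Ck_on_const: "open S \<Longrightarrow> Ck_on k S (\<lambda>x. c)"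
proof (induction k arbitrary: c)
  case (Suc k)
  show ?case by (rule Ck_on_SucI[where f' = "\<lambda>x v. 0"]) (use Suc in auto)
qed auto

lemma Ck_on_linear:
  assumes "open S" "bounded_linear f"
  shows "Ck_on k S f"
proof (cases k)
  case 0
  then show ?thesis using assms by (simp add: linear_continuous_on)
next
  case (Suc j)
  then show ?thesis
    using Ck_on_SucI[of S f "\<lambda>x. f" j] assms Ck_on_const by (auto intro: bounded_linear_imp_has_derivative)
qed

lemma Ck_on_add:
  assumes "open S" "Ck_on k S f" "Ck_on k S g"
  shows "Ck_on k S (\<lambda>x. f x + g x)"
  using assms(2,3)
proof (induction k arbitrary: f g)
  case (Suc k)
  show ?case
  proof (rule Ck_on_SucI[OF assms(1)])
    show "((\<lambda>x. f x + g x) has_derivative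
        (\<lambda>v. frechet_derivative f (at x) v + frechet_derivative g (at x) v)) (at x)" if "x \<in> S" for x
      by (rule has_derivative_add[OF Ck_on_has_derivative[OF Suc.prems(1) that] Ck_on_has_derivative[OF Suc.prems(2) that]])
    show "Ck_on k S (\<lambda>x. frechet_derivative f (at x) v + frechet_derivative g (at x) v)" for v
      by (rule Suc.IH) (use Suc.prems in simp_all)
  qed
qed (auto intro: continuous_intros)

lemma Ck_on_scaleR:
  fixes u :: "'a::real_normed_vector \<Rightarrow> real"
  assumes "open S" "Ck_on k S u" "Ck_on k S g"
  shows "Ck_on k S (\<lambda>x. u x *\<^sub>R g x)"
  using assms(2,3)
proof (induction k arbitrary: u g)
  case (Suc k)
  have lower: "Ck_on k S u" "Ck_on k S g"
    using Suc.prems Ck_on_decrease by blast+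
  show ?case
  proof (rule Ck_on_SucI[OF assms(1)])
    show "((\<lambda>x. u x *\<^sub>R g x) has_derivative
        (\<lambda>v. u x *\<^sub>R frechet_derivative g (at x) v + frechet_derivative u (at x) v *\<^sub>R g x)) (at x)"
      if "x \<in> S" for x
      by (rule has_derivative_scaleR[OF Ck_on_has_derivative[OF Suc.prems(1) that] Ck_on_has_derivative[OF Suc.prems(2) that]])
    show "Ck_on k S (\<lambda>x. u x *\<^sub>R frechet_derivative g (at x) v + frechet_derivative u (at x) v *\<^sub>R g x)" for v
      by (intro Ck_on_add assms(1) Suc.IH) (use Suc.prems lower in simp_all)
  qed
qed (auto intro: continuous_intros)

lemma Ck_on_mult:
  fixes u :: "'a::real_normed_vector \<Rightarrow> real"
  assumes "open S" "Ck_on k S u" "Ck_on k S g"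
  shows "Ck_on k S (\<lambda>x. u x * g x)"
  using Ck_on_scaleR[OF assms] by simp

lemma Ck_on_minus:
  assumes "open S" "Ck_on k S f"
  shows "Ck_on k S (\<lambda>x. - f x)"
  using Ck_on_scaleR[OF assms(1) Ck_on_const[OF assms(1), of k "-1"] assms(2)] by simp

lemma Ck_on_diff:
  assumes "open S" "Ck_on k S f" "Ck_on k S g"
  shows "Ck_on k S (\<lambda>x. f x - g x)"
  using Ck_on_add[OF assms(1,2) Ck_on_minus[OF assms(1,3)]] by simp

lemma Ck_on_sum:
  assumes "open S" "\<And>i. i \<in> I \<Longrightarrow> Ck_on k S (f i)"
  shows "Ck_on k S (\<lambda>x. \<Sum>i\<in>I. f i x)"
  using assms(2)
proof (induction I rule: infinite_finite_induct)
  case (insert i I)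
  then show ?case
    using Ck_on_add[OF assms(1), of k "f i" "\<lambda>x. \<Sum>i\<in>I. f i x"] by simp
qed (use Ck_on_const[OF assms(1)] in simp_all)

text \<open>Only compositions with an outer function of one real variable occur below. For these the
  chain rule has a single term, so that the general formula for iterated derivatives is avoided.\<close>

lemma Ck_on_compose_real:
  fixes u :: "'a::real_normed_vector \<Rightarrow> real" and g :: "real \<Rightarrow> 'b::real_normed_vector"
  assumes "open S" "Ck_on k S u" "Ck_on k J g" "u ` S \<subseteq> J"
  shows "Ck_on k S (\<lambda>x. g (u x))"
  using assms(2,3)
proof (induction k arbitrary: g)
  case 0
  then show ?case
    using assms(4) by (auto intro: continuous_on_compose2)
next
  case (Suc k)
  define u' where "u' x = frechet_derivative u (at x)" for x
  define g' where "g' y = frechet_derivative g (at y)" for y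
  have D: "((\<lambda>x. g (u x)) has_derivative (\<lambda>v. u' x v *\<^sub>R g' (u x) 1)) (at x)" if "x \<in> S" for x
  proof -
    have du: "(u has_derivative u' x) (at x)" and dg: "(g has_derivative g' (u x)) (at (u x))"
      using Suc.prems that assms(4) Ck_on_has_derivative unfolding u'_def g'_def by blast+
    have "linear (g' (u x))"
      using dg has_derivative_linear by blast
    then have "(\<lambda>v. g' (u x) (u' x v)) = (\<lambda>v. u' x v *\<^sub>R g' (u x) 1)"
      using linear_scale[of "g' (u x)" "u' x _" 1] by (intro ext) simp
    then show ?thesis
      using has_derivative_compose[OF du dg] by simp
  qed
  have lower: "Ck_on k S u"
    using Suc.prems Ck_on_decrease by blast
  have "Ck_on k S (\<lambda>x. g' (u x) 1)"
    by (rule Suc.IH[OF lower]) (use Suc.prems in \<open>simp add: g'_def\<close>)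
  moreover have "Ck_on k S (\<lambda>x. u' x v)" for v
    using Suc.prems unfolding u'_def by simp
  ultimately show ?case
    by (intro Ck_on_SucI[OF assms(1) D] Ck_on_scaleR[OF assms(1)])
qed

lemma Ck_on_SucI_real:
  fixes g :: "real \<Rightarrow> real"
  assumes "open J" "\<And>y. y \<in> J \<Longrightarrow> (g has_real_derivative g' y) (at y)" "Ck_on k J g'"
  shows "Ck_on (Suc k) J g"
proof (rule Ck_on_SucI[OF assms(1)])
  show "(g has_derivative (\<lambda>v. g' y * v)) (at y)" if "y \<in> J" for y
    using assms(2)[OF that] by (simp add: has_field_derivative_def)
  show "Ck_on k J (\<lambda>x. g' x * v)" for v
    by (intro Ck_on_mult Ck_on_const assms)
qed

lemma Ck_on_cosh_sinh: "Ck_on k UNIV (cosh :: real \<Rightarrow> real) \<and> Ck_on k UNIV (sinh :: real \<Rightarrow> real)"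
proof (induction k)
  case (Suc k)
  have "Ck_on (Suc k) UNIV (cosh :: real \<Rightarrow> real)"
    by (rule Ck_on_SucI_real[where g' = sinh]) (use Suc in \<open>auto intro!: derivative_eq_intros\<close>)
  moreover have "Ck_on (Suc k) UNIV (sinh :: real \<Rightarrow> real)"
    by (rule Ck_on_SucI_real[where g' = cosh]) (use Suc in \<open>auto intro!: derivative_eq_intros\<close>)
  ultimately show ?case ..
qed (auto intro!: continuous_intros)

lemma Ck_on_inverse: "Ck_on k (- {0}) (inverse :: real \<Rightarrow> real)"
proof (induction k)
  case (Suc k)
  have "Ck_on k (- {0}) (\<lambda>y::real. - (inverse y * inverse y))"
    by (intro Ck_on_minus Ck_on_mult Suc) auto
  then show ?case
    by (intro Ck_on_SucI_real[where g' = "\<lambda>y. - (inverse y * inverse y)"])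
      (auto intro!: derivative_eq_intros)
qed (auto intro!: continuous_intros)

lemma Ck_on_sqrt: "Ck_on k {0<..} (sqrt :: real \<Rightarrow> real)"
proof (induction k)
  case (Suc k)
  have "Ck_on k {0<..} (\<lambda>y. inverse (sqrt y) * (1/2))"
    by (intro Ck_on_mult Ck_on_const Ck_on_compose_real[OF _ Suc Ck_on_inverse]) auto
  then show ?case
    by (intro Ck_on_SucI_real[where g' = "\<lambda>y. inverse (sqrt y) * (1/2)"])
      (auto intro!: DERIV_real_sqrt[THEN DERIV_cong])
qed (auto intro!: continuous_intros)

section \<open>Charts and curves\<close>

lemma gradient_multiple:
  fixes \<nu> g :: "'a::real_inner"
  assumes "\<And>v. \<nu> \<bullet> v = 0 \<Longrightarrow> g \<bullet> v = 0"
  shows "\<exists>c. g = c *\<^sub>R \<nu>"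
proof (cases "\<nu> = 0")
  case True
  then have "g \<bullet> g = 0" using assms by simp
  then show ?thesis using True by simp
next
  case False
  define c where "c = (\<nu> \<bullet> g) / (\<nu> \<bullet> \<nu>)"
  have o: "\<nu> \<bullet> (g - c *\<^sub>R \<nu>) = 0"
    using False by (simp add: c_def inner_diff_right)
  then have "(g - c *\<^sub>R \<nu>) \<bullet> (g - c *\<^sub>R \<nu>) = 0"
    using assms[OF o] by (simp add: inner_diff_left)
  then show ?thesis by auto
qed

lemma linear_functional_inner:
  fixes g :: "'a::euclidean_space \<Rightarrow> real"
  assumes "linear g"
  shows "\<exists>\<nu>. \<forall>v. g v = \<nu> \<bullet> v"
proof (intro exI allI)
  show "g v = adjoint g 1 \<bullet> v" for v
    using adjoint_works[OF assms, of v 1] by (simp add: inner_commute)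
qed

lemma smooth_onD: "smooth_on S f \<Longrightarrow> Ck_on k S f"
  unfolding smooth_on_def by (rule spec)

lemma smooth_on_has_derivative:
  "smooth_on S f \<Longrightarrow> x \<in> S \<Longrightarrow> (f has_derivative frechet_derivative f (at x)) (at x)"
  by (rule Ck_on_has_derivative[OF smooth_onD])

lemma diffeo_on_derivative_inverse:
  assumes "diffeo_on U \<Phi>" "p \<in> U"
  shows "frechet_derivative (inv_into U \<Phi>) (at (\<Phi> p)) (frechet_derivative \<Phi> (at p) v) = v"
    and "frechet_derivative \<Phi> (at p) (frechet_derivative (inv_into U \<Phi>) (at (\<Phi> p)) w) = w"
proof -
  note d = assms(1)[unfolded diffeo_on_def]
  have a: "(\<Phi> has_derivative frechet_derivative \<Phi> (at p)) (at p)"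
    using d assms(2) smooth_on_has_derivative by blast
  have b: "(inv_into U \<Phi> has_derivative frechet_derivative (inv_into U \<Phi>) (at (\<Phi> p))) (at (\<Phi> p))"
    using d assms(2) smooth_on_has_derivative by blast
  have "((\<lambda>x. inv_into U \<Phi> (\<Phi> x)) has_derivative (\<lambda>v. v)) (at p)"
    by (rule has_derivative_transform_within_open[OF has_derivative_ident _ assms(2)])
      (use d in \<open>auto simp: inv_into_f_f\<close>)
  from has_derivative_unique[OF has_derivative_compose[OF a b] this]
  show "frechet_derivative (inv_into U \<Phi>) (at (\<Phi> p)) (frechet_derivative \<Phi> (at p) v) = v"
    by metis
  have "((\<lambda>y. \<Phi> (inv_into U \<Phi> y)) has_derivative (\<lambda>v. v)) (at (\<Phi> p))"
    by (rule has_derivative_transform_within_open[OF has_derivative_ident, of "\<Phi> ` U"])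
      (use d assms(2) in \<open>auto simp: f_inv_into_f\<close>)
  moreover have "(\<Phi> has_derivative frechet_derivative \<Phi> (at p)) (at (inv_into U \<Phi> (\<Phi> p)))"
    using a d assms(2) by simp
  ultimately show "frechet_derivative \<Phi> (at p) (frechet_derivative (inv_into U \<Phi>) (at (\<Phi> p)) w) = w"
    using has_derivative_unique[OF has_derivative_compose[OF b]] by metis
qed

text \<open>Pulling back a straight line through the image of a point gives a curve with prescribed
  velocity whose image stays in every affine subspace that contains the line.\<close>

lemma diffeo_on_line:
  fixes \<Phi> :: "'a::euclidean_space \<Rightarrow> 'b::euclidean_space"
  assumes "diffeo_on U \<Phi>" "p \<in> U"
  obtains \<gamma> \<gamma>' \<delta> where "(0::real) < \<delta>" "\<gamma> 0 = p" "\<gamma>' 0 = v" "isCont \<gamma>' 0"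
    "\<forall>s. \<bar>s\<bar> < \<delta> \<longrightarrow> \<gamma> s \<in> U \<and> \<Phi> (\<gamma> s) = \<Phi> p + s *\<^sub>R frechet_derivative \<Phi> (at p) v \<and>
      (\<gamma> has_vector_derivative \<gamma>' s) (at s) \<and>
      frechet_derivative \<Phi> (at (\<gamma> s)) (\<gamma>' s) = frechet_derivative \<Phi> (at p) v"
proof -
  note d = assms(1)[unfolded diffeo_on_def]
  define w where "w = frechet_derivative \<Phi> (at p) v"
  define l where "l s = \<Phi> p + s *\<^sub>R w" for s :: real
  define \<Psi> where "\<Psi> = inv_into U \<Phi>"
  define \<gamma> where "\<gamma> s = \<Psi> (l s)" for s
  define \<gamma>' where "\<gamma>' s = frechet_derivative \<Psi> (at (l s)) w" for s
  have "open (l -` (\<Phi> ` U))"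
    unfolding l_def by (rule open_vimage) (use d in \<open>auto intro!: continuous_intros\<close>)
  moreover have "0 \<in> l -` (\<Phi> ` U)"
    using assms(2) by (simp add: l_def)
  ultimately obtain \<delta> where \<delta>0: "\<delta> > 0" "ball 0 \<delta> \<subseteq> l -` (\<Phi> ` U)"
    using open_contains_ball by blast
  have \<delta>: "\<delta> > 0" "\<And>s. \<bar>s\<bar> < \<delta> \<Longrightarrow> l s \<in> \<Phi> ` U"
    using \<delta>0 by (auto simp: subset_eq)
  have U: "\<gamma> s \<in> U" and \<Phi>: "\<Phi> (\<gamma> s) = l s" if "\<bar>s\<bar> < \<delta>" for s
    using \<delta>(2)[OF that] by (simp_all add: \<gamma>_def \<Psi>_def inv_into_into f_inv_into_f)
  have 0: "\<gamma> 0 = p"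
    using d assms(2) by (simp add: \<gamma>_def \<Psi>_def l_def)
  have deriv: "(\<gamma> has_vector_derivative \<gamma>' s) (at s)" if "\<bar>s\<bar> < \<delta>" for s
  proof -
    have a: "(\<Psi> has_derivative frechet_derivative \<Psi> (at (l s))) (at (l s))"
      using d \<delta>(2)[OF that] smooth_on_has_derivative unfolding \<Psi>_def by blast
    have b: "(l has_derivative (\<lambda>h. h *\<^sub>R w)) (at s)"
      unfolding l_def by (auto intro!: derivative_eq_intros)
    have "linear (frechet_derivative \<Psi> (at (l s)))"
      using a has_derivative_linear by blast
    then have "frechet_derivative \<Psi> (at (l s)) (h *\<^sub>R w) = h *\<^sub>R \<gamma>' s" for h
      by (simp add: \<gamma>'_def linear_scale)
    then show ?thesis
      using has_derivative_compose[OF b a] by (simp add: has_vector_derivative_def \<gamma>_def[abs_def])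
  qed
  have "Ck_on (Suc 0) (\<Phi> ` U) \<Psi>"
    using d smooth_onD unfolding \<Psi>_def by blast
  then have "continuous_on (\<Phi> ` U) (\<lambda>y. frechet_derivative \<Psi> (at y) w)"
    by simp
  then have c: "isCont (\<lambda>y. frechet_derivative \<Psi> (at y) w) (\<Phi> p)"
    using d assms(2) continuous_on_eq_continuous_at by blast
  have "isCont \<gamma>' 0"
    unfolding \<gamma>'_def
    by (rule isCont_o2[where f = l and g = "\<lambda>y. frechet_derivative \<Psi> (at y) w"])
      (use c in \<open>simp_all add: l_def[abs_def]\<close>)
  moreover have "\<gamma>' 0 = v"
    using diffeo_on_derivative_inverse(1)[OF assms] by (simp add: \<gamma>'_def l_def w_def \<Psi>_def)
  moreover have "frechet_derivative \<Phi> (at (\<gamma> s)) (\<gamma>' s) = w" if "\<bar>s\<bar> < \<delta>" for s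
    using diffeo_on_derivative_inverse(2)[OF assms(1) U[OF that], of w]
    by (simp add: \<Phi>[OF that] \<gamma>'_def \<Psi>_def)
  ultimately show ?thesis
    using that[of \<delta> \<gamma> \<gamma>'] \<delta>(1) 0 U \<Phi> deriv by (simp add: w_def l_def)
qed

text \<open>At a point outside the boundary both kinds of chart lead to the same picture: in a half space
  chart the coordinate that is required to be nonnegative is positive there, hence near the point.\<close>

lemma interior_chart:
  fixes M :: "'n::finite amb set"
  assumes "hypersurface M" "p \<in> M" "p \<notin> boundary M"
  obtains U V and \<Phi> :: "'n amb \<Rightarrow> 'n amb" where "diffeo_on U \<Phi>" "open V" "p \<in> V" "V \<subseteq> U"
    "\<forall>x\<in>V. x \<in> M \<longleftrightarrow> snd (\<Phi> x) = 0"
    "\<forall>x\<in>V. \<forall>v. snd (frechet_derivative \<Phi> (at x) v) = 0 \<longrightarrow> v \<in> tangent_space M x"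
proof -
  obtain U \<Phi> where U: "p \<in> U" "slice_chart M U \<Phi> \<or> (\<exists>i. half_slice_chart M U \<Phi> i)"
    using assms unfolding hypersurface_def by blast
  have T: "v \<in> tangent_space M x" if "x \<in> U" "snd (frechet_derivative \<Phi> (at x) v) = 0" for x v
    using that U(2) unfolding tangent_space_def by blast
  from U(2) show ?thesis
  proof
    assume "slice_chart M U \<Phi>"
    then show ?thesis
      using that[of U \<Phi> U] U(1) T unfolding slice_chart_def diffeo_on_def by blast
  next
    assume "\<exists>i. half_slice_chart M U \<Phi> i"
    then obtain i where h: "half_slice_chart M U \<Phi> i" by blast
    have d: "diffeo_on U \<Phi>" and MU: "\<forall>x\<in>U. x \<in> M \<longleftrightarrow> snd (\<Phi> x) = 0 \<and> 0 \<le> fst (\<Phi> x) $ i"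
      using h unfolding half_slice_chart_def by blast+
    have "fst (\<Phi> p) $ i \<noteq> 0"
      using h U(1) assms(2,3) unfolding boundary_def by blast
    moreover have "0 \<le> fst (\<Phi> p) $ i"
      using MU U(1) assms(2) by blast
    ultimately have pos: "0 < fst (\<Phi> p) $ i" by simp
    define V where "V = {x \<in> U. 0 < fst (\<Phi> x) $ i}"
    have "Ck_on 0 U \<Phi>" "open U"
      using d smooth_onD unfolding diffeo_on_def by blast+
    then have "open (U \<inter> (\<lambda>x. fst (\<Phi> x) $ i) -` {0<..})"
      by (intro continuous_open_preimage) (auto intro!: continuous_intros)
    moreover have "U \<inter> (\<lambda>x. fst (\<Phi> x) $ i) -` {0<..} = V"
      by (auto simp: V_def)
    ultimately have "open V" by simp
    moreover have "\<forall>x\<in>V. x \<in> M \<longleftrightarrow> snd (\<Phi> x) = 0"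
      using MU unfolding V_def by force
    moreover have "p \<in> V" "V \<subseteq> U"
      using pos U(1) by (auto simp: V_def)
    ultimately show ?thesis
      using that[of U \<Phi> V] d T by blast
  qed
qed

text \<open>Every vector of the hyperplane orthogonal to \<open>\<nu>\<close> is the velocity of a curve in \<open>M\<close>. That the
  velocity stays tangent to \<open>M\<close> and is continuous is needed for second derivatives along the curve.\<close>

lemma interior_curves:
  fixes M :: "'n::finite amb set"
  assumes "hypersurface M" "p \<in> M" "p \<notin> boundary M"
  obtains \<nu> :: "'n amb" where "\<nu> \<noteq> 0"
    "\<forall>v. \<nu> \<bullet> v = 0 \<longrightarrow> (\<exists>\<gamma> \<gamma>' \<delta>. 0 < (\<delta>::real) \<and> \<gamma> 0 = p \<and> \<gamma>' 0 = v \<and> isCont \<gamma>' 0 \<and>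
      (\<forall>s. \<bar>s\<bar> < \<delta> \<longrightarrow> \<gamma> s \<in> M \<and> (\<gamma> has_vector_derivative \<gamma>' s) (at s) \<and>
        \<gamma>' s \<in> tangent_space M (\<gamma> s)))"
proof -
  obtain U V and \<Phi> :: "'n amb \<Rightarrow> 'n amb" where c: "diffeo_on U \<Phi>" "open V" "p \<in> V" "V \<subseteq> U"
    "\<forall>x\<in>V. x \<in> M \<longleftrightarrow> snd (\<Phi> x) = 0"
    "\<forall>x\<in>V. \<forall>v. snd (frechet_derivative \<Phi> (at x) v) = 0 \<longrightarrow> v \<in> tangent_space M x"
    by (rule interior_chart[OF assms]) (rule that)
  have p: "p \<in> U" using c by blast
  let ?D = "frechet_derivative \<Phi> (at p)"
  have "linear ?D"
    using c(1) p smooth_on_has_derivative has_derivative_linear unfolding diffeo_on_def by blast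
  then have "linear (\<lambda>v. snd (?D v))"
    by (intro linearI) (simp_all add: linear_add linear_scale)
  then obtain \<nu> where \<nu>: "\<And>v. snd (?D v) = \<nu> \<bullet> v"
    using linear_functional_inner by metis
  have "snd (?D (frechet_derivative (inv_into U \<Phi>) (at (\<Phi> p)) (0, 1))) = 1"
    using diffeo_on_derivative_inverse(2)[OF c(1) p] by simp
  then have "\<nu> \<noteq> 0"
    unfolding \<nu> by auto
  moreover have "\<exists>\<gamma> \<gamma>' \<delta>. 0 < (\<delta>::real) \<and> \<gamma> 0 = p \<and> \<gamma>' 0 = v \<and> isCont \<gamma>' 0 \<and>
      (\<forall>s. \<bar>s\<bar> < \<delta> \<longrightarrow> \<gamma> s \<in> M \<and> (\<gamma> has_vector_derivative \<gamma>' s) (at s) \<and>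
        \<gamma>' s \<in> tangent_space M (\<gamma> s))" if v: "\<nu> \<bullet> v = 0" for v
  proof -
    obtain \<gamma> \<gamma>' \<delta> where g: "(0::real) < \<delta>" "\<gamma> 0 = p" "\<gamma>' 0 = v" "isCont \<gamma>' 0"
      "\<forall>s. \<bar>s\<bar> < \<delta> \<longrightarrow> \<gamma> s \<in> U \<and> \<Phi> (\<gamma> s) = \<Phi> p + s *\<^sub>R ?D v \<and>
        (\<gamma> has_vector_derivative \<gamma>' s) (at s) \<and> frechet_derivative \<Phi> (at (\<gamma> s)) (\<gamma>' s) = ?D v"
      by (rule diffeo_on_line[OF c(1) p, of v]) (rule that)
    have "(\<gamma> has_vector_derivative \<gamma>' 0) (at 0)"
      using g(1,5) by simp
    then have "isCont \<gamma> 0"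
      by (rule has_vector_derivative_continuous)
    then have "filterlim \<gamma> (nhds (\<gamma> 0)) (nhds 0)"
      by (simp only: isCont_def tendsto_at_iff_tendsto_nhds)
    then have "\<forall>\<^sub>F s in nhds 0. \<gamma> s \<in> V"
      by (rule topological_tendstoD) (use c(2,3) g(2) in simp_all)
    then obtain d where d: "d > 0" "\<And>s. \<bar>s\<bar> < d \<Longrightarrow> \<gamma> s \<in> V"
      unfolding eventually_nhds_metric by (auto simp: dist_real_def)
    have "snd (\<Phi> p) = 0"
      using c assms(2) by blast
    then have "\<gamma> s \<in> M" if "\<bar>s\<bar> < min \<delta> d" for s
      using c(5) d(2)[of s] g(5) that v by (auto simp: \<nu>)
    moreover have "\<gamma>' s \<in> tangent_space M (\<gamma> s)" if "\<bar>s\<bar> < min \<delta> d" for s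
    proof -
      have "snd (frechet_derivative \<Phi> (at (\<gamma> s)) (\<gamma>' s)) = 0"
        using g(5) that v by (simp add: \<nu>)
      moreover have "\<gamma> s \<in> V" using d(2) that by simp
      ultimately show ?thesis using c(6) by blast
    qed
    ultimately show ?thesis
      using g d by (intro exI[of _ \<gamma>] exI[of _ \<gamma>'] exI[of _ "min \<delta> d"]) auto
  qed
  ultimately show ?thesis using that by blast
qed

text \<open>Two functions whose restrictions to \<open>M\<close> have a local maximum at the same interior point have
  parallel gradients there. This excludes interior contact of \<open>M\<close> with a wedge.\<close>

lemma common_normal:
  fixes M :: "'n::finite amb set"
  assumes "hypersurface M" "p \<in> M" "p \<notin> boundary M"
  obtains \<nu> :: "'n amb" where "\<nu> \<noteq> 0"
    "\<forall>F g. (F has_derivative (\<lambda>w. g \<bullet> w)) (at p) \<longrightarrow> (\<forall>\<^sub>F y in nhds p. y \<in> M \<longrightarrow> F y \<le> (F p :: real))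
      \<longrightarrow> (\<exists>c. g = c *\<^sub>R \<nu>)"
proof -
  obtain \<nu> where \<nu>: "\<nu> \<noteq> 0"
    "\<forall>v. \<nu> \<bullet> v = 0 \<longrightarrow> (\<exists>\<gamma> \<gamma>' \<delta>. 0 < (\<delta>::real) \<and> \<gamma> 0 = p \<and> \<gamma>' 0 = v \<and> isCont \<gamma>' 0 \<and>
      (\<forall>s. \<bar>s\<bar> < \<delta> \<longrightarrow> \<gamma> s \<in> M \<and> (\<gamma> has_vector_derivative \<gamma>' s) (at s) \<and>
        \<gamma>' s \<in> tangent_space M (\<gamma> s)))"
    by (rule interior_curves[OF assms]) (rule that)
  have "\<exists>c. g = c *\<^sub>R \<nu>"
    if F: "(F has_derivative (\<lambda>w. g \<bullet> w)) (at p)" "\<forall>\<^sub>F y in nhds p. y \<in> M \<longrightarrow> F y \<le> F p"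
    for F :: "'n amb \<Rightarrow> real" and g
  proof (rule gradient_multiple)
    fix v assume "\<nu> \<bullet> v = 0"
    then obtain \<gamma> \<gamma>' \<delta> where c: "0 < (\<delta>::real)" "\<gamma> 0 = p" "\<gamma>' 0 = v"
      "\<And>s. \<bar>s\<bar> < \<delta> \<Longrightarrow> \<gamma> s \<in> M" "\<And>s. \<bar>s\<bar> < \<delta> \<Longrightarrow> (\<gamma> has_vector_derivative \<gamma>' s) (at s)"
      using \<nu>(2) by blast
    have d: "(\<gamma> has_vector_derivative v) (at 0)"
      using c by force
    have "((\<lambda>s. F (\<gamma> s)) has_derivative (\<lambda>h. g \<bullet> (h *\<^sub>R v))) (at 0)"
      using has_derivative_compose[OF d[unfolded has_vector_derivative_def], of F "\<lambda>w. g \<bullet> w"] F(1) c(2)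
      by simp
    then have D: "((\<lambda>s. F (\<gamma> s)) has_real_derivative g \<bullet> v) (at 0)"
      by (simp add: has_field_derivative_def mult_commute_abs)
    have "isCont \<gamma> 0"
      using d has_vector_derivative_continuous by blast
    then have "filterlim \<gamma> (nhds (\<gamma> 0)) (nhds 0)"
      by (simp only: isCont_def tendsto_at_iff_tendsto_nhds)
    then have "filterlim \<gamma> (nhds p) (nhds 0)"
      by (simp add: c(2))
    then have "\<forall>\<^sub>F s in nhds 0. \<gamma> s \<in> M \<longrightarrow> F (\<gamma> s) \<le> F p"
      by (rule eventually_compose_filterlim[OF F(2)])
    then obtain e where e: "e > 0" "\<And>s. \<bar>s\<bar> < e \<Longrightarrow> \<gamma> s \<in> M \<Longrightarrow> F (\<gamma> s) \<le> F p"
      unfolding eventually_nhds_metric by (auto simp: dist_real_def)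
    show "g \<bullet> v = 0"
      by (rule DERIV_local_max[OF D, of "min \<delta> e"]) (use c e in auto)
  qed
  then show ?thesis using that \<nu>(1) by blast
qed

section \<open>Elementary symmetric functions\<close>

definition esym :: "nat \<Rightarrow> 'a set \<Rightarrow> ('a \<Rightarrow> real) \<Rightarrow> real" where
  "esym j B k = (\<Sum>I | I \<subseteq> B \<and> card I = j. \<Prod>i\<in>I. k i)"

lemma esym_0: "finite B \<Longrightarrow> esym 0 B k = 1"
proof -
  assume "finite B"
  then have "{I. I \<subseteq> B \<and> card I = 0} = {{}}"
    by (auto simp: finite_subset card_eq_0_iff)
  then show ?thesis by (simp add: esym_def)
qed

lemma esym_insert:
  assumes "finite B" "b \<notin> B"
  shows "esym (Suc j) (insert b B) k = esym (Suc j) B k + k b * esym j B k"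
proof -
  let ?S = "\<lambda>j. {I. I \<subseteq> B \<and> card I = j}"
  have eq: "{I. I \<subseteq> insert b B \<and> card I = Suc j} = ?S (Suc j) \<union> insert b ` ?S j" (is "?L = ?R")
  proof
    show "?L \<subseteq> ?R"
    proof
      fix I assume I: "I \<in> ?L"
      then have fin: "finite I" using assms(1) finite_subset by auto
      show "I \<in> ?R"
      proof (cases "b \<in> I")
        case True
        then have "I = insert b (I - {b})" "I - {b} \<in> ?S j"
          using I fin by auto
        then show ?thesis by blast
      qed (use I in auto)
    qed
    show "?R \<subseteq> ?L"
      using assms finite_subset by (fastforce simp: card_insert_if)
  qed
  have fin: "finite (?S i)" for i
    using assms(1) by simp
  have disj: "?S (Suc j) \<inter> insert b ` ?S j = {}"
    using assms(2) by auto
  have inj: "inj_on (insert b) (?S j)"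
    using assms(2) by (auto simp: inj_on_def)
  have "(\<Prod>i\<in>insert b I. k i) = k b * (\<Prod>i\<in>I. k i)" if "I \<in> ?S j" for I
    using that assms finite_subset by (subst prod.insert) auto
  then show ?thesis
    unfolding esym_def eq sum.union_disjoint[OF fin finite_imageI[OF fin] disj]
    by (simp add: sum.reindex[OF inj] sum_distrib_left)
qed

lemma esym_remove:
  assumes "finite B" "b \<in> B"
  shows "esym (Suc j) B k = esym (Suc j) (B - {b}) k + k b * esym j (B - {b}) k"
  using esym_insert[of "B - {b}" b j k] assms by (simp add: insert_absorb)

lemma esym_nonneg: "(\<And>i. i \<in> B \<Longrightarrow> 0 \<le> k i) \<Longrightarrow> 0 \<le> esym j B k"
  unfolding esym_def by (intro sum_nonneg prod_nonneg) auto

lemma esym_pos: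
  assumes "finite B" "j \<le> card B" "\<And>i. i \<in> B \<Longrightarrow> 0 < k i"
  shows "0 < esym j B k"
proof -
  obtain I where "I \<subseteq> B" "card I = j"
    using assms(2) by (meson obtain_subset_with_card_n)
  then show ?thesis
    unfolding esym_def using assms
    by (intro sum_pos) (auto intro!: prod_pos)
qed

text \<open>A Newton-type inequality for tuples bounded below by \<open>l \<ge> 0\<close>: each subset of size \<open>j\<close> has
  \<open>card B - j\<close> extensions by one element, each subset of size \<open>j + 1\<close> arises \<open>j + 1\<close> times, and an
  extension multiplies the product by at least \<open>l\<close>.\<close>

lemma esym_Suc_ge:
  assumes "finite B" "0 \<le> l" "\<And>i. i \<in> B \<Longrightarrow> l \<le> k i"
  shows "(real (card B) - real j) * l * esym j B k \<le> (real j + 1) * esym (Suc j) B k"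
  using assms(1,3)
proof (induction B arbitrary: j rule: finite_induct)
  case empty
  have "esym (Suc j) {} k = 0" "j \<noteq> 0 \<Longrightarrow> esym j {} k = 0"
    by (auto simp: esym_def intro!: sum.neutral)
  then show ?case by (cases "j = 0") auto
next
  case (insert b B)
  have kb: "l \<le> k b" and k: "\<And>i. i \<in> B \<Longrightarrow> l \<le> k i"
    using insert.prems by auto
  have IH: "(real (card B) - real j) * l * esym j B k \<le> (real j + 1) * esym (Suc j) B k" for j
    using insert.IH k by blast
  have nn: "0 \<le> esym j B k" for j
    by (rule esym_nonneg) (use k assms(2) in force)
  show ?case
  proof (cases j)
    case 0
    have "(real (card B)) * l \<le> esym (Suc 0) B k"
      using IH[of 0] insert.hyps by (simp add: esym_0)
    then show ?thesis
      using insert.hyps kb 0 esym_insert[OF insert.hyps(1,2), of 0 k]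
      by (simp add: esym_0 algebra_simps)
  next
    case (Suc i)
    have 1: "(real (card B) - real j) * l * esym j B k \<le> (real j + 1) * esym (Suc j) B k"
      by (rule IH)
    have 2: "k b * ((real (card B) - real i) * l * esym i B k) \<le> k b * ((real i + 1) * esym j B k)"
      unfolding Suc by (rule mult_left_mono[OF IH]) (use kb assms(2) in simp)
    have 3: "l * esym j B k \<le> k b * esym j B k"
      by (rule mult_right_mono[OF kb nn])
    have c: "real (card (insert b B)) = real (card B) + 1"
      using insert.hyps by simp
    have j: "real j = real i + 1" by (simp add: Suc)
    have e1: "esym (Suc j) (insert b B) k = esym (Suc j) B k + k b * esym j B k"
      and e2: "esym j (insert b B) k = esym j B k + k b * esym i B k"
      using esym_insert[OF insert.hyps(1,2)] by (simp_all add: Suc)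
    show ?thesis
      unfolding c e1 e2 j using 1 2 3 unfolding j by (simp add: algebra_simps)
  qed
qed

lemma mean_curvature_eq_0_iff:
  fixes k :: "'n::finite \<Rightarrow> real"
  assumes "j \<le> CARD('n)"
  shows "mean_curvature j k = 0 \<longleftrightarrow> esym j UNIV k = 0"
  using assms by (simp add: mean_curvature_def esym_def)

lemma esym_scale: "esym j B (\<lambda>i. c * k i) = c ^ j * esym j B k"
  unfolding esym_def sum_distrib_left by (rule sum.cong) (auto simp: prod.distrib)

text \<open>Quantitative isolation of the zero \<open>lam \<cdot> (1, \<dots>, 1, -q)\<close> of the elementary symmetric function of
  degree \<open>r + 1\<close>. Let \<open>k\<close> be a zero that is bounded below by this tuple up to \<open>\<delta>\<close>. Not all entries
  can be positive, so exactly one of them, \<open>k i0\<close>, is below \<open>lam - \<delta>\<close>. Solving the equation for \<open>k i0\<close>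
  shows that it is at most about \<open>-q lam\<close>; as it is also at least about \<open>-q lam\<close>, every other entry
  can exceed \<open>lam\<close> by a multiple of \<open>\<delta>\<close> only, for otherwise \<open>k i0\<close> would have to be smaller. So the
  trace exceeds \<open>(n - 1 - q) lam\<close> by at most a multiple of \<open>\<delta>\<close>.\<close>

lemma esym_nonzero:
  fixes r :: nat
  assumes r: "1 \<le> r" "r + 1 < CARD('n)"
    and q: "q = (real CARD('n) - real r - 1) / (real r + 1)"
  obtains D \<delta>0 where "(0::real) < D" "(0::real) < \<delta>0"
    "\<forall>(k :: 'n::finite \<Rightarrow> real) lam \<delta>. 1 \<le> lam \<longrightarrow> 0 < \<delta> \<longrightarrow> \<delta> \<le> \<delta>0 \<longrightarrow>
      (\<forall>i. - q * lam - \<delta> \<le> k i) \<longrightarrow>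
      (\<forall>i j. i \<noteq> j \<longrightarrow> lam - \<delta> \<le> k i \<or> lam - \<delta> \<le> k j) \<longrightarrow>
      (real CARD('n) - 1 - q) * lam + D * \<delta> \<le> sum k UNIV \<longrightarrow> esym (r + 1) UNIV k \<noteq> 0"
proof -
  define n where "n = real CARD('n)"
  define R where "R = real r"
  define q2 where "q2 = (n - 1 - R) / R"
  define E where "E = 2 * (R + 1) * (q + 1) * (1 + 1 / q2)"
  have rR: "1 \<le> R" "R + 2 \<le> n" using r by (auto simp: n_def R_def)
  have q_eq: "q = (n - R - 1) / (R + 1)" using q by (simp add: n_def R_def)
  have pos: "q > 0" "q2 > 0" using rR by (auto simp: q_eq q2_def)
  have E0: "E > 0" using rR pos by (auto simp: E_def intro!: mult_pos_pos add_pos_pos)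
  define D where "D = n * E + q + 1"
  define \<delta>0 where "\<delta>0 = min (1/2) (q2 / (4 * (R + 1) * (q + 1)))"
  have D: "0 < D" using E0 rR pos by (auto simp: D_def intro!: add_pos_pos)
  have d0: "0 < \<delta>0" using rR pos by (auto simp: \<delta>0_def)
  have main: "esym (r + 1) UNIV k \<noteq> 0"
    if lam: "1 \<le> lam" and \<delta>: "0 < \<delta>" "\<delta> \<le> \<delta>0" and lb: "\<forall>i. - q * lam - \<delta> \<le> k i"
      and two: "\<forall>i j. i \<noteq> j \<longrightarrow> lam - \<delta> \<le> k i \<or> lam - \<delta> \<le> k j"
      and tr: "(real CARD('n) - 1 - q) * lam + D * \<delta> \<le> sum k UNIV"
    for k :: "'n::finite \<Rightarrow> real" and lam \<delta>
  proof
    assume zero: "esym (r + 1) UNIV k = 0"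
    define l where "l = lam - \<delta>"
    have l: "1/2 \<le> l" using lam \<delta> by (simp add: l_def \<delta>0_def)
    obtain i0 where i0: "k i0 < l"
    proof (rule ccontr)
      assume "\<not> thesis"
      then have "0 < k i" for i using that l by (meson less_le_trans half_gt_zero zero_less_one not_less)
      then have "0 < esym (r + 1) UNIV k" using r by (intro esym_pos) auto
      then show False using zero by simp
    qed
    define B where "B = UNIV - {i0}"
    have kB: "l \<le> k i" if "i \<in> B" for i
      using two[rule_format, of i i0] i0 that by (auto simp: B_def l_def)
    have cB: "real (card B) = n - 1"
      using r by (simp add: B_def n_def card_Diff_singleton of_nat_diff)
    have sB: "0 < esym r B k"
      by (rule esym_pos) (use r kB l in \<open>auto simp: B_def card_Diff_singleton, force\<close>)
    have z: "esym (Suc r) B k + k i0 * esym r B k = 0"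
      using zero esym_remove[of UNIV i0 r k] by (simp add: B_def)
    have "(n - 1 - R) * l * esym r B k \<le> (R + 1) * esym (Suc r) B k"
      using esym_Suc_ge[of B l k r] kB l by (simp add: cB R_def)
    then have "q * l * esym r B k \<le> esym (Suc r) B k"
      using rR by (simp add: q_eq divide_simps algebra_simps)
    then have "(q * l + k i0) * esym r B k \<le> 0"
      using z by (simp add: algebra_simps)
    then have ki0: "k i0 \<le> - q * l"
      using sB by (simp add: mult_le_0_iff not_less) 
    \<comment> \<open>Expand the equation in the two entries \<open>k i0\<close> and \<open>k j\<close>; the coefficient of their
      product is the symmetric function of degree \<open>r - 1\<close> of the remaining ones.\<close>
    have kj: "k j - l \<le> E * \<delta>" if j: "j \<in> B" for j
    proof -
      define B' where "B' = B - {j}"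
      define S where "S = esym r B' k"
      have jj: "j \<noteq> i0" using j by (simp add: B_def)
      have cB': "real (card B') = n - 2"
        using r j cB by (simp add: B'_def n_def card_Diff_singleton of_nat_diff)
      have kB': "\<And>i. i \<in> B' \<Longrightarrow> l \<le> k i" using kB by (simp add: B'_def)
      have kj: "l \<le> k j" using kB j by blast
      have "real r \<le> real (card B')" using rR cB' by (simp add: R_def)
      then have S: "0 < S"
        unfolding S_def by (intro esym_pos) (use kB' l in force)+
      have a: "(n - 2 - R) * l * S \<le> (R + 1) * esym (Suc r) B' k"
        using esym_Suc_ge[of B' l k r] kB' l by (simp add: cB' R_def S_def)
      have b: "(n - 1 - R) * l * esym (r - 1) B' k \<le> R * S"
        using esym_Suc_ge[of B' l k "r - 1"] kB' l r by (simp add: cB' R_def S_def of_nat_diff algebra_simps)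
      have b': "q2 * l * esym (r - 1) B' k \<le> S"
        using b rR by (simp add: q2_def divide_simps mult.commute)
      have e1: "esym (Suc r) B k = esym (Suc r) B' k + k j * S"
        and e2: "esym r B k = S + k j * esym (r - 1) B' k"
        using esym_remove[of B j r k] esym_remove[of B j "r - 1" k] j r by (simp_all add: B'_def S_def)
      define m where "m = - k i0"
      have m: "0 < m" using ki0 mult_pos_pos[of q l] l pos unfolding m_def by linarith
      have mle: "m \<le> q * l + (q + 1) * \<delta>"
        using spec[OF lb, of i0] by (simp add: m_def l_def algebra_simps)
      have "esym (r - 1) B' k \<le> S / (q2 * l)"
        using b' pos l by (simp add: pos_le_divide_eq mult.commute)
      then have c: "m * k j * esym (r - 1) B' k \<le> m * k j * (S / (q2 * l))"
        using m kj l by (intro mult_left_mono) auto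
      have a': "(n - 2 - R) / (R + 1) * l * S \<le> esym (Suc r) B' k"
        using a rR by (simp add: divide_simps mult.commute)
      have "esym (Suc r) B' k + k j * S - m * (S + k j * esym (r - 1) B' k) = 0"
        using z by (simp add: e1 e2 m_def)
      then have "(n - 2 - R) / (R + 1) * l * S + k j * S - m * S - m * k j * (S / (q2 * l)) \<le> 0"
        using a' c by (simp add: algebra_simps)
      then have "S * ((n - 2 - R) / (R + 1) * l + k j - m * (1 + k j / (q2 * l))) \<le> 0"
        by (simp add: algebra_simps)
      then have d: "(n - 2 - R) / (R + 1) * l + k j \<le> m * (1 + k j / (q2 * l))"
        using S by (simp add: mult_le_0_iff not_less)
      also have "\<dots> \<le> (q * l + (q + 1) * \<delta>) * (1 + k j / (q2 * l))"
        by (rule mult_right_mono[OF mle]) (use kj l pos in \<open>auto intro!: add_nonneg_nonneg divide_nonneg_nonneg\<close>)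
      also have "\<dots> = q * l + q / q2 * k j + (q + 1) * \<delta> * (1 + k j / (q2 * l))"
        using l pos by (simp add: field_simps)
      finally have f: "(n - 2 - R) / (R + 1) * l + k j \<le> q * l + q / q2 * k j + (q + 1) * \<delta> * (1 + k j / (q2 * l))" .
      have g1: "(n - 2 - R) / (R + 1) = q - 1 / (R + 1)"
      proof -
        have "n - 2 - R = (n - R - 1) - 1" by simp
        then show ?thesis by (simp only: q_eq diff_divide_distrib)
      qed
      have g2: "q / q2 = 1 - 1 / (R + 1)"
      proof -
        have "n - R - 1 = n - 1 - R" "n - 1 - R \<noteq> 0" "R \<noteq> 0" "R + 1 \<noteq> 0" using rR by auto
        then have "q / q2 = R / (R + 1)"
          unfolding q_eq q2_def \<open>n - R - 1 = n - 1 - R\<close> by (simp add: divide_simps)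
        also have "\<dots> = 1 - 1 / (R + 1)" using rR by (simp add: field_simps)
        finally show ?thesis .
      qed
      have h: "(k j - l) / (R + 1) \<le> (q + 1) * \<delta> * (1 + k j / (q2 * l))"
        using f unfolding g1 g2 by (simp add: algebra_simps diff_divide_distrib)
      have "k j / (q2 * l) = (k j - l) / (q2 * l) + 1 / q2"
        using l pos by (simp add: field_simps)
      moreover have "(k j - l) / (q2 * l) \<le> 2 * (k j - l) / q2"
      proof -
        have "0 < l" using l by simp
        then have "1 / l \<le> 2" using l by (simp add: pos_divide_le_eq)
        then have "(k j - l) / q2 * (1 / l) \<le> (k j - l) / q2 * 2"
          by (rule mult_left_mono) (use kj pos in simp)
        then show ?thesis by (simp add: field_simps)
      qed
      ultimately have "1 + k j / (q2 * l) \<le> 1 + 1 / q2 + 2 * (k j - l) / q2" by linarith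
      then have "(q + 1) * \<delta> * (1 + k j / (q2 * l)) \<le> (q + 1) * \<delta> * (1 + 1 / q2 + 2 * (k j - l) / q2)"
        using pos \<delta> by (intro mult_left_mono) auto
      also have "\<dots> = (q + 1) * \<delta> * (1 + 1 / q2) + (k j - l) * (2 * (q + 1) * \<delta> / q2)"
        by (simp add: algebra_simps)
      also have "(k j - l) * (2 * (q + 1) * \<delta> / q2) \<le> (k j - l) * (1 / (2 * (R + 1)))"
      proof (rule mult_left_mono)
        have "\<delta> \<le> q2 / (4 * (R + 1) * (q + 1))"
          using \<delta> by (simp add: \<delta>0_def)
        moreover have "0 < 4 * (R + 1) * (q + 1)"
          using pos rR by (auto intro!: mult_pos_pos)
        ultimately have "\<delta> * (4 * (R + 1) * (q + 1)) \<le> q2"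
          by (simp only: pos_le_divide_eq)
        then have "2 * (q + 1) * \<delta> * (2 * (R + 1)) \<le> q2"
          by (simp add: algebra_simps)
        moreover have "0 < 2 * (R + 1)" using rR by simp
        ultimately have "2 * (q + 1) * \<delta> \<le> q2 / (2 * (R + 1))"
          by (simp only: pos_le_divide_eq)
        then have "2 * (q + 1) * \<delta> \<le> 1 / (2 * (R + 1)) * q2"
          by simp
        then show "2 * (q + 1) * \<delta> / q2 \<le> 1 / (2 * (R + 1))"
          using pos by (simp only: pos_divide_le_eq)
      qed (use kj in simp)
      finally have trade: "(k j - l) / (R + 1) \<le> (q + 1) * \<delta> * (1 + 1 / q2) + (k j - l) * (1 / (2 * (R + 1)))"
        using h by linarith
      have halve: "x / m = 2 * (x / (2 * m))" for x m :: real by simp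
      define z where "z = (k j - l) / (2 * (R + 1))"
      have "(k j - l) / (R + 1) = 2 * z" "(k j - l) * (1 / (2 * (R + 1))) = z"
        unfolding z_def using halve[of "k j - l" "R + 1"] by simp_all
      then have "2 * z \<le> (q + 1) * \<delta> * (1 + 1 / q2) + z"
        using trade by simp
      then have "z \<le> (q + 1) * \<delta> * (1 + 1 / q2)"
        by linarith
      then have "(k j - l) / (2 * (R + 1)) \<le> (q + 1) * \<delta> * (1 + 1 / q2)"
        unfolding z_def .
      then have "k j - l \<le> (q + 1) * \<delta> * (1 + 1 / q2) * (2 * (R + 1))"
        using rR by (subst (asm) pos_divide_le_eq) auto
      then show ?thesis by (simp add: E_def algebra_simps)
    qed
    have "sum k UNIV = k i0 + sum k B"
      unfolding B_def by (simp add: sum.remove)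
    also have "sum k B \<le> (\<Sum>j\<in>B. l + E * \<delta>)"
      by (rule sum_mono) (use kj in force)
    also have "\<dots> = (n - 1) * (l + E * \<delta>)" using cB by simp
    finally have "sum k UNIV \<le> - q * l + (n - 1) * (l + E * \<delta>)" using ki0 by linarith
    moreover have "- q * l + (n - 1) * (l + E * \<delta>) = (n - 1 - q) * lam + D * \<delta> - \<delta> * (n + E)"
      by (simp add: l_def D_def algebra_simps)
    moreover have "0 < \<delta> * (n + E)" using \<delta> E0 rR by simp
    ultimately show False using tr by (simp add: n_def)
  qed
  show ?thesis
    by (rule that[OF D d0]) (intro allI impI, rule main)
qed

section \<open>The comparison principle at one point\<close>

text \<open>The factor by which the hyperbolic metric scales the Euclidean one. The hyperbolic distance \<open>d\<close>
  of \<open>x\<close> from the centre satisfies \<open>cosh d = conf x - 1\<close>; see \<open>hyp_dist_0\<close> below.\<close>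

definition conf :: "real^'n::finite \<Rightarrow> real" where
  "conf x = 2 / (1 - (norm x)\<^sup>2)"

lemma metric_conf: "metric p u v = (conf (fst p))\<^sup>2 * (fst u \<bullet> fst v) + snd u * snd v"
  by (simp add: metric_def conf_def)

lemma HxR_iff: "p \<in> HxR \<longleftrightarrow> norm (fst p) < 1"
  by (cases p) (auto simp: HxR_def)

lemma conf_ge_2: "norm x < 1 \<Longrightarrow> 2 \<le> conf x"
proof -
  assume "norm x < 1"
  then have "(norm x)\<^sup>2 < 1" by (simp add: power_less_one_iff)
  then show ?thesis by (simp add: conf_def pos_le_divide_eq)
qed

lemma christoffel_conf:
  assumes "p \<in> HxR"
  shows "christoffel p u v = (conf (fst p) *\<^sub>R
    ((fst p \<bullet> fst u) *\<^sub>R fst v + (fst p \<bullet> fst v) *\<^sub>R fst u - (fst u \<bullet> fst v) *\<^sub>R fst p), 0)"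
  using christoffel_eq[OF assms] by (simp add: conf_def)

lemma conf_has_derivative:
  assumes "norm x < 1"
  shows "(conf has_derivative (\<lambda>w. (conf x)\<^sup>2 * (x \<bullet> w))) (at x)"
proof -
  have "(norm x)\<^sup>2 < 1" using assms by (simp add: power_less_one_iff)
  then have ne: "1 - x \<bullet> x \<noteq> 0" by (simp add: power2_norm_eq_inner)
  show ?thesis
    unfolding conf_def[abs_def] power2_norm_eq_inner using ne
    apply (auto intro!: derivative_eq_intros)
    apply (rule ext)
    apply (simp add: inner_commute divide_simps power2_eq_square)
    done
qed

lemma metric_commute: "metric p u v = metric p v u"
  by (simp add: metric_def inner_commute mult.commute)

text \<open>Rescaling by the conformal factor turns the metric into the Euclidean inner product, where
  an orthonormal family of full cardinality is a basis.\<close>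

lemma orthonormal_spans:
  fixes p :: "'n::finite amb" and e :: "'n \<Rightarrow> 'n amb"
  assumes p: "p \<in> HxR" and N: "metric p N N = 1" "\<And>i. metric p N (e i) = 0"
    and e: "\<And>i j. metric p (e i) (e j) = (if i = j then 1 else 0)"
    and v: "metric p N v = 0"
  shows "v = (\<Sum>i\<in>UNIV. metric p v (e i) *\<^sub>R e i)"
proof -
  define c where "c = conf (fst p)"
  have c: "c > 0" using conf_ge_2[of "fst p"] p by (simp add: HxR_iff c_def)
  define S :: "'n amb \<Rightarrow> 'n amb" where "S u = (c *\<^sub>R fst u, snd u)" for u
  have S: "S u \<bullet> S w = metric p u w" for u w
    by (simp add: S_def metric_conf c_def inner_prod_def power2_eq_square)
  define B where "B = insert (S N) (range (\<lambda>i. S (e i)))"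
  have N': "metric p (e i) N = 0" for i
    using N(2)[of i] by (simp add: metric_commute[of p "e i"])
  have ne: "S N \<noteq> S (e i)" for i
    using S[of N N] S[of N "e i"] N by auto
  have inj: "inj (\<lambda>i. S (e i))"
  proof (rule injI, rule ccontr)
    fix i j assume "S (e i) = S (e j)" "i \<noteq> j"
    then show False using S[of "e i" "e i"] S[of "e i" "e j"] e by auto
  qed
  have "pairwise orthogonal B"
    unfolding B_def pairwise_insert
    using e N N' by (auto simp: pairwise_def orthogonal_def S)
  moreover have "0 \<notin> B"
  proof
    assume "0 \<in> B"
    then consider "S N = 0" | i where "S (e i) = 0" unfolding B_def by auto
    then show False
      using S[of N N] S[of "e _" "e _"] e N(1) by cases (metis inner_zero_left zero_neq_one)+
  qed
  ultimately have "independent B"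
    by (rule pairwise_orthogonal_independent)
  moreover have "card B = DIM('n amb)"
    using ne inj by (auto simp: B_def card_insert_if card_image)
  ultimately have span: "span B = UNIV"
    using card_ge_dim_independent[of B UNIV] by auto
  define w where "w = v - (\<Sum>i\<in>UNIV. metric p v (e i) *\<^sub>R e i)"
  have lin: "metric p (x - (\<Sum>i\<in>UNIV. a i *\<^sub>R e i)) u = metric p x u - (\<Sum>i\<in>UNIV. a i * metric p (e i) u)" for a x u
    by (simp add: metric_def fst_sum snd_sum inner_diff_left inner_sum_left algebra_simps
      sum_distrib_left sum_distrib_right sum.distrib)
  have "metric p w N = 0"
    unfolding w_def lin using v N' by (simp add: metric_commute[of p v])
  moreover have "metric p w (e j) = 0" for j
    unfolding w_def lin by (simp add: e if_distrib cong: if_cong)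
  ultimately have "orthogonal (S w) x" if "x \<in> B" for x
    using that unfolding B_def orthogonal_def by (auto simp: S)
  then have "orthogonal (S w) (S w)"
    using orthogonal_to_span[of "S w" B] span by auto
  then have "w = 0"
    using c unfolding orthogonal_def inner_eq_zero_iff by (simp add: S_def prod_eq_iff)
  then show ?thesis by (simp add: w_def)
qed

lemma second_derivative_local_max:
  fixes \<psi> \<psi>' :: "real \<Rightarrow> real"
  assumes "0 < \<delta>" "\<And>s. \<bar>s\<bar> < \<delta> \<Longrightarrow> (\<psi> has_real_derivative \<psi>' s) (at s)"
    and d: "(\<psi>' has_real_derivative d) (at 0)" and "\<psi>' 0 = 0"
    and max: "\<And>s. \<bar>s\<bar> < \<delta> \<Longrightarrow> \<psi> s \<le> \<psi> 0"
  shows "d \<le> 0"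
proof (rule ccontr)
  assume "\<not> d \<le> 0"
  then obtain e where e: "e > 0" "\<And>h. 0 < h \<Longrightarrow> h < e \<Longrightarrow> \<psi>' 0 < \<psi>' h"
    using DERIV_pos_inc_right[OF d] by auto
  define h where "h = min \<delta> e / 2"
  have h: "0 < h" "h < \<delta>" "h < e" using e(1) assms(1) by (auto simp: h_def)
  obtain z where "0 < z" "z < h" "\<psi> h - \<psi> 0 = (h - 0) * \<psi>' z"
    using MVT2[of 0 h \<psi> \<psi>'] h assms(2) by auto
  moreover from this have "0 < \<psi>' z" using e(2)[of z] h assms(4) by auto
  ultimately have "\<psi> 0 < \<psi> h" using h by (auto simp: algebra_simps)
  then show False using max[of h] h by auto
qed

text \<open>A product rule in which one factor is merely continuous, at the price that the other one
  vanishes at the point.\<close>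

lemma inner_derivative_at_zero:
  fixes A B :: "real \<Rightarrow> 'a::real_inner"
  assumes "(A has_vector_derivative a) (at 0)" "A 0 = 0" "isCont B 0"
  shows "((\<lambda>s. A s \<bullet> B s) has_real_derivative a \<bullet> B 0) (at 0)"
proof -
  have "((\<lambda>h. A h /\<^sub>R h) \<longlongrightarrow> a) (at 0)"
  proof -
    have "((\<lambda>h. norm (A h - h *\<^sub>R a) / norm h) \<longlongrightarrow> 0) (at 0)"
      using assms(1,2) unfolding has_vector_derivative_def has_derivative_at by simp
    moreover have "\<forall>\<^sub>F h in at 0. norm (A h - h *\<^sub>R a) / norm h = norm (A h /\<^sub>R h - a)"
      unfolding eventually_at_filter
    proof (intro always_eventually allI impI)
      fix h :: real assume "h \<noteq> 0"
      then have "A h /\<^sub>R h - a = (1 / h) *\<^sub>R (A h - h *\<^sub>R a)"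
        by (simp add: scaleR_diff_right divide_inverse)
      then show "norm (A h - h *\<^sub>R a) / norm h = norm (A h /\<^sub>R h - a)"
        by simp
    qed
    ultimately have "((\<lambda>h. norm (A h /\<^sub>R h - a)) \<longlongrightarrow> 0) (at 0)"
      by (rule Lim_transform_eventually)
    then show ?thesis
      by (rule LIM_zero_cancel[OF tendsto_norm_zero_cancel])
  qed
  then have "((\<lambda>h. (A h /\<^sub>R h) \<bullet> B h) \<longlongrightarrow> a \<bullet> B 0) (at 0)"
    using assms(3) by (intro tendsto_inner) (auto simp: isCont_def)
  then show ?thesis
    by (simp add: has_field_derivative_iff assms(2) divide_inverse mult.commute)
qed

text \<open>At an interior local maximum of \<open>F\<close> on \<open>M\<close> the gradient of \<open>F\<close> is \<open>\<kappa>\<close> times the (lowered) normal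
  \<open>m\<close>, so that \<open>X = grad F - \<kappa> m\<close> vanishes at the point. Along a curve in \<open>M\<close> the derivative of \<open>F\<close> is
  the inner product of \<open>X\<close> with the velocity, because \<open>m\<close> annihilates tangent vectors. Differentiating
  once more at the maximum does not involve the acceleration of the curve, as \<open>X\<close> is zero there, and
  yields \<open>Hess F \<le> \<kappa> Dm\<close> on the tangent space. Rewritten covariantly the right-hand side is
  \<open>-\<kappa>\<close> times the second fundamental form; the numbers \<open>k i\<close> are the principal curvatures times \<open>-\<kappa>\<close>.\<close>

lemma one_point_comparison:
  fixes M :: "'n::finite amb set" and F :: "'n amb \<Rightarrow> real" and g :: "'n amb \<Rightarrow> 'n amb"
  assumes M: "hypersurface M" "r_minimal r M" "p \<in> M" "p \<notin> boundary M"
    and F: "\<forall>\<^sub>F y in nhds p. (F has_derivative (\<lambda>w. g y \<bullet> w)) (at y)"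
    and g: "(g has_derivative H) (at p)"
    and max: "\<forall>\<^sub>F y in nhds p. y \<in> M \<longrightarrow> F y \<le> F p"
    and rn: "r + 1 \<le> CARD('n)"
  obtains e :: "'n \<Rightarrow> 'n amb" and k :: "'n \<Rightarrow> real" where
    "\<forall>i j. metric p (e i) (e j) = (if i = j then 1 else 0)"
    "\<forall>i. g p \<bullet> e i = 0"
    "g p \<noteq> 0 \<longrightarrow> (\<forall>v. g p \<bullet> v = 0 \<longrightarrow> v = (\<Sum>i\<in>UNIV. metric p v (e i) *\<^sub>R e i))"
    "\<forall>c v. v = (\<Sum>i\<in>UNIV. c i *\<^sub>R e i) \<longrightarrow> H v \<bullet> v - g p \<bullet> christoffel p v v \<le> (\<Sum>i\<in>UNIV. k i * (c i)\<^sup>2)"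
    "esym (r + 1) UNIV k = 0"
proof -
  have p: "p \<in> HxR" using M unfolding hypersurface_def by blast
  then have np: "norm (fst p) < 1" by (simp add: HxR_iff)
  obtain U N k0 where UN: "p \<in> U" "unit_normal_on M U N" "principal_curvatures M N p k0"
    "mean_curvature (r + 1) k0 = 0"
    using M(2,3) unfolding r_minimal_def by blast
  have U: "open U" "smooth_on U N"
    and N: "\<And>x. x \<in> M \<Longrightarrow> x \<in> U \<Longrightarrow> metric x (N x) (N x) = 1"
      "\<And>x v. x \<in> M \<Longrightarrow> x \<in> U \<Longrightarrow> v \<in> tangent_space M x \<Longrightarrow> metric x (N x) v = 0"
    using UN(2) unfolding unit_normal_on_def by blast+
  obtain e where e: "\<And>i. e i \<in> tangent_space M p"
    "\<And>i j. metric p (e i) (e j) = (if i = j then 1 else 0)"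
    "\<And>i. - cov_deriv N p (e i) = k0 i *\<^sub>R e i"
    using UN(3) unfolding principal_curvatures_def by metis
  obtain \<nu> where \<nu>: "\<nu> \<noteq> 0"
    "\<forall>v. \<nu> \<bullet> v = 0 \<longrightarrow> (\<exists>\<gamma> \<gamma>' \<delta>. 0 < (\<delta>::real) \<and> \<gamma> 0 = p \<and> \<gamma>' 0 = v \<and> isCont \<gamma>' 0 \<and>
      (\<forall>s. \<bar>s\<bar> < \<delta> \<longrightarrow> \<gamma> s \<in> M \<and> (\<gamma> has_vector_derivative \<gamma>' s) (at s) \<and>
        \<gamma>' s \<in> tangent_space M (\<gamma> s)))"
    by (rule interior_curves[OF M(1,3,4)]) (rule that)
  \<comment> \<open>The covector dual to \<open>N\<close>, as a vector for the Euclidean inner product.\<close>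
  define m where "m y = ((conf (fst y))\<^sup>2 *\<^sub>R fst (N y), snd (N y))" for y :: "'n amb"
  have m: "metric y (N y) v = m y \<bullet> v" for y v
    by (simp add: m_def metric_conf inner_prod_def)
  have mp: "m p \<noteq> 0"
    using N(1)[OF M(3) UN(1)] unfolding m by auto
  have "m p \<bullet> v = 0" if v0: "\<nu> \<bullet> v = 0" for v
  proof -
    obtain \<gamma> \<gamma>' \<delta> where c: "0 < (\<delta>::real)" "\<gamma> 0 = p" "\<gamma>' 0 = v" "isCont \<gamma>' 0"
      "\<forall>s. \<bar>s\<bar> < \<delta> \<longrightarrow> \<gamma> s \<in> M \<and> (\<gamma> has_vector_derivative \<gamma>' s) (at s) \<and> \<gamma>' s \<in> tangent_space M (\<gamma> s)"
      using \<nu>(2) v0 by blast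
    have "\<gamma>' 0 \<in> tangent_space M (\<gamma> 0)" using c(1,5) by simp
    then have "v \<in> tangent_space M p" using c by simp
    then show ?thesis using N(2)[OF M(3) UN(1)] by (simp add: m)
  qed
  then obtain c1 where c1: "m p = c1 *\<^sub>R \<nu>" using gradient_multiple by blast
  then have c1n: "c1 \<noteq> 0" using mp by auto
  have Fp: "(F has_derivative (\<lambda>w. g p \<bullet> w)) (at p)"
    using F eventually_nhds_x_imp_x by blast
  obtain \<nu>2 where \<nu>2: "\<nu>2 \<noteq> 0"
    "\<forall>F g. (F has_derivative (\<lambda>w. g \<bullet> w)) (at p) \<longrightarrow> (\<forall>\<^sub>F y in nhds p. y \<in> M \<longrightarrow> F y \<le> (F p :: real))
      \<longrightarrow> (\<exists>c. g = c *\<^sub>R \<nu>2)"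
    by (rule common_normal[OF M(1,3,4)]) (rule that)
  have loc: "\<forall>\<^sub>F y in nhds p. y \<in> U \<and> (F has_derivative (\<lambda>w. g y \<bullet> w)) (at y) \<and> (y \<in> M \<longrightarrow> F y \<le> F p)"
    using F max eventually_nhds_in_open[OF U(1) UN(1)] by (auto intro: eventually_conj)
  have curve: "\<exists>\<gamma> \<gamma>' \<delta>. 0 < (\<delta>::real) \<and> \<gamma> 0 = p \<and> \<gamma>' 0 = v \<and> isCont \<gamma>' 0 \<and>
      (\<forall>s. \<bar>s\<bar> < \<delta> \<longrightarrow> (\<gamma> has_vector_derivative \<gamma>' s) (at s) \<and> m (\<gamma> s) \<bullet> \<gamma>' s = 0 \<and>
        (F has_derivative (\<lambda>w. g (\<gamma> s) \<bullet> w)) (at (\<gamma> s)) \<and> F (\<gamma> s) \<le> F p)"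
    if v: "m p \<bullet> v = 0" for v
  proof -
    have "\<nu> \<bullet> v = 0" using v c1 c1n by simp
    then obtain \<gamma> \<gamma>' \<delta> where c: "0 < (\<delta>::real)" "\<gamma> 0 = p" "\<gamma>' 0 = v" "isCont \<gamma>' 0"
      "\<forall>s. \<bar>s\<bar> < \<delta> \<longrightarrow> \<gamma> s \<in> M \<and> (\<gamma> has_vector_derivative \<gamma>' s) (at s) \<and> \<gamma>' s \<in> tangent_space M (\<gamma> s)"
      using \<nu>(2) by blast
    have "(\<gamma> has_vector_derivative \<gamma>' 0) (at 0)" using c(1,5) by simp
    then have "isCont \<gamma> 0" by (rule has_vector_derivative_continuous)
    then have "filterlim \<gamma> (nhds (\<gamma> 0)) (nhds 0)"
      by (simp only: isCont_def tendsto_at_iff_tendsto_nhds)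
    then have "filterlim \<gamma> (nhds p) (nhds 0)" by (simp add: c(2))
    from eventually_compose_filterlim[OF loc this]
    obtain d where d: "d > 0" "\<And>s. \<bar>s\<bar> < d \<Longrightarrow> \<gamma> s \<in> U \<and> (F has_derivative (\<lambda>w. g (\<gamma> s) \<bullet> w)) (at (\<gamma> s)) \<and> (\<gamma> s \<in> M \<longrightarrow> F (\<gamma> s) \<le> F p)"
      unfolding eventually_nhds_metric by (auto simp: dist_real_def)
    have "\<forall>s. \<bar>s\<bar> < min \<delta> d \<longrightarrow> (\<gamma> has_vector_derivative \<gamma>' s) (at s) \<and> m (\<gamma> s) \<bullet> \<gamma>' s = 0 \<and>
        (F has_derivative (\<lambda>w. g (\<gamma> s) \<bullet> w)) (at (\<gamma> s)) \<and> F (\<gamma> s) \<le> F p"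
      using c(5) d(2) N(2) by (metis m min_less_iff_conj)
    then show ?thesis using c d(1) by (intro exI[of _ \<gamma>] exI[of _ \<gamma>'] exI[of _ "min \<delta> d"]) auto
  qed
  have chain: "((\<lambda>s. F (\<gamma> s)) has_real_derivative g (\<gamma> s) \<bullet> \<gamma>' s) (at s)"
    if "(\<gamma> has_vector_derivative \<gamma>' s) (at s)" "(F has_derivative (\<lambda>w. g (\<gamma> s) \<bullet> w)) (at (\<gamma> s))"
    for \<gamma> \<gamma>' s
    using has_derivative_compose[OF that(1)[unfolded has_vector_derivative_def] that(2)]
    by (simp add: has_field_derivative_def mult_commute_abs)
  have "g p \<bullet> v = 0" if v0: "m p \<bullet> v = 0" for v
  proof -
    obtain \<gamma> \<gamma>' \<delta> where c: "0 < (\<delta>::real)" "\<gamma> 0 = p" "\<gamma>' 0 = v" "isCont \<gamma>' 0"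
      "\<forall>s. \<bar>s\<bar> < \<delta> \<longrightarrow> (\<gamma> has_vector_derivative \<gamma>' s) (at s) \<and> m (\<gamma> s) \<bullet> \<gamma>' s = 0 \<and>
        (F has_derivative (\<lambda>w. g (\<gamma> s) \<bullet> w)) (at (\<gamma> s)) \<and> F (\<gamma> s) \<le> F p"
      using curve[OF v0] by blast
    have "((\<lambda>s. F (\<gamma> s)) has_real_derivative g (\<gamma> 0) \<bullet> \<gamma>' 0) (at 0)"
      by (rule chain) (use c in auto)
    from DERIV_local_max[OF this c(1)] show ?thesis using c by simp
  qed
  then obtain \<kappa> where \<kappa>: "g p = \<kappa> *\<^sub>R m p" using gradient_multiple by blast
  define DN where "DN = frechet_derivative N (at p)"
  have DN: "(N has_derivative DN) (at p)"
    unfolding DN_def by (rule smooth_on_has_derivative[OF U(2) UN(1)])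
  have linDN: "linear DN" using DN has_derivative_linear by blast
  define c where "c = conf (fst p)"
  define Dm where "Dm v = ((2 * c ^ 3 * (fst p \<bullet> fst v)) *\<^sub>R fst (N p) + c\<^sup>2 *\<^sub>R fst (DN v), snd (DN v))" for v
  have dconf: "((\<lambda>y. (conf (fst y))\<^sup>2) has_derivative (\<lambda>v. 2 * c ^ 3 * (fst p \<bullet> fst v))) (at p)"
  proof -
    have "((\<lambda>y. conf (fst y)) has_derivative (\<lambda>v. (conf (fst p))\<^sup>2 * (fst p \<bullet> fst v))) (at p)"
      by (rule has_derivative_compose[OF has_derivative_fst[OF has_derivative_ident] conf_has_derivative[OF np]])
    from has_derivative_power[OF this, of 2] show ?thesis
      by (rule has_derivative_eq_rhs) (auto simp: c_def power2_eq_square power3_eq_cube)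
  qed
  have Dm: "(m has_derivative Dm) (at p)"
    unfolding m_def[abs_def] Dm_def[abs_def]
    by (rule has_derivative_eq_rhs[OF has_derivative_Pair[OF has_derivative_scaleR[OF dconf has_derivative_fst[OF DN]] has_derivative_snd[OF DN]]])
      (simp add: c_def add.commute)
  define X where "X y = g y - \<kappa> *\<^sub>R m y" for y
  have X: "(X has_derivative (\<lambda>v. H v - \<kappa> *\<^sub>R Dm v)) (at p)"
    unfolding X_def[abs_def] by (intro has_derivative_diff has_derivative_scaleR_right g Dm)
  have X0: "X p = 0" by (simp add: X_def \<kappa>)
  have second: "H v \<bullet> v \<le> \<kappa> * (Dm v \<bullet> v)" if v: "m p \<bullet> v = 0" for v
  proof -
    obtain \<gamma> \<gamma>' \<delta> where c: "0 < (\<delta>::real)" "\<gamma> 0 = p" "\<gamma>' 0 = v" "isCont \<gamma>' 0"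
      "\<forall>s. \<bar>s\<bar> < \<delta> \<longrightarrow> (\<gamma> has_vector_derivative \<gamma>' s) (at s) \<and> m (\<gamma> s) \<bullet> \<gamma>' s = 0 \<and>
        (F has_derivative (\<lambda>w. g (\<gamma> s) \<bullet> w)) (at (\<gamma> s)) \<and> F (\<gamma> s) \<le> F p"
      using curve[OF v] by blast
    have "(H v - \<kappa> *\<^sub>R Dm v) \<bullet> v \<le> 0"
    proof (rule second_derivative_local_max[OF c(1)])
      show "((\<lambda>s. F (\<gamma> s)) has_real_derivative X (\<gamma> s) \<bullet> \<gamma>' s) (at s)" if "\<bar>s\<bar> < \<delta>" for s
        using chain[of \<gamma> \<gamma>' s] c(5) that by (simp add: X_def inner_diff_left)
      have d0: "(\<gamma> has_vector_derivative v) (at 0)" using c by force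
      have lin: "linear (\<lambda>v. H v - \<kappa> *\<^sub>R Dm v)" using X has_derivative_linear by blast
      have "((\<lambda>s. X (\<gamma> s)) has_vector_derivative (H v - \<kappa> *\<^sub>R Dm v)) (at 0)"
        using has_derivative_compose[OF d0[unfolded has_vector_derivative_def], of X "\<lambda>v. H v - \<kappa> *\<^sub>R Dm v"]
          X c(2) linear_scale[OF lin] by (simp add: has_vector_derivative_def)
      from inner_derivative_at_zero[OF this _ c(4)]
      show "((\<lambda>s. X (\<gamma> s) \<bullet> \<gamma>' s) has_real_derivative (H v - \<kappa> *\<^sub>R Dm v) \<bullet> v) (at 0)"
        using c X0 by simp
      show "X (\<gamma> 0) \<bullet> \<gamma>' 0 = 0" using c X0 by simp
      show "F (\<gamma> s) \<le> F (\<gamma> 0)" if "\<bar>s\<bar> < \<delta>" for s using c that by simp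
    qed
    then show ?thesis by (simp add: inner_diff_left)
  qed
  define k where "k i = - \<kappa> * k0 i" for i
  have tan: "m p \<bullet> e i = 0" for i
    using N(2)[OF M(3) UN(1) e(1)] by (simp add: m)
  have hess: "H v \<bullet> v - g p \<bullet> christoffel p v v \<le> (\<Sum>i\<in>UNIV. k i * (a i)\<^sup>2)"
    if v: "v = (\<Sum>i\<in>UNIV. a i *\<^sub>R e i)" for a v
  proof -
    have mv: "m p \<bullet> v = 0"
      by (simp add: v inner_sum_right tan)
    let ?n = "fst (N p)" and ?x = "fst p" and ?w = "fst v"
    have chr: "christoffel p u (N p) = (c *\<^sub>R ((?x \<bullet> fst u) *\<^sub>R ?n + (?x \<bullet> ?n) *\<^sub>R fst u - (fst u \<bullet> ?n) *\<^sub>R ?x), 0)" for u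
      using christoffel_conf[OF p] by (simp add: c_def)
    have DNe: "DN (e i) = - (k0 i *\<^sub>R e i) - christoffel p (e i) (N p)" for i
    proof -
      have "DN (e i) + christoffel p (e i) (N p) = - (k0 i *\<^sub>R e i)"
        using e(3)[of i] unfolding cov_deriv_def DN_def by (metis minus_minus)
      then show ?thesis by (simp add: eq_diff_eq)
    qed
    have lchr: "(\<Sum>i\<in>UNIV. a i *\<^sub>R christoffel p (e i) (N p)) = christoffel p v (N p)"
      unfolding chr v by (simp add: prod_eq_iff fst_sum snd_sum inner_sum_right inner_sum_left
          scaleR_sum_right scaleR_sum_left algebra_simps sum.distrib sum_subtractf)
    have "DN v = (\<Sum>i\<in>UNIV. a i *\<^sub>R DN (e i))"
      unfolding v by (simp add: linear_sum[OF linDN] linear_scale[OF linDN])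
    also have "\<dots> = - (\<Sum>i\<in>UNIV. (a i * k0 i) *\<^sub>R e i) - christoffel p v (N p)"
      unfolding DNe lchr[symmetric] by (simp add: scaleR_diff_right sum_subtractf sum_negf)
    finally have DNv: "DN v = - (\<Sum>i\<in>UNIV. (a i * k0 i) *\<^sub>R e i) - christoffel p v (N p)" .
    have lin: "metric p (\<Sum>i\<in>UNIV. b i *\<^sub>R e i) u = (\<Sum>i\<in>UNIV. b i * metric p (e i) u)" for b u
      by (simp add: metric_def fst_sum snd_sum inner_sum_left algebra_simps
        sum_distrib_left sum_distrib_right sum.distrib)
    have ev: "metric p (e i) v = a i" for i
      unfolding v metric_commute[of p "e i"] lin by (simp add: e if_distrib cong: if_cong)
    have s: "metric p (\<Sum>i\<in>UNIV. (a i * k0 i) *\<^sub>R e i) v = (\<Sum>i\<in>UNIV. k0 i * (a i)\<^sup>2)"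
      unfolding lin ev by (rule sum.cong) (auto simp: power2_eq_square)
    have "Dm v \<bullet> v = 2 * c ^ 3 * (?x \<bullet> ?w) * (?n \<bullet> ?w) + metric p (DN v) v"
      by (simp add: Dm_def metric_conf c_def inner_prod_def inner_add_left)
    also have "metric p (DN v) v = - (\<Sum>i\<in>UNIV. k0 i * (a i)\<^sup>2) - metric p (christoffel p v (N p)) v"
      unfolding DNv s[symmetric] by (simp add: metric_def inner_diff_left algebra_simps)
    also have "metric p (christoffel p v (N p)) v = c ^ 3 * (?x \<bullet> ?n) * (?w \<bullet> ?w)"
      unfolding chr by (simp add: metric_conf c_def[symmetric] inner_diff_left inner_add_left inner_commute
          power2_eq_square power3_eq_cube algebra_simps)
    finally have A: "Dm v \<bullet> v = 2 * c ^ 3 * (?x \<bullet> ?w) * (?n \<bullet> ?w) - c ^ 3 * (?x \<bullet> ?n) * (?w \<bullet> ?w)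
        - (\<Sum>i\<in>UNIV. k0 i * (a i)\<^sup>2)" by simp
    have "m p \<bullet> christoffel p v v = 2 * c ^ 3 * (?x \<bullet> ?w) * (?n \<bullet> ?w) - c ^ 3 * (?x \<bullet> ?n) * (?w \<bullet> ?w)"
      unfolding christoffel_conf[OF p] m_def c_def[symmetric]
      by (simp only: inner_prod_def fst_conv snd_conv inner_scaleR_left inner_scaleR_right inner_diff_right
          inner_add_right inner_zero_right)
        (simp add: inner_commute power2_eq_square power3_eq_cube algebra_simps)
    then have "Dm v \<bullet> v = m p \<bullet> christoffel p v v - (\<Sum>i\<in>UNIV. k0 i * (a i)\<^sup>2)"
      using A by simp
    then have "H v \<bullet> v - g p \<bullet> christoffel p v v \<le> - \<kappa> * (\<Sum>i\<in>UNIV. k0 i * (a i)\<^sup>2)"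
      using second[OF mv] unfolding \<kappa> by (simp add: right_diff_distrib)
    then show ?thesis by (simp add: k_def sum_distrib_left mult.assoc)
  qed
  have zero: "esym (r + 1) UNIV k = 0"
    using UN(4) mean_curvature_eq_0_iff[OF rn, of k0]
    unfolding k_def[abs_def] esym_scale by simp
  have span: "\<forall>v. g p \<bullet> v = 0 \<longrightarrow> v = (\<Sum>i\<in>UNIV. metric p v (e i) *\<^sub>R e i)" if "g p \<noteq> 0"
  proof (intro allI impI)
    fix v assume "g p \<bullet> v = 0"
    then have "m p \<bullet> v = 0" using \<kappa> that by auto
    then show "v = (\<Sum>i\<in>UNIV. metric p v (e i) *\<^sub>R e i)"
      using orthonormal_spans[OF p N(1)[OF M(3) UN(1)], of e v] e(2) tan by (simp add: m)
  qed
  show ?thesis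
  proof (rule that[of e k])
    show "\<forall>i j. metric p (e i) (e j) = (if i = j then 1 else 0)" by (simp add: e(2))
    show "\<forall>i. g p \<bullet> e i = 0" by (simp add: \<kappa> tan)
  qed (use span hess zero in \<open>blast+\<close>)
qed

section \<open>Strict barriers near a rotational hypersurface\<close>

lemma profile_onE:
  assumes "profile_on q a J f"
  shows "\<And>t. t \<in> J \<Longrightarrow> 0 < f t" "f 0 = a"
    "\<And>t. t \<in> J \<Longrightarrow> (f has_real_derivative deriv f t) (at t)"
    "\<And>t. open J \<Longrightarrow> t \<in> J \<Longrightarrow>
      (deriv f has_real_derivative q * (cosh (f t) / sinh (f t)) * (1 + (deriv f t)\<^sup>2)) (at t)"
    "0 \<in> J \<Longrightarrow> deriv f 0 = 0"
proof -
  obtain f' where f': "f' 0 = 0"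
    "\<And>t. t \<in> J \<Longrightarrow> (f has_real_derivative f' t) (at t)"
    "\<And>t. t \<in> J \<Longrightarrow> (f' has_real_derivative q * (cosh (f t) / sinh (f t)) * (1 + (f' t)\<^sup>2)) (at t)"
    using assms unfolding profile_on_def by blast
  show "\<And>t. t \<in> J \<Longrightarrow> 0 < f t" "f 0 = a" using assms unfolding profile_on_def by blast+
  have eq: "deriv f t = f' t" if "t \<in> J" for t using f'(2)[OF that] by (rule DERIV_imp_deriv)
  show "(f has_real_derivative deriv f t) (at t)" if "t \<in> J" for t using f'(2)[OF that] eq[OF that] by simp
  show "0 \<in> J \<Longrightarrow> deriv f 0 = 0" using eq f'(1) by simp
  show "(deriv f has_real_derivative q * (cosh (f t) / sinh (f t)) * (1 + (deriv f t)\<^sup>2)) (at t)"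
    if "open J" "t \<in> J" for t
    unfolding eq[OF that(2)]
    by (rule has_field_derivative_transform_within_open[OF f'(3)[OF that(2)] that]) (simp add: eq)
qed

text \<open>For \<open>p = (x, t)\<close> the difference of the hyperbolic cosines of the distance from the axis and of
  the prescribed radius \<open>f t\<close>: negative inside the rotational hypersurface of profile \<open>f\<close>.\<close>

definition gap :: "(real \<Rightarrow> real) \<Rightarrow> 'n::finite amb \<Rightarrow> real" where
  "gap f p = conf (fst p) - 1 - cosh (f (snd p))"

text \<open>The Euclidean gradient of \<open>gap f\<close>.\<close>

definition grad_gap :: "(real \<Rightarrow> real) \<Rightarrow> 'n::finite amb \<Rightarrow> 'n amb" where
  "grad_gap f p = ((conf (fst p))\<^sup>2 *\<^sub>R fst p, - sinh (f (snd p)) * deriv f (snd p))"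

lemma gap_has_derivative:
  assumes "norm (fst p) < 1" "(f has_real_derivative deriv f (snd p)) (at (snd p))"
  shows "(gap f has_derivative (\<lambda>v. grad_gap f p \<bullet> v)) (at p)"
proof -
  have c: "((\<lambda>y. conf (fst y)) has_derivative (\<lambda>v. (conf (fst p))\<^sup>2 * (fst p \<bullet> fst v))) (at p)"
    by (rule has_derivative_compose[OF has_derivative_fst[OF has_derivative_ident] conf_has_derivative[OF assms(1)]])
  have "((\<lambda>t. cosh (f t)) has_real_derivative sinh (f (snd p)) * deriv f (snd p)) (at (snd p))"
    using assms(2) by (auto intro!: derivative_eq_intros)
  from has_derivative_compose[OF has_derivative_snd[OF has_derivative_ident] this[unfolded has_field_derivative_def]]
  have "((\<lambda>y. cosh (f (snd y))) has_derivative (\<lambda>v. sinh (f (snd p)) * deriv f (snd p) * snd v)) (at p)" .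
  from has_derivative_diff[OF has_derivative_diff[OF c has_derivative_const[of 1]] this]
  show ?thesis
    unfolding gap_def[abs_def]
    by (rule has_derivative_eq_rhs) (simp add: grad_gap_def inner_prod_def fun_eq_iff)
qed

text \<open>The equation of the profile enters here: it replaces the second derivative of \<open>f\<close>.\<close>

lemma grad_gap_has_derivative:
  assumes "norm (fst p) < 1" and f: "profile_on q a J f" "open J" "snd p \<in> J"
  shows "(grad_gap f has_derivative (\<lambda>v. ((2 * conf (fst p) ^ 3 * (fst p \<bullet> fst v)) *\<^sub>R fst p
      + (conf (fst p))\<^sup>2 *\<^sub>R fst v,
      - (cosh (f (snd p)) * ((deriv f (snd p))\<^sup>2 + q * (1 + (deriv f (snd p))\<^sup>2))) * snd v))) (at p)"
proof -
  note pf = profile_onE[OF f(1)]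
  have c: "((\<lambda>y. conf (fst y)) has_derivative (\<lambda>v. (conf (fst p))\<^sup>2 * (fst p \<bullet> fst v))) (at p)"
    by (rule has_derivative_compose[OF has_derivative_fst[OF has_derivative_ident] conf_has_derivative[OF assms(1)]])
  have 1: "((\<lambda>y. (conf (fst y))\<^sup>2 *\<^sub>R fst y) has_derivative
     (\<lambda>v. (2 * conf (fst p) ^ 3 * (fst p \<bullet> fst v)) *\<^sub>R fst p + (conf (fst p))\<^sup>2 *\<^sub>R fst v)) (at p)"
    by (rule has_derivative_eq_rhs[OF has_derivative_scaleR[OF has_derivative_power[OF c, of 2] has_derivative_fst[OF has_derivative_ident]]])
      (simp add: fun_eq_iff power2_eq_square power3_eq_cube add.commute mult_ac)
  have "sinh (f (snd p)) \<noteq> 0" using pf(1)[OF f(3)] by simp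
  then have "((\<lambda>t. - sinh (f t) * deriv f t) has_real_derivative
     - (cosh (f (snd p)) * ((deriv f (snd p))\<^sup>2 + q * (1 + (deriv f (snd p))\<^sup>2)))) (at (snd p))"
    by (auto intro!: derivative_eq_intros pf(3)[OF f(3)] pf(4)[OF f(2,3)] simp: power2_eq_square field_simps)
  from has_derivative_compose[OF has_derivative_snd[OF has_derivative_ident] this[unfolded has_field_derivative_def]]
  have 2: "((\<lambda>y. - sinh (f (snd y)) * deriv f (snd y)) has_derivative
     (\<lambda>v. - (cosh (f (snd p)) * ((deriv f (snd p))\<^sup>2 + q * (1 + (deriv f (snd p))\<^sup>2))) * snd v)) (at p)" .
  show ?thesis
    unfolding grad_gap_def[abs_def] by (rule has_derivative_Pair[OF 1 2])
qed

lemma conf_norm_sq: "norm x < 1 \<Longrightarrow> conf x * (norm x)\<^sup>2 = conf x - 2"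
proof -
  assume "norm x < 1"
  then have "(norm x)\<^sup>2 < 1" by (simp add: power_less_one_iff)
  then show ?thesis by (simp add: conf_def field_simps)
qed

lemma norm_christoffel_le:
  assumes "p \<in> HxR"
  shows "norm (christoffel p v v) \<le> 3 * conf (fst p) * (norm (fst v))\<^sup>2"
proof -
  have x: "norm (fst p) < 1" using assms by (simp add: HxR_iff)
  have c: "0 \<le> conf (fst p)" using conf_ge_2[OF x] by simp
  let ?w = "fst v" and ?x = "fst p"
  have a: "norm ((?x \<bullet> ?w) *\<^sub>R ?w) \<le> norm ?w ^ 2"
  proof -
    have "\<bar>?x \<bullet> ?w\<bar> \<le> 1 * norm ?w"
      using Cauchy_Schwarz_ineq2[of ?x ?w] x by (meson less_imp_le mult_right_mono norm_ge_zero order_trans)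
    then show ?thesis by (simp add: power2_eq_square mult_right_mono)
  qed
  have b: "norm ((?w \<bullet> ?w) *\<^sub>R ?x) \<le> norm ?w ^ 2"
    using x by (simp add: power2_norm_eq_inner mult_left_le)
  have "norm ((?x \<bullet> ?w) *\<^sub>R ?w + (?x \<bullet> ?w) *\<^sub>R ?w - (?w \<bullet> ?w) *\<^sub>R ?x) \<le> norm ?w ^ 2 + norm ?w ^ 2 + norm ?w ^ 2"
    using a b norm_triangle_ineq4 norm_triangle_ineq by (smt (verit))
  then have "conf ?x * norm ((?x \<bullet> ?w) *\<^sub>R ?w + (?x \<bullet> ?w) *\<^sub>R ?w - (?w \<bullet> ?w) *\<^sub>R ?x) \<le> conf ?x * (3 * norm ?w ^ 2)"
    using c by (intro mult_left_mono) auto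
  then show ?thesis
    unfolding christoffel_conf[OF assms] using c by (simp add: norm_Pair)
qed

text \<open>The covariant Hessian \<open>Q\<close> of \<open>gap f + \<epsilon> exp (- K s)\<close> at one point, in terms of numbers only: \<open>g\<close> is
  the gradient of this function and \<open>b\<close> that of \<open>s\<close>, the derivative of which is \<open>\<kappa>\<close> times the identity;
  \<open>\<eta> = \<epsilon> K exp (- K s)\<close>; \<open>f1\<close> is the derivative of the profile, and \<open>G0\<close>, \<open>G1\<close>, \<open>G2\<close> are the values of
  \<open>cosh f\<close> and of its first two derivatives. The assumption \<open>close\<close> says that the gap lies between
  \<open>- \<epsilon> exp (- K s)\<close> and \<open>0\<close>, and \<open>\<Lambda>\<close> bounds all other quantities and the reciprocal of the squared distance to the axis (as
  \<open>sinh\<^sup>2\<close>), so that every error is a constant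
  times \<open>\<eta>\<close>.\<close>

locale barrier_point =
  fixes p b g :: "'n::finite amb" and q G0 f1 G1 G2 \<eta> K \<kappa> \<Lambda> :: real
  assumes x: "norm (fst p) < 1"
    and G1: "G1\<^sup>2 = (G0\<^sup>2 - 1) * f1\<^sup>2" and G2: "G2 = G0 * (f1\<^sup>2 + q * (1 + f1\<^sup>2))"
    and q: "0 < q" and \<eta>: "0 < \<eta>" "\<eta> \<le> 1" and K: "1 \<le> K"
    and close: "conf (fst p) - 1 \<le> G0" "G0 \<le> conf (fst p) - 1 + \<eta> / K"
    and \<Lambda>: "1 \<le> \<Lambda>" "conf (fst p) \<le> \<Lambda>" "1 \<le> \<Lambda> * ((conf (fst p))\<^sup>2 * (norm (fst p))\<^sup>2)"
      "\<bar>G1\<bar> \<le> \<Lambda>" "norm b \<le> \<Lambda>" "0 \<le> \<kappa>" "\<kappa> \<le> \<Lambda>"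
    and g: "g = ((conf (fst p))\<^sup>2 *\<^sub>R fst p, - G1) - \<eta> *\<^sub>R b"
begin

abbreviation "c \<equiv> conf (fst p)"
abbreviation "ch \<equiv> conf (fst p) - 1"
abbreviation "m v \<equiv> metric p v v"

definition C1 :: real where "C1 = \<Lambda> + 3 * \<Lambda>\<^sup>2"
definition C5 :: real where "C5 = (1 + q) * (1 + 2 * \<Lambda> ^ 4 + 2 * \<Lambda> ^ 3)"

definition H :: "'n amb \<Rightarrow> 'n amb" where
  "H v = ((2 * c ^ 3 * (fst p \<bullet> fst v)) *\<^sub>R fst p + c\<^sup>2 *\<^sub>R fst v, - G2 * snd v)
     + (\<eta> * K * (b \<bullet> v)) *\<^sub>R b - (\<eta> * \<kappa>) *\<^sub>R v"

definition Q where "Q v = H v \<bullet> v - g \<bullet> christoffel p v v"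

lemma c2: "2 \<le> c" using conf_ge_2[OF x] .

lemma m_eq: "m v = c\<^sup>2 * (norm (fst v))\<^sup>2 + (snd v)\<^sup>2"
  unfolding metric_conf power2_norm_eq_inner by (simp add: power2_eq_square)

lemma norm_le_m: "(norm v)\<^sup>2 \<le> m v"
proof -
  have "1 \<le> c\<^sup>2" using c2 by (simp add: one_le_power)
  then have "1 * (norm (fst v))\<^sup>2 \<le> c\<^sup>2 * (norm (fst v))\<^sup>2" by (rule mult_right_mono) simp
  then show ?thesis by (cases v) (simp add: m_eq norm_Pair)
qed

lemma m_le: "m v \<le> c\<^sup>2 * (norm v)\<^sup>2"
proof -
  have "1 \<le> c\<^sup>2" using c2 by (simp add: one_le_power)
  then have "1 * (snd v)\<^sup>2 \<le> c\<^sup>2 * (snd v)\<^sup>2" by (rule mult_right_mono) simp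
  then show ?thesis by (cases v) (simp add: m_eq norm_Pair distrib_left)
qed

lemma m_nonneg: "0 \<le> m v" using norm_le_m[of v] by (meson order_trans zero_le_power2)

lemma fst_le_m: "(norm (fst v))\<^sup>2 \<le> m v"
proof -
  have "norm (fst v) \<le> norm v" using norm_fst_le[of "fst v" "snd v"] by simp
  then have "(norm (fst v))\<^sup>2 \<le> (norm v)\<^sup>2" by (rule power_mono) simp
  then show ?thesis using norm_le_m by (rule order_trans)
qed

lemma pHxR: "p \<in> HxR" using x by (simp add: HxR_iff)

lemma Q_ge: "ch * m v - (ch + G2) * (snd v)\<^sup>2 + \<eta> * K * (b \<bullet> v)\<^sup>2 - \<eta> * C1 * m v \<le> Q v"
proof -
  let ?w = "fst v" and ?x = "fst p"
  let ?g0 = "((conf ?x)\<^sup>2 *\<^sub>R ?x, - G1)"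
  have xx: "c * (?x \<bullet> ?x) = c - 2" using conf_norm_sq[OF x] by (simp add: power2_norm_eq_inner)
  have "?g0 \<bullet> christoffel p v v = 2 * c ^ 3 * (?x \<bullet> ?w)\<^sup>2 - c\<^sup>2 * (?w \<bullet> ?w) * (c * (?x \<bullet> ?x))"
    unfolding christoffel_conf[OF pHxR]
    by (simp only: inner_prod_def fst_conv snd_conv inner_scaleR_left inner_scaleR_right inner_diff_right
          inner_add_right inner_zero_right mult_zero_right)
      (simp add: inner_commute power2_eq_square power3_eq_cube algebra_simps)
  then have g0: "?g0 \<bullet> christoffel p v v = 2 * c ^ 3 * (?x \<bullet> ?w)\<^sup>2 - c\<^sup>2 * (?w \<bullet> ?w) * (c - 2)"
    unfolding xx .
  have H: "H v \<bullet> v = 2 * c ^ 3 * (?x \<bullet> ?w)\<^sup>2 + c\<^sup>2 * (?w \<bullet> ?w) - G2 * (snd v)\<^sup>2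
      + \<eta> * K * (b \<bullet> v)\<^sup>2 - \<eta> * \<kappa> * (norm v)\<^sup>2"
    unfolding H_def inner_diff_left inner_add_left inner_scaleR_left power2_norm_eq_inner[of v]
    by (simp only: inner_prod_def[of "(_, _)"] fst_conv snd_conv inner_add_left inner_scaleR_left)
      (simp add: power2_eq_square power3_eq_cube)
  have gv: "g \<bullet> christoffel p v v = 2 * c ^ 3 * (?x \<bullet> ?w)\<^sup>2 - c\<^sup>2 * (?w \<bullet> ?w) * (c - 2)
      - \<eta> * (b \<bullet> christoffel p v v)"
    using g0 by (simp add: g inner_diff_left)
  have "Q v = c\<^sup>2 * (?w \<bullet> ?w) * ch - G2 * (snd v)\<^sup>2 + \<eta> * K * (b \<bullet> v)\<^sup>2
      - \<eta> * \<kappa> * (norm v)\<^sup>2 + \<eta> * (b \<bullet> christoffel p v v)"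
    unfolding Q_def H gv by (simp add: algebra_simps)
  also have "c\<^sup>2 * (?w \<bullet> ?w) = m v - (snd v)\<^sup>2" by (simp add: m_eq power2_norm_eq_inner)
  finally have Q: "Q v = ch * m v - (ch + G2) * (snd v)\<^sup>2 + \<eta> * K * (b \<bullet> v)\<^sup>2
      - \<eta> * (\<kappa> * (norm v)\<^sup>2 - b \<bullet> christoffel p v v)"
    by (simp add: algebra_simps)
  have "\<kappa> * (norm v)\<^sup>2 \<le> \<Lambda> * m v"
    by (rule mult_mono) (use \<Lambda> norm_le_m in auto)
  moreover have "- (b \<bullet> christoffel p v v) \<le> 3 * \<Lambda>\<^sup>2 * m v"
  proof -
    have "- (b \<bullet> christoffel p v v) \<le> norm b * norm (christoffel p v v)"
      using Cauchy_Schwarz_ineq2[of b "christoffel p v v"] by linarith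
    also have "\<dots> \<le> \<Lambda> * (3 * c * (norm ?w)\<^sup>2)"
      by (rule mult_mono) (use \<Lambda> norm_christoffel_le[OF pHxR] in auto)
    also have "\<dots> \<le> \<Lambda> * (3 * \<Lambda> * m v)"
      by (intro mult_left_mono mult_mono) (use \<Lambda> fst_le_m c2 in auto)
    finally show ?thesis by (simp add: power2_eq_square)
  qed
  ultimately have "\<kappa> * (norm v)\<^sup>2 - b \<bullet> christoffel p v v \<le> C1 * m v"
    by (simp add: C1_def algebra_simps)
  then have "\<eta> * (\<kappa> * (norm v)\<^sup>2 - b \<bullet> christoffel p v v) \<le> \<eta> * (C1 * m v)"
    using \<eta> by (intro mult_left_mono) auto
  then show ?thesis unfolding Q by simp
qed

text \<open>On the tangent space of the rotational hypersurface itself the vertical component of a unit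
  vector is at most \<open>1 / sqrt (1 + f1\<^sup>2)\<close>, which makes the left-hand side at most \<open>(1 + q) ch\<close>. The
  rest of the bound accounts for the deviation of \<open>g\<close> from the gradient of the gap.\<close>

lemma tau_le:
  assumes v: "g \<bullet> v = 0"
  shows "(ch + G2) * (snd v)\<^sup>2 \<le> ((1 + q) * ch + C5 * \<eta>) * m v"
proof -
  let ?w = "fst v" and ?x = "fst p" and ?t = "snd v"
  define sh2 where "sh2 = c\<^sup>2 * (norm ?x)\<^sup>2"
  have sh2: "sh2 = ch\<^sup>2 - 1"
  proof -
    have "sh2 = c * (c * (norm ?x)\<^sup>2)" by (simp add: sh2_def power2_eq_square)
    then show ?thesis unfolding conf_norm_sq[OF x] by (simp add: power2_eq_square algebra_simps)
  qed
  have sh2_pos: "1 \<le> \<Lambda> * sh2" "0 < sh2"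
    using \<Lambda> unfolding sh2_def[symmetric] by (auto simp: zero_less_mult_iff dest: less_le_trans[OF zero_less_one])
  have "c\<^sup>2 * (?x \<bullet> ?w) = G1 * ?t + \<eta> * (b \<bullet> v)"
    using v unfolding g by (simp add: inner_diff_left inner_prod_def[of "(_, _)"])
  then have "(G1 * ?t + \<eta> * (b \<bullet> v))\<^sup>2 = c ^ 4 * (?x \<bullet> ?w)\<^sup>2"
    by (metis (no_types) power_mult_distrib power2_eq_square power4_eq_xxxx mult.assoc)
  also have "\<dots> \<le> c ^ 4 * ((norm ?x)\<^sup>2 * (norm ?w)\<^sup>2)"
    using Cauchy_Schwarz_ineq[of ?x ?w] c2 by (intro mult_left_mono) (auto simp: power2_norm_eq_inner)
  also have "\<dots> = sh2 * (m v - ?t\<^sup>2)"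
    by (simp add: sh2_def m_eq power4_eq_xxxx power2_eq_square)
  finally have A: "(G1 * ?t + \<eta> * (b \<bullet> v))\<^sup>2 \<le> sh2 * (m v - ?t\<^sup>2)" .
  have B: "G1\<^sup>2 * ?t\<^sup>2 - 2 * \<Lambda>\<^sup>2 * \<eta> * m v \<le> (G1 * ?t + \<eta> * (b \<bullet> v))\<^sup>2"
  proof -
    have s: "\<bar>?t\<bar> \<le> sqrt (m v)" "norm v \<le> sqrt (m v)"
      using norm_le_m[of v] by (auto intro!: real_le_rsqrt simp: m_eq)
    have "\<bar>b \<bullet> v\<bar> \<le> norm b * norm v" by (rule Cauchy_Schwarz_ineq2)
    also have "\<dots> \<le> \<Lambda> * sqrt (m v)" by (rule mult_mono) (use \<Lambda> s in auto)
    finally have bv: "\<bar>b \<bullet> v\<bar> \<le> \<Lambda> * sqrt (m v)" .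
    have "\<bar>G1 * ?t * (b \<bullet> v)\<bar> = \<bar>G1\<bar> * (\<bar>?t\<bar> * \<bar>b \<bullet> v\<bar>)" by (simp add: abs_mult)
    also have "\<dots> \<le> \<Lambda> * (sqrt (m v) * (\<Lambda> * sqrt (m v)))"
      by (intro mult_mono) (use \<Lambda> s bv m_nonneg in auto)
    also have "\<dots> = \<Lambda>\<^sup>2 * m v" using m_nonneg[of v] by (simp add: power2_eq_square)
    finally have "- (\<Lambda>\<^sup>2 * m v) \<le> G1 * ?t * (b \<bullet> v)" by linarith
    then have "\<eta> * - (\<Lambda>\<^sup>2 * m v) \<le> \<eta> * (G1 * ?t * (b \<bullet> v))" using \<eta> by (intro mult_left_mono) auto
    moreover have "(G1 * ?t + \<eta> * (b \<bullet> v))\<^sup>2 = G1\<^sup>2 * ?t\<^sup>2 + 2 * (\<eta> * (G1 * ?t * (b \<bullet> v))) + (\<eta> * (b \<bullet> v))\<^sup>2"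
      by (simp add: power2_eq_square algebra_simps)
    moreover have "2 * \<Lambda>\<^sup>2 * \<eta> * m v = - 2 * (\<eta> * - (\<Lambda>\<^sup>2 * m v))" by simp
    moreover have "0 \<le> (\<eta> * (b \<bullet> v))\<^sup>2" by simp
    ultimately show ?thesis by linarith
  qed
  have C: "?t\<^sup>2 * (sh2 + G1\<^sup>2) \<le> (sh2 + 2 * \<Lambda>\<^sup>2 * \<eta>) * m v"
    using A B by (simp add: algebra_simps)
  have G0ge: "1 \<le> G0" using close c2 by linarith
  have sG: "sh2 \<le> G0\<^sup>2 - 1"
    unfolding sh2 using close c2 by (simp add: power_mono)
  have "sh2 * (1 + f1\<^sup>2) \<le> sh2 + G1\<^sup>2"
    unfolding G1 using mult_right_mono[OF sG, of "f1\<^sup>2"] by (simp add: distrib_left)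
  then have "?t\<^sup>2 * (sh2 * (1 + f1\<^sup>2)) \<le> (sh2 + 2 * \<Lambda>\<^sup>2 * \<eta>) * m v"
    using C by (meson mult_left_mono order_trans zero_le_power2)
  then have "?t\<^sup>2 * (1 + f1\<^sup>2) * sh2 \<le> (sh2 + 2 * \<Lambda>\<^sup>2 * \<eta>) * m v" by (simp add: mult_ac)
  also have "\<dots> \<le> (sh2 + 2 * \<Lambda>\<^sup>2 * \<eta> * (\<Lambda> * sh2)) * m v"
  proof (rule mult_right_mono[OF _ m_nonneg])
    have "2 * \<Lambda>\<^sup>2 * \<eta> * 1 \<le> 2 * \<Lambda>\<^sup>2 * \<eta> * (\<Lambda> * sh2)"
      by (rule mult_left_mono[OF sh2_pos(1)]) (use \<eta> in simp)
    then show "sh2 + 2 * \<Lambda>\<^sup>2 * \<eta> \<le> sh2 + 2 * \<Lambda>\<^sup>2 * \<eta> * (\<Lambda> * sh2)" by simp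
  qed
  also have "\<dots> = (1 + 2 * \<Lambda> ^ 3 * \<eta>) * m v * sh2"
    by (simp add: power2_eq_square power3_eq_cube algebra_simps)
  finally have D: "?t\<^sup>2 * (1 + f1\<^sup>2) \<le> (1 + 2 * \<Lambda> ^ 3 * \<eta>) * m v"
    using sh2_pos(2) by (simp add: mult_le_cancel_right)
  have "(ch + G2) * ?t\<^sup>2 \<le> (G0 + G2) * ?t\<^sup>2"
    using close by (intro mult_right_mono) auto
  also have "\<dots> = G0 * (1 + q) * (?t\<^sup>2 * (1 + f1\<^sup>2))"
    unfolding G2 by (simp add: algebra_simps)
  also have "\<dots> \<le> G0 * (1 + q) * ((1 + 2 * \<Lambda> ^ 3 * \<eta>) * m v)"
    using G0ge q by (intro mult_left_mono[OF D]) auto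
  also have "\<dots> \<le> (ch + \<eta>) * (1 + q) * ((1 + 2 * \<Lambda> ^ 3 * \<eta>) * m v)"
  proof -
    have "\<eta> / K \<le> \<eta>" using \<eta> K by (simp add: divide_le_eq mult_left_le)
    then show ?thesis using close q \<eta> \<Lambda> m_nonneg by (intro mult_right_mono) auto
  qed
  also have "\<dots> = (1 + q) * ((ch + \<eta>) * (1 + 2 * \<Lambda> ^ 3 * \<eta>)) * m v" by (simp add: mult_ac)
  also have "\<dots> \<le> (1 + q) * (ch + \<eta> * (1 + 2 * \<Lambda> ^ 4 + 2 * \<Lambda> ^ 3)) * m v"
  proof (intro mult_right_mono mult_left_mono m_nonneg)
    have "\<Lambda> ^ 3 * (\<eta> * ch) \<le> \<Lambda> ^ 3 * (\<eta> * \<Lambda>)"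
      using \<Lambda> \<eta> by (intro mult_left_mono) auto
    moreover have "\<Lambda> ^ 3 * (\<eta> * \<eta>) \<le> \<Lambda> ^ 3 * (\<eta> * 1)"
      using \<Lambda> \<eta> by (intro mult_left_mono) auto
    ultimately show "(ch + \<eta>) * (1 + 2 * \<Lambda> ^ 3 * \<eta>) \<le> ch + \<eta> * (1 + 2 * \<Lambda> ^ 4 + 2 * \<Lambda> ^ 3)"
      by (simp add: algebra_simps power4_eq_xxxx power3_eq_cube)
  qed (use q in simp)
  finally show ?thesis by (simp add: C5_def algebra_simps)
qed

lemma Q_ge_all: "g \<bullet> v = 0 \<Longrightarrow> (- q * ch - (C1 + C5) * \<eta>) * m v \<le> Q v"
proof -
  assume "g \<bullet> v = 0"
  from tau_le[OF this] Q_ge[of v]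
  have "ch * m v - ((1 + q) * ch + C5 * \<eta>) * m v + \<eta> * K * (b \<bullet> v)\<^sup>2 - \<eta> * C1 * m v \<le> Q v" by linarith
  moreover have "0 \<le> \<eta> * K * (b \<bullet> v)\<^sup>2" using \<eta> K by simp
  ultimately show ?thesis by (simp add: algebra_simps)
qed

lemma Q_ge_horizontal: "snd v = 0 \<Longrightarrow> (ch - (C1 + C5) * \<eta>) * m v \<le> Q v"
proof -
  assume 0: "snd v = 0"
  have "0 \<le> \<eta> * K * (b \<bullet> v)\<^sup>2" using \<eta> K by simp
  moreover have "0 \<le> C5 * \<eta> * m v" using q \<eta> \<Lambda> m_nonneg[of v] by (simp add: C5_def)
  ultimately show ?thesis using Q_ge[of v] 0 by (simp add: algebra_simps)
qed

text \<open>The numbers \<open>k i\<close> dominate \<open>Q\<close> in an orthonormal basis of the hyperplane orthogonal to \<open>g\<close>. The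
  first bound evaluates \<open>Q\<close> on basis vectors. For the second, the plane of two basis vectors contains
  a horizontal vector, on which \<open>Q\<close> is almost \<open>ch\<close>. For the third, \<open>Q\<close> is summed over the basis; the
  vertical contributions are estimated by \<open>tau_le\<close> applied to the projection of the vertical
  direction, and the vector \<open>u\<close> shows that \<open>b\<close> has a tangential component of definite size.\<close>

lemma eigenvalue_bounds:
  fixes e :: "'n \<Rightarrow> 'n amb" and k :: "'n \<Rightarrow> real"
  assumes e: "\<forall>i j. metric p (e i) (e j) = (if i = j then 1 else 0)" "\<forall>i. g \<bullet> e i = 0"
    and span: "u = (\<Sum>i\<in>UNIV. metric p u (e i) *\<^sub>R e i)"
    and k: "\<forall>c v. v = (\<Sum>i\<in>UNIV. c i *\<^sub>R e i) \<longrightarrow> Q v \<le> (\<Sum>i\<in>UNIV. k i * (c i)\<^sup>2)"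
    and u: "c1 * m u \<le> (b \<bullet> u)\<^sup>2" "u \<noteq> 0"
  shows "\<forall>i. - q * ch - (C1 + C5) * \<eta> \<le> k i"
    "\<forall>i j. i \<noteq> j \<longrightarrow> ch - (C1 + C5) * \<eta> \<le> k i \<or> ch - (C1 + C5) * \<eta> \<le> k j"
    "(real CARD('n) - 1 - q) * ch + \<eta> * (K * c1 - C5 - real CARD('n) * C1) \<le> sum k UNIV"
proof -
  have lin: "metric p (\<Sum>i\<in>UNIV. b i *\<^sub>R e i) w = (\<Sum>i\<in>UNIV. b i * metric p (e i) w)" for b w
    by (simp add: metric_def fst_sum snd_sum inner_sum_left algebra_simps
      sum_distrib_left sum_distrib_right sum.distrib)
  have msum: "m (\<Sum>i\<in>UNIV. a i *\<^sub>R e i) = (\<Sum>i\<in>UNIV. (a i)\<^sup>2)" for a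
  proof -
    have "metric p (e i) (\<Sum>i\<in>UNIV. a i *\<^sub>R e i) = a i" for i
      unfolding metric_commute[of p "e i"] lin by (simp add: e(1)[rule_format] if_distrib cong: if_cong)
    then show ?thesis unfolding lin by (simp add: power2_eq_square)
  qed
  have ei: "e i = (\<Sum>j\<in>UNIV. (if j = i then 1 else 0) *\<^sub>R e j)" for i
    by (simp add: if_distrib[of "\<lambda>a. a *\<^sub>R _"] cong: if_cong)
  have Qe: "Q (e i) \<le> k i" for i
    using k[rule_format, OF ei[of i]] by (simp add: if_distrib[of "\<lambda>a. a\<^sup>2"] if_distrib[of "\<lambda>a. _ * a"] cong: if_cong)
  have me: "m (e i) = 1" for i using e(1) by simp
  show "\<forall>i. - q * ch - (C1 + C5) * \<eta> \<le> k i"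
  proof
    fix i show "- q * ch - (C1 + C5) * \<eta> \<le> k i"
      using Q_ge_all[of "e i"] Qe[of i] e(2) me[of i] by simp
  qed
  show "\<forall>i j. i \<noteq> j \<longrightarrow> ch - (C1 + C5) * \<eta> \<le> k i \<or> ch - (C1 + C5) * \<eta> \<le> k j"
  proof (intro allI impI, rule ccontr)
    fix i j :: 'n assume ij: "i \<noteq> j" and "\<not> (ch - (C1 + C5) * \<eta> \<le> k i \<or> ch - (C1 + C5) * \<eta> \<le> k j)"
    then have lt: "k i < ch - (C1 + C5) * \<eta>" "k j < ch - (C1 + C5) * \<eta>" by auto
    define ti tj where "ti = snd (e i)" and "tj = snd (e j)"
    show False
    proof (cases "ti = 0 \<and> tj = 0")
      case True
      then show ?thesis using Q_ge_horizontal[of "e i"] Qe[of i] me[of i] lt by (simp add: ti_def)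
    next
      case False
      define a where "a l = (if l = i then tj else if l = j then - ti else 0)" for l
      define v where "v = (\<Sum>l\<in>UNIV. a l *\<^sub>R e l)"
      have two: "(\<Sum>l\<in>UNIV. F l) = F i + F j" if "\<And>l. l \<noteq> i \<Longrightarrow> l \<noteq> j \<Longrightarrow> F l = 0" for F :: "'n \<Rightarrow> real"
      proof -
        have "(\<Sum>l\<in>UNIV. F l) = (\<Sum>l\<in>{i, j}. F l)"
          by (rule sum.mono_neutral_right) (use that in auto)
        then show ?thesis using ij by simp
      qed
      have "snd v = (\<Sum>l\<in>UNIV. a l * snd (e l))" by (simp add: v_def snd_sum)
      also have "\<dots> = 0" by (subst two) (use ij in \<open>auto simp: a_def ti_def tj_def\<close>)
      finally have "(ch - (C1 + C5) * \<eta>) * m v \<le> Q v" by (rule Q_ge_horizontal)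
      moreover have "m v = tj\<^sup>2 + ti\<^sup>2"
        unfolding v_def msum by (subst two) (use ij in \<open>auto simp: a_def\<close>)
      moreover have "Q v \<le> k i * tj\<^sup>2 + k j * ti\<^sup>2"
      proof -
        have "Q v \<le> (\<Sum>l\<in>UNIV. k l * (a l)\<^sup>2)" using k v_def by blast
        also have "\<dots> = k i * tj\<^sup>2 + k j * ti\<^sup>2" by (subst two) (use ij in \<open>auto simp: a_def\<close>)
        finally show ?thesis .
      qed
      ultimately have "(ch - (C1 + C5) * \<eta> - k i) * tj\<^sup>2 + (ch - (C1 + C5) * \<eta> - k j) * ti\<^sup>2 \<le> 0"
        by (simp add: algebra_simps)
      moreover have "0 \<le> (ch - (C1 + C5) * \<eta> - k i) * tj\<^sup>2" "0 \<le> (ch - (C1 + C5) * \<eta> - k j) * ti\<^sup>2"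
        "tj \<noteq> 0 \<Longrightarrow> 0 < (ch - (C1 + C5) * \<eta> - k i) * tj\<^sup>2" "ti \<noteq> 0 \<Longrightarrow> 0 < (ch - (C1 + C5) * \<eta> - k j) * ti\<^sup>2"
        using lt by (auto intro!: mult_pos_pos mult_nonneg_nonneg)
      ultimately show False using False by linarith
    qed
  qed
  show "(real CARD('n) - 1 - q) * ch + \<eta> * (K * c1 - C5 - real CARD('n) * C1) \<le> sum k UNIV"
  proof -
    define Z where "Z = (\<Sum>i\<in>UNIV. (snd (e i))\<^sup>2)"
    define z where "z = (\<Sum>i\<in>UNIV. snd (e i) *\<^sub>R e i)"
    define W where "W = (\<Sum>i\<in>UNIV. (b \<bullet> e i)\<^sup>2)"
    have Z0: "0 \<le> Z" by (simp add: Z_def sum_nonneg)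
    have "snd z = Z" "m z = Z" by (simp_all add: z_def Z_def msum snd_sum power2_eq_square)
    moreover have "g \<bullet> z = 0" using e(2) by (simp add: z_def inner_sum_right)
    ultimately have "(ch + G2) * Z\<^sup>2 \<le> ((1 + q) * ch + C5 * \<eta>) * Z" using tau_le[of z] by simp
    then have "Z * ((ch + G2) * Z) \<le> Z * ((1 + q) * ch + C5 * \<eta>)" by (simp add: power2_eq_square mult_ac)
    moreover have "0 \<le> (1 + q) * ch + C5 * \<eta>" using q c2 \<eta> \<Lambda> by (simp add: C5_def)
    ultimately have Z: "(ch + G2) * Z \<le> (1 + q) * ch + C5 * \<eta>"
      using Z0 by (cases "Z = 0") (auto simp: mult_le_cancel_left)
    define a where "a i = metric p u (e i)" for i
    have ua: "u = (\<Sum>i\<in>UNIV. a i *\<^sub>R e i)" using span by (simp add: a_def)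
    have mu: "m u = (\<Sum>i\<in>UNIV. (a i)\<^sup>2)" using msum[of a] by (simp only: ua[symmetric])
    have "b \<bullet> u = (\<Sum>i\<in>UNIV. a i * (b \<bullet> e i))" by (subst ua) (simp add: inner_sum_right)
    then have "(b \<bullet> u)\<^sup>2 \<le> m u * W"
      unfolding mu W_def using Cauchy_Schwarz_ineq_sum[of a "\<lambda>i. b \<bullet> e i" UNIV] by simp
    moreover have "0 < m u" using norm_le_m[of u] u(2) by (smt (verit) zero_less_norm_iff zero_less_power)
    ultimately have W: "c1 \<le> W"
    proof -
      assume pos: "0 < m u" and "(b \<bullet> u)\<^sup>2 \<le> m u * W"
      then have "c1 * m u \<le> m u * W" using order_trans[OF u(1)] by blast
      then have "m u * c1 \<le> m u * W" by (simp only: mult.commute)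
      then show ?thesis using pos by (simp only: mult_le_cancel_left_pos)
    qed
    have "(\<Sum>i\<in>UNIV. ch - (ch + G2) * (snd (e i))\<^sup>2 + \<eta> * K * (b \<bullet> e i)\<^sup>2 - \<eta> * C1) \<le> sum k UNIV"
    proof (rule sum_mono)
      fix i show "ch - (ch + G2) * (snd (e i))\<^sup>2 + \<eta> * K * (b \<bullet> e i)\<^sup>2 - \<eta> * C1 \<le> k i"
        using Q_ge[of "e i"] Qe[of i] me[of i] by simp
    qed
    also have "(\<Sum>i\<in>UNIV. ch - (ch + G2) * (snd (e i))\<^sup>2 + \<eta> * K * (b \<bullet> e i)\<^sup>2 - \<eta> * C1)
       = real CARD('n) * ch - (ch + G2) * Z + \<eta> * K * W - real CARD('n) * (\<eta> * C1)"
      by (simp add: sum.distrib sum_subtractf sum_distrib_left Z_def W_def)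
    finally have "real CARD('n) * ch - (ch + G2) * Z + \<eta> * K * W - real CARD('n) * (\<eta> * C1) \<le> sum k UNIV" .
    moreover have "\<eta> * K * c1 \<le> \<eta> * K * W" using W \<eta> K by (intro mult_left_mono) auto
    ultimately show ?thesis using Z by (simp add: algebra_simps)
  qed
qed

end

lemma continuous_on_grad_gap:
  assumes "profile_on q a J f" "open J" "\<And>p. p \<in> C \<Longrightarrow> norm (fst p) < 1 \<and> snd p \<in> J"
  shows "continuous_on C (grad_gap f)"
proof (rule continuous_at_imp_continuous_on, rule ballI)
  fix p assume "p \<in> C"
  from has_derivative_continuous[OF grad_gap_has_derivative[OF _ assms(1,2), of p]] assms(3)[OF this]
  show "isCont (grad_gap f) p" by simp
qed

text \<open>Strict form of the Cauchy-Schwarz inequality for vectors that are not parallel.\<close>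

lemma gram_pos:
  fixes u v :: "'a::real_inner"
  assumes "v \<noteq> 0" "\<And>c. u \<noteq> c *\<^sub>R v"
  shows "0 < (u \<bullet> u) * (v \<bullet> v) - (u \<bullet> v)\<^sup>2"
proof -
  define c where "c = (u \<bullet> v) / (v \<bullet> v)"
  have vv: "0 < v \<bullet> v" using assms(1) by simp
  have "0 < (u - c *\<^sub>R v) \<bullet> (u - c *\<^sub>R v)" using assms(2)[of c] by simp
  also have "\<dots> = u \<bullet> u - (u \<bullet> v)\<^sup>2 / (v \<bullet> v)"
    using vv by (simp add: c_def inner_diff_left inner_diff_right inner_commute power2_eq_square field_simps)
  finally have "0 < (v \<bullet> v) * (u \<bullet> u - (u \<bullet> v)\<^sup>2 / (v \<bullet> v))" using vv by simp
  then show ?thesis using vv by (simp add: algebra_simps)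
qed

text \<open>The barrier function. At an interior local maximum of \<open>gap f + \<epsilon> exp (- K s)\<close> the comparison at
  one point gives numbers \<open>k i\<close> that dominate the Hessian and are a zero of the symmetric function.
  The first two bounds in \<open>eigenvalue_bounds\<close> are those of the rotational hypersurface up to \<open>O(\<eta>)\<close>,
  while transversality of \<open>gs\<close> to the gradient of the gap adds \<open>\<eta> K c1\<close> to the trace. For large \<open>K\<close>
  this beats all errors and contradicts \<open>esym_nonzero\<close>.\<close>

lemma no_local_max_near_profile:
  fixes M C :: "'n::finite amb set" and s :: "'n amb \<Rightarrow> real" and gs :: "'n amb \<Rightarrow> 'n amb"
  assumes r: "1 \<le> r" "r + 1 < CARD('n)"
    and q: "q = (real CARD('n) - real r - 1) / (real r + 1)"
    and f: "profile_on q a J f" "open J"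
    and M: "hypersurface M" "r_minimal r M"
    and C: "compact C" "\<And>p. p \<in> C \<Longrightarrow> norm (fst p) < 1 \<and> fst p \<noteq> 0 \<and> snd p \<in> J"
    and s: "\<And>y. (s has_derivative (\<lambda>v. gs y \<bullet> v)) (at y)"
      "\<And>y. (gs has_derivative (\<lambda>v. \<kappa> *\<^sub>R v)) (at y)" "0 \<le> \<kappa>"
    and transversal: "\<And>p c. p \<in> C \<Longrightarrow> gs p \<noteq> c *\<^sub>R grad_gap f p"
  obtains K \<epsilon>0 where "0 < K" "0 < \<epsilon>0"
    "\<forall>\<epsilon> p. 0 < \<epsilon> \<longrightarrow> \<epsilon> < \<epsilon>0 \<longrightarrow> p \<in> M \<longrightarrow> p \<in> C \<longrightarrow> p \<notin> boundary M \<longrightarrow>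
      - (\<epsilon> * exp (- K * s p)) \<le> gap f p \<longrightarrow> gap f p \<le> 0 \<longrightarrow>
      \<not> (\<forall>\<^sub>F y in nhds p. y \<in> M \<longrightarrow> gap f y + \<epsilon> * exp (- K * s y) \<le> gap f p + \<epsilon> * exp (- K * s p))"
proof (cases "C = {}")
  case True
  then show ?thesis using that[of 1 1] by auto
next
  case False
  note pf = profile_onE[OF f(1)]
  have q0: "0 < q" using r by (simp add: q field_simps)
  have cont_gs: "continuous_on C gs" and cont_s: "continuous_on C s"
    using s(1,2) has_derivative_continuous
    by (blast intro: continuous_at_imp_continuous_on)+
  have cont_g0: "continuous_on C (grad_gap f)"
    by (rule continuous_on_grad_gap[OF f]) (use C in auto)
  have cont_conf: "continuous_on C (\<lambda>p. conf (fst p))"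
    unfolding conf_def
  proof (intro continuous_intros ballI)
    fix p assume "p \<in> C"
    then have "(norm (fst p))\<^sup>2 < 1" using C(2) by (simp add: power_less_one_iff)
    then show "1 - (norm (fst p))\<^sup>2 \<noteq> 0" by simp
  qed
  have g0_ne: "grad_gap f p \<noteq> 0" if "p \<in> C" for p
    using C(2)[OF that] conf_ge_2[of "fst p"] by (auto simp: grad_gap_def prod_eq_iff)
  define gram where "gram p = (gs p \<bullet> gs p) * (grad_gap f p \<bullet> grad_gap f p) - (gs p \<bullet> grad_gap f p)\<^sup>2" for p
  have "continuous_on C gram"
    unfolding gram_def by (intro continuous_intros cont_gs cont_g0)
  then obtain p1 where "p1 \<in> C" "\<And>p. p \<in> C \<Longrightarrow> gram p1 \<le> gram p"
    using continuous_attains_inf[OF C(1) False] by blast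
  moreover have gram_p: "0 < gram p" if "p \<in> C" for p
    unfolding gram_def by (rule gram_pos) (use g0_ne transversal that in auto)
  ultimately obtain \<gamma> where \<gamma>: "0 < \<gamma>" "\<And>p. p \<in> C \<Longrightarrow> \<gamma> \<le> gram p" by blast
  have bdd: "\<exists>B. \<forall>p\<in>C. \<bar>h p\<bar> \<le> B" if "continuous_on C h" for h :: "'n amb \<Rightarrow> real"
    using compact_imp_bounded[OF compact_continuous_image[OF that C(1)]] by (auto simp: bounded_iff)
  obtain S where S: "\<And>p. p \<in> C \<Longrightarrow> \<bar>s p\<bar> \<le> S" using bdd[OF cont_s] by blast
  obtain B1 where B1: "\<And>p. p \<in> C \<Longrightarrow> \<bar>conf (fst p)\<bar> \<le> B1" using bdd[OF cont_conf] by blast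
  obtain B2 where B2: "\<And>p. p \<in> C \<Longrightarrow> \<bar>norm (grad_gap f p)\<bar> \<le> B2"
    using bdd[OF continuous_on_norm[OF cont_g0]] by blast
  obtain B3 where B3: "\<And>p. p \<in> C \<Longrightarrow> \<bar>norm (gs p)\<bar> \<le> B3"
    using bdd[OF continuous_on_norm[OF cont_gs]] by blast
  define sh2 where "sh2 p = (conf (fst p))\<^sup>2 * (norm (fst p))\<^sup>2" for p :: "'n amb"
  have sh2_pos: "0 < sh2 p" if "p \<in> C" for p
    using C(2)[OF that] conf_ge_2[of "fst p"] by (auto simp: sh2_def)
  have "continuous_on C (\<lambda>p. inverse (sh2 p))"
  proof (rule continuous_on_inverse)
    show "continuous_on C sh2"
      unfolding sh2_def by (intro continuous_intros cont_conf)
    show "\<forall>p\<in>C. sh2 p \<noteq> 0" using sh2_pos by fastforce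
  qed
  then obtain B4 where B4: "\<And>p. p \<in> C \<Longrightarrow> \<bar>inverse (sh2 p)\<bar> \<le> B4" using bdd by blast
  define \<Lambda> where "\<Lambda> = 1 + \<bar>B1\<bar> + \<bar>B2\<bar> + \<bar>B3\<bar> + \<bar>B4\<bar> + \<kappa>"
  define n where "n = real CARD('n)"
  define E1 where "E1 = \<Lambda> + 3 * \<Lambda>\<^sup>2"
  define E5 where "E5 = (1 + q) * (1 + 2 * \<Lambda> ^ 4 + 2 * \<Lambda> ^ 3)"
  define c1 where "c1 = \<gamma> / (4 * \<Lambda> ^ 4)"
  have \<Lambda>1: "1 \<le> \<Lambda>" using s(3) by (simp add: \<Lambda>_def)
  have CC: "0 < E1 + E5" using \<Lambda>1 q0 by (auto simp: E1_def E5_def intro!: add_pos_pos mult_pos_pos)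
  have c1: "0 < c1" using \<gamma> \<Lambda>1 by (simp add: c1_def)
  obtain D \<delta>0 where D: "(0::real) < D" "(0::real) < \<delta>0"
    "\<forall>(k :: 'n \<Rightarrow> real) lam \<delta>. 1 \<le> lam \<longrightarrow> 0 < \<delta> \<longrightarrow> \<delta> \<le> \<delta>0 \<longrightarrow>
      (\<forall>i. - q * lam - \<delta> \<le> k i) \<longrightarrow>
      (\<forall>i j. i \<noteq> j \<longrightarrow> lam - \<delta> \<le> k i \<or> lam - \<delta> \<le> k j) \<longrightarrow>
      (real CARD('n) - 1 - q) * lam + D * \<delta> \<le> sum k UNIV \<longrightarrow> esym (r + 1) UNIV k \<noteq> 0"
    by (rule esym_nonzero[OF r q]) (rule that)
  define K where "K = 1 + (E5 + n * E1 + D * (E1 + E5)) / c1"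
  have "0 \<le> E1" "0 \<le> E5" using \<Lambda>1 q0 by (simp_all add: E1_def E5_def)
  then have K1: "1 \<le> K" using c1 D(1) by (simp add: K_def n_def)
  have Kc1: "D * (E1 + E5) \<le> K * c1 - E5 - n * E1"
    using c1 by (simp add: K_def field_simps)
  define \<epsilon>0 where "\<epsilon>0 = min 1 (\<delta>0 / (E1 + E5)) / (K * exp (K * S))"
  have \<epsilon>0: "0 < \<epsilon>0" using D(2) CC K1 by (simp add: \<epsilon>0_def)
  have "\<not> (\<forall>\<^sub>F y in nhds p. y \<in> M \<longrightarrow> gap f y + \<epsilon> * exp (- K * s y) \<le> gap f p + \<epsilon> * exp (- K * s p))"
    if \<epsilon>: "0 < \<epsilon>" "\<epsilon> < \<epsilon>0" and p: "p \<in> M" "p \<in> C" "p \<notin> boundary M"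
      and gp: "- (\<epsilon> * exp (- K * s p)) \<le> gap f p" "gap f p \<le> 0" for \<epsilon> p
  proof
    assume max: "\<forall>\<^sub>F y in nhds p. y \<in> M \<longrightarrow> gap f y + \<epsilon> * exp (- K * s y) \<le> gap f p + \<epsilon> * exp (- K * s p)"
    define \<eta> where "\<eta> = \<epsilon> * K * exp (- K * s p)"
    have \<eta>0: "0 < \<eta>" using \<epsilon> K1 by (simp add: \<eta>_def)
    have "- (K * s p) \<le> K * S"
      using S[OF p(2)] K1 mult_left_mono[of "- s p" S K] by simp
    then have "\<eta> \<le> \<epsilon>0 * (K * exp (K * S))"
      unfolding \<eta>_def mult.assoc using \<epsilon> K1 \<epsilon>0 by (intro mult_mono) auto
    also have "\<dots> = min 1 (\<delta>0 / (E1 + E5))" using K1 by (simp add: \<epsilon>0_def)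
    finally have \<eta>1: "\<eta> \<le> 1" and \<eta>2: "(E1 + E5) * \<eta> \<le> \<delta>0"
      using CC by (simp_all add: pos_le_divide_eq mult.commute)
    have px: "norm (fst p) < 1" "fst p \<noteq> 0" "snd p \<in> J" using C(2)[OF p(2)] by auto
    define g where "g y = grad_gap f y - (\<epsilon> * K * exp (- K * s y)) *\<^sub>R gs y" for y
    define f1 where "f1 = deriv f (snd p)"
    define G0 where "G0 = cosh (f (snd p))"
    define G1 where "G1 = sinh (f (snd p)) * f1"
    define G2 where "G2 = G0 * (f1\<^sup>2 + q * (1 + f1\<^sup>2))"
    have gap_G0: "gap f p = conf (fst p) - 1 - G0" by (simp add: gap_def G0_def)
    have \<eta>K: "\<eta> / K = \<epsilon> * exp (- K * s p)" using K1 by (simp add: \<eta>_def)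
    interpret barrier_point p "gs p" "g p" q G0 f1 G1 G2 \<eta> K \<kappa> \<Lambda>
    proof
      show "G1\<^sup>2 = (G0\<^sup>2 - 1) * f1\<^sup>2"
        by (simp add: G1_def G0_def power_mult_distrib cosh_square_eq)
      show "1 \<le> \<Lambda> * ((conf (fst p))\<^sup>2 * (norm (fst p))\<^sup>2)"
      proof -
        have "inverse (sh2 p) \<le> \<Lambda>" using B4[OF p(2)] s(3) unfolding \<Lambda>_def by linarith
        then show ?thesis using sh2_pos[OF p(2)] unfolding sh2_def[symmetric]
          by (simp add: inverse_eq_divide pos_divide_le_eq)
      qed
      have "grad_gap f p = ((conf (fst p))\<^sup>2 *\<^sub>R fst p, - G1)"
        by (simp add: grad_gap_def G1_def f1_def)
      moreover from this have "\<bar>G1\<bar> \<le> norm (grad_gap f p)"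
        using norm_snd_le[of "- G1" "(conf (fst p))\<^sup>2 *\<^sub>R fst p"] by simp
      ultimately show "\<bar>G1\<bar> \<le> \<Lambda>" and "g p = ((conf (fst p))\<^sup>2 *\<^sub>R fst p, - G1) - \<eta> *\<^sub>R gs p"
        using B2[OF p(2)] s(3) by (simp_all add: \<Lambda>_def g_def \<eta>_def)
      show "conf (fst p) \<le> \<Lambda>" "norm (gs p) \<le> \<Lambda>" "\<kappa> \<le> \<Lambda>"
        using B1[OF p(2)] B3[OF p(2)] s(3) by (simp_all add: \<Lambda>_def)
      show "conf (fst p) - 1 \<le> G0" "G0 \<le> conf (fst p) - 1 + \<eta> / K"
        using gp unfolding gap_G0 \<eta>K by simp_all
    qed (use px q0 \<eta>0 \<eta>1 K1 \<Lambda>1 s(3) G2_def in simp_all)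
    have dF: "\<forall>\<^sub>F y in nhds p. ((\<lambda>y. gap f y + \<epsilon> * exp (- K * s y)) has_derivative (\<lambda>w. g y \<bullet> w)) (at y)"
    proof -
      have "open (ball 0 1 \<times> J :: 'n amb set)" using f(2) by (intro open_Times) auto
      moreover have "p \<in> ball 0 1 \<times> J" using px by (simp add: mem_Times_iff)
      ultimately have "\<forall>\<^sub>F y in nhds p. y \<in> ball 0 1 \<times> J" by (rule eventually_nhds_in_open)
      then show ?thesis
      proof (rule eventually_mono)
        fix y :: "'n amb" assume "y \<in> ball 0 1 \<times> J"
        then have y: "norm (fst y) < 1" "snd y \<in> J" by auto
        note gap_has_derivative[OF y(1) pf(3)[OF y(2)]]
        moreover have "((\<lambda>y. \<epsilon> * exp (- K * s y)) has_derivative (\<lambda>v. - (\<epsilon> * K * exp (- K * s y)) * (gs y \<bullet> v))) (at y)"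
          by (auto intro!: derivative_eq_intros s(1) simp: fun_eq_iff)
        ultimately show "((\<lambda>y. gap f y + \<epsilon> * exp (- K * s y)) has_derivative (\<lambda>w. g y \<bullet> w)) (at y)"
          by (rule has_derivative_eq_rhs[OF has_derivative_add]) (simp add: g_def inner_diff_left fun_eq_iff)
      qed
    qed
    have dg: "(g has_derivative H) (at p)"
    proof -
      have "((\<lambda>y. \<epsilon> * K * exp (- K * s y)) has_derivative (\<lambda>v. - (\<eta> * K) * (gs p \<bullet> v))) (at p)"
        by (auto intro!: derivative_eq_intros s(1) simp: fun_eq_iff \<eta>_def)
      from has_derivative_diff[OF grad_gap_has_derivative[OF px(1) f px(3)] has_derivative_scaleR[OF this s(2)]]
      show ?thesis
        unfolding g_def[abs_def] H_def[abs_def]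
        by (rule has_derivative_eq_rhs)
          (simp add: fun_eq_iff G2_def G0_def f1_def \<eta>_def algebra_simps)
    qed
    obtain e :: "'n \<Rightarrow> 'n amb" and k :: "'n \<Rightarrow> real" where ek:
      "\<forall>i j. metric p (e i) (e j) = (if i = j then 1 else 0)"
      "\<forall>i. g p \<bullet> e i = 0"
      "g p \<noteq> 0 \<longrightarrow> (\<forall>v. g p \<bullet> v = 0 \<longrightarrow> v = (\<Sum>i\<in>UNIV. metric p v (e i) *\<^sub>R e i))"
      "\<forall>c v. v = (\<Sum>i\<in>UNIV. c i *\<^sub>R e i) \<longrightarrow> H v \<bullet> v - g p \<bullet> christoffel p v v \<le> (\<Sum>i\<in>UNIV. k i * (c i)\<^sup>2)"
      "esym (r + 1) UNIV k = 0"
      by (rule one_point_comparison[OF M p(1,3) dF dg max]) (use r in simp, rule that)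
    \<comment> \<open>The vector \<open>u\<close> below is the component of \<open>gs p\<close> orthogonal to the gradient \<open>X\<close>.\<close>
    define b where "b = gs p"
    define X where "X = g p"
    \<comment> \<open>The Gram determinant does not change when a multiple of \<open>gs\<close> is added to the gradient of the gap.\<close>
    have gramX: "(b \<bullet> b) * (X \<bullet> X) - (b \<bullet> X)\<^sup>2 = gram p"
      unfolding gram_def b_def X_def g_def
      by (simp add: inner_diff_left inner_diff_right inner_commute power2_eq_square algebra_simps)
    have X0: "X \<noteq> 0" using gramX gram_p[OF p(2)] by auto
    then have XX: "0 < X \<bullet> X" by simp
    define u where "u = b - ((b \<bullet> X) / (X \<bullet> X)) *\<^sub>R X"
    have Xu: "X \<bullet> u = 0" using XX by (simp add: u_def inner_diff_right inner_commute)
    have bu: "b \<bullet> u = gram p / (X \<bullet> X)"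
      using XX by (simp add: u_def inner_diff_right gramX[symmetric] power2_eq_square field_simps)
    have uu: "(norm u)\<^sup>2 = b \<bullet> u"
      unfolding power2_norm_eq_inner using Xu by (subst (1) u_def) (simp add: inner_diff_left)
    have bu_pos: "0 < b \<bullet> u" unfolding bu using XX gram_p[OF p(2)] by simp
    then have u0: "u \<noteq> 0" by auto
    have "norm X \<le> norm (grad_gap f p) + \<eta> * norm (gs p)"
      unfolding X_def g_def using norm_triangle_ineq4[of "grad_gap f p" "\<eta> *\<^sub>R gs p"] \<eta>0 by (simp add: \<eta>_def)
    also have "\<dots> \<le> \<Lambda> + 1 * \<Lambda>"
      using B2[OF p(2)] B3[OF p(2)] s(3) \<eta>1 \<eta>0 by (intro add_mono mult_mono) (auto simp: \<Lambda>_def)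
    finally have "(norm X)\<^sup>2 \<le> (2 * \<Lambda>)\<^sup>2" by (intro power_mono) auto
    then have "X \<bullet> X \<le> 4 * \<Lambda>\<^sup>2" by (simp add: power2_norm_eq_inner power_mult_distrib)
    then have "\<gamma> / (4 * \<Lambda>\<^sup>2) \<le> gram p / (X \<bullet> X)"
      using \<gamma>(1) \<gamma>(2)[OF p(2)] XX by (intro frac_le) auto
    then have "c1 * \<Lambda>\<^sup>2 \<le> b \<bullet> u"
      unfolding bu c1_def using \<Lambda>1 by (simp add: power2_eq_square power4_eq_xxxx)
    have "c1 * metric p u u \<le> c1 * ((conf (fst p))\<^sup>2 * (norm u)\<^sup>2)"
      using c1 m_le by (intro mult_left_mono) auto
    also have "\<dots> \<le> c1 * (\<Lambda>\<^sup>2 * (norm u)\<^sup>2)"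
      using c1 \<Lambda> c2 by (intro mult_left_mono mult_right_mono power_mono) auto
    also have "\<dots> \<le> (b \<bullet> u) * (b \<bullet> u)"
      unfolding uu mult.assoc[symmetric] using \<open>c1 * \<Lambda>\<^sup>2 \<le> b \<bullet> u\<close> bu_pos by (intro mult_right_mono) auto
    finally have cu: "c1 * metric p u u \<le> (gs p \<bullet> u)\<^sup>2" by (simp add: power2_eq_square b_def)
    have span: "u = (\<Sum>i\<in>UNIV. metric p u (e i) *\<^sub>R e i)"
      using ek(3) X0 Xu unfolding X_def by blast
    have kQ: "\<forall>c v. v = (\<Sum>i\<in>UNIV. c i *\<^sub>R e i) \<longrightarrow> Q v \<le> (\<Sum>i\<in>UNIV. k i * (c i)\<^sup>2)"
      using ek(4) unfolding Q_def .
    note ev = eigenvalue_bounds[OF ek(1,2) span kQ cu u0]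
    have "C1 = E1" "C5 = E5"
      by (simp_all add: C1_def C5_def E1_def E5_def)
    note ev' = ev[unfolded this]
    have "esym (r + 1) UNIV k \<noteq> 0"
    proof (rule D(3)[rule_format, OF _ _ \<eta>2])
      show "1 \<le> conf (fst p) - 1" using c2 by simp
      show "0 < (E1 + E5) * \<eta>" using CC \<eta>0 by simp
      show "- q * (conf (fst p) - 1) - (E1 + E5) * \<eta> \<le> k i" for i using ev'(1) by blast
      show "conf (fst p) - 1 - (E1 + E5) * \<eta> \<le> k i \<or> conf (fst p) - 1 - (E1 + E5) * \<eta> \<le> k j"
        if "i \<noteq> j" for i j using ev'(2) that by blast
      have "D * ((E1 + E5) * \<eta>) \<le> \<eta> * (K * c1 - E5 - n * E1)"
        using mult_left_mono[OF Kc1, of \<eta>] \<eta>0 by (simp add: mult_ac)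
      then show "(real CARD('n) - 1 - q) * (conf (fst p) - 1) + D * ((E1 + E5) * \<eta>) \<le> sum k UNIV"
        using ev'(3) unfolding n_def by linarith
    qed
    then show False using ek(5) by simp
  qed
  then show ?thesis
    using that[of K \<epsilon>0] K1 \<epsilon>0 by (simp del: not_eventually)
qed

section \<open>Profile curves\<close>

text \<open>The logarithmic derivatives of both sides agree, by the equation of the profile.\<close>

lemma first_integral:
  assumes q: "0 < q" and a: "0 < a" and f: "profile_on q a {-l<..<l} f" and t: "t \<in> {-l<..<l}"
  shows "1 + (deriv f t)\<^sup>2 = (sinh (f t) / sinh a) powr (2 * q)"
proof -
  note pf = profile_onE[OF f]
  have l: "0 \<in> {-l<..<l}" using t by auto
  define W where "W t = ln (1 + (deriv f t)\<^sup>2) - 2 * q * ln (sinh (f t))" for t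
  have pos: "0 < 1 + (deriv f s)\<^sup>2" for s by (simp add: add_pos_nonneg)
  have "(W has_real_derivative 0) (at s within {-l<..<l})" if s: "s \<in> {-l<..<l}" for s
  proof -
    have sh: "0 < sinh (f s)" using pf(1)[OF s] by simp
    have "(W has_real_derivative (2 * deriv f s * (q * (cosh (f s) / sinh (f s)) * (1 + (deriv f s)\<^sup>2)) / (1 + (deriv f s)\<^sup>2)
        - 2 * q * (cosh (f s) * deriv f s / sinh (f s)))) (at s)"
      unfolding W_def using sh pos[of s]
      by (auto intro!: derivative_eq_intros pf(3)[OF s] pf(4)[OF open_greaterThanLessThan s] simp: field_simps)
    moreover have "2 * deriv f s * (q * (cosh (f s) / sinh (f s)) * (1 + (deriv f s)\<^sup>2)) / (1 + (deriv f s)\<^sup>2)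
        - 2 * q * (cosh (f s) * deriv f s / sinh (f s)) = 0"
      using sh pos[of s] by simp
    ultimately show ?thesis using has_field_derivative_at_within by metis
  qed
  then obtain c where "\<And>s. s \<in> {-l<..<l} \<Longrightarrow> W s = c"
    using has_field_derivative_zero_constant[of "{-l<..<l}" W] by auto
  then have "W t = W 0" using t l by metis
  also have "W 0 = - 2 * q * ln (sinh a)" using pf(5)[OF l] pf(2) by (simp add: W_def)
  finally have "ln (1 + (deriv f t)\<^sup>2) = 2 * q * ln (sinh (f t) / sinh a)"
    using pf(1)[OF t] a by (simp add: W_def ln_div algebra_simps)
  then have "exp (ln (1 + (deriv f t)\<^sup>2)) = (sinh (f t) / sinh a) powr (2 * q)"
    using pf(1)[OF t] a by (simp add: powr_def)
  then show ?thesis using pos[of t] by simp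
qed

lemma deriv_profile_strict_mono:
  assumes q: "0 < q" and f: "profile_on q a {-l<..<l} f" and st: "-l < s" "s < t" "t < l"
  shows "deriv f s < deriv f t"
proof (rule DERIV_pos_imp_increasing[OF st(2)])
  fix x assume x: "s \<le> x" "x \<le> t"
  then have xJ: "x \<in> {-l<..<l}" using st by auto
  have "0 < q * (cosh (f x) / sinh (f x)) * (1 + (deriv f x)\<^sup>2)"
    using q profile_onE(1)[OF f xJ] by (intro mult_pos_pos divide_pos_pos add_pos_nonneg) simp_all
  then show "\<exists>y. (deriv f has_real_derivative y) (at x) \<and> 0 < y"
    using profile_onE(4)[OF f open_greaterThanLessThan xJ] by blast
qed

lemma deriv_profile_pos:
  assumes "0 < q" "profile_on q a {-l<..<l} f" "0 < t" "t < l"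
  shows "0 < deriv f t"
  using deriv_profile_strict_mono[OF assms(1,2), of 0 t] profile_onE(5)[OF assms(2)] assms(3,4) by simp

lemma profile_strict_mono:
  assumes "0 < q" "profile_on q a {-l<..<l} f" "0 \<le> s" "s < t" "t < l"
  shows "f s < f t"
proof -
  have c: "continuous_on {s..t} f"
  proof (intro continuous_at_imp_continuous_on ballI)
    fix x assume "x \<in> {s..t}"
    then show "isCont f x"
      using DERIV_isCont[OF profile_onE(3)[OF assms(2), of x]] assms(3-5) by simp
  qed
  show ?thesis
  proof (rule DERIV_pos_imp_increasing_open[OF assms(4) _ c])
    fix x assume "s < x" "x < t"
    then show "\<exists>y. (f has_real_derivative y) (at x) \<and> 0 < y"
      using profile_onE(3)[OF assms(2), of x] deriv_profile_pos[OF assms(1,2), of x] assms(3-5)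
      by (intro exI[of _ "deriv f x"]) auto
  qed
qed

lemma profile_ge:
  assumes "0 < q" "profile_on q a {-l<..<l} f" "0 \<le> t" "t < l"
  shows "a \<le> f t"
  using profile_strict_mono[OF assms(1,2), of 0 t] profile_onE(2)[OF assms(2)] assms(3,4)
  by (cases "t = 0") auto

lemma profile_reflect:
  assumes "profile_on q a {-l<..<l} f"
  shows "profile_on q a {-l<..<l} (\<lambda>t. f (- t))"
proof -
  note pf = profile_onE[OF assms]
  have "((\<lambda>t. f (- t)) has_real_derivative - deriv f (- t)) (at t)"
    "((\<lambda>t. - deriv f (- t)) has_real_derivative q * (cosh (f (- t)) / sinh (f (- t))) * (1 + (- deriv f (- t))\<^sup>2)) (at t)"
    if t: "t \<in> {-l<..<l}" for t
  proof -
    have t': "- t \<in> {-l<..<l}" using t by auto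
    show "((\<lambda>t. f (- t)) has_real_derivative - deriv f (- t)) (at t)"
      by (rule DERIV_cong[OF DERIV_chain2[where f = f and g = uminus and x = t and Db = "-1", OF pf(3)[OF t']]])
        (auto intro!: derivative_eq_intros)
    have "((\<lambda>t. deriv f (- t)) has_real_derivative (q * (cosh (f (- t)) / sinh (f (- t))) * (1 + (deriv f (- t))\<^sup>2)) * -1) (at t)"
      by (rule DERIV_chain2[where f = "deriv f" and g = uminus and x = t, OF pf(4)[OF open_greaterThanLessThan t']])
        (auto intro!: derivative_eq_intros)
    from DERIV_minus[OF this]
    show "((\<lambda>t. - deriv f (- t)) has_real_derivative q * (cosh (f (- t)) / sinh (f (- t))) * (1 + (- deriv f (- t))\<^sup>2)) (at t)"
      by simp
  qed
  note D = this
  have pos: "0 < f (- t)" if "t \<in> {-l<..<l}" for t using pf(1)[of "- t"] that by auto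
  show ?thesis
  proof (cases "0 < l")
    case True
    then have "- deriv f (- 0) = 0" using pf(5) by simp
    then show ?thesis
      unfolding profile_on_def using pf(2) pos D by (intro conjI exI[of _ "\<lambda>t. - deriv f (- t)"]) auto
  next
    case False
    then have "{-l<..<l} = {}" by simp
    then show ?thesis using pf(2) unfolding profile_on_def by auto
  qed
qed

text \<open>The function \<open>sinh (f t) / sinh a\<close> starts at \<open>1\<close> for every \<open>a\<close> and solves an autonomous equation of
  first order; \<open>speed q a\<close> is its right-hand side. It decreases in \<open>a\<close>, which is why this
  normalization makes different profiles comparable.\<close>

definition speed :: "real \<Rightarrow> real \<Rightarrow> real \<Rightarrow> real" where
  "speed q a y = sqrt (y powr (2 * q) - 1) * sqrt (1 / (sinh a)\<^sup>2 + y\<^sup>2)"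

lemma speed_pos: "0 < q \<Longrightarrow> 1 < y \<Longrightarrow> 0 < speed q a y"
  unfolding speed_def by (intro mult_pos_pos) (auto intro!: add_nonneg_pos simp: gr_one_powr)

lemma continuous_on_speed: "continuous_on {1<..} (speed q a)"
  unfolding speed_def by (intro continuous_intros) auto

lemma rescaled_profile_derivative:
  assumes q: "0 < q" and a: "0 < a" and f: "profile_on q a {-l<..<l} f" and t: "0 < t" "t < l"
  shows "((\<lambda>t. sinh (f t) / sinh a) has_real_derivative speed q a (sinh (f t) / sinh a)) (at t)"
    "1 < sinh (f t) / sinh a"
proof -
  have tJ: "t \<in> {-l<..<l}" using t by auto
  have sa: "0 < sinh a" using a by simp
  have "a < f t" using profile_strict_mono[OF q f, of 0 t] profile_onE(2)[OF f] t by simp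
  then show "1 < sinh (f t) / sinh a" using sa by simp
  have "(deriv f t)\<^sup>2 = (sinh (f t) / sinh a) powr (2 * q) - 1"
    using first_integral[OF q a f tJ] by simp
  then have d: "deriv f t = sqrt ((sinh (f t) / sinh a) powr (2 * q) - 1)"
    using deriv_profile_pos[OF q f t] by (metis less_imp_le real_sqrt_unique)
  have "1 / (sinh a)\<^sup>2 + (sinh (f t) / sinh a)\<^sup>2 = (cosh (f t) / sinh a)\<^sup>2"
    using sa by (simp add: cosh_square_eq power_divide add_divide_distrib)
  then have c: "sqrt (1 / (sinh a)\<^sup>2 + (sinh (f t) / sinh a)\<^sup>2) = cosh (f t) / sinh a"
    using sa by simp
  show "((\<lambda>t. sinh (f t) / sinh a) has_real_derivative speed q a (sinh (f t) / sinh a)) (at t)"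
    unfolding speed_def c d[symmetric] using sa
    by (auto intro!: derivative_eq_intros profile_onE(3)[OF f tJ])
qed

text \<open>The point \<open>1\<close> is a zero of the right-hand side in the application, so that the usual uniqueness
  and comparison theorems fail at the initial time. Instead a primitive \<open>\<Theta>\<close> of \<open>1 / \<Psi>\<close> on \<open>{1<..}\<close> is
  used: \<open>\<Theta> \<circ> u\<close> grows with speed \<open>1\<close> and \<open>\<Theta> \<circ> w\<close> with speed at least \<open>1\<close>. If \<open>w\<close> were smaller
  than \<open>u\<close> at some time, it would have been smaller by a fixed amount of time ever since the start,
  contrary to the initial condition on \<open>u\<close>.\<close>

lemma separable_comparison:
  fixes u w w' \<Psi> :: "real \<Rightarrow> real"
  assumes u: "\<And>t. 0 < t \<Longrightarrow> t < l \<Longrightarrow> (u has_real_derivative \<Psi> (u t)) (at t) \<and> 1 < u t"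
    and u0: "(u \<longlongrightarrow> 1) (at_right 0)"
    and w: "\<And>t. 0 < t \<Longrightarrow> t < l \<Longrightarrow> (w has_real_derivative w' t) (at t) \<and> 1 < w t \<and> \<Psi> (w t) \<le> w' t"
    and \<Psi>: "continuous_on {1<..} \<Psi>" "\<And>y. 1 < y \<Longrightarrow> 0 < \<Psi> y"
    and t: "0 < t" "t < l"
  shows "u t \<le> w t"
proof -
  have "\<exists>F. \<forall>x. ereal 1 < ereal x \<longrightarrow> ereal x < \<infinity> \<longrightarrow> (F has_vector_derivative inverse (\<Psi> x)) (at x)"
  proof (rule einterval_antiderivative)
    fix x :: real assume "ereal 1 < ereal x"
    then have x: "1 < x" by simp
    then have "isCont \<Psi> x" using \<Psi>(1) by (simp add: continuous_on_eq_continuous_at)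
    then show "isCont (\<lambda>x. inverse (\<Psi> x)) x" using \<Psi>(2)[OF x] by (intro continuous_intros) auto
  qed simp
  then obtain \<Theta> where \<Theta>: "\<And>x. 1 < x \<Longrightarrow> (\<Theta> has_real_derivative inverse (\<Psi> x)) (at x)"
    by (auto simp: has_real_derivative_iff_has_vector_derivative)
  have \<Theta>_mono: "\<Theta> x < \<Theta> y" if "1 < x" "x < y" for x y
  proof (rule DERIV_pos_imp_increasing[OF that(2)])
    fix z assume "x \<le> z" "z \<le> y"
    then show "\<exists>d. (\<Theta> has_real_derivative d) (at z) \<and> 0 < d"
      using \<Theta>[of z] \<Psi>(2)[of z] that by (intro exI[of _ "inverse (\<Psi> z)"]) simp
  qed
  have step: "u t \<le> w (t + \<sigma>)" if \<sigma>: "0 < \<sigma>" "t + \<sigma> < l" for \<sigma>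
  proof -
    define D where "D s = \<Theta> (w (s + \<sigma>)) - \<Theta> (u s)" for s
    have D: "(D has_real_derivative (inverse (\<Psi> (w (s + \<sigma>))) * w' (s + \<sigma>) - 1)) (at s)"
      and D0: "0 \<le> inverse (\<Psi> (w (s + \<sigma>))) * w' (s + \<sigma>) - 1" if s: "0 < s" "s \<le> t" for s
    proof -
      have us: "(u has_real_derivative \<Psi> (u s)) (at s)" "1 < u s" using u[of s] s t by auto
      have ws: "(w has_real_derivative w' (s + \<sigma>)) (at (s + \<sigma>))" "1 < w (s + \<sigma>)" "\<Psi> (w (s + \<sigma>)) \<le> w' (s + \<sigma>)"
        using w[of "s + \<sigma>"] s \<sigma> by auto
      have "((\<lambda>s. w (s + \<sigma>)) has_real_derivative w' (s + \<sigma>)) (at s)"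
        using ws(1) by (simp add: DERIV_shift)
      from DERIV_diff[OF DERIV_chain2[OF \<Theta>[OF ws(2)] this] DERIV_chain2[OF \<Theta>[OF us(2)] us(1)]]
      show "(D has_real_derivative (inverse (\<Psi> (w (s + \<sigma>))) * w' (s + \<sigma>) - 1)) (at s)"
        unfolding D_def using \<Psi>(2)[OF us(2)] by simp
      have "inverse (\<Psi> (w (s + \<sigma>))) * \<Psi> (w (s + \<sigma>)) \<le> inverse (\<Psi> (w (s + \<sigma>))) * w' (s + \<sigma>)"
        using ws(3) \<Psi>(2)[OF ws(2)] by (intro mult_left_mono) auto
      then show "0 \<le> inverse (\<Psi> (w (s + \<sigma>))) * w' (s + \<sigma>) - 1" using \<Psi>(2)[OF ws(2)] by simp
    qed
    have w\<sigma>: "isCont w \<sigma>" "1 < w \<sigma>" using w[of \<sigma>] \<sigma> t by (auto intro: DERIV_isCont)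
    have "((\<lambda>s. w (s + \<sigma>)) \<longlongrightarrow> w (0 + \<sigma>)) (at_right 0)"
      by (rule isCont_tendsto_compose[where g = w and l = "0 + \<sigma>"])
        (use w\<sigma> in \<open>simp, intro tendsto_intros\<close>)
    from tendsto_diff[OF this u0] have "\<forall>\<^sub>F s in at_right 0. 0 < w (s + \<sigma>) - u s"
      by (rule order_tendstoD) (use w\<sigma> in simp)
    moreover have "\<forall>\<^sub>F s in at_right 0. s \<in> {0<..<t}"
      by (rule eventually_at_rightI[OF _ t(1)])
    ultimately have "\<forall>\<^sub>F s in at_right 0. 0 < w (s + \<sigma>) - u s \<and> s \<in> {0<..<t}"
      by (rule eventually_conj)
    from eventually_happens'[OF _ this] obtain s where s: "u s < w (s + \<sigma>)" "0 < s" "s < t" by auto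
    have "0 < D s" using \<Theta>_mono[of "u s" "w (s + \<sigma>)"] u[of s] s t by (simp add: D_def)
    also have "D s \<le> D t"
    proof (rule DERIV_nonneg_imp_nondecreasing[of s t D])
      fix z assume "s \<le> z" "z \<le> t"
      then show "\<exists>d. (D has_real_derivative d) (at z) \<and> 0 \<le> d"
        using D[of z] D0[of z] s by auto
    qed (use s in simp)
    finally have "\<Theta> (u t) < \<Theta> (w (t + \<sigma>))" by (simp add: D_def)
    then show ?thesis
      using \<Theta>_mono[of "w (t + \<sigma>)" "u t"] w[of "t + \<sigma>"] \<sigma> t by (meson add_pos_pos less_asym not_less)
  qed
  have "isCont w t" using w[OF t] by (auto intro: DERIV_isCont)
  then have "((\<lambda>\<sigma>. w (t + \<sigma>)) \<longlongrightarrow> w (t + 0)) (at_right 0)"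
    by (intro isCont_tendsto_compose[where g = w and l = "t + 0"] tendsto_intros) simp
  moreover have "\<forall>\<^sub>F \<sigma> in at_right 0. u t \<le> w (t + \<sigma>)"
    by (rule eventually_at_rightI[of 0 "l - t"]) (use step t in auto)
  ultimately show ?thesis
    using tendsto_lowerbound[of "\<lambda>\<sigma>. w (t + \<sigma>)" "w t" "at_right 0" "u t"] by simp
qed

lemma rescaled_profile_tendsto:
  assumes a: "0 < a" and f: "profile_on q a {-l<..<l} f" and l: "0 < l"
  shows "((\<lambda>t. sinh (f t) / sinh a) \<longlongrightarrow> 1) (at_right 0)"
proof -
  have "isCont (\<lambda>t. sinh (f t) / sinh a) 0"
    using DERIV_isCont[OF profile_onE(3)[OF f, of 0]] l a by (intro continuous_intros) auto
  then have "((\<lambda>t. sinh (f t) / sinh a) \<longlongrightarrow> sinh (f 0) / sinh a) (at_right 0)"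
    unfolding isCont_def by (rule tendsto_within_subset) simp
  then show ?thesis using profile_onE(2)[OF f] a by simp
qed

lemma rescaled_profile_antimono:
  assumes q: "0 < q" and ab: "0 < a" "a \<le> b"
    and f: "profile_on q a {-la<..<la} f" and g: "profile_on q b {-lb<..<lb} g"
    and t: "0 \<le> t" "t < la" "t < lb"
  shows "sinh (g t) / sinh b \<le> sinh (f t) / sinh a"
proof (cases "t = 0")
  case True
  then show ?thesis using profile_onE(2)[OF f] profile_onE(2)[OF g] ab by simp
next
  case False
  show ?thesis
  proof (rule separable_comparison[where t = t and l = "min la lb" and \<Psi> = "speed q b"
      and u = "\<lambda>t. sinh (g t) / sinh b" and w = "\<lambda>t. sinh (f t) / sinh a"
      and w' = "\<lambda>t. speed q a (sinh (f t) / sinh a)"])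
    fix t assume t: "0 < t" "t < min la lb"
    have "speed q b y \<le> speed q a y" if "1 < y" for y
    proof -
      have "1 / (sinh b)\<^sup>2 \<le> 1 / (sinh a)\<^sup>2"
        using ab by (intro divide_left_mono power_mono) auto
      then show ?thesis
        unfolding speed_def using that q by (intro mult_left_mono) (auto simp: ge_one_powr_ge_zero)
    qed
    then show "((\<lambda>t. sinh (f t) / sinh a) has_real_derivative speed q a (sinh (f t) / sinh a)) (at t) \<and>
      1 < sinh (f t) / sinh a \<and> speed q b (sinh (f t) / sinh a) \<le> speed q a (sinh (f t) / sinh a)"
      using rescaled_profile_derivative[OF q ab(1) f, of t] t by simp
    show "((\<lambda>t. sinh (g t) / sinh b) has_real_derivative speed q b (sinh (g t) / sinh b)) (at t) \<and>
      1 < sinh (g t) / sinh b"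
      using rescaled_profile_derivative[OF q _ g, of t] t ab by simp
  qed (use False t ab q continuous_on_speed speed_pos rescaled_profile_tendsto[OF _ g] in auto)
qed

text \<open>Dilating time by \<open>\<rho> = sinh b / sinh a\<close> makes up for the smaller speed of the profile of larger
  neck \<open>b\<close>. Together with \<open>rescaled_profile_antimono\<close> this encloses one rescaled profile between two
  versions of another one, and both agree in the limit \<open>\<rho> = 1\<close>; this yields continuity in \<open>a\<close>
  without theorems on the dependence of solutions on parameters.\<close>

lemma rescaled_profile_le_dilation:
  assumes q: "0 < q" and ab: "0 < a" "a \<le> b"
    and f: "profile_on q a {-la<..<la} f" and g: "profile_on q b {-lb<..<lb} g"
    and t: "0 \<le> t" "t < la" "sinh b / sinh a * t < lb"
  shows "sinh (f t) / sinh a \<le> sinh (g (sinh b / sinh a * t)) / sinh b"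
proof (cases "t = 0")
  case True
  then show ?thesis using profile_onE(2)[OF f] profile_onE(2)[OF g] ab by simp
next
  case False
  define \<rho> where "\<rho> = sinh b / sinh a"
  have \<rho>: "1 \<le> \<rho>" using ab by (simp add: \<rho>_def)
  have eq: "\<rho> / sinh b = 1 / sinh a" using ab by (simp add: \<rho>_def)
  show ?thesis unfolding \<rho>_def[symmetric]
  proof (rule separable_comparison[where t = t and l = "min la (lb / \<rho>)" and \<Psi> = "speed q a"
      and u = "\<lambda>t. sinh (f t) / sinh a"
      and w = "\<lambda>t. sinh (g (\<rho> * t)) / sinh b" and w' = "\<lambda>t. \<rho> * speed q b (sinh (g (\<rho> * t)) / sinh b)"])
    fix t assume t: "0 < t" "t < min la (lb / \<rho>)"
    show "((\<lambda>t. sinh (f t) / sinh a) has_real_derivative speed q a (sinh (f t) / sinh a)) (at t) \<and>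
      1 < sinh (f t) / sinh a"
      using rescaled_profile_derivative[OF q ab(1) f, of t] t by simp
    have \<rho>t: "0 < \<rho> * t" "\<rho> * t < lb" using t \<rho> by (auto simp: pos_less_divide_eq mult.commute)
    note d = rescaled_profile_derivative[OF q _ g \<rho>t]
    have "((\<lambda>t. sinh (g (\<rho> * t)) / sinh b) has_real_derivative speed q b (sinh (g (\<rho> * t)) / sinh b) * \<rho>) (at t)"
      by (rule DERIV_chain2[where f = "\<lambda>t. sinh (g t) / sinh b" and g = "\<lambda>t. \<rho> * t", OF d(1)])
        (use ab in \<open>auto intro!: derivative_eq_intros\<close>)
    moreover have "speed q a y \<le> \<rho> * speed q b y" if "1 < y" for y
    proof -
      have "1 / (sinh a)\<^sup>2 + y\<^sup>2 \<le> (\<rho> / sinh b)\<^sup>2 + \<rho>\<^sup>2 * y\<^sup>2"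
        unfolding eq using mult_right_mono[of 1 "\<rho>\<^sup>2" "y\<^sup>2"] \<rho> by (simp add: power_divide one_le_power)
      also have "\<dots> = \<rho>\<^sup>2 * (1 / (sinh b)\<^sup>2 + y\<^sup>2)" by (simp add: power_divide algebra_simps)
      finally have "sqrt (1 / (sinh a)\<^sup>2 + y\<^sup>2) \<le> sqrt (\<rho>\<^sup>2 * (1 / (sinh b)\<^sup>2 + y\<^sup>2))" by simp
      also have "\<dots> = \<rho> * sqrt (1 / (sinh b)\<^sup>2 + y\<^sup>2)" using \<rho> by (simp add: real_sqrt_mult)
      finally have "sqrt (y powr (2 * q) - 1) * sqrt (1 / (sinh a)\<^sup>2 + y\<^sup>2)
         \<le> sqrt (y powr (2 * q) - 1) * (\<rho> * sqrt (1 / (sinh b)\<^sup>2 + y\<^sup>2))"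
        using that q by (intro mult_left_mono) (auto simp: ge_one_powr_ge_zero)
      then show ?thesis unfolding speed_def by (simp add: mult_ac)
    qed
    ultimately show "((\<lambda>t. sinh (g (\<rho> * t)) / sinh b) has_real_derivative \<rho> * speed q b (sinh (g (\<rho> * t)) / sinh b)) (at t) \<and>
      1 < sinh (g (\<rho> * t)) / sinh b \<and> speed q a (sinh (g (\<rho> * t)) / sinh b) \<le> \<rho> * speed q b (sinh (g (\<rho> * t)) / sinh b)"
      using d(2) ab by (simp add: mult.commute)
  qed (use False t ab q \<rho> continuous_on_speed speed_pos rescaled_profile_tendsto[OF _ f] in
      \<open>auto simp: \<rho>_def[symmetric] pos_less_divide_eq mult.commute\<close>)
qed

text \<open>The reflected profile solves the same problem; apply the comparison in both directions with
  \<open>a = b\<close>.\<close>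

lemma profile_even:
  assumes q: "0 < q" and a: "0 < a" and f: "profile_on q a {-l<..<l} f" and t: "\<bar>t\<bar> < l"
  shows "f (- t) = f t"
proof -
  have "f (- t) = f t" if "0 \<le> t" "t < l" for t
  proof -
    have "sinh (f (- t)) / sinh a \<le> sinh (f t) / sinh a" "sinh (f t) / sinh a \<le> sinh (f (- t)) / sinh a"
      using rescaled_profile_antimono[OF q a order_refl _ _ that(1) that(2,2)] f profile_reflect[OF f] by blast+
    then show ?thesis using a by (simp add: divide_le_cancel)
  qed
  from this[of "\<bar>t\<bar>"] t show ?thesis by (auto simp: abs_if split: if_splits)
qed

text \<open>A maximal profile does not stay bounded. For \<open>t > 0\<close> the first integral makes it a solution of an
  autonomous equation \<open>f' = \<Psi> f\<close>, so it is the inverse of a primitive \<open>\<Theta>\<close> of \<open>1 / \<Psi>\<close>, up to a shift of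
  time. The function \<open>\<Theta>\<close> is defined on all of \<open>{a<..}\<close>. If \<open>f\<close> were bounded by \<open>B\<close>, its inverse would
  continue the profile up to the time at which it reaches the value \<open>B + 1\<close>.\<close>

lemma profile_unbounded:
  assumes q: "0 < q" and a: "0 < a" and max: "maximal_profile q a l f"
  shows "\<exists>t. 0 < t \<and> t < l \<and> B < f t"
proof (rule ccontr)
  assume "\<not> ?thesis"
  then have B: "f t \<le> B" if "0 < t" "t < l" for t using that by force
  have l: "0 < l" and f: "profile_on q a {-l<..<l} f"
    and mx: "\<And>J g. open J \<Longrightarrow> is_interval J \<Longrightarrow> 0 \<in> J \<Longrightarrow> profile_on q a J g \<Longrightarrow> J \<subseteq> {-l<..<l}"
    using max unfolding maximal_profile_def by blast+
  note pf = profile_onE[OF f]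
  have sa: "0 < sinh a" using a by simp
  define \<Psi> where "\<Psi> y = sqrt ((sinh y / sinh a) powr (2 * q) - 1)" for y
  have gt1: "1 < (sinh y / sinh a) powr (2 * q)" if "a < y" for y
    using that sa q by (intro gr_one_powr) auto
  have \<Psi>_pos: "0 < \<Psi> y" if "a < y" for y using gt1[OF that] by (simp add: \<Psi>_def)
  have \<Psi>_sq: "(\<Psi> y)\<^sup>2 = (sinh y / sinh a) powr (2 * q) - 1" if "a < y" for y
    using gt1[OF that] by (simp add: \<Psi>_def)
  have \<Psi>_deriv: "(\<Psi> has_real_derivative q * (cosh y / sinh y) * (1 + (\<Psi> y)\<^sup>2) / \<Psi> y) (at y)" if "a < y" for y
  proof -
    have sy: "0 < sinh y" using that a by simp
    have "((\<lambda>y. (sinh y / sinh a) powr (2 * q)) has_real_derivative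
        2 * q * (cosh y / sinh y) * (sinh y / sinh a) powr (2 * q)) (at y)"
    proof -
      have x: "0 < sinh y / sinh a" using sy sa by simp
      have "((\<lambda>y. sinh y / sinh a) has_real_derivative cosh y / sinh a) (at y)"
        using sa by (auto intro!: derivative_eq_intros)
      from DERIV_chain2[where f = "\<lambda>z. z powr (2 * q)" and g = "\<lambda>y. sinh y / sinh a", OF has_real_derivative_powr[OF x] this]
      show ?thesis
        by (rule DERIV_cong) (use sy sa x in \<open>simp add: powr_diff\<close>)
    qed
    from DERIV_diff[OF this DERIV_const[of 1]]
    have "((\<lambda>y. (sinh y / sinh a) powr (2 * q) - 1) has_real_derivative
        2 * q * (cosh y / sinh y) * (1 + (\<Psi> y)\<^sup>2)) (at y)"
      unfolding \<Psi>_sq[OF that] by simp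
    from DERIV_chain2[OF DERIV_real_sqrt this] show ?thesis
      unfolding \<Psi>_def[abs_def] using gt1[OF that] by (simp add: field_simps)
  qed
  have "\<exists>F. \<forall>x. ereal a < ereal x \<longrightarrow> ereal x < \<infinity> \<longrightarrow> (F has_vector_derivative inverse (\<Psi> x)) (at x)"
  proof (rule einterval_antiderivative)
    fix x :: real assume "ereal a < ereal x"
    then have x: "a < x" by simp
    show "isCont (\<lambda>x. inverse (\<Psi> x)) x"
      using DERIV_isCont[OF \<Psi>_deriv[OF x]] \<Psi>_pos[OF x] by (intro continuous_intros) auto
  qed simp
  then obtain \<Theta> where \<Theta>: "\<And>x. a < x \<Longrightarrow> (\<Theta> has_real_derivative inverse (\<Psi> x)) (at x)"
    by (auto simp: has_real_derivative_iff_has_vector_derivative)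
  have \<Theta>_mono: "\<Theta> x < \<Theta> y" if "a < x" "x < y" for x y
  proof (rule DERIV_pos_imp_increasing[OF that(2)])
    fix z assume "x \<le> z" "z \<le> y"
    then show "\<exists>d. (\<Theta> has_real_derivative d) (at z) \<and> 0 < d"
      using \<Theta>[of z] \<Psi>_pos[of z] that by (intro exI[of _ "inverse (\<Psi> z)"]) simp
  qed
  have \<Theta>_cont: "continuous_on {a<..} \<Theta>"
    using \<Theta> by (intro continuous_at_imp_continuous_on ballI DERIV_isCont) auto
  have inj: "inj_on \<Theta> {a<..}"
    using \<Theta>_mono by (intro linorder_inj_onI) (auto, force)
  have fa: "a < f t" if "0 < t" "t < l" for t
    using profile_strict_mono[OF q f, of 0 t] pf(2) that by simp
  have fd: "deriv f t = \<Psi> (f t)" if "0 < t" "t < l" for t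
  proof -
    have "(deriv f t)\<^sup>2 = (sinh (f t) / sinh a) powr (2 * q) - 1"
      using first_integral[OF q a f, of t] that by simp
    then show ?thesis
      unfolding \<Psi>_def using deriv_profile_pos[OF q f that] by (metis less_imp_le real_sqrt_unique)
  qed
  obtain c where c: "\<And>t. t \<in> {0<..<l} \<Longrightarrow> \<Theta> (f t) - t = c"
  proof -
    have "((\<lambda>t. \<Theta> (f t) - t) has_real_derivative 0) (at t within {0<..<l})" if t: "t \<in> {0<..<l}" for t
    proof -
      have "((\<lambda>t. \<Theta> (f t)) has_real_derivative inverse (\<Psi> (f t)) * \<Psi> (f t)) (at t)"
        by (rule DERIV_chain2[OF \<Theta>]) (use t fa pf(3)[of t] fd[of t] in auto)
      then have "((\<lambda>t. \<Theta> (f t)) has_real_derivative 1) (at t)"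
        using \<Psi>_pos[OF fa, of t] t by simp
      from DERIV_diff[OF this DERIV_ident] show ?thesis by (simp add: has_field_derivative_at_within)
    qed
    then show ?thesis
      using that has_field_derivative_zero_constant[of "{0<..<l}" "\<lambda>t. \<Theta> (f t) - t"] by auto
  qed
  define Y where "Y = inv_into {a<..} \<Theta>"
  have Y\<Theta>: "Y (\<Theta> y) = y" if "a < y" for y
    using inj that by (simp add: Y_def inv_into_f_f)
  have Y_deriv: "(Y has_real_derivative \<Psi> y) (at (\<Theta> y))" if "a < y" for y
  proof -
    have "(\<Theta> has_derivative (*) (inverse (\<Psi> y))) (at y)"
      using \<Theta>[OF that] by (simp add: has_field_derivative_def)
    moreover have "(*) (inverse (\<Psi> y)) \<circ> (*) (\<Psi> y) = id"
      using \<Psi>_pos[OF that] by (auto simp: fun_eq_iff)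
    ultimately have "(Y has_derivative (*) (\<Psi> y)) (at (\<Theta> y))"
      by (intro has_derivative_inverse_strong[of "{a<..}" y \<Theta> Y]) (use that \<Theta>_cont Y\<Theta> in auto)
    then show ?thesis by (simp add: has_field_derivative_def)
  qed
  have Yf: "Y (t + c) = f t" if "0 < t" "t < l" for t
    using c[of t] Y\<Theta>[OF fa[OF that]] that by (simp add: algebra_simps)
  have aB: "a < B" using fa[of "l/2"] B[of "l/2"] l by simp
  define l2 where "l2 = \<Theta> (B + 1) - c"
  have ll2: "l < l2"
  proof -
    have "t \<le> \<Theta> B - c" if "t < l" for t
    proof (cases "0 < t")
      case True
      then have "\<Theta> (f t) \<le> \<Theta> B"
        using \<Theta>_mono[OF fa, of t B] B[of t] that by (cases "f t = B") (auto simp: less_le)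
      then show ?thesis using c[of t] True that by auto
    next
      case False
      have "\<Theta> (f (l/2)) \<le> \<Theta> B"
        using \<Theta>_mono[OF fa, of "l/2" B] B[of "l/2"] l by (cases "f (l/2) = B") (auto simp: less_le)
      then show ?thesis using c[of "l/2"] False l by auto
    qed
    then have "l \<le> \<Theta> B - c" by (meson dense_le)
    also have "\<dots> < l2" using \<Theta>_mono[OF aB, of "B + 1"] by (simp add: l2_def)
    finally show ?thesis .
  qed
  have ex: "\<exists>y>a. \<Theta> y = t + c" if t: "0 < t" "t < l2" for t
  proof (cases "t < l")
    case True
    then show ?thesis using c[of t] fa[of t] t by (intro exI[of _ "f t"]) auto
  next
    case False
    have "\<exists>y\<ge>f (l/2). y \<le> B + 1 \<and> \<Theta> y = t + c"
    proof (rule IVT')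
      show "\<Theta> (f (l/2)) \<le> t + c" using c[of "l/2"] l False by simp
      show "t + c \<le> \<Theta> (B + 1)" using t by (simp add: l2_def)
      show "f (l/2) \<le> B + 1" using B[of "l/2"] l by simp
      show "continuous_on {f (l/2)..B + 1} \<Theta>"
        by (rule continuous_on_subset[OF \<Theta>_cont]) (use fa[of "l/2"] l in auto)
    qed
    then obtain y where "f (l/2) \<le> y" "\<Theta> y = t + c" by blast
    then show ?thesis using fa[of "l/2"] l by (intro exI[of _ y]) auto
  qed
  have Y2: "a < Y (t + c)" "((\<lambda>t. Y (t + c)) has_real_derivative \<Psi> (Y (t + c))) (at t)" if t: "0 < t" "t < l2" for t
  proof -
    obtain y where y: "a < y" "\<Theta> y = t + c" using ex[OF t] by blast
    have Yy: "Y (t + c) = y" using Y\<Theta>[OF y(1)] y(2) by simp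
    then show "a < Y (t + c)" using y(1) by simp
    have "(Y has_real_derivative \<Psi> y) (at (t + c))" using Y_deriv[OF y(1)] y(2) by simp
    then show "((\<lambda>t. Y (t + c)) has_real_derivative \<Psi> (Y (t + c))) (at t)"
      unfolding Yy by (simp add: DERIV_shift)
  qed
  define g where "g t = (if t < l then f t else Y (t + c))" for t
  define g' where "g' t = (if t < l then deriv f t else \<Psi> (Y (t + c)))" for t
  have g1: "g t = Y (t + c)" "g' t = \<Psi> (Y (t + c))" if "0 < t" for t
    using that Yf[of t] fd[of t] by (auto simp: g_def g'_def)
  have "profile_on q a {-l<..<l2} g"
    unfolding profile_on_def
  proof (intro conjI exI[of _ g'] ballI)
    show "g 0 = a" "g' 0 = 0" using l pf(2) pf(5) by (simp_all add: g_def g'_def)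
    fix t assume t: "t \<in> {-l<..<l2}"
    show "0 < g t"
      using pf(1)[of t] Y2(1)[of t] t a ll2 l by (cases "t < l") (auto simp: g_def)
    have "(g has_real_derivative g' t) (at t) \<and>
      (g' has_real_derivative q * (cosh (g t) / sinh (g t)) * (1 + (g' t)\<^sup>2)) (at t)"
    proof (cases "t < l")
      case True
      then have tJ: "t \<in> {-l<..<l}" using t by simp
      have "(g has_real_derivative deriv f t) (at t)"
        by (rule has_field_derivative_transform_within_open[OF pf(3)[OF tJ] open_greaterThanLessThan tJ]) (simp add: g_def)
      moreover have "(g' has_real_derivative q * (cosh (f t) / sinh (f t)) * (1 + (deriv f t)\<^sup>2)) (at t)"
        by (rule has_field_derivative_transform_within_open[OF pf(4)[OF open_greaterThanLessThan tJ] open_greaterThanLessThan tJ]) (simp add: g'_def)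
      ultimately show ?thesis using True by (simp add: g_def g'_def)
    next
      case False
      then have t0: "0 < t" "t < l2" using t l by auto
      then have tJ: "t \<in> {0<..<l2}" by simp
      note y = Y2[OF t0]
      have "(g has_real_derivative \<Psi> (Y (t + c))) (at t)"
        by (rule has_field_derivative_transform_within_open[OF y(2) open_greaterThanLessThan tJ]) (simp add: g1)
      moreover have "((\<lambda>t. \<Psi> (Y (t + c))) has_real_derivative
          q * (cosh (Y (t + c)) / sinh (Y (t + c))) * (1 + (\<Psi> (Y (t + c)))\<^sup>2)) (at t)"
        using DERIV_chain2[OF \<Psi>_deriv[OF y(1)] y(2)] \<Psi>_pos[OF y(1)] by simp
      then have "(g' has_real_derivative q * (cosh (Y (t + c)) / sinh (Y (t + c))) * (1 + (\<Psi> (Y (t + c)))\<^sup>2)) (at t)"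
        by (rule has_field_derivative_transform_within_open[OF _ open_greaterThanLessThan tJ]) (simp add: g1)
      ultimately show ?thesis using g1[OF t0(1)] by simp
    qed
    then show "(g has_real_derivative g' t) (at t)"
      "(g' has_real_derivative q * (cosh (g t) / sinh (g t)) * (1 + (g' t)\<^sup>2)) (at t)" by auto
  qed
  then have sub: "{-l<..<l2} \<subseteq> {-l<..<l}"
    by (rule mx[rotated 3]) (use l ll2 in \<open>auto simp: is_interval_oo\<close>)
  have "l \<in> {-l<..<l2}" using l ll2 by simp
  from subsetD[OF sub this] show False by simp
qed

text \<open>If the life times were in the wrong order, one profile would be bounded by the other one.\<close>

lemma maximal_profile_lifetime:
  assumes q: "0 < q" and ab: "0 < a" "a \<le> b"
    and f: "maximal_profile q a la f" and g: "maximal_profile q b lb g"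
  shows "la \<le> lb" "lb \<le> sinh b / sinh a * la"
proof -
  have pf: "profile_on q a {-la<..<la} f" and pg: "profile_on q b {-lb<..<lb} g" and l0: "0 < la" "0 < lb"
    using f g unfolding maximal_profile_def by auto
  have sh: "0 < sinh a" "0 < sinh b" using ab by auto
  show "la \<le> lb"
  proof (rule ccontr)
    assume n: "\<not> la \<le> lb"
    define S where "S = sinh b * (sinh (f lb) / sinh a)"
    obtain t where t: "0 < t" "t < lb" "arsinh S < g t"
      using profile_unbounded[OF q _ g, of "arsinh S"] ab by auto
    have "sinh (g t) / sinh b \<le> sinh (f t) / sinh a"
      by (rule rescaled_profile_antimono[OF q ab pf pg]) (use t n in auto)
    also have "\<dots> \<le> sinh (f lb) / sinh a"
      using profile_strict_mono[OF q pf, of t lb] t n sh by (intro divide_right_mono) auto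
    finally have "sinh (g t) \<le> S" using sh by (simp add: S_def field_simps)
    then have "g t \<le> arsinh S" by (metis sinh_arsinh_real sinh_real_le_iff)
    then show False using t by simp
  qed
  show "lb \<le> sinh b / sinh a * la"
  proof (rule ccontr)
    assume n: "\<not> lb \<le> sinh b / sinh a * la"
    let ?\<rho> = "sinh b / sinh a"
    have \<rho>: "0 < ?\<rho>" using sh by simp
    define S where "S = sinh a * (sinh (g (?\<rho> * la)) / sinh b)"
    obtain t where t: "0 < t" "t < la" "arsinh S < f t"
      using profile_unbounded[OF q _ f, of "arsinh S"] ab by auto
    have tl: "?\<rho> * t < ?\<rho> * la" using mult_strict_left_mono[OF t(2) \<rho>] .
    have "sinh (f t) / sinh a \<le> sinh (g (?\<rho> * t)) / sinh b"
      by (rule rescaled_profile_le_dilation[OF q ab pf pg]) (use t n tl in linarith)+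
    also have "\<dots> \<le> sinh (g (?\<rho> * la)) / sinh b"
      using profile_strict_mono[OF q pg, of "?\<rho> * t" "?\<rho> * la"] tl t n \<rho> sh by (intro divide_right_mono) auto
    finally have "sinh (f t) \<le> S" using sh by (simp add: S_def field_simps)
    then have "f t \<le> arsinh S" by (metis sinh_arsinh_real sinh_real_le_iff)
    then show False using t by simp
  qed
qed

text \<open>By induction, as the equation expresses the second derivative through smooth functions of \<open>f\<close>
  and of its derivative.\<close>

lemma profile_Ck:
  assumes f: "profile_on q a J f" and J: "open J"
  shows "Ck_on k J f \<and> Ck_on k J (deriv f)"
proof (induction k)
  case 0
  have "isCont f t" "isCont (deriv f) t" if "t \<in> J" for t
    using profile_onE(3)[OF f that] profile_onE(4)[OF f J that] DERIV_isCont by blast+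
  then show ?case by (simp add: continuous_at_imp_continuous_on)
next
  case (Suc k)
  then have k: "Ck_on k J f" "Ck_on k J (deriv f)" by auto
  have "sinh (f t) \<noteq> 0" if "t \<in> J" for t using profile_onE(1)[OF f that] by simp
  then have "Ck_on k J (\<lambda>t. q * (cosh (f t) * inverse (sinh (f t))) * (1 + deriv f t * deriv f t))"
    by (intro Ck_on_mult[OF J] Ck_on_add[OF J] Ck_on_const[OF J] k
        Ck_on_compose_real[OF J k(1), of UNIV cosh]
        Ck_on_compose_real[OF J Ck_on_compose_real[OF J k(1), of UNIV sinh] Ck_on_inverse])
      (use Ck_on_cosh_sinh in auto)
  then have "Ck_on k J (\<lambda>t. q * (cosh (f t) / sinh (f t)) * (1 + (deriv f t)\<^sup>2))"
    by (simp add: divide_inverse power2_eq_square)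
  then have "Ck_on (Suc k) J (deriv f)"
    by (intro Ck_on_SucI_real[OF J profile_onE(4)[OF f J]])
  moreover have "Ck_on (Suc k) J f"
    using Ck_on_SucI_real[OF J profile_onE(3)[OF f] k(2)] .
  ultimately show ?case by blast
qed

section \<open>Sweeping by rotational hypersurfaces\<close>

lemma conf_gt_2_iff: "norm x < 1 \<Longrightarrow> 2 < conf x \<longleftrightarrow> x \<noteq> 0"
proof -
  assume x: "norm x < 1"
  have "conf x - 2 = conf x * (norm x)\<^sup>2" using conf_norm_sq[OF x] by simp
  moreover have "0 < conf x" using conf_ge_2[OF x] by simp
  ultimately show ?thesis
    by (metis diff_gt_0_iff_gt less_irrefl mult_zero_right norm_eq_zero power2_eq_square zero_less_mult_iff zero_less_norm_iff zero_less_power2)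
qed

lemma continuous_on_conf: "S \<subseteq> ball 0 1 \<Longrightarrow> continuous_on S conf"
proof (intro continuous_at_imp_continuous_on ballI)
  fix x assume "S \<subseteq> ball 0 1" "x \<in> S"
  then have "norm x < 1" by auto
  from has_derivative_continuous[OF conf_has_derivative[OF this]] show "isCont conf x" .
qed

lemma gap_continuous_on:
  assumes "profile_on q a J f" "\<And>p. p \<in> C \<Longrightarrow> norm (fst p) < 1 \<and> snd p \<in> J"
  shows "continuous_on C (gap f)"
proof (intro continuous_at_imp_continuous_on ballI)
  fix p assume "p \<in> C"
  then have p: "norm (fst p) < 1" "snd p \<in> J" using assms(2) by blast+
  from has_derivative_continuous[OF gap_has_derivative[OF p(1) profile_onE(3)[OF assms(1) p(2)]]]
  show "isCont (gap f) p" .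
qed

text \<open>The situation in which \<open>M\<close> is swept by the hypersurfaces of profile \<open>f a\<close>. The position of the
  boundary within the slices \<open>t = \<plusminus>t0\<close> is left open until the very end.\<close>

locale sweep =
  fixes M :: "'n::finite amb set" and r :: nat and q t0 :: real
    and f :: "real \<Rightarrow> real \<Rightarrow> real" and L :: "real \<Rightarrow> real"
  assumes r: "1 \<le> r" "r + 1 < CARD('n)"
    and q: "q = (real CARD('n) - real r - 1) / (real r + 1)"
    and f_L: "\<And>a. 0 < a \<Longrightarrow> maximal_profile q a (L a) (f a)"
    and t0: "0 < t0"
    and M: "compact M" "connected M" "hypersurface M" "r_minimal r M"
    and bdry: "\<And>p. p \<in> boundary M \<Longrightarrow> \<bar>snd p\<bar> = t0"
    and ends: "\<exists>p\<in>M. snd p = t0" "\<exists>p\<in>M. snd p = - t0"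
begin

lemma q_pos: "0 < q" using r by (simp add: q field_simps)

lemma L_pos: "0 < a \<Longrightarrow> 0 < L a"
  by (rule conjunct1[OF f_L[unfolded maximal_profile_def]])

lemma profile: "0 < a \<Longrightarrow> profile_on q a {- L a<..<L a} (f a)"
  by (rule conjunct1[OF conjunct2[OF f_L[unfolded maximal_profile_def]]])

lemma even: "0 < a \<Longrightarrow> \<bar>t\<bar> < L a \<Longrightarrow> f a \<bar>t\<bar> = f a t"
  using profile_even[OF q_pos _ profile, of a t] by (auto simp: abs_if)

lemma f_pos: "0 < a \<Longrightarrow> \<bar>t\<bar> < L a \<Longrightarrow> 0 < f a t"
  using profile_onE(1)[OF profile, of a t] by (auto simp: abs_less_iff)

lemma f_ge: "0 < a \<Longrightarrow> \<bar>t\<bar> < L a \<Longrightarrow> a \<le> f a t"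
  using profile_ge[OF q_pos profile, of a "\<bar>t\<bar>"] even[of a t] by simp

lemma MHxR: "p \<in> M \<Longrightarrow> norm (fst p) < 1"
  using M(3) unfolding hypersurface_def by (auto simp: HxR_iff)

lemma conf_cont_M: "continuous_on M (\<lambda>p. conf (fst p))"
proof -
  have "continuous_on (fst ` M) conf" by (rule continuous_on_conf) (use MHxR in auto)
  then show ?thesis by (rule continuous_on_compose2) (auto intro: continuous_intros)
qed

lemma conf_bound: "\<exists>B. \<forall>p\<in>M. conf (fst p) \<le> B"
proof -
  obtain B where "\<forall>x\<in>(\<lambda>p. conf (fst p)) ` M. norm x \<le> B"
    using compact_imp_bounded[OF compact_continuous_image[OF conf_cont_M M(1)]] unfolding bounded_iff by blast
  then show ?thesis by (intro exI[of _ B]) (auto simp: abs_le_iff)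
qed

lemma conf_M: "p \<in> M \<Longrightarrow> 2 \<le> conf (fst p)"
  using conf_ge_2 MHxR by blast

text \<open>The slices are totally geodesic, and the symmetric function of degree \<open>r + 1\<close>
  vanishes at zero, so that contact with them yields no contradiction. Therefore the height is perturbed by a
  small multiple of \<open>conf\<close>, which is strictly convex: at a maximum outside the slab all numbers \<open>k i\<close> of
  the comparison at one point would be positive.\<close>

lemma slab:
  assumes "p \<in> M"
  shows "\<bar>snd p\<bar> \<le> t0"
proof -
  have "\<sigma> * snd p \<le> t0" if \<sigma>: "\<sigma> = 1 \<or> \<sigma> = -1" for \<sigma> :: real
  proof (rule ccontr)
    assume out: "\<not> \<sigma> * snd p \<le> t0"
    obtain B where B: "\<And>p. p \<in> M \<Longrightarrow> conf (fst p) \<le> B" using conf_bound by blast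
    have B2: "2 \<le> B" using B[OF assms] conf_M[OF assms] by simp
    define \<delta> where "\<delta> = (\<sigma> * snd p - t0) / (2 * B)"
    have \<delta>: "0 < \<delta>" using out B2 by (simp add: \<delta>_def)
    have \<delta>B: "\<delta> * B < \<sigma> * snd p - t0" using out B2 by (simp add: \<delta>_def)
    define F where "F y = \<sigma> * snd y + \<delta> * conf (fst y)" for y :: "'n amb"
    have "continuous_on M F" unfolding F_def by (intro continuous_intros conf_cont_M)
    then obtain z where z: "z \<in> M" "\<And>y. y \<in> M \<Longrightarrow> F y \<le> F z"
      using continuous_attains_sup[OF M(1)] assms by blast
    have "\<sigma> * snd p \<le> F p" using \<delta> conf_M[OF assms] by (simp add: F_def)
    also have "F p \<le> F z" using z assms by blast
    also have "F z \<le> \<sigma> * snd z + \<delta> * B" using \<delta> B[OF z(1)] by (simp add: F_def)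
    finally have "t0 < \<sigma> * snd z" using \<delta>B by simp
    then have "\<bar>snd z\<bar> \<noteq> t0" using \<sigma> by auto
    then have zb: "z \<notin> boundary M" using bdry by blast
    have nz: "norm (fst z) < 1" using MHxR z(1) by blast
    define c where "c = conf (fst z)"
    have c2: "2 \<le> c" using conf_ge_2[OF nz] by (simp add: c_def)
    define g where "g y = (\<delta> * (conf (fst y))\<^sup>2) *\<^sub>R (fst y, 0) + (0, \<sigma>)" for y :: "'n amb"
    define H where "H v = (\<delta> * (2 * c ^ 3 * (fst z \<bullet> fst v))) *\<^sub>R (fst z, 0::real) + (\<delta> * c\<^sup>2) *\<^sub>R (fst v, 0)" for v :: "'n amb"
    have dconf: "((\<lambda>y. conf (fst y)) has_derivative (\<lambda>v. (conf (fst y))\<^sup>2 * (fst y \<bullet> fst v))) (at y)"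
      if "norm (fst y) < 1" for y :: "'n amb"
      by (rule has_derivative_compose[OF has_derivative_fst[OF has_derivative_ident] conf_has_derivative[OF that]])
    have "open (ball 0 1 \<times> UNIV :: 'n amb set)" by (intro open_Times) auto
    moreover have "z \<in> ball 0 1 \<times> UNIV" using nz by (simp add: mem_Times_iff)
    ultimately have "\<forall>\<^sub>F y in nhds z. y \<in> ball 0 1 \<times> UNIV" by (rule eventually_nhds_in_open)
    then have dF: "\<forall>\<^sub>F y in nhds z. (F has_derivative (\<lambda>w. g y \<bullet> w)) (at y)"
    proof (rule eventually_mono)
      fix y :: "'n amb" assume "y \<in> ball 0 1 \<times> UNIV"
      then have y: "norm (fst y) < 1" by auto
      show "(F has_derivative (\<lambda>w. g y \<bullet> w)) (at y)"
        unfolding F_def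
        by (auto intro!: derivative_eq_intros dconf[OF y] simp: g_def inner_add_left inner_prod_def fun_eq_iff)
    qed
    have dg: "(g has_derivative H) (at z)"
    proof -
      have "((\<lambda>y. \<delta> * (conf (fst y))\<^sup>2) has_derivative (\<lambda>v. \<delta> * (2 * c ^ 3 * (fst z \<bullet> fst v)))) (at z)"
        by (auto intro!: derivative_eq_intros dconf[OF nz] simp: c_def fun_eq_iff power2_eq_square power3_eq_cube)
      moreover have "((\<lambda>y::'n amb. (fst y, 0::real)) has_derivative (\<lambda>v. (fst v, 0))) (at z)"
        by (auto intro!: derivative_eq_intros)
      ultimately have "((\<lambda>y. (\<delta> * (conf (fst y))\<^sup>2) *\<^sub>R (fst y, 0::real)) has_derivative
         (\<lambda>v. (\<delta> * (conf (fst z))\<^sup>2) *\<^sub>R (fst v, 0) + (\<delta> * (2 * c ^ 3 * (fst z \<bullet> fst v))) *\<^sub>R (fst z, 0))) (at z)"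
        by (rule has_derivative_scaleR)
      from has_derivative_add[OF this has_derivative_const] show ?thesis
        unfolding g_def[abs_def] H_def[abs_def]
        by (rule has_derivative_eq_rhs) (simp add: c_def add.commute fun_eq_iff)
    qed
    have mx: "\<forall>\<^sub>F y in nhds z. y \<in> M \<longrightarrow> F y \<le> F z" using z(2) by simp
    obtain e :: "'n \<Rightarrow> 'n amb" and k :: "'n \<Rightarrow> real" where ek:
      "\<forall>i j. metric z (e i) (e j) = (if i = j then 1 else 0)"
      "\<forall>i. g z \<bullet> e i = 0"
      "g z \<noteq> 0 \<longrightarrow> (\<forall>v. g z \<bullet> v = 0 \<longrightarrow> v = (\<Sum>i\<in>UNIV. metric z v (e i) *\<^sub>R e i))"
      "\<forall>c v. v = (\<Sum>i\<in>UNIV. c i *\<^sub>R e i) \<longrightarrow> H v \<bullet> v - g z \<bullet> christoffel z v v \<le> (\<Sum>i\<in>UNIV. k i * (c i)\<^sup>2)"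
      "esym (r + 1) UNIV k = 0"
      by (rule one_point_comparison[OF M(3,4) z(1) zb dF dg mx]) (use r in simp, rule that)
    have "0 < k i" for i
    proof -
      let ?v = "e i" and ?x = "fst z"
      have "?v = (\<Sum>j\<in>UNIV. (if j = i then 1 else 0) *\<^sub>R e j)"
        by (simp add: if_distrib[of "\<lambda>a. a *\<^sub>R _"] cong: if_cong)
      from ek(4)[rule_format, OF this] have "H ?v \<bullet> ?v - g z \<bullet> christoffel z ?v ?v \<le> k i"
        by (simp add: if_distrib[of "\<lambda>a. a\<^sup>2"] if_distrib[of "\<lambda>a. _ * a"] cong: if_cong)
      moreover have "H ?v \<bullet> ?v - g z \<bullet> christoffel z ?v ?v = \<delta> * c\<^sup>2 * (fst ?v \<bullet> fst ?v) * (1 + c * (?x \<bullet> ?x))"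
      proof -
        have zH: "z \<in> HxR" using nz by (simp add: HxR_iff)
        have "g z \<bullet> christoffel z ?v ?v = \<delta> * c\<^sup>2 * c * (2 * (?x \<bullet> fst ?v)\<^sup>2 - (fst ?v \<bullet> fst ?v) * (?x \<bullet> ?x))"
          unfolding christoffel_conf[OF zH] g_def c_def[symmetric]
          by (simp only: inner_add_left inner_scaleR_left inner_prod_def fst_conv snd_conv inner_scaleR_right inner_diff_right
              inner_add_right inner_zero_right inner_zero_left mult_zero_right mult_zero_left)
            (simp add: inner_commute power2_eq_square algebra_simps)
        moreover have "H ?v \<bullet> ?v = \<delta> * 2 * c ^ 3 * (?x \<bullet> fst ?v)\<^sup>2 + \<delta> * c\<^sup>2 * (fst ?v \<bullet> fst ?v)"
          unfolding H_def by (simp add: inner_add_left inner_prod_def power2_eq_square)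
        ultimately show ?thesis by (simp add: power2_eq_square power3_eq_cube algebra_simps)
      qed
      moreover have "0 < \<delta> * c\<^sup>2 * (fst ?v \<bullet> fst ?v) * (1 + c * (?x \<bullet> ?x))"
      proof -
        have "fst ?v \<noteq> 0"
        proof
          assume 0: "fst ?v = 0"
          then have "\<sigma> * snd ?v = 0" using ek(2)[rule_format, of i] by (simp add: g_def inner_prod_def inner_add_left)
          then have "?v = 0" using \<sigma> 0 by (auto simp: prod_eq_iff)
          then show False using ek(1)[rule_format, of i i] by (simp add: metric_def)
        qed
        then have "0 < fst ?v \<bullet> fst ?v" by simp
        moreover have "0 \<le> c * (?x \<bullet> ?x)" using c2 by simp
        then have "0 < 1 + c * (?x \<bullet> ?x)" by linarith
        ultimately show ?thesis using \<delta> c2 by (intro mult_pos_pos) auto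
      qed
      ultimately show ?thesis by linarith
    qed
    then have "0 < esym (r + 1) UNIV k" using r by (intro esym_pos) auto
    then show False using ek(5) by simp
  qed
  from this[of 1] this[of "-1"] show ?thesis by auto
qed

text \<open>The parameters of the rotational hypersurfaces that \<open>M\<close> reaches from inside or crosses.\<close>

definition E :: "real set" where
  "E = {a. 0 < a \<and> (\<exists>p\<in>M. \<bar>snd p\<bar> < L a \<and> 0 \<le> gap (f a) p)}"

text \<open>Translates the sign of the gap into the normalization in which profiles are compared.\<close>

lemma rescaled_le_iff:
  assumes "0 < a" "\<bar>t\<bar> < L a" "1 \<le> X"
  shows "cosh (f a t) \<le> X \<longleftrightarrow> sinh (f a \<bar>t\<bar>) / sinh a \<le> sqrt (X\<^sup>2 - 1) / sinh a"
proof -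
  have "0 < f a t" using f_pos assms by blast
  then have s: "0 < sinh (f a t)" by simp
  have "cosh (f a t) \<le> X \<longleftrightarrow> (cosh (f a t))\<^sup>2 \<le> X\<^sup>2"
    using assms(3) by (simp add: abs_le_square_iff[symmetric])
  also have "\<dots> \<longleftrightarrow> (sinh (f a t))\<^sup>2 \<le> X\<^sup>2 - 1" by (auto simp: cosh_square_eq)
  also have "\<dots> \<longleftrightarrow> sinh (f a t) \<le> sqrt (X\<^sup>2 - 1)"
    using s real_le_rsqrt[of "sinh (f a t)"] sqrt_ge_absD[of "sinh (f a t)"] by auto
  finally have main: "cosh (f a t) \<le> X \<longleftrightarrow> sinh (f a t) \<le> sqrt (X\<^sup>2 - 1)" .
  have "x / sinh a \<le> y / sinh a \<longleftrightarrow> x \<le> y" for x y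
    using assms(1) by (simp add: divide_le_cancel)
  then show ?thesis by (simp only: main even[OF assms(1,2)])
qed

text \<open>Witnesses \<open>p j\<close> for \<open>a j \<in> E\<close> subconverge in the compact set \<open>M\<close>. The two comparisons of rescaled
  profiles transfer the inequality from \<open>a j\<close> to \<open>b\<close>, at times that are divided by factors \<open>\<rho> j\<close>
  tending to \<open>1\<close>. The limit point also has to lie below the life time of \<open>b\<close>; it does because the
  profile of \<open>b\<close> is unbounded, whereas the heights of the witnesses control its values.\<close>

lemma E_closed:
  assumes a: "\<And>j. a j \<in> E" "a \<longlonglongrightarrow> b" "0 < b"
  shows "b \<in> E"
proof -
  have "\<forall>j. \<exists>p. p \<in> M \<and> \<bar>snd p\<bar> < L (a j) \<and> 0 \<le> gap (f (a j)) p"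
    using a(1) unfolding E_def by blast
  then obtain p where p: "\<And>j. p j \<in> M" "\<And>j. \<bar>snd (p j)\<bar> < L (a j)" "\<And>j. 0 \<le> gap (f (a j)) (p j)"
    by metis
  have apos: "0 < a j" for j using a(1)[of j] by (simp add: E_def)
  obtain z \<phi> where z: "z \<in> M" "strict_mono \<phi>" "(p \<circ> \<phi>) \<longlonglongrightarrow> z"
    using M(1) p(1) unfolding compact_def by metis
  define aa where "aa j = a (\<phi> j)" for j
  define s where "s j = \<bar>snd (p (\<phi> j))\<bar>" for j
  define X where "X j = conf (fst (p (\<phi> j))) - 1" for j
  define V where "V j = sqrt ((X j)\<^sup>2 - 1) / sinh (aa j)" for j
  define \<rho> where "\<rho> j = max 1 (sinh (aa j) / sinh b)" for j
  have X1: "1 \<le> X j" for j using conf_M[OF p(1)[of "\<phi> j"]] by (simp add: X_def)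
  have aa: "aa \<longlonglongrightarrow> b" unfolding aa_def using LIMSEQ_subseq_LIMSEQ[OF a(2) z(2)] by (simp add: o_def)
  have pz: "(\<lambda>j. p (\<phi> j)) \<longlonglongrightarrow> z" using z(3) by (simp add: o_def)
  have s: "s \<longlonglongrightarrow> \<bar>snd z\<bar>" unfolding s_def by (intro tendsto_intros pz)
  have "(\<lambda>j. conf (fst (p (\<phi> j)))) \<longlonglongrightarrow> conf (fst z)"
    by (rule continuous_on_tendsto_compose[where f = "\<lambda>p. conf (fst p)", OF conf_cont_M pz z(1)]) (use p(1) in simp)
  then have X: "X \<longlonglongrightarrow> conf (fst z) - 1" unfolding X_def by (intro tendsto_intros)
  define V0 where "V0 = sqrt ((conf (fst z) - 1)\<^sup>2 - 1) / sinh b"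
  have sb: "0 < sinh b" using a(3) by simp
  have V: "V \<longlonglongrightarrow> V0" unfolding V_def V0_def
    using sb by (intro tendsto_intros X aa) auto
  have "(\<lambda>j. max 1 (sinh (aa j) / sinh b)) \<longlonglongrightarrow> max 1 (sinh b / sinh b)"
    using sb by (intro tendsto_intros aa) auto
  then have \<rho>: "\<rho> \<longlonglongrightarrow> 1" unfolding \<rho>_def using sb by simp
  have key: "s j / \<rho> j < L b \<and> sinh (f b (s j / \<rho> j)) / sinh b \<le> V j" for j
  proof -
    have aj: "0 < aa j" using apos by (simp add: aa_def)
    have sj: "0 \<le> s j" "s j < L (aa j)" using p(2)[of "\<phi> j"] by (simp_all add: s_def aa_def)
    have "cosh (f (aa j) (snd (p (\<phi> j)))) \<le> X j"
      using p(3)[of "\<phi> j"] by (simp add: gap_def X_def aa_def)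
    then have v: "sinh (f (aa j) (s j)) / sinh (aa j) \<le> V j"
      using rescaled_le_iff[OF aj _ X1, of "snd (p (\<phi> j))" j] p(2)[of "\<phi> j"] by (simp add: V_def s_def aa_def)
    show ?thesis
    proof (cases "aa j \<le> b")
      case True
      then have "sinh (aa j) / sinh b \<le> 1" using sb by simp
      then have \<rho>1: "\<rho> j = 1" by (simp add: \<rho>_def)
      have lb: "s j < L b"
        using maximal_profile_lifetime(1)[OF q_pos aj True f_L f_L] aj a(3) sj by simp
      have "sinh (f b (s j)) / sinh b \<le> sinh (f (aa j) (s j)) / sinh (aa j)"
        by (rule rescaled_profile_antimono[OF q_pos aj True profile profile]) (use aj a(3) sj lb in auto)
      then show ?thesis using \<rho>1 lb v by simp
    next
      case False
      then have ba: "b \<le> aa j" by simp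
      have "1 \<le> sinh (aa j) / sinh b" using sb ba by simp
      then have \<rho>1: "\<rho> j = sinh (aa j) / sinh b" by (simp add: \<rho>_def)
      have \<rho>p: "0 < \<rho> j" by (simp add: \<rho>_def)
      have "L (aa j) \<le> \<rho> j * L b"
        unfolding \<rho>1 by (rule maximal_profile_lifetime(2)[OF q_pos a(3) ba f_L f_L]) (use aj a(3) in auto)
      then have lb: "s j / \<rho> j < L b" using sj \<rho>p by (simp add: pos_divide_less_eq mult.commute)
      have eq: "sinh (aa j) / sinh b * (s j / \<rho> j) = s j" unfolding \<rho>1[symmetric] using \<rho>p by simp
      have "sinh (f b (s j / \<rho> j)) / sinh b \<le> sinh (f (aa j) (sinh (aa j) / sinh b * (s j / \<rho> j))) / sinh (aa j)"
        by (rule rescaled_profile_le_dilation[OF q_pos a(3) ba profile[OF a(3)] profile[OF aj]])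
          (use sj lb \<rho>p in \<open>auto simp only: eq intro!: divide_nonneg_pos\<close>)
      then show ?thesis unfolding eq using v lb by simp
    qed
  qed
  obtain th where th: "0 < th" "th < L b" "arsinh ((V0 + 1) * sinh b) < f b th"
    using profile_unbounded[OF q_pos a(3) f_L[OF a(3)]] by blast
  have "(V0 + 1) * sinh b < sinh (f b th)" using th(3) by (metis sinh_arsinh_real sinh_real_less_iff)
  then have vth: "V0 + 1 < sinh (f b th) / sinh b" using sb by (simp add: pos_less_divide_eq)
  have "(\<lambda>j. s j / \<rho> j) \<longlonglongrightarrow> \<bar>snd z\<bar> / 1" by (intro tendsto_intros s \<rho>) simp
  then have sr: "(\<lambda>j. s j / \<rho> j) \<longlonglongrightarrow> \<bar>snd z\<bar>" by simp
  have "\<forall>\<^sub>F j in sequentially. V j < V0 + 1" using order_tendstoD(2)[OF V, of "V0 + 1"] by simp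
  then have "\<forall>\<^sub>F j in sequentially. s j / \<rho> j \<le> th"
  proof (rule eventually_mono)
    fix j assume Vj: "V j < V0 + 1"
    show "s j / \<rho> j \<le> th"
    proof (rule ccontr)
      assume "\<not> s j / \<rho> j \<le> th"
      then have "f b th < f b (s j / \<rho> j)"
        using profile_strict_mono[OF q_pos profile[OF a(3)], of th "s j / \<rho> j"] th key[of j] by auto
      then have "sinh (f b th) / sinh b \<le> sinh (f b (s j / \<rho> j)) / sinh b"
        using sb by (simp add: divide_le_cancel)
      then show False using key[of j] Vj vth by linarith
    qed
  qed
  then have "\<bar>snd z\<bar> \<le> th"
    using tendsto_upperbound[OF sr] by simp
  then have zL: "\<bar>snd z\<bar> < L b" using th by simp
  have "isCont (\<lambda>t. sinh (f b t) / sinh b) \<bar>snd z\<bar>"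
    using DERIV_isCont[OF profile_onE(3)[OF profile[OF a(3)], of "\<bar>snd z\<bar>"]] zL sb
    by (intro continuous_intros) auto
  from isCont_tendsto_compose[OF this sr]
  have "(\<lambda>j. sinh (f b (s j / \<rho> j)) / sinh b) \<longlonglongrightarrow> sinh (f b \<bar>snd z\<bar>) / sinh b" .
  then have "sinh (f b \<bar>snd z\<bar>) / sinh b \<le> V0"
    by (rule LIMSEQ_le[OF _ V]) (use key in blast)
  then have "cosh (f b (snd z)) \<le> conf (fst z) - 1"
    using rescaled_le_iff[OF a(3) zL, of "conf (fst z) - 1"] conf_M[OF z(1)] by (simp add: V0_def)
  then show ?thesis unfolding E_def using a(3) z(1) zL by (auto simp: gap_def)
qed

text \<open>A point strictly outside the hypersurface of parameter \<open>a\<close> would also be outside those of slightly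
  larger parameter.\<close>

lemma inside_of_gap_in_E:
  assumes a: "0 < a" "a < b" "{a<..<b} \<inter> E = {}" and p: "p \<in> M" "\<bar>snd p\<bar> < L a"
  shows "gap (f a) p \<le> 0"
proof (rule ccontr)
  assume "\<not> gap (f a) p \<le> 0"
  define X where "X = conf (fst p) - 1"
  have X1: "1 \<le> X" using conf_M[OF p(1)] by (simp add: X_def)
  have cX: "cosh (f a (snd p)) < X" using \<open>\<not> gap (f a) p \<le> 0\<close> by (simp add: gap_def X_def)
  have fp: "0 < f a (snd p)" using f_pos[OF a(1) p(2)] .
  define S where "S = sinh (f a \<bar>snd p\<bar>)"
  have S0: "0 < S" using fp even[OF a(1) p(2)] by (simp add: S_def)
  have "S\<^sup>2 < X\<^sup>2 - 1"
  proof -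
    have "(cosh (f a (snd p)))\<^sup>2 < X\<^sup>2" using cX by (intro power_strict_mono) auto
    then show ?thesis using even[OF a(1) p(2)] by (simp add: S_def cosh_square_eq)
  qed
  then have SX: "S < sqrt (X\<^sup>2 - 1)" using S0 by (intro real_less_rsqrt)
  have sa: "0 < sinh a" using a by simp
  have "((\<lambda>c. sinh c / sinh a * S) \<longlongrightarrow> sinh a / sinh a * S) (at_right a)"
    using sa by (intro tendsto_intros) auto
  then have "\<forall>\<^sub>F c in at_right a. sinh c / sinh a * S < sqrt (X\<^sup>2 - 1)"
    by (rule order_tendstoD(2)) (use SX sa in simp)
  moreover have "\<forall>\<^sub>F c in at_right a. c \<in> {a<..<b}"
    by (rule eventually_at_rightI[OF _ a(2)])
  ultimately have "\<forall>\<^sub>F c in at_right a. sinh c / sinh a * S < sqrt (X\<^sup>2 - 1) \<and> c \<in> {a<..<b}"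
    by (rule eventually_conj)
  from eventually_happens'[OF _ this] obtain c where c: "sinh c / sinh a * S < sqrt (X\<^sup>2 - 1)" "a < c" "c < b" by auto
  have c0: "0 < c" using a c by simp
  have "L a \<le> L c" using maximal_profile_lifetime(1)[OF q_pos a(1) _ f_L f_L] a c by simp
  then have pc: "\<bar>snd p\<bar> < L c" using p(2) by simp
  have "sinh (f c \<bar>snd p\<bar>) / sinh c \<le> S / sinh a"
    unfolding S_def
    by (rule rescaled_profile_antimono[OF q_pos a(1) _ profile profile]) (use a c c0 p(2) pc in auto)
  also have "\<dots> \<le> sqrt (X\<^sup>2 - 1) / sinh c"
    using c(1) sa c0 by (simp add: field_simps)
  finally have "cosh (f c (snd p)) \<le> X" using rescaled_le_iff[OF c0 pc X1] by simp
  then have "c \<in> E" unfolding E_def using c0 p(1) pc by (auto simp: gap_def X_def)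
  then show False using a(3) c by auto
qed

text \<open>At an interior point of \<open>M\<close> both the height and the gap would have a maximum on \<open>M\<close>, but their
  gradients are not parallel off the axis.\<close>

lemma wedge:
  assumes a: "0 < a" "t0 < L a" and inside: "\<And>p. p \<in> M \<Longrightarrow> gap (f a) p \<le> 0"
    and p: "p \<in> M" "\<bar>snd p\<bar> = t0" "gap (f a) p = 0"
  shows "p \<in> boundary M"
proof (rule ccontr)
  assume pb: "p \<notin> boundary M"
  define \<sigma> where "\<sigma> = sgn (snd p)"
  have \<sigma>: "\<sigma> * snd p = t0" "\<sigma> = 1 \<or> \<sigma> = -1" using p(2) t0 by (auto simp: \<sigma>_def sgn_if)
  obtain \<nu> where \<nu>: "\<nu> \<noteq> 0"
    "\<forall>F g. (F has_derivative (\<lambda>w. g \<bullet> w)) (at p) \<longrightarrow> (\<forall>\<^sub>F y in nhds p. y \<in> M \<longrightarrow> F y \<le> (F p :: real))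
      \<longrightarrow> (\<exists>c. g = c *\<^sub>R \<nu>)"
    by (rule common_normal[OF M(3) p(1) pb]) (rule that)
  have "((\<lambda>y. \<sigma> * snd y) has_derivative (\<lambda>w. (0, \<sigma>) \<bullet> w)) (at p)"
    by (auto intro!: derivative_eq_intros simp: inner_prod_def)
  moreover have "\<sigma> * snd y \<le> \<sigma> * snd p" if "y \<in> M" for y
    using slab[OF that] \<sigma> by auto
  ultimately have "\<exists>c. (0, \<sigma>) = c *\<^sub>R \<nu>" using \<nu>(2) by (simp add: always_eventually)
  then obtain c1 where c1: "(0, \<sigma>) = c1 *\<^sub>R \<nu>" by blast
  then have "c1 \<noteq> 0" using \<sigma> by (auto simp: prod_eq_iff)
  have "0 = c1 *\<^sub>R fst \<nu>" using c1 by (metis fst_conv fst_scaleR)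
  then have f\<nu>: "fst \<nu> = 0" using \<open>c1 \<noteq> 0\<close> by simp
  have pL: "snd p \<in> {- L a<..<L a}" using p(2) a by auto
  have "(gap (f a) has_derivative (\<lambda>w. grad_gap (f a) p \<bullet> w)) (at p)"
    by (rule gap_has_derivative[OF MHxR[OF p(1)] profile_onE(3)[OF profile[OF a(1)] pL]])
  moreover have "\<forall>\<^sub>F y in nhds p. y \<in> M \<longrightarrow> gap (f a) y \<le> gap (f a) p"
    using inside p(3) by simp
  ultimately obtain c2 where "grad_gap (f a) p = c2 *\<^sub>R \<nu>" using \<nu>(2) by blast
  then have "fst (grad_gap (f a) p) = 0" using f\<nu> by simp
  then have "fst p = 0" using conf_M[OF p(1)] by (auto simp: grad_gap_def)
  then have "cosh (f a (snd p)) = 1" using p(3) by (simp add: gap_def conf_def)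
  moreover have "0 < f a (snd p)" using profile_onE(1)[OF profile[OF a(1)] pL] .
  ultimately show False using cosh_real_strict_mono[of 0 "f a (snd p)"] by simp
qed

text \<open>While the profile is below \<open>2 a\<close> its slope is bounded by the first integral, uniformly in small \<open>a\<close>:
  \<open>sinh (2 a) / sinh a = 2 cosh a\<close>.\<close>

lemma reach_in_short_time:
  assumes a: "0 < a" "a < \<beta>" and \<kappa>: "\<kappa> = (2 * cosh \<beta>) powr q" and t: "\<bar>t\<bar> \<le> a / \<kappa>"
  shows "\<bar>t\<bar> < L a \<and> f a t \<le> 2 * a"
proof -
  note pf = profile[OF a(1)]
  note pe = profile_onE[OF pf]
  obtain t2 where t2: "0 < t2" "t2 < L a" "2 * a < f a t2"
    using profile_unbounded[OF q_pos a(1) f_L[OF a(1)]] by blast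
  have cont: "continuous_on {0..t2} (f a)"
  proof (intro continuous_at_imp_continuous_on ballI)
    fix t assume "t \<in> {0..t2}"
    then show "isCont (f a) t" using DERIV_isCont[OF pe(3)[of t]] t2 by simp
  qed
  have "\<exists>t1\<ge>0. t1 \<le> t2 \<and> f a t1 = 2 * a"
    by (rule IVT') (use t2 pe(2) a cont in auto)
  then obtain t1 where t1: "0 \<le> t1" "t1 \<le> t2" "f a t1 = 2 * a" by blast
  then have t1p: "0 < t1" "t1 < L a" using pe(2) a t2 by (auto simp: less_le)
  obtain z where z: "0 < z" "z < t1" "f a t1 - f a 0 = (t1 - 0) * deriv (f a) z"
    using MVT2[of 0 t1 "f a" "deriv (f a)"] pe(3) t1p by auto
  have \<kappa>0: "0 < \<kappa>" by (simp add: \<kappa>)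
  have "deriv (f a) z \<le> \<kappa>"
  proof -
    have sa: "0 < sinh a" using a by simp
    have fz: "f a z < 2 * a" using profile_strict_mono[OF q_pos pf, of z t1] z t1p t1 by simp
    have "sinh (f a z) \<le> sinh (2 * a)" using fz by simp
    also have "\<dots> = 2 * sinh a * cosh a" by (simp add: sinh_double)
    finally have "sinh (f a z) / sinh a \<le> 2 * cosh a" using sa by (simp add: pos_divide_le_eq mult_ac)
    also have "\<dots> \<le> 2 * cosh \<beta>" using a by (simp add: cosh_real_nonneg_le_iff)
    finally have le: "sinh (f a z) / sinh a \<le> 2 * cosh \<beta>" .
    have nn: "0 < sinh (f a z) / sinh a" using sa pe(1)[of z] z t1p by simp
    have "(deriv (f a) z)\<^sup>2 \<le> (sinh (f a z) / sinh a) powr (2 * q)"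
      using first_integral[OF q_pos a(1) pf, of z] z t1p by simp
    also have "\<dots> \<le> (2 * cosh \<beta>) powr (2 * q)" using le nn q_pos by (intro powr_mono2) auto
    also have "\<dots> = \<kappa>\<^sup>2" unfolding \<kappa> power2_eq_square powr_add[symmetric] by simp
    finally have "(deriv (f a) z)\<^sup>2 \<le> \<kappa>\<^sup>2" .
    then show ?thesis using \<kappa>0 by (rule power2_le_imp_le[OF _ less_imp_le])
  qed
  then have "a \<le> t1 * \<kappa>" using z(3) t1 pe(2) t1p mult_left_mono[of "deriv (f a) z" \<kappa> t1] by simp
  then have "a / \<kappa> \<le> t1" using \<kappa>0 by (simp add: pos_divide_le_eq)
  then have tt: "\<bar>t\<bar> \<le> t1" using t by simp
  then have tL: "\<bar>t\<bar> < L a" using t1p by simp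
  have "f a \<bar>t\<bar> \<le> f a t1"
    using profile_strict_mono[OF q_pos pf, of "\<bar>t\<bar>" t1] tt t1p by (cases "\<bar>t\<bar> = t1") auto
  then show ?thesis using tL even[OF a(1) tL] t1 by simp
qed

end

context sweep begin

text \<open>If \<open>E\<close> contained no element below \<open>\<beta>\<close>, then no point of \<open>M\<close> would be on or outside a thin rotational
  hypersurface. Near the axis these cover everything but a double cone \<open>|t| \<ge> c |x|\<close>. Being connected, \<open>M\<close>
  meets the slice \<open>t = 0\<close>, and it can do so in the origin only. As \<open>n \<ge> 2\<close>, the tangent space there
  contains a horizontal vector, and a curve in \<open>M\<close> in this direction leaves the cone.\<close>

lemma E_small:
  assumes "0 < \<beta>"
  shows "\<exists>a\<in>E. a < \<beta>"
proof (rule ccontr)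
  assume none: "\<not> ?thesis"
  have "connected (snd ` M)" by (intro connected_continuous_image continuous_intros M(2))
  moreover have "t0 \<in> snd ` M" using ends(1) by (metis image_eqI)
  moreover have "- t0 \<in> snd ` M" using ends(2) by (metis image_eqI)
  ultimately have "0 \<in> snd ` M"
    using connected_contains_Icc[of "snd ` M" "- t0" t0] t0 by auto
  then obtain p where p: "p \<in> M" "snd p = 0" by auto
  \<comment> \<open>The profile with neck \<open>rad y\<close> reaches \<open>2 rad y\<close> after a time proportional to \<open>rad y\<close> only. The radius is
    chosen so that \<open>cosh (2 * rad y) = conf (fst y) - 1\<close>.\<close>
  define \<kappa> where "\<kappa> = (2 * cosh \<beta>) powr q"
  have \<kappa>: "0 < \<kappa>" by (simp add: \<kappa>_def)
  define rad where "rad y = arsinh (sqrt ((conf (fst y) - 2) / 2))" for y :: "'n amb"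
  have cone: "rad y / \<kappa> < \<bar>snd y\<bar>" if y: "y \<in> M" "fst y \<noteq> 0" "rad y < \<beta>" for y
  proof (rule ccontr)
    assume near: "\<not> rad y / \<kappa> < \<bar>snd y\<bar>"
    have c: "2 < conf (fst y)" using conf_gt_2_iff[OF MHxR] y by blast
    then have ry: "0 < rad y" by (simp add: rad_def)
    have "\<bar>snd y\<bar> < L (rad y) \<and> f (rad y) (snd y) \<le> 2 * rad y"
      by (rule reach_in_short_time[OF ry y(3) \<kappa>_def]) (use near in simp)
    then have fy: "\<bar>snd y\<bar> < L (rad y)" "f (rad y) (snd y) \<le> 2 * rad y" by auto
    have "cosh (f (rad y) (snd y)) \<le> cosh (2 * rad y)"
      using fy f_pos[OF ry fy(1)] ry by (simp add: cosh_real_nonneg_le_iff)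
    also have "\<dots> = 1 + 2 * (sinh (rad y))\<^sup>2" by (simp add: cosh_double cosh_square_eq)
    also have "(sinh (rad y))\<^sup>2 = (conf (fst y) - 2) / 2" using c by (simp add: rad_def)
    also have "1 + 2 * ((conf (fst y) - 2) / 2) = conf (fst y) - 1" by (simp add: field_simps)
    finally have "rad y \<in> E" unfolding E_def using ry y(1) fy(1) by (auto simp: gap_def)
    then show False using none y(3) by blast
  qed
  have p0: "fst p = 0"
  proof (rule ccontr)
    assume off: "fst p \<noteq> 0"
    have c: "2 < conf (fst p)" using conf_gt_2_iff[OF MHxR] p off by blast
    define a where "a = min (\<beta> / 2) (arcosh (conf (fst p) - 1))"
    have ar: "0 < arcosh (conf (fst p) - 1)" using c by simp
    then have a: "0 < a" "a < \<beta>" using assms by (auto simp: a_def)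
    have "cosh a \<le> cosh (arcosh (conf (fst p) - 1))"
      using a ar by (simp add: cosh_real_nonneg_le_iff a_def)
    also have "\<dots> = conf (fst p) - 1" using c by (simp add: cosh_arcosh_real)
    finally have "0 \<le> gap (f a) p" using p(2) profile_onE(2)[OF profile[OF a(1)]] by (simp add: gap_def)
    then have "a \<in> E" unfolding E_def using a(1) p L_pos[OF a(1)] by (simp, intro bexI[of _ p]) simp_all
    then show False using none a by blast
  qed
  have "p = (0, 0)" using p(2) p0 by (simp add: prod_eq_iff)
  have pb: "p \<notin> boundary M" using bdry[of p] p(2) t0 by auto
  obtain \<nu> where \<nu>: "\<nu> \<noteq> 0"
    "\<forall>v. \<nu> \<bullet> v = 0 \<longrightarrow> (\<exists>\<gamma> \<gamma>' \<delta>. 0 < (\<delta>::real) \<and> \<gamma> 0 = p \<and> \<gamma>' 0 = v \<and> isCont \<gamma>' 0 \<and>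
      (\<forall>s. \<bar>s\<bar> < \<delta> \<longrightarrow> \<gamma> s \<in> M \<and> (\<gamma> has_vector_derivative \<gamma>' s) (at s) \<and>
        \<gamma>' s \<in> tangent_space M (\<gamma> s)))"
    by (rule interior_curves[OF M(3) p(1) pb]) (rule that)
  have "2 \<le> DIM(real^'n)" using r by simp
  then obtain w :: "real^'n" where w: "w \<noteq> 0" "orthogonal (fst \<nu>) w"
    by (metis orthogonal_to_vector_exists)
  define v where "v = (w, 0::real)"
  have "\<nu> \<bullet> v = 0" using w by (simp add: v_def inner_prod_def orthogonal_def)
  then obtain \<gamma> \<gamma>' \<delta> where c: "0 < (\<delta>::real)" "\<gamma> 0 = p" "\<gamma>' 0 = v" "isCont \<gamma>' 0"
    "\<forall>s. \<bar>s\<bar> < \<delta> \<longrightarrow> \<gamma> s \<in> M \<and> (\<gamma> has_vector_derivative \<gamma>' s) (at s) \<and> \<gamma>' s \<in> tangent_space M (\<gamma> s)"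
    using \<nu>(2) by blast
  have "(\<gamma> has_vector_derivative \<gamma>' 0) (at 0)" using c(1,5) by simp
  then have d: "(\<gamma> has_vector_derivative v) (at 0)" using c(3) by simp
  have quot: "((\<lambda>s. \<gamma> s /\<^sub>R s) \<longlongrightarrow> v) (at 0)"
  proof -
    have "((\<lambda>h. norm (\<gamma> h - h *\<^sub>R v) / norm h) \<longlongrightarrow> 0) (at 0)"
      using d c(2) \<open>p = (0, 0)\<close> unfolding has_vector_derivative_def has_derivative_at by (simp add: zero_prod_def[symmetric])
    moreover have "\<forall>\<^sub>F h in at 0. norm (\<gamma> h - h *\<^sub>R v) / norm h = norm (\<gamma> h /\<^sub>R h - v)"
      unfolding eventually_at_filter
    proof (intro always_eventually allI impI)
      fix h :: real assume "h \<noteq> 0"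
      then have "\<gamma> h /\<^sub>R h - v = (1 / h) *\<^sub>R (\<gamma> h - h *\<^sub>R v)"
        by (simp add: scaleR_diff_right divide_inverse)
      then show "norm (\<gamma> h - h *\<^sub>R v) / norm h = norm (\<gamma> h /\<^sub>R h - v)" by simp
    qed
    ultimately have "((\<lambda>h. norm (\<gamma> h /\<^sub>R h - v)) \<longlongrightarrow> 0) (at 0)"
      by (rule Lim_transform_eventually)
    then show ?thesis by (rule LIM_zero_cancel[OF tendsto_norm_zero_cancel])
  qed
  have xs: "((\<lambda>s. norm (fst (\<gamma> s)) / \<bar>s\<bar>) \<longlongrightarrow> norm w) (at 0)"
    using tendsto_norm[OF tendsto_fst[OF quot]] by (simp add: v_def divide_inverse mult.commute abs_inverse)
  have ts: "((\<lambda>s. \<bar>snd (\<gamma> s)\<bar> / \<bar>s\<bar>) \<longlongrightarrow> 0) (at 0)"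
    using tendsto_rabs[OF tendsto_snd[OF quot]] by (simp add: v_def divide_inverse mult.commute abs_mult abs_inverse)
  define \<theta> where "\<theta> = \<kappa> * cosh \<beta>"
  have \<theta>: "0 < \<theta>" using \<kappa> by (simp add: \<theta>_def)
  have lim: "((\<lambda>s. norm (fst (\<gamma> s)) / \<bar>s\<bar> - \<theta> * (\<bar>snd (\<gamma> s)\<bar> / \<bar>s\<bar>)) \<longlongrightarrow> norm w - \<theta> * 0) (at 0)"
    by (intro tendsto_intros xs ts)
  have e1: "\<forall>\<^sub>F s in at 0. 0 < norm (fst (\<gamma> s)) / \<bar>s\<bar> - \<theta> * (\<bar>snd (\<gamma> s)\<bar> / \<bar>s\<bar>)"
    by (rule order_tendstoD(1)[OF lim]) (use w in simp)
  have e0: "\<forall>\<^sub>F s in at 0. 0 < norm (fst (\<gamma> s)) / \<bar>s\<bar>"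
    by (rule order_tendstoD(1)[OF xs]) (use w in simp)
  have "isCont \<gamma> 0" using d by (rule has_vector_derivative_continuous)
  then have "(\<gamma> \<longlongrightarrow> (0, 0)) (at 0)" unfolding isCont_def using c(2) \<open>p = (0, 0)\<close> by simp
  from tendsto_fst[OF this] have fst0: "((\<lambda>s. fst (\<gamma> s)) \<longlongrightarrow> 0) (at 0)" by simp
  have "isCont conf (0::real^'n)" by (rule has_derivative_continuous[OF conf_has_derivative]) simp
  then have "((\<lambda>s. conf (fst (\<gamma> s))) \<longlongrightarrow> conf (0::real^'n)) (at 0)"
    by (rule isCont_tendsto_compose[OF _ fst0])
  then have "((\<lambda>s. rad (\<gamma> s)) \<longlongrightarrow> arsinh (sqrt ((conf (0::real^'n) - 2) / 2))) (at 0)"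
    unfolding rad_def by (intro tendsto_intros) auto
  then have "((\<lambda>s. rad (\<gamma> s)) \<longlongrightarrow> 0) (at 0)" by (simp add: conf_def)
  then have e2: "\<forall>\<^sub>F s in at 0. rad (\<gamma> s) < \<beta>" by (rule order_tendstoD(2)) (use assms in simp)
  have e3: "\<forall>\<^sub>F s in at 0. \<bar>s\<bar> < \<delta> \<and> s \<noteq> 0"
    unfolding eventually_at using c(1) by (intro exI[of _ \<delta>]) (auto simp: dist_real_def)
  have "\<forall>\<^sub>F s in at 0. (0 < norm (fst (\<gamma> s)) / \<bar>s\<bar> - \<theta> * (\<bar>snd (\<gamma> s)\<bar> / \<bar>s\<bar>) \<and>
      0 < norm (fst (\<gamma> s)) / \<bar>s\<bar>) \<and> rad (\<gamma> s) < \<beta> \<and> \<bar>s\<bar> < \<delta> \<and> s \<noteq> 0"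
    by (intro eventually_conj e0 e1 e2 e3)
  from eventually_happens'[OF _ this] obtain s where s:
    "\<theta> * (\<bar>snd (\<gamma> s)\<bar> / \<bar>s\<bar>) < norm (fst (\<gamma> s)) / \<bar>s\<bar>" "0 < norm (fst (\<gamma> s)) / \<bar>s\<bar>"
    "rad (\<gamma> s) < \<beta>" "\<bar>s\<bar> < \<delta>" "s \<noteq> 0" by auto
  define y where "y = \<gamma> s"
  have y: "y \<in> M" using c(5) s(4) by (simp add: y_def)
  have fy: "fst y \<noteq> 0" using s(2) by (auto simp: y_def)
  have lt: "\<theta> * \<bar>snd y\<bar> < norm (fst y)" using s(1,5) by (simp add: y_def divide_less_cancel)
  have cy: "2 < conf (fst y)" using conf_gt_2_iff[OF MHxR] y fy by blast
  have ry: "0 < rad y" "rad y < \<beta>" using cy s(3) by (simp_all add: rad_def y_def)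
  have "(norm (fst y))\<^sup>2 \<le> (conf (fst y) - 2) / 2"
    using conf_norm_sq[OF MHxR[OF y]] mult_right_mono[of 2 "conf (fst y)" "(norm (fst y))\<^sup>2"] cy by simp
  then have "norm (fst y) \<le> sqrt ((conf (fst y) - 2) / 2)" by (rule real_le_rsqrt)
  also have "\<dots> = sinh (rad y)" by (simp add: rad_def)
  also have "sinh (rad y) \<le> rad y * cosh \<beta>"
  proof -
    obtain z where z: "0 < z" "z < rad y" "sinh (rad y) - sinh 0 = (rad y - 0) * cosh z"
    proof -
      have "(sinh has_real_derivative cosh x) (at x)" for x :: real
        by (auto intro!: derivative_eq_intros)
      then show ?thesis using that MVT2[of 0 "rad y" sinh cosh] ry(1) by auto
    qed
    have "cosh z \<le> cosh \<beta>" using z ry by (simp add: cosh_real_nonneg_le_iff)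
    then show ?thesis using z ry by (simp add: mult_left_mono)
  qed
  finally have "norm (fst y) \<le> rad y * cosh \<beta>" .
  moreover have "rad y < \<bar>snd y\<bar> * \<kappa>"
    using cone[OF y fy ry(2)] \<kappa> by (simp add: pos_divide_less_eq)
  then have "rad y * cosh \<beta> \<le> \<bar>snd y\<bar> * \<kappa> * cosh \<beta>" by (intro mult_right_mono) auto
  moreover have "\<theta> * \<bar>snd y\<bar> = \<bar>snd y\<bar> * \<kappa> * cosh \<beta>" by (simp add: \<theta>_def)
  ultimately show False using lt by linarith
qed

text \<open>A boundary point estimate in the manner of Hopf: \<open>gap + \<epsilon> exp (- K t)\<close> takes its maximum over
  \<open>0 \<le> t \<le> t0\<close> on the slice \<open>t = t0\<close>, since an interior maximum close to the hypersurface is excluded by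
  \<open>no_local_max_near_profile\<close>, and away from it, or on \<open>t = 0\<close>, the value is too small if \<open>\<epsilon>\<close> is small.
  The bound \<open>(3 + cosh a) / 2\<close> cuts off a neighbourhood of the axis, where the gap is far from zero. The
  slope is then that of the exponential function at \<open>t0\<close>.\<close>

lemma boundary_slope:
  assumes a: "0 < a" "t0 < L a" and inside: "\<And>p. p \<in> M \<Longrightarrow> gap (f a) p \<le> 0"
    and strict: "\<And>p. p \<in> M \<Longrightarrow> \<bar>snd p\<bar> < t0 \<Longrightarrow> gap (f a) p < 0"
    and \<sigma>: "\<sigma> = 1 \<or> \<sigma> = (-1::real)"
  shows "\<exists>\<epsilon>>0. \<forall>p\<in>M. 0 \<le> \<sigma> * snd p \<longrightarrow> gap (f a) p \<le> - (\<epsilon> * (t0 - \<sigma> * snd p))"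
proof -
  define D where "D = M \<inter> {p. 0 \<le> \<sigma> * snd p}"
  define C where "C = D \<inter> {p \<in> M. (3 + cosh a) / 2 \<le> conf (fst p)}"
  have MJ: "norm (fst p) < 1 \<and> snd p \<in> {- L a<..<L a}" if "p \<in> M" for p
    using MHxR[OF that] slab[OF that] a(2) by auto
  have cD: "compact D"
    unfolding D_def by (intro compact_Int_closed M(1) closed_Collect_le continuous_intros)
  have "closed {p \<in> M. (3 + cosh a) / 2 \<le> conf (fst p)}"
  proof -
    have "closed (M \<inter> (\<lambda>p. conf (fst p)) -` {(3 + cosh a) / 2..})"
      by (rule continuous_closed_preimage[OF conf_cont_M]) (use M(1) compact_imp_closed in auto)
    moreover have "M \<inter> (\<lambda>p. conf (fst p)) -` {(3 + cosh a) / 2..} = {p \<in> M. (3 + cosh a) / 2 \<le> conf (fst p)}" by auto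
    ultimately show ?thesis by simp
  qed
  then have cC: "compact C" unfolding C_def using cD by (rule compact_Int_closed[rotated])
  have ca: "1 < cosh a" using a cosh_real_nonneg_less_iff[of 0 a] by simp
  have CC: "norm (fst p) < 1 \<and> fst p \<noteq> 0 \<and> snd p \<in> {- L a<..<L a}" if "p \<in> C" for p
  proof -
    have "p \<in> M" "2 < conf (fst p)" using that ca by (auto simp: C_def D_def)
    then show ?thesis using MJ conf_gt_2_iff MHxR by blast
  qed
  obtain K \<epsilon>0 where K: "0 < K" "0 < \<epsilon>0"
    "\<forall>\<epsilon> p. 0 < \<epsilon> \<longrightarrow> \<epsilon> < \<epsilon>0 \<longrightarrow> p \<in> M \<longrightarrow> p \<in> C \<longrightarrow> p \<notin> boundary M \<longrightarrow>
      - (\<epsilon> * exp (- K * (\<sigma> * snd p))) \<le> gap (f a) p \<longrightarrow> gap (f a) p \<le> 0 \<longrightarrow>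
      \<not> (\<forall>\<^sub>F y in nhds p. y \<in> M \<longrightarrow> gap (f a) y + \<epsilon> * exp (- K * (\<sigma> * snd y)) \<le> gap (f a) p + \<epsilon> * exp (- K * (\<sigma> * snd p)))"
  proof (rule no_local_max_near_profile[OF r q profile[OF a(1)] open_greaterThanLessThan M(3,4) cC CC,
        where s = "\<lambda>p. \<sigma> * snd p" and gs = "\<lambda>p. (0, \<sigma>)" and \<kappa> = 0])
    show "((\<lambda>p. \<sigma> * snd p) has_derivative (\<lambda>v. (0, \<sigma>) \<bullet> v)) (at y)" for y :: "'n amb"
      by (auto intro!: derivative_eq_intros simp: inner_prod_def)
    show "(0, \<sigma>) \<noteq> c *\<^sub>R grad_gap (f a) p" if "p \<in> C" for p c
    proof
      assume eq: "(0, \<sigma>) = c *\<^sub>R grad_gap (f a) p"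
      then have "c * (conf (fst p))\<^sup>2 = 0 \<or> fst p = 0" by (auto simp: grad_gap_def)
      then have "c = 0" using CC[OF that] conf_ge_2[of "fst p"] by auto
      then show False using eq \<sigma> by (auto simp: prod_eq_iff)
    qed
  qed (auto intro!: derivative_eq_intros that)
  define B where "B = M \<inter> {p. snd p = 0}"
  have cont: "continuous_on M (gap (f a))" by (rule gap_continuous_on[OF profile[OF a(1)] MJ])
  obtain \<zeta> where \<zeta>: "0 < \<zeta>" "\<And>p. p \<in> B \<Longrightarrow> gap (f a) p \<le> - \<zeta>"
  proof (cases "B = {}")
    case False
    have "compact B" unfolding B_def by (intro compact_Int_closed M(1) closed_Collect_eq continuous_intros)
    moreover have "continuous_on B (gap (f a))" by (rule continuous_on_subset[OF cont]) (auto simp: B_def)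
    ultimately obtain z where z: "z \<in> B" "\<And>p. p \<in> B \<Longrightarrow> gap (f a) p \<le> gap (f a) z"
      using continuous_attains_sup[OF _ False] by blast
    have "gap (f a) z < 0" using strict[of z] z(1) t0 by (simp add: B_def)
    then show ?thesis using that[of "- gap (f a) z"] z(2) by simp
  qed (use that[of 1] in simp)
  define \<epsilon> where "\<epsilon> = min \<epsilon>0 (min \<zeta> ((cosh a - 1) / 2)) / 2"
  have \<epsilon>: "0 < \<epsilon>" "\<epsilon> < \<epsilon>0" "\<epsilon> < \<zeta>" "\<epsilon> < (cosh a - 1) / 2"
    using K(2) \<zeta>(1) ca by (auto simp: \<epsilon>_def min_def)
  define F where "F p = gap (f a) p + \<epsilon> * exp (- K * (\<sigma> * snd p))" for p :: "'n amb"
  have small: "exp (- K * (\<sigma> * snd p)) \<le> 1" if "p \<in> D" for p using that K(1) by (simp add: D_def)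
  have main: "F p \<le> \<epsilon> * exp (- K * t0)" if pD: "p \<in> D" for p
  proof (rule ccontr)
    assume big: "\<not> F p \<le> \<epsilon> * exp (- K * t0)"
    have "continuous_on D F"
      unfolding F_def by (intro continuous_intros continuous_on_subset[OF cont]) (auto simp: D_def)
    then obtain z where z: "z \<in> D" "\<And>y. y \<in> D \<Longrightarrow> F y \<le> F z"
      using continuous_attains_sup[OF cD] pD by blast
    have Fz: "\<epsilon> * exp (- K * t0) < F z" using z(2)[OF pD] big by simp
    have zM: "z \<in> M" "0 \<le> \<sigma> * snd z" using z(1) by (auto simp: D_def)
    have gz: "gap (f a) z \<le> 0" using inside zM by blast
    have pos: "0 < F z" using Fz \<epsilon>(1) by (smt (verit) exp_gt_zero mult_pos_pos)
    have s1: "\<sigma> * snd z \<noteq> t0" using Fz gz by (auto simp: F_def)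
    have s2: "snd z \<noteq> 0"
    proof
      assume "snd z = 0"
      then have "gap (f a) z \<le> - \<zeta>" using \<zeta>(2) zM by (simp add: B_def)
      then show False using pos small[OF z(1)] \<epsilon> \<open>snd z = 0\<close> by (simp add: F_def)
    qed
    have st: "0 < \<sigma> * snd z" "\<sigma> * snd z < t0" using s1 s2 zM slab[OF zM(1)] \<sigma> by auto
    have "\<bar>snd z\<bar> \<noteq> t0" using st \<sigma> by auto
    then have zb: "z \<notin> boundary M" using bdry by blast
    have ge: "- (\<epsilon> * exp (- K * (\<sigma> * snd z))) \<le> gap (f a) z" using pos by (simp add: F_def)
    have "\<epsilon> * exp (- K * (\<sigma> * snd z)) \<le> \<epsilon>" using small[OF z(1)] \<epsilon>(1) by simp
    moreover have "cosh a \<le> cosh (f a (snd z))"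
    proof -
      have "\<bar>snd z\<bar> < L a" using MJ[OF zM(1)] by auto
      then show ?thesis using f_ge[OF a(1)] a(1) f_pos[OF a(1)] by (simp add: cosh_real_nonneg_le_iff less_imp_le)
    qed
    ultimately have "(3 + cosh a) / 2 \<le> conf (fst z)" using ge \<epsilon>(4) by (simp add: gap_def field_simps)
    then have zC: "z \<in> C" using z(1) zM(1) by (simp add: C_def)
    have "open {y :: 'n amb. 0 < \<sigma> * snd y}" by (intro open_Collect_less continuous_intros)
    then have "\<forall>\<^sub>F y in nhds z. y \<in> {y. 0 < \<sigma> * snd y}"
      by (rule eventually_nhds_in_open) (use st in simp)
    then have "\<forall>\<^sub>F y in nhds z. y \<in> M \<longrightarrow> F y \<le> F z"
      by (rule eventually_mono) (use z(2) in \<open>auto simp: D_def\<close>)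
    then show False using K(3) \<epsilon>(1,2) zM(1) zC zb ge gz unfolding F_def by blast
  qed
  show ?thesis
  proof (intro exI[of _ "\<epsilon> * (exp (- K * t0) * K)"] conjI ballI impI)
    show "0 < \<epsilon> * (exp (- K * t0) * K)" using \<epsilon> K by simp
    fix p assume p: "p \<in> M" "0 \<le> \<sigma> * snd p"
    define s where "s = \<sigma> * snd p"
    have "1 + K * (t0 - s) \<le> exp (K * (t0 - s))" by (rule exp_ge_add_one_self)
    then have "exp (- K * t0) * (1 + K * (t0 - s)) \<le> exp (- K * t0) * exp (K * (t0 - s))"
      by (intro mult_left_mono) auto
    also have "\<dots> = exp (- K * s)" by (simp add: exp_add[symmetric] algebra_simps)
    finally have "\<epsilon> * (exp (- K * t0) * (1 + K * (t0 - s))) \<le> \<epsilon> * exp (- K * s)"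
      using \<epsilon> by (intro mult_left_mono) auto
    moreover have "gap (f a) p + \<epsilon> * exp (- K * s) \<le> \<epsilon> * exp (- K * t0)"
      using main[of p] p by (simp add: D_def F_def s_def)
    ultimately show "gap (f a) p \<le> - (\<epsilon> * (exp (- K * t0) * K) * (t0 - \<sigma> * snd p))"
      unfolding s_def[symmetric] by (simp add: algebra_simps)
  qed
qed

text \<open>Let \<open>a\<close> be slightly smaller than \<open>b\<close>. Then \<open>H t = cosh (f a t) - cosh (f b t)\<close> is positive at \<open>t0\<close>, and its
  derivative is less than the slope \<open>e\<close> at which \<open>M\<close> separates from the hypersurface of parameter \<open>b\<close>,
  by the dilation comparison and uniform continuity. Hence \<open>M\<close> is strictly inside the
  hypersurface of parameter \<open>a\<close> at all heights. Note that \<open>H\<close> itself is negative near \<open>t = 0\<close>.\<close>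

lemma parameter_gap:
  assumes b: "0 < b" "t0 < L b" and inside: "\<And>p. p \<in> M \<Longrightarrow> gap (f b) p \<le> 0"
    and strict: "\<And>p. p \<in> M \<Longrightarrow> \<bar>snd p\<bar> < t0 \<Longrightarrow> gap (f b) p < 0"
    and wider: "0 \<le> \<alpha>" "\<alpha> < b" "\<And>a. \<alpha> < a \<Longrightarrow> a < b \<Longrightarrow> f b t0 < f a t0"
  shows "\<exists>a<b. {a<..<b} \<inter> E = {}"
proof -
  obtain e1 where e1: "0 < e1" "\<forall>p\<in>M. 0 \<le> 1 * snd p \<longrightarrow> gap (f b) p \<le> - (e1 * (t0 - 1 * snd p))"
    using boundary_slope[OF b inside strict, of 1] by blast
  obtain e2 where e2: "0 < e2" "\<forall>p\<in>M. 0 \<le> -1 * snd p \<longrightarrow> gap (f b) p \<le> - (e2 * (t0 - -1 * snd p))"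
    using boundary_slope[OF b inside strict, of "-1"] by blast
  define e where "e = min e1 e2"
  have e: "0 < e" using e1 e2 by (simp add: e_def)
  have slope: "gap (f b) p \<le> - (e * (t0 - \<bar>snd p\<bar>))" if p: "p \<in> M" for p
  proof -
    have nn: "0 \<le> t0 - \<bar>snd p\<bar>" using slab[OF p] by simp
    have "e * (t0 - \<bar>snd p\<bar>) \<le> e1 * (t0 - \<bar>snd p\<bar>)" "e * (t0 - \<bar>snd p\<bar>) \<le> e2 * (t0 - \<bar>snd p\<bar>)"
      using nn by (auto intro!: mult_right_mono simp: e_def)
    then show ?thesis
      using e1(2)[rule_format, OF p] e2(2)[rule_format, OF p] by (cases "0 \<le> snd p") (auto simp: abs_if)
  qed
  define k where "k t = sinh (f b t) * deriv (f b) t" for t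
  note pb = profile_onE[OF profile[OF b(1)]]
  define t1 where "t1 = (t0 + L b) / 2"
  have t1: "t0 < t1" "t1 < L b" using b by (auto simp: t1_def)
  have "continuous_on {0..t1} k"
  proof (intro continuous_at_imp_continuous_on ballI)
    fix t assume "t \<in> {0..t1}"
    then have t: "t \<in> {- L b<..<L b}" using t1 by auto
    show "isCont k t"
      unfolding k_def using DERIV_isCont[OF pb(3)[OF t]] DERIV_isCont[OF pb(4)[OF open_greaterThanLessThan t]]
      by (intro continuous_intros) auto
  qed
  then have "uniformly_continuous_on {0..t1} k" by (rule compact_uniformly_continuous) simp
  then obtain d where d: "0 < d" "\<And>x y. x \<in> {0..t1} \<Longrightarrow> y \<in> {0..t1} \<Longrightarrow> dist y x < d \<Longrightarrow> dist (k y) (k x) < e"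
    unfolding uniformly_continuous_on_def using e by blast
  \<comment> \<open>Dilating times up to \<open>t0\<close> by a factor below \<open>\<rho>1\<close> moves them by less than \<open>d\<close> and keeps them below \<open>t1\<close>.\<close>
  define \<rho>1 where "\<rho>1 = 1 + min (d / (2 * t0)) ((t1 - t0) / t0)"
  have \<rho>1: "1 < \<rho>1" using d(1) t1 t0 by (simp add: \<rho>1_def)
  have sb: "0 < sinh b" using b by simp
  have "((\<lambda>a. sinh b / sinh a) \<longlongrightarrow> sinh b / sinh b) (at_left b)"
    using sb by (intro tendsto_intros) auto
  then have "\<forall>\<^sub>F a in at_left b. sinh b / sinh a < \<rho>1"
    by (rule order_tendstoD(2)) (use sb \<rho>1 in simp)
  then obtain a1 where a1: "a1 < b" "\<And>a. a1 < a \<Longrightarrow> a < b \<Longrightarrow> sinh b / sinh a < \<rho>1"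
    unfolding eventually_at_left_field by blast
  define a2 where "a2 = max a1 \<alpha>"
  have "a \<notin> E" if a: "a2 < a" "a < b" for a
  proof
    assume "a \<in> E"
    then obtain p where p: "p \<in> M" "\<bar>snd p\<bar> < L a" "0 \<le> gap (f a) p" by (auto simp: E_def)
    have a0: "0 < a" using a wider by (simp add: a2_def)
    have sa: "0 < sinh a" using a0 by simp
    define \<rho> where "\<rho> = sinh b / sinh a"
    have \<rho>: "1 \<le> \<rho>" "\<rho> < \<rho>1" using a a1(2)[of a] sa by (auto simp: \<rho>_def a2_def)
    have \<rho>t0: "\<rho> * t0 < t1" "\<rho> * t0 - t0 < d"
    proof -
      have "(\<rho> - 1) * t0 < min (d / (2 * t0)) ((t1 - t0) / t0) * t0"
        using \<rho>(2) t0 by (intro mult_strict_right_mono) (auto simp: \<rho>1_def)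
      moreover have "min (d / (2 * t0)) ((t1 - t0) / t0) * t0 \<le> d / (2 * t0) * t0"
        "min (d / (2 * t0)) ((t1 - t0) / t0) * t0 \<le> (t1 - t0) / t0 * t0"
        using t0 by (simp_all only: mult_right_mono min.cobounded1 min.cobounded2 less_imp_le)
      moreover have "d / (2 * t0) * t0 = d / 2" "(t1 - t0) / t0 * t0 = t1 - t0"
        using t0 by simp_all
      ultimately have "(\<rho> - 1) * t0 < d / 2" "(\<rho> - 1) * t0 < t1 - t0" by linarith+
      then show "\<rho> * t0 < t1" "\<rho> * t0 - t0 < d" using d(1) by (auto simp: algebra_simps)
    qed
    have "L b \<le> \<rho> * L a"
      unfolding \<rho>_def by (rule maximal_profile_lifetime(2)[OF q_pos a0 _ f_L f_L]) (use a b a0 in auto)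
    then have "\<rho> * t0 < \<rho> * L a" using \<rho>t0(1) t1 by simp
    then have aL: "t0 < L a" using \<rho> by simp
    note pa = profile_onE[OF profile[OF a0]]
    define H where "H t = cosh (f a t) - cosh (f b t)" for t
    have dH: "(H has_real_derivative (sinh (f a t) * deriv (f a) t - k t)) (at t)" if "0 \<le> t" "t \<le> t0" for t
      unfolding H_def k_def using pa(3)[of t] pb(3)[of t] that t0 aL b(2)
      by (auto intro!: derivative_eq_intros)
    have kd: "sinh (f a t) * deriv (f a) t - k t < e" if t: "0 < t" "t < t0" for t
    proof -
      define u where "u = \<rho> * t"
      have u: "t \<le> u" "u < t1" "u - t < d"
      proof -
        show "t \<le> u" using \<rho> t mult_right_mono[of 1 \<rho> t] by (simp add: u_def)
        have "\<rho> * t \<le> \<rho> * t0" using \<rho> t by (intro mult_left_mono) auto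
        then show "u < t1" using \<rho>t0 by (simp add: u_def)
        have "(\<rho> - 1) * t \<le> (\<rho> - 1) * t0" using \<rho> t by (intro mult_left_mono) auto
        then show "u - t < d" using \<rho>t0 by (simp add: u_def algebra_simps)
      qed
      have u0: "0 < u" "u < L b" using u t t1 by auto
      define va where "va = sinh (f a t) / sinh a"
      define vb where "vb = sinh (f b u) / sinh b"
      have vle: "va \<le> vb"
        unfolding va_def vb_def u_def \<rho>_def
        by (rule rescaled_profile_le_dilation[OF q_pos a0 _ profile profile])
          (use a b a0 t aL u0 in \<open>auto simp: u_def \<rho>_def\<close>)
      have va1: "1 < va" unfolding va_def
        by (rule rescaled_profile_derivative(2)[OF q_pos a0 profile[OF a0]]) (use t aL in auto)
      have da: "deriv (f a) t = sqrt (va powr (2 * q) - 1)"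
        using first_integral[OF q_pos a0 profile[OF a0], of t] deriv_profile_pos[OF q_pos profile[OF a0], of t] t aL
        unfolding va_def by (simp add: real_sqrt_unique[symmetric])
      have db: "deriv (f b) u = sqrt (vb powr (2 * q) - 1)"
        using first_integral[OF q_pos b(1) profile[OF b(1)], of u] deriv_profile_pos[OF q_pos profile[OF b(1)], of u] u0
        unfolding vb_def by (simp add: real_sqrt_unique[symmetric])
      have "deriv (f a) t \<le> deriv (f b) u"
        unfolding da db using vle va1 q_pos by (simp add: powr_mono2)
      moreover have "sinh (f a t) \<le> sinh (f b u)"
      proof -
        have "sinh (f a t) = sinh a * va" using sa by (simp add: va_def)
        also have "\<dots> \<le> sinh b * vb" using vle va1 a sa sb by (intro mult_mono) auto
        also have "\<dots> = sinh (f b u)" using sb by (simp add: vb_def)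
        finally show ?thesis .
      qed
      ultimately have "sinh (f a t) * deriv (f a) t \<le> k u"
        unfolding k_def using deriv_profile_pos[OF q_pos profile[OF a0], of t] t aL pb(1)[of u] u0
        by (intro mult_mono) auto
      moreover have "dist (k u) (k t) < e" using d(2)[of t u] u t t1 u0 by (simp add: dist_real_def)
      ultimately show ?thesis by (simp add: dist_real_def)
    qed
    define s where "s = \<bar>snd p\<bar>"
    have s: "0 \<le> s" "s \<le> t0" using slab[OF p(1)] by (auto simp: s_def)
    have H0: "0 < H t0"
    proof -
      have "f b t0 < f a t0" using wider(3)[of a] a by (simp add: a2_def)
      moreover have "0 < f b t0" using pb(1)[of t0] b t0 by simp
      ultimately show ?thesis by (simp add: H_def cosh_real_nonneg_less_iff)
    qed
    have "H t0 - H s \<le> e * (t0 - s)"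
    proof (cases "s = t0")
      case False
      then have "s < t0" using s by simp
      then obtain z where "s < z" "z < t0" "H t0 - H s = (t0 - s) * (sinh (f a z) * deriv (f a) z - k z)"
        using MVT2[of s t0 H "\<lambda>t. sinh (f a t) * deriv (f a) t - k t"] dH s by auto
      then show ?thesis using kd[of z] s mult_left_mono[of "sinh (f a z) * deriv (f a) z - k z" e "t0 - s"]
        by (simp add: mult.commute)
    qed simp
    moreover have "gap (f a) p = gap (f b) p - H s"
    proof -
      have "\<bar>snd p\<bar> < L b" using slab[OF p(1)] b(2) by simp
      then show ?thesis using even[OF a0 p(2)] even[OF b(1)] by (simp add: gap_def H_def s_def)
    qed
    ultimately have "gap (f a) p < 0" using slope[OF p(1)] H0 by (simp add: s_def)
    then show False using p(3) by simp
  qed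
  moreover have "a2 < b" using a1 wider by (simp add: a2_def)
  ultimately show ?thesis by auto
qed

end

section \<open>Geometry of the rotational hypersurfaces\<close>

text \<open>Converts the Euclidean radius used in the parametrization into the hyperbolic one.\<close>

lemma norm_eq_tanh_iff:
  assumes "norm x < 1" "0 \<le> R"
  shows "conf x - 1 = cosh R \<longleftrightarrow> norm x = tanh (R / 2)"
proof -
  have c: "0 < cosh (R / 2)" by simp
  have ch: "cosh R = 2 * (cosh (R / 2))\<^sup>2 - 1"
    using cosh_double[of "R / 2"] by (simp add: cosh_square_eq)
  have T: "(tanh (R / 2))\<^sup>2 = 1 - 1 / (cosh (R / 2))\<^sup>2"
    using c by (simp add: tanh_def power_divide sinh_square_eq diff_divide_distrib)
  have x: "0 < 1 - (norm x)\<^sup>2" using assms(1) by (simp add: power_less_one_iff)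
  have "conf x - 1 = cosh R \<longleftrightarrow> 1 / (1 - (norm x)\<^sup>2) = (cosh (R / 2))\<^sup>2"
    unfolding ch conf_def by (auto simp: field_simps)
  also have "\<dots> \<longleftrightarrow> 1 - (norm x)\<^sup>2 = 1 / (cosh (R / 2))\<^sup>2"
    using x c by (auto simp: field_simps)
  also have "\<dots> \<longleftrightarrow> (norm x)\<^sup>2 = (tanh (R / 2))\<^sup>2" unfolding T by auto
  also have "\<dots> \<longleftrightarrow> norm x = tanh (R / 2)"
    using assms(2) by (auto intro: power2_eq_imp_eq)
  finally show ?thesis .
qed

definition rot_point :: "(real \<Rightarrow> real) \<Rightarrow> real^'n::finite \<Rightarrow> real \<Rightarrow> 'n amb" where
  "rot_point f \<zeta> t = (tanh (f t / 2) *\<^sub>R \<zeta>, t)"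

lemma rot_point:
  assumes "norm \<zeta> = 1" "0 < f t"
  shows "norm (fst (rot_point f \<zeta> t)) < 1" "gap f (rot_point f \<zeta> t) = 0" "snd (rot_point f \<zeta> t) = t"
proof -
  have n: "norm (tanh (f t / 2) *\<^sub>R \<zeta>) = tanh (f t / 2)"
    using assms by simp
  then have lt: "norm (tanh (f t / 2) *\<^sub>R \<zeta>) < 1" by (simp add: tanh_real_lt_1)
  then show "norm (fst (rot_point f \<zeta> t)) < 1" by (simp add: rot_point_def)
  have "conf (tanh (f t / 2) *\<^sub>R \<zeta>) - 1 = cosh (f t)"
    by (rule iffD2[OF norm_eq_tanh_iff[OF lt]]) (use n assms(2) in simp_all)
  then show "gap f (rot_point f \<zeta> t) = 0" by (simp add: gap_def rot_point_def)
qed (simp add: rot_point_def)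

lemma gap_0_imp_rot_point:
  assumes "norm (fst p) < 1" "gap f p = 0" "0 < f (snd p)"
  shows "fst p \<noteq> 0" "p = rot_point f (fst p /\<^sub>R norm (fst p)) (snd p)" "norm (fst p) = tanh (f (snd p) / 2)"
proof -
  show n: "norm (fst p) = tanh (f (snd p) / 2)"
  proof (rule iffD1[OF norm_eq_tanh_iff[OF assms(1)]])
    show "conf (fst p) - 1 = cosh (f (snd p))" using assms(2) unfolding gap_def by linarith
  qed (use assms(3) in simp)
  then show x: "fst p \<noteq> 0" using assms(3) by auto
  show "p = rot_point f (fst p /\<^sub>R norm (fst p)) (snd p)"
    using x by (simp add: rot_point_def n[symmetric] prod_eq_iff)
qed

lemma catenoid_eq:
  assumes "\<And>t. \<bar>t\<bar> < l \<Longrightarrow> 0 < f t"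
  shows "catenoid l f = {p. norm (fst p) < 1 \<and> \<bar>snd p\<bar> < l \<and> gap f p = 0}"
proof (intro set_eqI iffI)
  fix p :: "'n::finite amb" assume "p \<in> catenoid l f"
  then obtain \<zeta> t where "p = rot_point f \<zeta> t" "norm \<zeta> = 1" "\<bar>t\<bar> < l"
    by (auto simp: catenoid_def rot_point_def)
  then show "p \<in> {p. norm (fst p) < 1 \<and> \<bar>snd p\<bar> < l \<and> gap f p = 0}"
    using rot_point[of \<zeta> f t] assms[of t] by simp
next
  fix p :: "'n::finite amb" assume "p \<in> {p. norm (fst p) < 1 \<and> \<bar>snd p\<bar> < l \<and> gap f p = 0}"
  then have p: "norm (fst p) < 1" "\<bar>snd p\<bar> < l" "gap f p = 0" by auto
  note g = gap_0_imp_rot_point[OF p(1,3) assms[OF p(2)]]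
  have "norm (fst p /\<^sub>R norm (fst p)) = 1" using g(1) by simp
  then show "p \<in> catenoid l f"
    unfolding catenoid_def using p(2) g(2) unfolding rot_point_def by blast
qed

text \<open>The curve moves \<open>x\<close> along a straight line and then rescales it to the radius that the profile
  prescribes at the current height. Its velocity is \<open>v\<close> because \<open>v\<close> is tangent to the hypersurface.\<close>

lemma curve_in_rotational:
  assumes f: "\<forall>t\<in>J. 0 < f t \<and> (f has_real_derivative deriv f t) (at t)" "open J"
    and p: "norm (fst p) < 1" "snd p \<in> J" "gap f p = 0" and v: "grad_gap f p \<bullet> v = 0"
  obtains \<gamma> where "\<gamma> (0::real) = p" "(\<gamma> has_vector_derivative v) (at 0)"
    "\<forall>\<^sub>F u in nhds 0. norm (fst (\<gamma> u)) < 1 \<and> gap f (\<gamma> u) = 0 \<and> snd (\<gamma> u) = snd p + u * snd v"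
proof -
  have pf: "0 < f t" "(f has_real_derivative deriv f t) (at t)" if "t \<in> J" for t using f(1) that by blast+
  define x where "x = fst p"
  define t where "t = snd p"
  define w where "w = fst v"
  define \<tau> where "\<tau> = snd v"
  have fp: "0 < f t" using pf(1) p(2) by (simp add: t_def)
  note g = gap_0_imp_rot_point[OF p(1,3), folded t_def x_def, OF fp]
  define d where "d = deriv f t"
  define \<rho> where "\<rho> u = tanh (f (t + u * \<tau>) / 2)" for u
  define y where "y u = x + u *\<^sub>R w" for u
  define \<gamma> where "\<gamma> u = (\<rho> u *\<^sub>R (inverse (norm (y u)) *\<^sub>R y u), t + u * \<tau>)" for u
  have nx: "0 < norm x" using g(1) by simp
  have c: "conf x = 2 * (cosh (f t / 2))\<^sup>2"
  proof -
    have "conf x = 1 + cosh (f t)" using p(3) by (simp add: gap_def x_def t_def)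
    then show ?thesis using cosh_double[of "f t / 2"] by (simp add: cosh_square_eq)
  qed
  have sh: "sinh (f t) = conf x * norm x"
    using sinh_double[of "f t / 2"] by (simp add: c g(3) tanh_def power2_eq_square)
  have c0: "0 < conf x" using conf_ge_2[OF p(1)] by (simp add: x_def)
  have "conf x * (conf x * (x \<bullet> w)) = conf x * (norm x * d * \<tau>)"
    using v by (simp add: grad_gap_def inner_prod_def x_def[symmetric] t_def[symmetric] w_def \<tau>_def d_def sh power2_eq_square algebra_simps)
  then have xw: "conf x * (x \<bullet> w) = norm x * d * \<tau>" using c0 by simp
  have "((\<lambda>u. f (t + u * \<tau>)) has_real_derivative d * \<tau>) (at 0)"
    by (rule DERIV_chain2[where f = f and g = "\<lambda>u. t + u * \<tau>"])
      (use pf(2)[OF p(2)] in \<open>auto intro!: derivative_eq_intros simp: t_def d_def\<close>)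
  then have "(\<rho> has_real_derivative (1 - (tanh (f t / 2))\<^sup>2) * (d * \<tau> / 2)) (at 0)"
    unfolding \<rho>_def by (auto intro!: derivative_eq_intros)
  moreover have "1 - (tanh (f t / 2))\<^sup>2 = 2 / conf x"
    unfolding c by (simp add: tanh_def power_divide sinh_square_eq diff_divide_distrib)
  ultimately have \<rho>: "(\<rho> has_real_derivative d * \<tau> / conf x) (at 0)"
    by simp
  have y: "(y has_vector_derivative w) (at 0)"
    unfolding y_def by (auto intro!: derivative_eq_intros simp: has_vector_derivative_def)
  have y0: "y 0 = x" by (simp add: y_def)
  have hn: "(norm has_derivative (\<lambda>v. v \<bullet> sgn (y 0))) (at (y 0))"
    by (rule has_derivative_norm) (use y0 g(1) in simp)
  have "((\<lambda>u. norm (y u)) has_derivative (\<lambda>h. (h *\<^sub>R w) \<bullet> sgn (y 0))) (at 0)"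
    by (rule has_derivative_compose[OF y[unfolded has_vector_derivative_def] hn])
  moreover have "(\<lambda>h. (h *\<^sub>R w) \<bullet> sgn (y 0)) = (*) ((x \<bullet> w) / norm x)"
    by (rule ext) (simp add: y0 sgn_div_norm inner_commute[of w x] divide_inverse)
  ultimately have ny: "((\<lambda>u. norm (y u)) has_real_derivative (x \<bullet> w) / norm x) (at 0)"
    unfolding has_field_derivative_def by metis
  have inv: "((\<lambda>u. inverse (norm (y u))) has_real_derivative - ((x \<bullet> w) / norm x * inverse ((norm x)\<^sup>2))) (at 0)"
    using DERIV_inverse_fun[OF ny] nx by (simp add: y0 power2_eq_square)
  have N: "((\<lambda>u. inverse (norm (y u)) *\<^sub>R y u) has_vector_derivative
      (inverse (norm x) *\<^sub>R w + (- ((x \<bullet> w) / norm x * inverse ((norm x)\<^sup>2))) *\<^sub>R x)) (at 0)"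
    using has_vector_derivative_scaleR[OF inv y] by (simp add: y0)
  have "\<rho> 0 = norm x" by (simp add: \<rho>_def g(3))
  then have P: "((\<lambda>u. \<rho> u *\<^sub>R (inverse (norm (y u)) *\<^sub>R y u)) has_vector_derivative
      (norm x *\<^sub>R (inverse (norm x) *\<^sub>R w + (- ((x \<bullet> w) / norm x * inverse ((norm x)\<^sup>2))) *\<^sub>R x)
        + (d * \<tau> / conf x) *\<^sub>R (inverse (norm x) *\<^sub>R x))) (at 0)"
    using has_vector_derivative_scaleR[OF \<rho> N] by (simp add: y0)
  have "x \<bullet> w = norm x * (d * \<tau> / conf x)" using xw c0 by (simp add: field_simps)
  then have "norm x * (- ((x \<bullet> w) / norm x * inverse ((norm x)\<^sup>2))) + d * \<tau> / conf x * inverse (norm x) = 0"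
    using nx by (simp add: field_simps power2_eq_square)
  moreover have "m *\<^sub>R (inverse m *\<^sub>R w + (- k) *\<^sub>R x) + j *\<^sub>R (inverse m *\<^sub>R x)
      = (m * inverse m) *\<^sub>R w + (m * (- k) + j * inverse m) *\<^sub>R x" for m k j :: real
    by (simp add: scaleR_add_right scaleR_add_left scaleR_diff_right scaleR_diff_left)
  ultimately have "norm x *\<^sub>R (inverse (norm x) *\<^sub>R w + (- ((x \<bullet> w) / norm x * inverse ((norm x)\<^sup>2))) *\<^sub>R x)
        + (d * \<tau> / conf x) *\<^sub>R (inverse (norm x) *\<^sub>R x) = (norm x * inverse (norm x)) *\<^sub>R w + 0 *\<^sub>R x"
    by (simp only:)
  also have "\<dots> = w" using nx by simp
  finally have P': "((\<lambda>u. \<rho> u *\<^sub>R (inverse (norm (y u)) *\<^sub>R y u)) has_vector_derivative w) (at 0)" using P by (simp only:)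
  have "((\<lambda>u. t + u * \<tau>) has_vector_derivative \<tau>) (at 0)"
    unfolding has_real_derivative_iff_has_vector_derivative[symmetric] by (auto intro!: derivative_eq_intros)
  from has_vector_derivative_Pair[OF P' this]
  have "(\<gamma> has_vector_derivative v) (at 0)" unfolding \<gamma>_def[abs_def] w_def \<tau>_def by simp
  moreover have "\<gamma> 0 = p"
    using \<open>\<rho> 0 = norm x\<close> nx by (simp add: \<gamma>_def y0 x_def t_def)
  moreover have "\<forall>\<^sub>F u in nhds 0. norm (fst (\<gamma> u)) < 1 \<and> gap f (\<gamma> u) = 0 \<and> snd (\<gamma> u) = snd p + u * snd v"
  proof -
    have "open ((\<lambda>u. t + u * \<tau>) -` J)" by (intro open_vimage f(2) continuous_intros)
    then have e1: "\<forall>\<^sub>F u in nhds 0. t + u * \<tau> \<in> J"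
      using p(2) eventually_nhds_in_open[of "(\<lambda>u. t + u * \<tau>) -` J" 0] by (simp add: t_def)
    have "open (y -` (- {0}))" unfolding y_def by (intro open_vimage continuous_intros)
    then have e2: "\<forall>\<^sub>F u in nhds 0. y u \<noteq> 0"
      using y0 g(1) eventually_nhds_in_open[of "y -` (- {0})" 0] by simp
    show ?thesis using eventually_conj[OF e1 e2]
    proof (rule eventually_mono)
      fix u assume u: "t + u * \<tau> \<in> J \<and> y u \<noteq> 0"
      have eq: "\<gamma> u = rot_point f (inverse (norm (y u)) *\<^sub>R y u) (t + u * \<tau>)"
        by (simp add: \<gamma>_def rot_point_def \<rho>_def)
      have "norm (inverse (norm (y u)) *\<^sub>R y u) = 1" using u by simp
      then show "norm (fst (\<gamma> u)) < 1 \<and> gap f (\<gamma> u) = 0 \<and> snd (\<gamma> u) = snd p + u * snd v"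
        unfolding eq using rot_point[of "inverse (norm (y u)) *\<^sub>R y u" f "t + u * \<tau>"] pf(1)[of "t + u * \<tau>"] u
        by (simp add: t_def \<tau>_def)
    qed
  qed
  ultimately show ?thesis using that[of \<gamma>] by simp
qed

lemma connected_rotational:
  assumes f: "profile_on q a J f" and "{-\<tau><..<\<tau>} \<subseteq> J" and n: "2 \<le> CARD('n::finite)"
  shows "connected {p :: 'n amb. norm (fst p) < 1 \<and> \<bar>snd p\<bar> < \<tau> \<and> gap f p = 0}"
proof -
  note pf = profile_onE[OF f]
  have eq: "{p :: 'n amb. norm (fst p) < 1 \<and> \<bar>snd p\<bar> < \<tau> \<and> gap f p = 0}
     = (\<lambda>z. rot_point f (fst z) (snd z)) ` (sphere 0 1 \<times> {-\<tau><..<\<tau>})" (is "?A = ?h ` ?B")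
  proof (intro set_eqI iffI)
    fix p assume "p \<in> ?A"
    then have p: "norm (fst p) < 1" "snd p \<in> {-\<tau><..<\<tau>}" "gap f p = 0" by auto
    then have "0 < f (snd p)" using assms(2) pf(1) by blast
    note g = gap_0_imp_rot_point[OF p(1,3) this]
    have "norm (fst p /\<^sub>R norm (fst p)) = 1" using g(1) by simp
    then have "(fst p /\<^sub>R norm (fst p), snd p) \<in> ?B" using p(2) by (simp only: mem_Times_iff fst_conv snd_conv mem_sphere_0)
    then show "p \<in> ?h ` ?B" using g(2) by (intro image_eqI[where x = "(fst p /\<^sub>R norm (fst p), snd p)"]) simp_all
  next
    fix p assume "p \<in> ?h ` ?B"
    then obtain \<zeta> t where z: "p = rot_point f \<zeta> t" "norm \<zeta> = 1" "t \<in> {-\<tau><..<\<tau>}" by auto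
    then have "0 < f t" using assms(2) pf(1) by blast
    then show "p \<in> ?A" using rot_point[of \<zeta> f t] z by auto
  qed
  have "continuous_on ?B ?h"
  proof -
    have "continuous_on {-\<tau><..<\<tau>} f"
      using pf(3) assms(2) by (intro continuous_at_imp_continuous_on ballI DERIV_isCont) blast
    then have "continuous_on ?B (\<lambda>z. f (snd z))"
      by (rule continuous_on_compose2) (auto intro!: continuous_intros)
    then show ?thesis unfolding rot_point_def by (intro continuous_intros) (auto)
  qed
  moreover have "connected ?B"
    using n by (intro connected_Times connected_sphere) auto
  ultimately show ?thesis unfolding eq by (rule connected_continuous_image)
qed

context sweep begin

text \<open>If the contact set were not open in the connected hypersurface, there would be a point \<open>w\<close> of
  the hypersurface outside \<open>M\<close> close to the contact set. Take a nearest contact point \<open>p0\<close> to \<open>w\<close>. The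
  ball whose diameter joins \<open>w\<close> to \<open>p0\<close> meets the contact set in \<open>p0\<close> alone. With \<open>s\<close> the squared
  distance from the centre \<open>p1\<close> of this ball, \<open>gap + \<epsilon> exp (- K s)\<close> on a small ball about \<open>p0\<close> has a
  larger value at \<open>p0\<close> than on the boundary sphere, hence an interior maximum, which contradicts
  \<open>no_local_max_near_profile\<close>. The gradient of \<open>s\<close> is transversal to that of the gap at \<open>p0\<close>, since the
  segment from \<open>w\<close> to \<open>p0\<close> joins two zeros of the gap.\<close>

lemma strong_maximum:
  assumes a: "0 < a" and \<tau>: "\<tau> = min t0 (L a)"
    and inside: "\<And>p. p \<in> M \<Longrightarrow> \<bar>snd p\<bar> < L a \<Longrightarrow> gap (f a) p \<le> 0"
    and touch: "p \<in> M" "\<bar>snd p\<bar> < \<tau>" "gap (f a) p = 0"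
  shows "{p. norm (fst p) < 1 \<and> \<bar>snd p\<bar> < \<tau> \<and> gap (f a) p = 0} \<subseteq> M"
proof -
  define W where "W = {p :: 'n amb. norm (fst p) < 1 \<and> \<bar>snd p\<bar> < \<tau> \<and> gap (f a) p = 0}"
  define J where "J = {- L a<..<L a}"
  have J: "open J" by (simp add: J_def)
  note prof = profile[OF a, folded J_def]
  note pf = profile_onE[OF prof]
  have \<tau>L: "\<tau> \<le> L a" "\<tau> \<le> t0" by (simp_all add: \<tau>)
  have inJ: "t \<in> J" if "\<bar>t\<bar> < \<tau>" for t using that \<tau>L by (auto simp: J_def)
  have conn: "connected W"
    unfolding W_def by (rule connected_rotational[OF prof]) (use \<tau>L r in \<open>auto simp: J_def\<close>)
  have "M \<inter> W = W"
  proof (rule ccontr)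
    assume proper: "M \<inter> W \<noteq> W"
    have "p \<in> M \<inter> W" using touch MHxR by (simp add: W_def)
    moreover have "closedin (top_of_set W) (M \<inter> W)"
      using compact_imp_closed[OF M(1)] by (metis closedin_closed_Int inf_commute)
    ultimately have "\<not> openin (top_of_set W) (M \<inter> W)"
      using conn proper unfolding connected_clopen by blast
    then obtain z where z: "z \<in> M" "z \<in> W" "\<And>e. 0 < e \<Longrightarrow> \<not> ball z e \<inter> W \<subseteq> M \<inter> W"
      unfolding openin_contains_ball by auto
    define G where "G = {y :: 'n amb. norm (fst y) < 1 \<and> fst y \<noteq> 0 \<and> \<bar>snd y\<bar> < \<tau>}"
    have "G = (ball 0 1 - {0}) \<times> {-\<tau><..<\<tau>}" by (auto simp: G_def)
    then have openG: "open G" by (simp add: open_Times open_delete)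
    have GJ: "norm (fst y) < 1 \<and> snd y \<in> J" if "y \<in> G" for y using that inJ by (auto simp: G_def)
    have zG: "z \<in> G"
      using z(2) gap_0_imp_rot_point(1)[of z "f a"] pf(1)[OF inJ] by (simp add: W_def G_def)
    have cont_grad: "continuous_on G (grad_gap (f a))"
      by (rule continuous_on_grad_gap[OF prof J GJ])
    have cont_gap: "continuous_on G (gap (f a))" by (rule gap_continuous_on[OF prof GJ])
    define g where "g = grad_gap (f a) z"
    have g0: "0 < norm g"
      using zG conf_ge_2[of "fst z"] by (auto simp: g_def grad_gap_def G_def prod_eq_iff)
    have "isCont (grad_gap (f a)) z" using cont_grad zG openG continuous_on_eq_continuous_at by blast
    then obtain \<delta>1 where \<delta>1: "0 < \<delta>1" "\<And>y. dist y z < \<delta>1 \<Longrightarrow> dist (grad_gap (f a) y) g < norm g / 3"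
      unfolding continuous_at_eps_delta g_def using g0[unfolded g_def] by (metis divide_pos_pos zero_less_numeral)
    obtain \<delta>2 where \<delta>2: "0 < \<delta>2" "ball z \<delta>2 \<subseteq> G" using openG zG openE by blast
    define \<delta> where "\<delta> = min \<delta>1 \<delta>2 / 3"
    have \<delta>: "0 < \<delta>" using \<delta>1 \<delta>2 by (simp add: \<delta>_def)
    have ballG: "ball z (3 * \<delta>) \<subseteq> G" using \<delta>2(2) by (auto simp: \<delta>_def)
    have gg: "0 < grad_gap (f a) y \<bullet> grad_gap (f a) y'" if y: "y \<in> ball z (3 * \<delta>)" "y' \<in> ball z (3 * \<delta>)" for y y'
    proof -
      define u where "u = grad_gap (f a) y - g"
      define u' where "u' = grad_gap (f a) y' - g"
      have u: "norm u < norm g / 3" "norm u' < norm g / 3"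
        using \<delta>1(2)[of y] \<delta>1(2)[of y'] y by (auto simp: u_def u'_def dist_norm \<delta>_def norm_minus_commute)
      have "- (g \<bullet> u) \<le> norm g * norm u" "- (g \<bullet> u') \<le> norm g * norm u'" "- (u \<bullet> u') \<le> norm u * norm u'"
        using Cauchy_Schwarz_ineq2[of g u] Cauchy_Schwarz_ineq2[of g u'] Cauchy_Schwarz_ineq2[of u u'] by linarith+
      moreover have "norm g * norm u \<le> norm g * (norm g / 3)" "norm g * norm u' \<le> norm g * (norm g / 3)"
        using u by (intro mult_left_mono; simp)+
      moreover have "norm u * norm u' \<le> (norm g / 3) * (norm g / 3)" using u by (intro mult_mono) auto
      moreover have "grad_gap (f a) y \<bullet> grad_gap (f a) y' = norm g * norm g + g \<bullet> u + g \<bullet> u' + u \<bullet> u'"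
        by (simp add: u_def u'_def inner_diff_left inner_diff_right inner_commute power2_eq_square[symmetric] power2_norm_eq_inner)
      moreover have "0 < norm g * norm g" using g0 by simp
      ultimately show ?thesis by (simp add: field_simps)
    qed
    obtain w where w: "w \<in> ball z \<delta>" "w \<in> W" "w \<notin> M" using z(3)[OF \<delta>] by blast
    define Z where "Z = M \<inter> {y \<in> cball z (2 * \<delta>). gap (f a) y = 0}"
    have cbG: "cball z (2 * \<delta>) \<subseteq> G" using ballG \<delta> by auto
    have "closed {y \<in> cball z (2 * \<delta>). gap (f a) y = 0}"
      using continuous_closed_preimage_constant[OF continuous_on_subset[OF cont_gap cbG] closed_cball] by simp
    then have cZ: "compact Z" unfolding Z_def using M(1) by (rule compact_Int_closed[rotated])
    have zZ: "z \<in> Z" using z(1,2) \<delta> by (simp add: Z_def W_def)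
    have "continuous_on Z (\<lambda>y. dist w y)" by (intro continuous_intros)
    then obtain p0 where p0: "p0 \<in> Z" "\<And>y. y \<in> Z \<Longrightarrow> dist w p0 \<le> dist w y"
      using continuous_attains_inf[OF cZ] zZ by blast
    have d0: "dist w p0 < \<delta>" using p0(2)[OF zZ] w(1) by (simp add: dist_commute)
    have p0b: "p0 \<in> ball z (2 * \<delta>)" using d0 w(1) dist_triangle[of z p0 w] by simp
    have p0M: "p0 \<in> M" "gap (f a) p0 = 0" using p0(1) by (auto simp: Z_def)
    \<comment> \<open>Halving the radius makes \<open>p0\<close> the only contact point in the closed ball, not only in the open one.\<close>
    define p1 where "p1 = (1/2) *\<^sub>R (w + p0)"
    define h where "h = p0 - p1"
    have h: "w = p1 - h" "p0 = p1 + h" "w - p0 = - (2 *\<^sub>R h)"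
      by (simp_all add: h_def p1_def algebra_simps scaleR_2[symmetric] flip: scaleR_add_left)
    have uniq: "y = p0" if y: "y \<in> Z" "dist y p1 \<le> norm h" for y
    proof -
      define u where "u = y - p1"
      have "dist w p0 \<le> dist w y" using p0(2) y(1) .
      moreover have "w - y = - (u + h)" by (simp add: u_def h(1))
      ultimately have "norm (2 *\<^sub>R h) \<le> norm (u + h)"
        unfolding dist_norm h(3) by (simp only: norm_minus_cancel)
      then have "(norm (2 *\<^sub>R h))\<^sup>2 \<le> (norm (u + h))\<^sup>2" by (rule power_mono) simp
      moreover have "(norm u)\<^sup>2 \<le> (norm h)\<^sup>2" using y(2) by (intro power_mono) (simp_all add: u_def dist_norm)
      ultimately have "(norm (u - h))\<^sup>2 \<le> 0"
        by (simp add: power2_norm_eq_inner inner_add_left inner_add_right inner_diff_left inner_diff_right inner_commute)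
      then have "u = h" by simp
      then show ?thesis by (simp add: u_def h_def)
    qed
    have h0: "h \<noteq> 0" using h(3) w(3) p0M by auto
    have nonpar: "h \<noteq> c *\<^sub>R grad_gap (f a) p0" for c
    proof
      assume hc: "h = c *\<^sub>R grad_gap (f a) p0"
      define l where "l u = w + u *\<^sub>R (p0 - w)" for u :: real
      have lb: "l u \<in> ball z (2 * \<delta>)" if "0 \<le> u" "u \<le> 1" for u
      proof -
        have "w \<in> ball z (2 * \<delta>)" using w(1) \<delta> by auto
        then have "(1 - u) *\<^sub>R w + u *\<^sub>R p0 \<in> ball z (2 * \<delta>)"
          using convexD_alt[OF convex_ball _ p0b that] by blast
        then show ?thesis by (simp add: l_def algebra_simps)
      qed
      have dl: "((\<lambda>u. gap (f a) (l u)) has_real_derivative (grad_gap (f a) (l u) \<bullet> (p0 - w))) (at u)"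
        if u: "0 \<le> u" "u \<le> 1" for u
      proof -
        have "l u \<in> G" using lb[OF u] ballG \<delta> by auto
        then have y: "norm (fst (l u)) < 1" "snd (l u) \<in> J" using GJ by blast+
        have "(l has_derivative (\<lambda>s. s *\<^sub>R (p0 - w))) (at u)"
          unfolding l_def by (auto intro!: derivative_eq_intros)
        from has_derivative_compose[OF this gap_has_derivative[OF y(1) pf(3)[OF y(2)]]]
        show ?thesis by (simp add: has_field_derivative_def mult_commute_abs)
      qed
      obtain u where u: "0 < u" "u < 1" "gap (f a) (l 1) - gap (f a) (l 0) = (1 - 0) * (grad_gap (f a) (l u) \<bullet> (p0 - w))"
        using MVT2[of 0 1 "\<lambda>u. gap (f a) (l u)" "\<lambda>u. grad_gap (f a) (l u) \<bullet> (p0 - w)"] dl by auto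
      have "gap (f a) (l 1) = 0" "gap (f a) (l 0) = 0" using p0M w(2) by (simp_all add: l_def W_def)
      then have "grad_gap (f a) (l u) \<bullet> (p0 - w) = 0" using u(3) by simp
      moreover have "p0 - w = 2 *\<^sub>R h" using h(3) by (simp add: algebra_simps)
      ultimately have "c * (grad_gap (f a) (l u) \<bullet> grad_gap (f a) p0) = 0" by (simp add: hc)
      moreover have "0 < grad_gap (f a) (l u) \<bullet> grad_gap (f a) p0"
        by (rule gg) (use lb[of u] u p0b \<delta> in auto)
      ultimately have "c = 0" by simp
      then show False using hc h0 by simp
    qed
    define gs where "gs y = 2 *\<^sub>R (y - p1)" for y
    define gram where "gram y = (gs y \<bullet> gs y) * (grad_gap (f a) y \<bullet> grad_gap (f a) y) - (gs y \<bullet> grad_gap (f a) y)\<^sup>2" for y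
    have p0G: "p0 \<in> G" using p0b ballG \<delta> by auto
    have gne: "grad_gap (f a) p0 \<noteq> 0" using gg[of p0 p0] p0b \<delta> by auto
    have gram0: "0 < gram p0"
      unfolding gram_def
    proof (rule gram_pos[OF gne])
      fix c show "gs p0 \<noteq> c *\<^sub>R grad_gap (f a) p0"
      proof
        assume "gs p0 = c *\<^sub>R grad_gap (f a) p0"
        then have "(1/2) *\<^sub>R gs p0 = (c / 2) *\<^sub>R grad_gap (f a) p0" by simp
        then show False using nonpar[of "c / 2"] by (simp add: gs_def h_def)
      qed
    qed
    have "continuous_on G gram"
      unfolding gram_def gs_def by (intro continuous_intros cont_grad)
    then have "isCont gram p0" using p0G openG continuous_on_eq_continuous_at by blast
    then have "filterlim gram (nhds (gram p0)) (nhds p0)"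
      by (simp only: isCont_def tendsto_at_iff_tendsto_nhds)
    then have "\<forall>\<^sub>F y in nhds p0. 0 < gram y" using gram0 by (rule order_tendstoD(1))
    then obtain e1 where e1: "0 < e1" "\<And>y. dist y p0 < e1 \<Longrightarrow> 0 < gram y"
      unfolding eventually_nhds_metric by blast
    obtain e2 where e2: "0 < e2" "ball p0 e2 \<subseteq> ball z (2 * \<delta>)"
      using openE[OF open_ball p0b] by blast
    define e where "e = min e1 e2 / 2"
    have e: "0 < e" "e < e1" "e < e2" using e1 e2 by (auto simp: e_def)
    define C where "C = cball p0 e"
    have Cb: "C \<subseteq> ball z (2 * \<delta>)" using e e2(2) by (auto simp: C_def)
    have CG: "C \<subseteq> G" using Cb cbG ball_subset_cball by blast
    have CC: "norm (fst y) < 1 \<and> fst y \<noteq> 0 \<and> snd y \<in> J" if "y \<in> C" for y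
      using CG that inJ by (auto simp: G_def)
    define s where "s y = (y - p1) \<bullet> (y - p1)" for y
    have s0: "s p0 = (norm h)\<^sup>2" by (simp add: s_def h_def power2_norm_eq_inner)
    obtain K \<epsilon>0 where K: "0 < K" "0 < \<epsilon>0"
      "\<forall>\<epsilon> p. 0 < \<epsilon> \<longrightarrow> \<epsilon> < \<epsilon>0 \<longrightarrow> p \<in> M \<longrightarrow> p \<in> C \<longrightarrow> p \<notin> boundary M \<longrightarrow>
        - (\<epsilon> * exp (- K * s p)) \<le> gap (f a) p \<longrightarrow> gap (f a) p \<le> 0 \<longrightarrow>
        \<not> (\<forall>\<^sub>F y in nhds p. y \<in> M \<longrightarrow> gap (f a) y + \<epsilon> * exp (- K * s y) \<le> gap (f a) p + \<epsilon> * exp (- K * s p))"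
    proof (rule no_local_max_near_profile[OF r q prof J M(3,4) _ CC, where s = s and gs = gs and \<kappa> = 2])
      show "compact C" by (simp add: C_def)
      show "(s has_derivative (\<lambda>v. gs y \<bullet> v)) (at y)" for y
        unfolding s_def gs_def by (auto intro!: derivative_eq_intros simp: inner_commute fun_eq_iff algebra_simps)
      show "(gs has_derivative (\<lambda>v. 2 *\<^sub>R v)) (at y)" for y
        unfolding gs_def by (auto intro!: derivative_eq_intros)
      show "gs y \<noteq> c *\<^sub>R grad_gap (f a) y" if "y \<in> C" for y c
      proof
        assume "gs y = c *\<^sub>R grad_gap (f a) y"
        then have "gram y = 0" by (simp add: gram_def power2_eq_square)
        moreover have "0 < gram y" using e1(2)[of y] that e by (simp add: C_def dist_commute)
        ultimately show False by simp
      qed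
    qed (auto intro: that)
    define A where "A = M \<inter> (sphere p0 e \<inter> {y. s y \<le> s p0})"
    have insideC: "gap (f a) y \<le> 0" if "y \<in> M" "y \<in> C" for y
      using inside[OF that(1)] CC[OF that(2)] by (auto simp: J_def)
    have sc: "continuous_on S s" for S unfolding s_def by (intro continuous_intros)
    obtain \<zeta> where \<zeta>: "0 < \<zeta>" "\<And>y. y \<in> A \<Longrightarrow> gap (f a) y \<le> - \<zeta>"
    proof (cases "A = {}")
      case False
      have "compact A"
        unfolding A_def by (intro compact_Int_closed M(1) closed_Int closed_sphere closed_Collect_le sc continuous_intros)
      moreover have "continuous_on A (gap (f a))"
        by (rule continuous_on_subset[OF cont_gap]) (use CG in \<open>auto simp: A_def C_def\<close>)
      ultimately obtain y where y: "y \<in> A" "\<And>y'. y' \<in> A \<Longrightarrow> gap (f a) y' \<le> gap (f a) y"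
        using continuous_attains_sup[OF _ False] by blast
      have yC: "y \<in> C" "y \<in> M" using y(1) by (auto simp: A_def C_def)
      have "gap (f a) y \<noteq> 0"
      proof
        assume "gap (f a) y = 0"
        then have "y \<in> Z" using yC Cb by (auto simp: Z_def)
        moreover have "(dist y p1)\<^sup>2 \<le> (norm h)\<^sup>2"
          using y(1) s0 by (simp add: A_def s_def dist_norm power2_norm_eq_inner)
        then have "dist y p1 \<le> norm h" by (rule power2_le_imp_le) simp
        ultimately have "y = p0" using uniq by blast
        then show False using y(1) e by (simp add: A_def)
      qed
      then have "gap (f a) y < 0" using insideC[OF yC(2,1)] by simp
      then show ?thesis using that[of "- gap (f a) y"] y(2) by simp
    qed (use that[of 1] in simp)
    define \<epsilon> where "\<epsilon> = min \<epsilon>0 \<zeta> / 2"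
    have \<epsilon>: "0 < \<epsilon>" "\<epsilon> < \<epsilon>0" "\<epsilon> < \<zeta>" using K(2) \<zeta>(1) by (auto simp: \<epsilon>_def)
    define F where "F y = gap (f a) y + \<epsilon> * exp (- K * s y)" for y
    have "compact (M \<inter> C)" unfolding C_def by (intro compact_Int_closed M(1) closed_cball)
    moreover have "p0 \<in> M \<inter> C" using p0M e by (simp add: C_def)
    moreover have "continuous_on (M \<inter> C) F"
      unfolding F_def by (intro continuous_intros sc continuous_on_subset[OF cont_gap]) (use CG in auto)
    ultimately obtain y where y: "y \<in> M" "y \<in> C" "\<And>y'. y' \<in> M \<Longrightarrow> y' \<in> C \<Longrightarrow> F y' \<le> F y"
      using continuous_attains_sup[of "M \<inter> C" F] by blast
    have Fy: "\<epsilon> * exp (- K * s p0) \<le> F y"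
      using y(3)[of p0] p0M e by (simp add: F_def C_def)
    then have Fpos: "0 < F y" using \<epsilon>(1) by (smt (verit) exp_gt_zero mult_pos_pos)
    have gy: "gap (f a) y \<le> 0" using insideC y by blast
    have snn: "0 \<le> s y" by (simp add: s_def)
    have "dist p0 y \<noteq> e"
    proof
      assume de: "dist p0 y = e"
      show False
      proof (cases "s y \<le> s p0")
        case True
        then have "gap (f a) y \<le> - \<zeta>" using \<zeta>(2)[of y] y(1) de by (simp add: A_def)
        moreover have "\<epsilon> * exp (- K * s y) \<le> \<epsilon> * 1" using \<epsilon>(1) K(1) snn by (intro mult_left_mono) auto
        ultimately show False using Fpos \<epsilon>(3) by (simp add: F_def)
      next
        case False
        then have "\<epsilon> * exp (- K * s y) < \<epsilon> * exp (- K * s p0)" using \<epsilon>(1) K(1) by simp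
        then show False using Fy gy by (simp add: F_def)
      qed
    qed
    then have yb: "y \<in> ball p0 e" using y(2) by (simp add: C_def)
    have "\<forall>\<^sub>F y' in nhds y. y' \<in> ball p0 e" by (rule eventually_nhds_in_open[OF open_ball yb])
    then have max: "\<forall>\<^sub>F y' in nhds y. y' \<in> M \<longrightarrow> F y' \<le> F y"
      by (rule eventually_mono) (use y(3) in \<open>auto simp: C_def\<close>)
    have "\<bar>snd y\<bar> \<noteq> t0" using CG y(2) \<tau>L by (auto simp: G_def)
    then have "y \<notin> boundary M" using bdry by blast
    moreover have "- (\<epsilon> * exp (- K * s y)) \<le> gap (f a) y" using Fpos by (simp add: F_def)
    ultimately show False using K(3) \<epsilon>(1,2) y(1,2) gy max unfolding F_def by blast
  qed
  then show ?thesis unfolding W_def by blast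
qed

end

text \<open>Described by the gap rather than by the parametrization, as the truncated rotational hypersurface
  is compared with \<open>M\<close> through the sign of the gap.\<close>

definition slab_part :: "real \<Rightarrow> (real \<Rightarrow> real) \<Rightarrow> 'n::finite amb set" where
  "slab_part s f = {p. norm (fst p) < 1 \<and> \<bar>snd p\<bar> \<le> s \<and> gap f p = 0}"

lemma derivative_along_curve:
  assumes "(\<gamma> has_vector_derivative v) (at (0::real))" "\<gamma> 0 = p" "(\<phi> has_derivative (\<lambda>v. h \<bullet> v)) (at p)"
  shows "((\<lambda>u. \<phi> (\<gamma> u)) has_real_derivative h \<bullet> v) (at 0)"
  using has_derivative_compose[OF assms(1)[unfolded has_vector_derivative_def], of \<phi> "\<lambda>v. h \<bullet> v"] assms(2,3)
  by (simp add: has_field_derivative_def mult_commute_abs)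

lemma eventually_along_curve:
  assumes "(\<gamma> has_vector_derivative v) (at (0::real))" "\<gamma> 0 = p" "\<forall>\<^sub>F y in nhds p. P y"
  shows "\<forall>\<^sub>F u in nhds 0. P (\<gamma> u)"
proof -
  have "isCont \<gamma> 0" using assms(1) by (rule has_vector_derivative_continuous)
  then have "filterlim \<gamma> (nhds (\<gamma> 0)) (nhds 0)"
    by (simp only: isCont_def tendsto_at_iff_tendsto_nhds)
  then have "filterlim \<gamma> (nhds p) (nhds 0)" by (simp add: assms(2))
  then show ?thesis by (rule eventually_compose_filterlim[OF assms(3)])
qed

lemma profile_on_positive:
  "profile_on q a J f \<Longrightarrow> \<forall>t\<in>J. 0 < f t \<and> (f has_real_derivative deriv f t) (at t)"
  using profile_onE(1,3) by blast

text \<open>A function that vanishes on a piece of the truncated hypersurface has a gradient normal to it,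
  also at points of its edge: there only curves that go into the slab are available, but one-sided
  derivatives suffice, as each tangent vector or its negative points into the slab.\<close>

lemma gradient_if_vanishing:
  assumes f: "profile_on q a {-l<..<l} f" and s: "0 < s" "s < l" and p: "p \<in> slab_part s f"
    and \<phi>: "(\<phi> has_derivative (\<lambda>v. h \<bullet> v)) (at p)" "\<forall>\<^sub>F y in nhds p. y \<in> slab_part s f \<longrightarrow> \<phi> y = (0::real)"
  shows "\<exists>c. h = c *\<^sub>R grad_gap f p"
proof (rule gradient_multiple)
  have pp: "norm (fst p) < 1" "\<bar>snd p\<bar> \<le> s" "gap f p = 0" using p by (auto simp: slab_part_def)
  have pJ: "snd p \<in> {-l<..<l}" using pp(2) s by auto
  have \<phi>p: "\<phi> p = 0" using eventually_nhds_x_imp_x[OF \<phi>(2)] p by blast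
  have half: "h \<bullet> v = 0" if v: "grad_gap f p \<bullet> v = 0" "snd p * snd v \<le> 0" for v
  proof -
    obtain \<gamma> where g: "\<gamma> (0::real) = p" "(\<gamma> has_vector_derivative v) (at 0)"
      "\<forall>\<^sub>F u in nhds 0. norm (fst (\<gamma> u)) < 1 \<and> gap f (\<gamma> u) = 0 \<and> snd (\<gamma> u) = snd p + u * snd v"
      by (rule curve_in_rotational[OF profile_on_positive[OF f] open_greaterThanLessThan pp(1) pJ pp(3) v(1)]) (rule that)
    have "((\<lambda>u. u * snd v) \<longlongrightarrow> 0 * snd v) (at_right (0::real))" by (intro tendsto_intros)
    then have "\<forall>\<^sub>F u in at_right 0. dist (u * snd v) (0 * snd v) < s" by (rule tendstoD) (use s in simp)
    then have e1: "\<forall>\<^sub>F u in at_right 0. \<bar>u * snd v\<bar> < s" by simp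
    have e2: "\<forall>\<^sub>F u in at_right (0::real). 0 < u" by (simp add: eventually_at_right_less)
    have "\<forall>\<^sub>F u in nhds 0. \<gamma> u \<in> slab_part s f \<longrightarrow> \<phi> (\<gamma> u) = 0"
      by (rule eventually_along_curve[OF g(2,1) \<phi>(2)])
    then have "\<forall>\<^sub>F u in nhds 0. (\<gamma> u \<in> slab_part s f \<longrightarrow> \<phi> (\<gamma> u) = 0) \<and>
        norm (fst (\<gamma> u)) < 1 \<and> gap f (\<gamma> u) = 0 \<and> snd (\<gamma> u) = snd p + u * snd v"
      using g(3) by (rule eventually_conj)
    then have e3: "\<forall>\<^sub>F u in at_right 0. (\<gamma> u \<in> slab_part s f \<longrightarrow> \<phi> (\<gamma> u) = 0) \<and>
        norm (fst (\<gamma> u)) < 1 \<and> gap f (\<gamma> u) = 0 \<and> snd (\<gamma> u) = snd p + u * snd v"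
      unfolding eventually_at_filter by (rule eventually_mono) simp
    have ev: "\<forall>\<^sub>F u in at_right 0. (\<phi> (\<gamma> u) - \<phi> (\<gamma> 0)) / (u - 0) = 0"
      using eventually_conj[OF e1 eventually_conj[OF e2 e3]]
    proof (rule eventually_mono)
      fix u assume u: "\<bar>u * snd v\<bar> < s \<and> 0 < u \<and> (\<gamma> u \<in> slab_part s f \<longrightarrow> \<phi> (\<gamma> u) = 0) \<and>
        norm (fst (\<gamma> u)) < 1 \<and> gap f (\<gamma> u) = 0 \<and> snd (\<gamma> u) = snd p + u * snd v"
      have "snd p * (u * snd v) \<le> 0" using v(2) u mult_left_mono[of "snd p * snd v" 0 u] by (simp add: mult_ac)
      moreover have "\<bar>A + B\<bar> \<le> s" if "A * B \<le> 0" "\<bar>A\<bar> \<le> s" "\<bar>B\<bar> < s" for A B :: real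
        using that by (auto simp: mult_le_0_iff)
      ultimately have "\<bar>snd p + u * snd v\<bar> \<le> s"
        using u pp(2) by blast
      then have "\<gamma> u \<in> slab_part s f" using u by (simp add: slab_part_def)
      then show "(\<phi> (\<gamma> u) - \<phi> (\<gamma> 0)) / (u - 0) = 0" using u g(1) \<phi>p by simp
    qed
    have "((\<lambda>u. (\<phi> (\<gamma> u) - \<phi> (\<gamma> 0)) / (u - 0)) \<longlongrightarrow> h \<bullet> v) (at_right 0)"
      using derivative_along_curve[OF g(2,1) \<phi>(1)] unfolding has_field_derivative_iff
      by (rule tendsto_within_subset) simp
    then have "((\<lambda>u::real. 0::real) \<longlongrightarrow> h \<bullet> v) (at_right 0)"
      by (rule Lim_transform_eventually[OF _ ev])
    then show ?thesis using tendsto_unique[OF _ tendsto_const, of "at_right (0::real)" 0 "h \<bullet> v"] tendsto_const_iff[of "at_right (0::real)" 0 "h \<bullet> v"] by simp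
  qed
  fix v assume v: "grad_gap f p \<bullet> v = 0"
  show "h \<bullet> v = 0"
  proof (cases "snd p * snd v \<le> 0")
    case False
    then have "h \<bullet> (- v) = 0" by (intro half) (use v in simp_all)
    then show ?thesis by simp
  qed (use half v in blast)
qed

lemma gradient_if_local_max:
  assumes f: "\<forall>t\<in>J. 0 < f t \<and> (f has_real_derivative deriv f t) (at t)" "open J"
    and p: "norm (fst p) < 1" "snd p \<in> J" "gap f p = 0"
    and \<phi>: "(\<phi> has_derivative (\<lambda>v. h \<bullet> v)) (at p)"
      "\<forall>\<^sub>F y in nhds p. norm (fst y) < 1 \<and> snd y \<in> J \<and> gap f y = 0 \<longrightarrow> \<phi> y \<le> (\<phi> p :: real)"
  shows "\<exists>c. h = c *\<^sub>R grad_gap f p"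
proof (rule gradient_multiple)
  fix v assume v: "grad_gap f p \<bullet> v = 0"
  obtain \<gamma> where g: "\<gamma> (0::real) = p" "(\<gamma> has_vector_derivative v) (at 0)"
    "\<forall>\<^sub>F u in nhds 0. norm (fst (\<gamma> u)) < 1 \<and> gap f (\<gamma> u) = 0 \<and> snd (\<gamma> u) = snd p + u * snd v"
    by (rule curve_in_rotational[OF f p v]) (rule that)
  have "open (snd -` J :: 'a amb set)" by (intro open_vimage_snd f(2))
  then have "\<forall>\<^sub>F y in nhds p. y \<in> snd -` J" by (rule eventually_nhds_in_open) (use p in simp)
  with \<phi>(2) have "\<forall>\<^sub>F y in nhds p. (norm (fst y) < 1 \<and> snd y \<in> J \<and> gap f y = 0 \<longrightarrow> \<phi> y \<le> \<phi> p) \<and> y \<in> snd -` J"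
    by (rule eventually_conj)
  from eventually_conj[OF eventually_along_curve[OF g(2,1) this] g(3)]
  have "\<forall>\<^sub>F u in nhds 0. \<phi> (\<gamma> u) \<le> \<phi> (\<gamma> 0)"
    by (rule eventually_mono) (auto simp: g(1))
  then obtain d where d: "0 < d" "\<And>u. \<bar>u\<bar> < d \<Longrightarrow> \<phi> (\<gamma> u) \<le> \<phi> (\<gamma> 0)"
    unfolding eventually_nhds_metric by (auto simp: dist_real_def)
  show "h \<bullet> v = 0"
    by (rule DERIV_local_max[OF derivative_along_curve[OF g(2,1) \<phi>(1)] d(1)]) (use d in auto)
qed

lemma grad_gap_radial:
  assumes "norm (fst p) < 1" "fst p \<noteq> 0"
  shows "0 < grad_gap f p \<bullet> (fst p, 0)"
  using assms conf_ge_2[OF assms(1)] by (simp add: grad_gap_def inner_prod_def)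

lemma slab_part_off_axis:
  assumes "profile_on q a {-l<..<l} f" "s < l" "p \<in> slab_part s f"
  shows "norm (fst p) < 1" "fst p \<noteq> 0" "snd p \<in> {-l<..<l}"
proof -
  show p: "norm (fst p) < 1" "snd p \<in> {-l<..<l}" using assms by (auto simp: slab_part_def)
  show "fst p \<noteq> 0"
    using gap_0_imp_rot_point(1)[OF p(1), of f] profile_onE(1)[OF assms(1) p(2)] assms(3)
    by (simp add: slab_part_def)
qed

text \<open>Applied to a chart of a set that contains the truncated rotational hypersurface: the kernel of the
  last coordinate of its derivative is the tangent space of the latter, at points of the edge as well.\<close>

lemma chart_gradient:
  assumes f: "profile_on q a {-l<..<l} f" and s: "0 < s" "s < l" and p: "p \<in> slab_part s f"
    and \<Phi>: "diffeo_on U \<Phi>" "p \<in> U" "\<And>y. y \<in> U \<Longrightarrow> y \<in> slab_part s f \<Longrightarrow> snd (\<Phi> y) = (0::real)"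
  obtains c where "c \<noteq> 0" "\<forall>v. snd (frechet_derivative \<Phi> (at p) v) = c * (grad_gap f p \<bullet> v)"
proof -
  have U: "open U" "smooth_on U \<Phi>" using \<Phi>(1) unfolding diffeo_on_def by blast+
  note D = smooth_on_has_derivative[OF U(2) \<Phi>(2)]
  have "linear (\<lambda>v. snd (frechet_derivative \<Phi> (at p) v))"
    using has_derivative_linear[OF has_derivative_snd[OF D]] .
  then obtain h where h: "\<And>v. snd (frechet_derivative \<Phi> (at p) v) = h \<bullet> v"
    using linear_functional_inner by metis
  have "((\<lambda>y. snd (\<Phi> y)) has_derivative (\<lambda>v. h \<bullet> v)) (at p)"
    using has_derivative_snd[OF D] by (simp add: h)
  moreover have "\<forall>\<^sub>F y in nhds p. y \<in> slab_part s f \<longrightarrow> snd (\<Phi> y) = 0"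
    using eventually_nhds_in_open[OF U(1) \<Phi>(2)] by (rule eventually_mono) (use \<Phi>(3) in blast)
  ultimately obtain c where c: "h = c *\<^sub>R grad_gap f p"
    using gradient_if_vanishing[OF f s p] by blast
  have "snd (frechet_derivative \<Phi> (at p) (frechet_derivative (inv_into U \<Phi>) (at (\<Phi> p)) (0, 1))) = 1"
    using diffeo_on_derivative_inverse(2)[OF \<Phi>(1,2)] by simp
  then have "c \<noteq> 0" unfolding h c by auto
  then show ?thesis using that[of c] h c by simp
qed

context sweep begin

text \<open>By \<open>inside_of_gap_in_E\<close> there is contact. If the contact point lies in the open slab, the strong
  maximum principle propagates contact up to \<open>t0\<close>, or up to the life time of the profile if this is
  smaller; the latter is impossible, as the profile is unbounded and \<open>M\<close> is compact. So \<open>M\<close> touches on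
  the boundary of the slab, and \<open>wedge\<close> applies.\<close>

lemma touching:
  assumes a: "a \<in> E" "a < b" "{a<..<b} \<inter> E = {}"
  shows "t0 < L a" "\<exists>p\<in>boundary M. gap (f a) p = 0" "\<forall>p\<in>M. gap (f a) p \<le> 0"
proof -
  have a0: "0 < a" using a(1) by (simp add: E_def)
  have inside: "gap (f a) p \<le> 0" if "p \<in> M" "\<bar>snd p\<bar> < L a" for p
    using inside_of_gap_in_E[OF a0 a(2,3) that] .
  obtain p where p: "p \<in> M" "\<bar>snd p\<bar> < L a" "0 \<le> gap (f a) p" using a(1) by (auto simp: E_def)
  have gp: "gap (f a) p = 0" using p(3) inside[OF p(1,2)] by simp
  have "\<exists>p\<in>M. t0 < L a \<and> \<bar>snd p\<bar> = t0 \<and> gap (f a) p = 0"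
  proof (cases "\<bar>snd p\<bar> = t0")
    case True
    then show ?thesis using p gp by (intro bexI[of _ p]) simp_all
  next
    case False
    then have "\<bar>snd p\<bar> < min t0 (L a)" using slab[OF p(1)] p(2) by simp
    note sub = strong_maximum[OF a0 refl inside p(1) this gp]
    obtain \<zeta> :: "real^'n" where \<zeta>: "norm \<zeta> = 1" using vector_choose_size[of 1] by auto
    have L: "t0 < L a"
    proof (rule ccontr)
      assume n: "\<not> t0 < L a"
      obtain B where B: "\<And>p. p \<in> M \<Longrightarrow> conf (fst p) \<le> B" using conf_bound by blast
      obtain t where t: "0 < t" "t < L a" "arcosh (max 1 B) < f a t"
        using profile_unbounded[OF q_pos a0 f_L[OF a0]] by blast
      have ft: "0 < f a t" using f_pos[OF a0, of t] t by simp
      note rp = rot_point[of \<zeta> "f a" t, OF \<zeta> ft]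
      have "rot_point (f a) \<zeta> t \<in> M" using sub rp t n by auto
      from B[OF this] rp(2) have "cosh (f a t) + 1 \<le> B" by (simp add: gap_def rot_point_def)
      moreover have "cosh (arcosh (max 1 B)) < cosh (f a t)"
        using t(3) ft by (subst cosh_real_nonneg_less_iff) auto
      ultimately show False by (simp add: cosh_arcosh_real)
    qed
    have ft: "0 < f a t0" using f_pos[OF a0, of t0] L t0 by simp
    note rp = rot_point[of \<zeta> "f a" t0, OF \<zeta> ft]
    have "isCont (f a) t0" using DERIV_isCont[OF profile_onE(3)[OF profile[OF a0], of t0]] L t0 by simp
    then have "((\<lambda>t. rot_point (f a) \<zeta> t) \<longlongrightarrow> rot_point (f a) \<zeta> t0) (at_left t0)"
      unfolding rot_point_def isCont_def
      by (intro tendsto_intros) (auto intro: tendsto_within_subset)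
    moreover have "\<forall>\<^sub>F t in at_left t0. rot_point (f a) \<zeta> t \<in> M"
    proof (rule eventually_at_leftI[of 0 t0])
      fix t assume t: "t \<in> {0<..<t0}"
      then have "0 < f a t" using f_pos[OF a0, of t] L by simp
      from rot_point[of \<zeta> "f a" t, OF \<zeta> this] show "rot_point (f a) \<zeta> t \<in> M" using sub t L by auto
    qed (rule t0)
    ultimately have "rot_point (f a) \<zeta> t0 \<in> M"
      using Lim_in_closed_set[OF compact_imp_closed[OF M(1)], of "\<lambda>t. rot_point (f a) \<zeta> t" "at_left t0"] by simp
    then show ?thesis using rp L t0 by (intro bexI[of _ "rot_point (f a) \<zeta> t0"]) simp_all
  qed
  then obtain z where z: "z \<in> M" "t0 < L a" "\<bar>snd z\<bar> = t0" "gap (f a) z = 0" by blast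
  show "t0 < L a" by (rule z(2))
  show all: "\<forall>p\<in>M. gap (f a) p \<le> 0"
  proof
    fix p assume "p \<in> M"
    then show "gap (f a) p \<le> 0" using inside slab[of p] z(2) by simp
  qed
  then show "\<exists>p\<in>boundary M. gap (f a) p = 0"
    using wedge[OF a0 z(2) _ z(1,3,4)] z(4) by blast
qed

text \<open>The strong maximum principle gives the part in the open slab; its edge follows as \<open>M\<close> is closed.\<close>

lemma contains_slab_part:
  assumes a: "0 < a" "t0 < L a" and inside: "\<forall>p\<in>M. gap (f a) p \<le> 0"
    and touch: "p \<in> M" "\<bar>snd p\<bar> < t0" "gap (f a) p = 0"
  shows "slab_part t0 (f a) \<subseteq> M"
proof
  fix y :: "'n amb" assume y: "y \<in> slab_part t0 (f a)"
  have \<tau>: "t0 = min t0 (L a)" using a(2) by simp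
  have sub: "{p. norm (fst p) < 1 \<and> \<bar>snd p\<bar> < t0 \<and> gap (f a) p = 0} \<subseteq> M"
    by (rule strong_maximum[OF a(1) \<tau> _ touch]) (use inside in blast)
  have ny: "norm (fst y) < 1" "gap (f a) y = 0" "\<bar>snd y\<bar> \<le> t0" using y by (auto simp: slab_part_def)
  have yL: "\<bar>snd y\<bar> < L a" using ny a(2) by simp
  have fy: "0 < f a (snd y)" using f_pos[OF a(1) yL] .
  note g = gap_0_imp_rot_point[OF ny(1,2) fy]
  define \<zeta> where "\<zeta> = fst y /\<^sub>R norm (fst y)"
  have \<zeta>: "norm \<zeta> = 1" using g(1) by (simp add: \<zeta>_def)
  define c where "c u = rot_point (f a) \<zeta> (u * snd y)" for u
  have "snd y \<in> {- L a<..<L a}" using yL by auto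
  then have "isCont (f a) (1 * snd y)" using DERIV_isCont[OF profile_onE(3)[OF profile[OF a(1)], of "snd y"]] by simp
  then have "((\<lambda>u. f a (u * snd y)) \<longlongrightarrow> f a (1 * snd y)) (at_left 1)"
    by (rule isCont_tendsto_compose) (intro tendsto_intros)
  then have "(c \<longlongrightarrow> rot_point (f a) \<zeta> (1 * snd y)) (at_left 1)"
    unfolding c_def[abs_def] rot_point_def by (intro tendsto_intros) auto
  then have "(c \<longlongrightarrow> y) (at_left 1)" using g(2) by (simp add: \<zeta>_def)
  moreover have "\<forall>\<^sub>F u in at_left 1. c u \<in> M"
  proof (rule eventually_at_leftI[of 0 "1::real"])
    fix u :: real assume u: "u \<in> {0<..<1}"
    have "u * \<bar>snd y\<bar> < t0"
    proof -
      have "u * \<bar>snd y\<bar> \<le> u * t0" using u ny(3) by (intro mult_left_mono) auto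
      also have "\<dots> < 1 * t0" using u t0 by (intro mult_strict_right_mono) auto
      finally show ?thesis by simp
    qed
    then have us: "\<bar>u * snd y\<bar> < t0" using u by (simp add: abs_mult)
    then have "0 < f a (u * snd y)" using f_pos[OF a(1)] a(2) by simp
    from rot_point[of \<zeta> "f a" "u * snd y", OF \<zeta> this] show "c u \<in> M"
      using sub us by (auto simp: c_def)
  qed simp
  ultimately show "y \<in> M"
    using Lim_in_closed_set[OF compact_imp_closed[OF M(1)], of c "at_left 1"] by simp
qed

text \<open>The part is the zero set of the gap in \<open>M\<close>, hence closed. To see that it is open in \<open>M\<close>, move a
  point \<open>y\<close> of \<open>M\<close> near \<open>p\<close> radially to the point \<open>\<pi> y\<close> of the hypersurface at the same height. In a
  chart of \<open>M\<close> at \<open>p\<close> the last coordinate vanishes at both, but its radial derivative is not zero near \<open>p\<close>.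
  Hence \<open>y = \<pi> y\<close>. The argument does not distinguish interior and boundary points of \<open>M\<close>.\<close>

lemma eq_slab_part:
  assumes a: "0 < a" "t0 < L a" and sub: "slab_part t0 (f a) \<subseteq> M"
  shows "M = slab_part t0 (f a)"
proof -
  define W :: "'n amb set" where "W = slab_part t0 (f a)"
  note prof = profile[OF a(1)]
  have offW: "norm (fst p) < 1" "fst p \<noteq> 0" "snd p \<in> {- L a<..<L a}" if "p \<in> W" for p
    using slab_part_off_axis[OF prof a(2), of p] that by (simp_all add: W_def)
  have MJ: "norm (fst p) < 1 \<and> snd p \<in> {- L a<..<L a}" if "p \<in> M" for p
    using MHxR[OF that] slab[OF that] a(2) by auto
  have WM: "W = {p \<in> M. gap (f a) p = 0}"
    using sub slab MHxR by (auto simp: W_def slab_part_def)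
  have "closedin (top_of_set M) W"
    unfolding WM by (rule continuous_closedin_preimage_constant[OF gap_continuous_on[OF prof MJ]])
  moreover have "openin (top_of_set M) W"
    unfolding openin_contains_ball
  proof (intro conjI ballI)
    show "W \<subseteq> M" using sub by (simp add: W_def)
    fix p assume pW: "p \<in> W"
    then have pM: "p \<in> M" using sub by (auto simp: W_def)
    obtain U \<Phi> where U: "p \<in> U" "slice_chart M U \<Phi> \<or> (\<exists>i. half_slice_chart M U \<Phi> i)"
      using M(3) pM unfolding hypersurface_def by blast
    have dU: "diffeo_on U \<Phi>" using U(2) unfolding slice_chart_def half_slice_chart_def by blast
    have zero: "snd (\<Phi> y) = 0" if "y \<in> U" "y \<in> M" for y
      using U(2) that unfolding slice_chart_def half_slice_chart_def by blast
    have oU: "open U" and sU: "smooth_on U \<Phi>" using dU unfolding diffeo_on_def by blast+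
    define h where "h y = (\<Sum>b\<in>Basis. snd (frechet_derivative \<Phi> (at y) b) *\<^sub>R b)" for y
    have h: "snd (frechet_derivative \<Phi> (at y) v) = h y \<bullet> v" if "y \<in> U" for y v
    proof -
      have lin: "linear (\<lambda>v. snd (frechet_derivative \<Phi> (at y) v))"
        using has_derivative_linear[OF has_derivative_snd[OF smooth_on_has_derivative[OF sU that]]] .
      have "snd (frechet_derivative \<Phi> (at y) v) = (\<Sum>b\<in>Basis. (v \<bullet> b) * snd (frechet_derivative \<Phi> (at y) b))"
        by (subst (1) euclidean_representation[of v, symmetric])
          (simp only: linear_sum[OF lin] linear_scale[OF lin] real_scaleR_def o_def)
      then show ?thesis by (simp add: h_def inner_sum_left inner_sum_right inner_commute mult.commute)
    qed
    have ch: "continuous_on U h"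
    proof -
      have "Ck_on (Suc 0) U \<Phi>" using sU by (rule smooth_onD)
      then have "continuous_on U (\<lambda>y. frechet_derivative \<Phi> (at y) b)" for b
        unfolding Ck_on.simps by blast
      then show ?thesis unfolding h_def by (intro continuous_intros)
    qed
    obtain c where c: "c \<noteq> 0" "\<forall>v. snd (frechet_derivative \<Phi> (at p) v) = c * (grad_gap (f a) p \<bullet> v)"
      by (rule chart_gradient[OF prof t0 a(2) pW[unfolded W_def] dU U(1)]) (use zero sub in blast, rule that)
    have "h p \<bullet> (fst p, 0) \<noteq> 0"
      using c grad_gap_radial[OF offW(1,2)[OF pW]] h[OF U(1)] by (metis less_irrefl mult_eq_0_iff)
    define k where "k z = h (fst z) \<bullet> (fst (snd z), 0::real)" for z :: "'n amb \<times> 'n amb"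
    have "continuous_on (U \<times> UNIV) k"
      unfolding k_def by (intro continuous_intros continuous_on_compose2[OF ch]) auto
    then have "open ((U \<times> UNIV) \<inter> k -` (- {0}))"
      by (intro continuous_open_preimage open_Times oU) auto
    moreover have "(p, p) \<in> (U \<times> UNIV) \<inter> k -` (- {0})"
      using U(1) \<open>h p \<bullet> (fst p, 0) \<noteq> 0\<close> by (simp add: k_def)
    ultimately obtain A B where AB: "open A" "open B" "p \<in> A" "p \<in> B" "A \<times> B \<subseteq> (U \<times> UNIV) \<inter> k -` (- {0})"
      by (metis mem_Times_iff open_prod_elim fst_conv snd_conv)
    have "open (A \<inter> B)" "p \<in> A \<inter> B" using AB by auto
    then obtain e where e: "0 < e" "ball p e \<subseteq> A \<inter> B" using openE by blast
    have hk: "\<xi> \<in> U \<and> h \<xi> \<bullet> (fst y, 0) \<noteq> 0" if "\<xi> \<in> ball p e" "y \<in> ball p e" for \<xi> y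
    proof -
      have "(\<xi>, y) \<in> A \<times> B" using e(2) that by blast
      from subsetD[OF AB(5) this] show ?thesis by (simp add: k_def)
    qed
    define \<pi> where "\<pi> y = rot_point (f a) (fst y /\<^sub>R norm (fst y)) (snd y)" for y :: "'n amb"
    have \<pi>p: "\<pi> p = p"
    proof -
      have "gap (f a) p = 0" using pW by (simp add: W_def slab_part_def)
      from gap_0_imp_rot_point(2)[OF offW(1)[OF pW] this profile_onE(1)[OF prof offW(3)[OF pW]]]
      show ?thesis unfolding \<pi>_def by (rule sym)
    qed
    have "isCont \<pi> p"
    proof -
      have "isCont (f a) (snd p)" using DERIV_isCont[OF profile_onE(3)[OF prof offW(3)[OF pW]]] .
      then have "isCont (\<lambda>y. f a (snd y)) p" by (rule isCont_o2[rotated]) simp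
      then show ?thesis unfolding \<pi>_def rot_point_def
        using offW(2)[OF pW] by (intro continuous_intros) auto
    qed
    then obtain d where d: "0 < d" "\<And>y. dist y p < d \<Longrightarrow> dist (\<pi> y) p < e"
      unfolding continuous_at_eps_delta \<pi>p using e(1) by blast
    show "\<exists>e>0. ball p e \<inter> M \<subseteq> W"
    proof (intro exI[of _ "min d e"] conjI subsetI)
      show "0 < min d e" using d e by simp
      fix y assume y: "y \<in> ball p (min d e) \<inter> M"
      then have yM: "y \<in> M" and ye: "y \<in> ball p e" and \<pi>e: "\<pi> y \<in> ball p e"
        using d(2)[of y] by (auto simp: dist_commute)
      have fy: "fst y \<noteq> 0"
      proof
        assume "fst y = 0"
        then have "(fst y, 0::real) = 0" by (simp add: zero_prod_def)
        then show False using hk[OF ye ye] by simp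
      qed
      have yJ: "snd y \<in> {- L a<..<L a}" "\<bar>snd y\<bar> \<le> t0" using MJ[OF yM] slab[OF yM] by auto
      have "norm (fst y /\<^sub>R norm (fst y)) = 1" using fy by simp
      from rot_point[of _ "f a" "snd y", OF this profile_onE(1)[OF prof yJ(1)]]
      have \<pi>W: "\<pi> y \<in> W" using yJ(2) by (simp add: \<pi>_def W_def slab_part_def)
      then have \<pi>M: "\<pi> y \<in> M" using sub by (auto simp: W_def)
      define \<mu> where "\<mu> = 1 - tanh (f a (snd y) / 2) / norm (fst y)"
      have diff: "y - \<pi> y = \<mu> *\<^sub>R (fst y, 0)"
      proof (rule prod_eqI)
        have "fst y - T *\<^sub>R (fst y /\<^sub>R m) = (1 - T / m) *\<^sub>R fst y" for T m
          by (simp add: scaleR_left_diff_distrib divide_inverse)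
        then show "fst (y - \<pi> y) = fst (\<mu> *\<^sub>R (fst y, 0))"
          by (simp only: \<pi>_def rot_point_def \<mu>_def fst_diff fst_scaleR fst_conv)
        show "snd (y - \<pi> y) = snd (\<mu> *\<^sub>R (fst y, 0::real))"
          by (simp add: \<pi>_def rot_point_def)
      qed
      define l where "l u = \<pi> y + u *\<^sub>R (y - \<pi> y)" for u :: real
      have lb: "l u \<in> ball p e" if "0 \<le> u" "u \<le> 1" for u
      proof -
        have "(1 - u) *\<^sub>R \<pi> y + u *\<^sub>R y \<in> ball p e"
          using convexD_alt[OF convex_ball \<pi>e ye that] .
        then show ?thesis by (simp add: l_def algebra_simps)
      qed
      have dl: "((\<lambda>u. snd (\<Phi> (l u))) has_real_derivative (h (l u) \<bullet> (y - \<pi> y))) (at u)"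
        if u: "0 \<le> u" "u \<le> 1" for u
      proof -
        have lU: "l u \<in> U" using hk[OF lb[OF u] ye] by blast
        have "(l has_derivative (\<lambda>s. s *\<^sub>R (y - \<pi> y))) (at u)"
          unfolding l_def by (auto intro!: derivative_eq_intros)
        from has_derivative_compose[OF this has_derivative_snd[OF smooth_on_has_derivative[OF sU lU]]]
        show ?thesis by (simp add: has_field_derivative_def h[OF lU] mult_commute_abs)
      qed
      obtain u where u: "0 < u" "u < 1" "snd (\<Phi> (l 1)) - snd (\<Phi> (l 0)) = (1 - 0) * (h (l u) \<bullet> (y - \<pi> y))"
        using MVT2[of 0 1 "\<lambda>u. snd (\<Phi> (l u))" "\<lambda>u. h (l u) \<bullet> (y - \<pi> y)"] dl by auto
      have "snd (\<Phi> (l 1)) = 0" "snd (\<Phi> (l 0)) = 0"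
        using zero[OF _ yM] zero[OF _ \<pi>M] hk[OF ye ye] hk[OF \<pi>e ye] by (simp_all add: l_def)
      then have "\<mu> * (h (l u) \<bullet> (fst y, 0)) = 0"
        using u(3) unfolding diff inner_scaleR_right by simp
      moreover have "h (l u) \<bullet> (fst y, 0) \<noteq> 0" using hk[OF lb ye] u by simp
      ultimately have "\<mu> = 0" by simp
      then have "y - \<pi> y = 0" unfolding diff by (simp only: scaleR_zero_left)
      then have "y = \<pi> y" by simp
      then show "y \<in> W" using \<pi>W by simp
    qed
  qed
  moreover have "W \<noteq> {}"
  proof -
    obtain \<zeta> :: "real^'n" where \<zeta>: "norm \<zeta> = 1" using vector_choose_size[of 1] by auto
    have f0: "0 < f a 0" using f_pos[OF a(1), of 0] L_pos[OF a(1)] by simp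
    from rot_point[of \<zeta> "f a" 0, OF \<zeta> f0] have "rot_point (f a) \<zeta> 0 \<in> W"
      using t0 by (simp add: W_def slab_part_def)
    then show ?thesis by blast
  qed
  ultimately have "W = M" using M(2) unfolding connected_clopen by blast
  then show ?thesis by (simp add: W_def)
qed

text \<open>Parameters in \<open>E\<close> that are isolated from the right equal \<open>a\<^sub>0\<close>. The maximum of \<open>E\<close> is one of them.
  Were there no interior contact for \<open>a\<^sub>0\<close>, \<open>parameter_gap\<close> would make the largest element of \<open>E\<close> below
  \<open>a\<^sub>0\<close> another one.\<close>

lemma unique_hypersurface:
  assumes m0: "\<And>p. p \<in> boundary M \<Longrightarrow> conf (fst p) - 1 = cosh m\<^sub>0" "0 \<le> m\<^sub>0"
    and \<alpha>: "0 < \<alpha>" "L \<alpha> = t0"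
    and a0: "\<alpha> < a\<^sub>0" "f a\<^sub>0 t0 = m\<^sub>0" "\<forall>a\<in>{\<alpha><..} - {a\<^sub>0}. m\<^sub>0 < f a t0"
  shows "t0 < L a\<^sub>0" "M = slab_part t0 (f a\<^sub>0)"
proof -
  have isolated: "a = a\<^sub>0" if a: "a \<in> E" "a < b" "{a<..<b} \<inter> E = {}" for a b
  proof (rule ccontr)
    assume ne: "a \<noteq> a\<^sub>0"
    have ap: "0 < a" using a(1) by (simp add: E_def)
    note t = touching[OF a]
    have "\<alpha> < a"
      using maximal_profile_lifetime(1)[OF q_pos ap _ f_L[OF ap] f_L[OF \<alpha>(1)]] t(1) \<alpha>(2) by force
    then have lt: "m\<^sub>0 < f a t0" using a0(3) ne by simp
    obtain p where p: "p \<in> boundary M" "gap (f a) p = 0" using t(2) by blast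
    have "cosh (f a (snd p)) = cosh m\<^sub>0" using p m0(1)[OF p(1)] by (simp add: gap_def)
    moreover have "f a (snd p) = f a t0"
      using even[OF ap, of "snd p"] bdry[OF p(1)] t(1) by simp
    ultimately have "cosh (f a t0) = cosh m\<^sub>0" by simp
    then show False using lt m0(2) cosh_real_nonneg_less_iff[of m\<^sub>0 "f a t0"] by simp
  qed
  obtain B where B: "\<And>p. p \<in> M \<Longrightarrow> conf (fst p) \<le> B" using conf_bound by blast
  have bdd: "a \<le> arcosh (max 1 B)" if aE: "a \<in> E" for a
  proof -
    obtain p where p: "0 < a" "p \<in> M" "\<bar>snd p\<bar> < L a" "0 \<le> gap (f a) p" using aE unfolding E_def by blast
    have "cosh a \<le> cosh (f a (snd p))"
      using f_ge[OF p(1,3)] p(1) by (simp add: cosh_real_nonneg_le_iff)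
    also have "\<dots> \<le> max 1 B" using p(4) B[OF p(2)] by (simp add: gap_def)
    finally have "cosh a \<le> cosh (arcosh (max 1 B))" by (simp add: cosh_arcosh_real)
    then show ?thesis using p(1) by (subst (asm) cosh_real_nonneg_le_iff) auto
  qed
  have supE: "Sup S \<in> E" if S: "S \<subseteq> E" "S \<noteq> {}" for S
  proof -
    have bS: "bdd_above S" using bdd S(1) by (auto intro!: bdd_aboveI[of _ "arcosh (max 1 B)"])
    have "Sup S \<in> closure S" by (rule closure_contains_Sup[OF S(2) bS])
    then obtain x where x: "\<And>n. x n \<in> S" "x \<longlonglongrightarrow> Sup S" unfolding closure_sequential by blast
    obtain s where s: "s \<in> S" using S(2) by blast
    have "0 < s" using s S(1) by (auto simp: E_def)
    also have "s \<le> Sup S" using cSup_upper[OF s bS] .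
    finally show ?thesis using E_closed[OF _ x(2)] x(1) S(1) by blast
  qed
  have ne: "E \<noteq> {}" using E_small[of 1] by auto
  define a1 where "a1 = Sup E"
  have a1: "a1 \<in> E" unfolding a1_def by (rule supE[OF order_refl ne])
  have upper: "a \<le> a1" if "a \<in> E" for a
    unfolding a1_def using that by (rule cSup_upper) (use bdd in \<open>auto intro!: bdd_aboveI[of _ "arcosh (max 1 B)"]\<close>)
  have iso1: "{a1<..<a1 + 1} \<inter> E = {}" using upper by force
  have a1a0: "a1 = a\<^sub>0" by (rule isolated[OF a1 _ iso1]) simp
  note t = touching[OF a1 _ iso1, simplified, unfolded a1a0]
  have a0p: "0 < a\<^sub>0" using \<alpha> a0 by simp
  show L0: "t0 < L a\<^sub>0" by (rule t(1))
  have "\<exists>p\<in>M. \<bar>snd p\<bar> < t0 \<and> gap (f a\<^sub>0) p = 0"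
  proof (rule ccontr)
    assume none: "\<not> ?thesis"
    have strict: "gap (f a\<^sub>0) p < 0" if "p \<in> M" "\<bar>snd p\<bar> < t0" for p
      using none t(3) that by force
    have "\<exists>a<a\<^sub>0. {a<..<a\<^sub>0} \<inter> E = {}"
      by (rule parameter_gap[OF a0p L0 _ strict, of \<alpha>]) (use t(3) \<alpha> a0 in auto)
    then obtain b where b: "b < a\<^sub>0" "{b<..<a\<^sub>0} \<inter> E = {}" by blast
    define S where "S = {a \<in> E. a < a\<^sub>0}"
    have "S \<noteq> {}" using E_small[OF a0p] by (auto simp: S_def)
    then have a2: "Sup S \<in> E" by (intro supE) (auto simp: S_def)
    have le: "s \<le> b" if "s \<in> S" for s using b(2) that by (force simp: S_def)
    then have "Sup S \<le> b" using \<open>S \<noteq> {}\<close> by (intro cSup_least)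
    then have lt: "Sup S < a\<^sub>0" using b(1) by simp
    have "{Sup S<..<a\<^sub>0} \<inter> E = {}"
    proof -
      have "a \<le> Sup S" if "a \<in> E" "a < a\<^sub>0" for a
        by (rule cSup_upper) (use that le in \<open>auto simp: S_def intro!: bdd_aboveI[of _ b]\<close>)
      then show ?thesis by force
    qed
    then have "Sup S = a\<^sub>0" by (rule isolated[OF a2 lt])
    then show False using lt by simp
  qed
  then obtain p where p: "p \<in> M" "\<bar>snd p\<bar> < t0" "gap (f a\<^sub>0) p = 0" by blast
  show "M = slab_part t0 (f a\<^sub>0)"
    by (rule eq_slab_part[OF a0p L0 contains_slab_part[OF a0p L0 t(3) p]])
qed

end

section \<open>The truncated rotational hypersurface\<close>

lemma gap_eq_0_iff:
  assumes "norm x < 1"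
  shows "gap f (x, t) = 0 \<longleftrightarrow> (norm x)\<^sup>2 = (cosh (f t) - 1) / (cosh (f t) + 1)"
proof -
  have x: "0 < 1 - (norm x)\<^sup>2" using assms by (simp add: power_less_one_iff)
  have c: "0 < cosh (f t) + 1" using cosh_real_pos[of "f t"] by linarith
  have "gap f (x, t) = 0 \<longleftrightarrow> 2 / (1 - (norm x)\<^sup>2) = cosh (f t) + 1"
    by (auto simp: gap_def conf_def)
  also have "\<dots> \<longleftrightarrow> (cosh (f t) + 1) * (norm x)\<^sup>2 = cosh (f t) - 1"
    using x by (auto simp: divide_eq_eq algebra_simps)
  also have "\<dots> \<longleftrightarrow> (norm x)\<^sup>2 = (cosh (f t) - 1) / (cosh (f t) + 1)"
    using c by (auto simp: eq_divide_eq mult.commute)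
  finally show ?thesis .
qed

lemma slab_part_iff:
  "(x, t) \<in> slab_part s f \<longleftrightarrow> \<bar>t\<bar> \<le> s \<and> (norm x)\<^sup>2 = (cosh (f t) - 1) / (cosh (f t) + 1)"
proof -
  have c: "0 < cosh (f t) + 1" using cosh_real_pos[of "f t"] by linarith
  have "norm x < 1" if "(norm x)\<^sup>2 = (cosh (f t) - 1) / (cosh (f t) + 1)"
  proof -
    have "(norm x)\<^sup>2 < 1" unfolding that using c by simp
    then show ?thesis by (simp add: power_less_one_iff)
  qed
  then show ?thesis using gap_eq_0_iff[of x f t] by (auto simp: slab_part_def)
qed

text \<open>A boundary chart would have a coordinate that is minimal at \<open>p\<close> on the rotational piece around \<open>p\<close>,
  and another one that is constant there. Both gradients would be normal to the piece, contradicting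
  the independence of the coordinates of a chart.\<close>

lemma boundary_inner_point:
  fixes S :: "'n::finite amb set"
  assumes f: "\<forall>t\<in>J. 0 < f t \<and> (f has_real_derivative deriv f t) (at t)" "open J"
    and p: "norm (fst p) < 1" "snd p \<in> J" "gap f p = 0"
    and sub: "{y. norm (fst y) < 1 \<and> snd y \<in> J \<and> gap f y = 0} \<subseteq> S"
  shows "p \<notin> boundary S"
proof
  assume "p \<in> boundary S"
  then obtain U \<Phi> i where U: "p \<in> U" "half_slice_chart S U \<Phi> i" "fst (\<Phi> p) $ i = 0"
    unfolding boundary_def by blast
  have d: "diffeo_on U \<Phi>" and SU: "S \<inter> U = {x \<in> U. snd (\<Phi> x) = 0 \<and> 0 \<le> fst (\<Phi> x) $ i}"
    using U(2) unfolding half_slice_chart_def by blast+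
  have oU: "open U" and sU: "smooth_on U \<Phi>" using d unfolding diffeo_on_def by blast+
  have SU': "snd (\<Phi> y) = 0 \<and> 0 \<le> fst (\<Phi> y) $ i"
    if "y \<in> U" "norm (fst y) < 1 \<and> snd y \<in> J \<and> gap f y = 0" for y
    using SU sub that by blast
  let ?D = "frechet_derivative \<Phi> (at p)"
  note D = smooth_on_has_derivative[OF sU U(1)]
  have D1: "((\<lambda>y. snd (\<Phi> y)) has_derivative (\<lambda>v. snd (?D v))) (at p)"
    by (rule has_derivative_snd[OF D])
  then obtain g where g: "\<And>v. snd (?D v) = g \<bullet> v"
    using linear_functional_inner[OF has_derivative_linear[OF D1]] by metis
  have D2: "((\<lambda>y. - (fst (\<Phi> y) $ i)) has_derivative (\<lambda>v. - (fst (?D v) $ i))) (at p)"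
    by (intro has_derivative_minus bounded_linear.has_derivative[OF bounded_linear_vec_nth] has_derivative_fst D)
  then obtain h where h: "\<And>v. - (fst (?D v) $ i) = h \<bullet> v"
    using linear_functional_inner[OF has_derivative_linear[OF D2]] by metis
  have "\<forall>\<^sub>F y in nhds p. y \<in> U" by (rule eventually_nhds_in_open[OF oU U(1)])
  then have "\<forall>\<^sub>F y in nhds p. norm (fst y) < 1 \<and> snd y \<in> J \<and> gap f y = 0 \<longrightarrow> snd (\<Phi> y) \<le> snd (\<Phi> p)"
    by (rule eventually_mono) (use SU' SU'[OF U(1)] p in auto)
  then obtain c1 where c1: "g = c1 *\<^sub>R grad_gap f p"
    using gradient_if_local_max[OF f p D1[unfolded g]] by blast
  have "\<forall>\<^sub>F y in nhds p. y \<in> U" by (rule eventually_nhds_in_open[OF oU U(1)])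
  then have "\<forall>\<^sub>F y in nhds p. norm (fst y) < 1 \<and> snd y \<in> J \<and> gap f y = 0 \<longrightarrow>
      - (fst (\<Phi> y) $ i) \<le> - (fst (\<Phi> p) $ i)"
    by (rule eventually_mono) (use SU' U(3) in auto)
  then obtain c2 where c2: "h = c2 *\<^sub>R grad_gap f p"
    using gradient_if_local_max[OF f p D2[unfolded h]] by blast
  let ?I = "frechet_derivative (inv_into U \<Phi>) (at (\<Phi> p))"
  note inv = diffeo_on_derivative_inverse(2)[OF d U(1)]
  have "g \<bullet> ?I (0, 1) = 1" using g[of "?I (0, 1)"] inv[of "(0, 1)"] by simp
  then have "grad_gap f p \<bullet> ?I (0, 1) \<noteq> 0" by (auto simp: c1)
  moreover have "h \<bullet> ?I (0, 1) = 0" using h[of "?I (0, 1)"] inv[of "(0, 1)"] by simp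
  ultimately have "c2 = 0" by (simp add: c2)
  then have "h \<bullet> ?I (axis i 1, 0) = 0" by (simp add: c2)
  then show False using h[of "?I (axis i 1, 0)"] inv[of "(axis i 1, 0)"] by (simp add: axis_def)
qed

context
  fixes f :: "real \<Rightarrow> real" and q a l s :: real
  assumes f: "profile_on q a {-l<..<l} f" and s: "0 < s" "s < l"
begin

definition sq_radius :: "real \<Rightarrow> real" where "sq_radius t = (cosh (f t) - 1) / (cosh (f t) + 1)"

lemma sq_radius_Ck: "Ck_on k {-l<..<l} sq_radius"
proof -
  have J: "open {-l<..<l}" by simp
  have fk: "Ck_on k {-l<..<l} f" using profile_Ck[OF f J] by blast
  have ch: "Ck_on k {-l<..<l} (\<lambda>t. cosh (f t))"
    by (rule Ck_on_compose_real[OF J fk, of UNIV]) (use Ck_on_cosh_sinh in auto)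
  have "cosh (f t) + 1 \<noteq> 0" for t using cosh_real_pos[of "f t"] by linarith
  then have "Ck_on k {-l<..<l} (\<lambda>t. (cosh (f t) - 1) * inverse (cosh (f t) + 1))"
    by (intro Ck_on_mult[OF J] Ck_on_diff[OF J] Ck_on_const[OF J] ch
        Ck_on_compose_real[OF J Ck_on_add[OF J ch Ck_on_const[OF J]] Ck_on_inverse]) auto
  then show ?thesis by (simp add: sq_radius_def[abs_def] divide_inverse)
qed

context
  fixes i :: "'n::finite" and \<sigma> e :: real
  assumes \<sigma>: "\<sigma> = 1 \<or> \<sigma> = -1" and e: "e = 1 \<or> e = -1"
begin

definition chart_domain :: "'n amb set" where
  "chart_domain = {z. 0 < \<sigma> * (fst z $ i) \<and> - s < e * snd z \<and> e * snd z < l}"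

text \<open>Near a point where \<open>x $ i\<close> has sign \<open>\<sigma>\<close>, and away from the edge at height \<open>- e s\<close>, the coordinate \<open>x $ i\<close> is replaced by the
  distance \<open>s - e t\<close> of the height \<open>t\<close> to the other edge, and the height by the defining function of the
  hypersurface. The coordinate \<open>x $ i\<close> is recovered from the defining function by a square root;
  the sign conditions make this possible, and \<open>s < l\<close> leaves room beyond the edge.\<close>

definition chart_map :: "'n amb \<Rightarrow> 'n amb" where
  "chart_map z = (\<chi> j. if j = i then s - e * snd z else fst z $ j, (norm (fst z))\<^sup>2 - sq_radius (snd z))"

definition height :: "'n amb \<Rightarrow> real" where "height z = e * (s - fst z $ i)"

definition sq_coordinate :: "'n amb \<Rightarrow> real" where
  "sq_coordinate z = snd z + sq_radius (height z) - (\<Sum>j\<in>UNIV - {i}. (fst z $ j) * (fst z $ j))"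

definition chart_range :: "'n amb set" where
  "chart_range = {z. s - l < fst z $ i \<and> fst z $ i < 2 * s \<and> 0 < sq_coordinate z}"

definition chart_inv :: "'n amb \<Rightarrow> 'n amb" where
  "chart_inv z = (\<chi> j. if j = i then \<sigma> * sqrt (sq_coordinate z) else fst z $ j, height z)"

lemma norm_split: "(norm x)\<^sup>2 = (x $ i)\<^sup>2 + (\<Sum>j\<in>UNIV - {i}. (x $ j) * (x $ j))" for x :: "real^'n"
  unfolding power2_norm_eq_inner inner_vec_def
  by (subst sum.remove[of UNIV i]) (simp_all add: power2_eq_square)

lemma height_range: "s - l < fst z $ i \<Longrightarrow> fst z $ i < 2 * s \<Longrightarrow> height z \<in> {-l<..<l}"
  using s e by (auto simp: height_def)

lemma open_chart_domain: "open chart_domain"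
  unfolding chart_domain_def by (intro open_Collect_conj open_Collect_less continuous_intros)

definition chart_strip :: "'n amb set" where "chart_strip = {z. s - l < fst z $ i \<and> fst z $ i < 2 * s}"

lemma open_chart_strip: "open chart_strip"
  unfolding chart_strip_def by (intro open_Collect_conj open_Collect_less continuous_intros)

lemma comp_linear: "bounded_linear (\<lambda>z::'n amb. fst z $ j)"
  by (rule bounded_linear_compose[OF bounded_linear_vec_nth bounded_linear_fst])

lemma sq_coordinate_Ck: "Ck_on k chart_strip sq_coordinate"
proof -
  note o = open_chart_strip
  have h: "Ck_on k chart_strip height"
    unfolding height_def by (intro Ck_on_mult[OF o] Ck_on_diff[OF o] Ck_on_const[OF o] Ck_on_linear[OF o] comp_linear)
  have Rh: "Ck_on k chart_strip (\<lambda>z. sq_radius (height z))"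
    by (rule Ck_on_compose_real[OF o h sq_radius_Ck]) (use height_range in \<open>auto simp: chart_strip_def\<close>)
  show ?thesis
    unfolding sq_coordinate_def
    by (rule Ck_on_diff[OF o Ck_on_add[OF o Ck_on_linear[OF o bounded_linear_snd] Rh]])
      (intro Ck_on_sum[OF o] Ck_on_mult[OF o] Ck_on_linear[OF o] comp_linear)
qed

lemma open_chart_range: "open chart_range"
proof -
  have "open (chart_strip \<inter> sq_coordinate -` {0<..})"
    by (intro continuous_open_preimage Ck_on_imp_continuous_on[OF sq_coordinate_Ck[of 0]] open_chart_strip) simp
  moreover have "chart_strip \<inter> sq_coordinate -` {0<..} = chart_range" by (auto simp: chart_range_def chart_strip_def)
  ultimately show ?thesis by simp
qed

lemma chart_inv_map: "z \<in> chart_domain \<Longrightarrow> chart_inv (chart_map z) = z \<and> chart_map z \<in> chart_range"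
proof -
  assume z: "z \<in> chart_domain"
  have h: "height (chart_map z) = snd z" using e by (auto simp: height_def chart_map_def)
  have d: "sq_coordinate (chart_map z) = (fst z $ i)\<^sup>2"
    unfolding sq_coordinate_def h using norm_split[of "fst z"] by (simp add: chart_map_def)
  have sg: "0 < \<sigma> * (fst z $ i)" using z by (simp add: chart_domain_def)
  then have "\<sigma> * sqrt (sq_coordinate (chart_map z)) = fst z $ i" unfolding d using \<sigma> by auto
  then have "chart_inv (chart_map z) = z"
    by (simp add: chart_inv_def h prod_eq_iff vec_eq_iff) (simp add: chart_map_def)
  moreover have "0 < sq_coordinate (chart_map z)" unfolding d using sg by auto
  then have "chart_map z \<in> chart_range" using z e by (auto simp: chart_range_def chart_map_def chart_domain_def)
  ultimately show ?thesis ..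
qed

lemma chart_map_inv: "y \<in> chart_range \<Longrightarrow> chart_map (chart_inv y) = y \<and> chart_inv y \<in> chart_domain"
proof -
  assume y: "y \<in> chart_range"
  have d: "0 < sq_coordinate y" using y by (simp add: chart_range_def)
  have i: "fst (chart_inv y) $ i = \<sigma> * sqrt (sq_coordinate y)" and sn: "snd (chart_inv y) = height y" by (simp_all add: chart_inv_def)
  have "(norm (fst (chart_inv y)))\<^sup>2 = sq_coordinate y + (\<Sum>j\<in>UNIV - {i}. (fst y $ j) * (fst y $ j))"
    unfolding norm_split[of "fst (chart_inv y)"] i using d \<sigma> by (auto simp: chart_inv_def power_mult_distrib)
  then have n: "(norm (fst (chart_inv y)))\<^sup>2 - sq_radius (snd (chart_inv y)) = snd y" unfolding sn sq_coordinate_def by simp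
  have eh: "s - e * height y = fst y $ i" using e by (auto simp: height_def)
  have "snd (chart_map (chart_inv y)) = snd y" unfolding chart_map_def using n by simp
  moreover have "fst (chart_map (chart_inv y)) = fst y" by (auto simp: vec_eq_iff chart_map_def chart_inv_def eh)
  ultimately have "chart_map (chart_inv y) = y" by (rule prod_eqI[rotated])
  moreover have "0 < \<sigma> * fst (chart_inv y) $ i" unfolding i using d \<sigma> by auto
  then have "chart_inv y \<in> chart_domain" using eh y by (auto simp: chart_domain_def chart_range_def sn)
  ultimately show ?thesis ..
qed

lemma image_chart_map: "chart_map ` chart_domain = chart_range"
  using chart_inv_map chart_map_inv by (auto intro!: image_eqI)

lemma inj_chart_map: "inj_on chart_map chart_domain"
  using chart_inv_map by (metis inj_onI)

lemma chart_map_Ck: "Ck_on k chart_domain chart_map"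
proof -
  note o = open_chart_domain
  let ?L = "\<lambda>z::'n amb. (\<chi> j. if j = i then - e * snd z else fst z $ j, 0::real)"
  have lin: "bounded_linear ?L"
    by (intro linear_conv_bounded_linear[THEN iffD1] linearI)
      (auto simp: prod_eq_iff vec_eq_iff algebra_simps)
  have Rs: "Ck_on k chart_domain (\<lambda>z. sq_radius (snd z))"
    by (rule Ck_on_compose_real[OF o Ck_on_linear[OF o bounded_linear_snd] sq_radius_Ck])
      (use s e in \<open>auto simp: chart_domain_def\<close>)
  have n: "Ck_on k chart_domain (\<lambda>z. (\<Sum>j\<in>UNIV. (fst z $ j) * (fst z $ j)) - sq_radius (snd z))"
    by (rule Ck_on_diff[OF o _ Rs]) (intro Ck_on_sum[OF o] Ck_on_mult[OF o] Ck_on_linear[OF o] comp_linear)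
  have "Ck_on k chart_domain (\<lambda>z. (?L z + (axis i s, 0)) + ((\<Sum>j\<in>UNIV. (fst z $ j) * (fst z $ j)) - sq_radius (snd z)) *\<^sub>R (0, 1))"
    by (intro Ck_on_add[OF o] Ck_on_scaleR[OF o n] Ck_on_const[OF o] Ck_on_linear[OF o lin])
  moreover have "(?L z + (axis i s, 0)) + ((\<Sum>j\<in>UNIV. (fst z $ j) * (fst z $ j)) - sq_radius (snd z)) *\<^sub>R (0, 1) = chart_map z" for z
    by (auto simp: chart_map_def prod_eq_iff vec_eq_iff axis_def power2_norm_eq_inner inner_vec_def)
  ultimately show ?thesis by simp
qed

lemma chart_inv_Ck: "Ck_on k chart_range chart_inv"
proof -
  note o = open_chart_range
  let ?L = "\<lambda>z::'n amb. (\<chi> j. if j = i then 0 else fst z $ j, - e * fst z $ i)"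
  have lin: "bounded_linear ?L"
    by (intro linear_conv_bounded_linear[THEN iffD1] linearI)
      (auto simp: prod_eq_iff vec_eq_iff algebra_simps)
  have "Ck_on k chart_range sq_coordinate" by (rule Ck_on_subset[OF sq_coordinate_Ck]) (auto simp: chart_range_def chart_strip_def)
  then have "Ck_on k chart_range (\<lambda>z. sqrt (sq_coordinate z))"
    by (rule Ck_on_compose_real[OF o _ Ck_on_sqrt]) (auto simp: chart_range_def)
  then have r: "Ck_on k chart_range (\<lambda>z. \<sigma> * sqrt (sq_coordinate z))" by (intro Ck_on_mult[OF o] Ck_on_const[OF o])
  have "Ck_on k chart_range (\<lambda>z. (?L z + (0, e * s)) + (\<sigma> * sqrt (sq_coordinate z)) *\<^sub>R (axis i 1, 0))"
    by (intro Ck_on_add[OF o] Ck_on_scaleR[OF o r] Ck_on_const[OF o] Ck_on_linear[OF o lin])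
  moreover have "(?L z + (0, e * s)) + (\<sigma> * sqrt (sq_coordinate z)) *\<^sub>R (axis i 1, 0) = chart_inv z" for z
    by (auto simp: chart_inv_def height_def prod_eq_iff vec_eq_iff axis_def algebra_simps)
  ultimately show ?thesis by simp
qed

lemma half_chart: "half_slice_chart (slab_part s f) chart_domain chart_map i"
  unfolding half_slice_chart_def diffeo_on_def
proof (intro conjI)
  show "open (chart_map ` chart_domain)" unfolding image_chart_map by (rule open_chart_range)
  show "smooth_on chart_domain chart_map" unfolding smooth_on_def using chart_map_Ck by blast
  have "inv_into chart_domain chart_map y = chart_inv y" if "y \<in> chart_range" for y
    using chart_map_inv[OF that] inv_into_f_f[OF inj_chart_map, of "chart_inv y"] by simp
  then have "Ck_on k chart_range (inv_into chart_domain chart_map)" for k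
    by (intro Ck_on_cong[OF open_chart_range _ chart_inv_Ck]) simp
  then show "smooth_on (chart_map ` chart_domain) (inv_into chart_domain chart_map)" unfolding image_chart_map smooth_on_def by blast
  show "slab_part s f \<inter> chart_domain = {x \<in> chart_domain. snd (chart_map x) = 0 \<and> 0 \<le> fst (chart_map x) $ i}"
  proof (intro set_eqI)
    fix z :: "'n amb"
    obtain x t where z: "z = (x, t)" by (cases z)
    show "z \<in> slab_part s f \<inter> chart_domain \<longleftrightarrow> z \<in> {x \<in> chart_domain. snd (chart_map x) = 0 \<and> 0 \<le> fst (chart_map x) $ i}"
      unfolding z using e by (auto simp: slab_part_iff chart_map_def sq_radius_def chart_domain_def)
  qed
qed (rule open_chart_domain inj_chart_map)+

end

text \<open>One family of charts covers all points: away from the edge the distance to it is positive.\<close>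

lemma half_chart_at:
  fixes p :: "'n::finite amb"
  assumes p: "p \<in> slab_part s f"
  obtains U \<Phi> i where "half_slice_chart (slab_part s f) U \<Phi> i" "p \<in> U" "fst (\<Phi> p) $ i = s - \<bar>snd p\<bar>"
proof -
  have "fst p \<noteq> 0" by (rule slab_part_off_axis[OF f s(2) p])
  then obtain i where i: "fst p $ i \<noteq> 0" by (auto simp: vec_eq_iff)
  define \<sigma> where "\<sigma> = sgn (fst p $ i)"
  define e :: real where "e = (if 0 \<le> snd p then 1 else -1)"
  have \<sigma>: "\<sigma> = 1 \<or> \<sigma> = -1" using i by (auto simp: \<sigma>_def sgn_if)
  have e: "e = 1 \<or> e = -1" by (simp add: e_def)
  have ep: "e * snd p = \<bar>snd p\<bar>" by (simp add: e_def)
  have "\<bar>snd p\<bar> \<le> s" using p by (simp add: slab_part_def)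
  then have "p \<in> chart_domain i \<sigma> e" using i s unfolding chart_domain_def[OF \<sigma> e] mem_Collect_eq ep by (auto simp: \<sigma>_def sgn_if)
  moreover have "fst (chart_map i e p) $ i = s - \<bar>snd p\<bar>" unfolding chart_map_def[OF \<sigma> e] ep by simp
  ultimately show ?thesis using that half_chart[OF \<sigma> e] by blast
qed

lemma hypersurface_slab_part: "hypersurface (slab_part s f :: 'n::finite amb set)"
  unfolding hypersurface_def
proof (intro conjI ballI)
  show "slab_part s f \<subseteq> HxR" by (auto simp: slab_part_def HxR_iff)
  fix p :: "'n amb" assume "p \<in> slab_part s f"
  from half_chart_at[OF this]
  show "\<exists>U \<Phi>. p \<in> U \<and> (slice_chart (slab_part s f) U \<Phi> \<or> (\<exists>i. half_slice_chart (slab_part s f) U \<Phi> i))"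
    by metis
qed

lemma boundary_slab_part:
  "boundary (slab_part s f :: 'n::finite amb set) = {p \<in> slab_part s f. \<bar>snd p\<bar> = s}"
proof (intro set_eqI iffI)
  fix p :: "'n amb" assume b: "p \<in> boundary (slab_part s f)"
  then have p: "p \<in> slab_part s f" by (simp add: boundary_def)
  then have sp: "\<bar>snd p\<bar> \<le> s" by (simp add: slab_part_def)
  show "p \<in> {p \<in> slab_part s f. \<bar>snd p\<bar> = s}"
  proof (rule ccontr)
    assume "\<not> ?thesis"
    then have "snd p \<in> {-s<..<s}" using p sp by auto
    moreover have "\<forall>t\<in>{-s<..<s}. 0 < f t \<and> (f has_real_derivative deriv f t) (at t)"
      using profile_on_positive[OF f] s by auto
    moreover have "{y. norm (fst y) < 1 \<and> snd y \<in> {-s<..<s} \<and> gap f y = 0} \<subseteq> slab_part s f"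
      by (auto simp: slab_part_def)
    ultimately have "p \<notin> boundary (slab_part s f)"
      using p by (intro boundary_inner_point[where J = "{-s<..<s}" and f = f]) (simp_all add: slab_part_def)
    then show False using b by blast
  qed
next
  fix p :: "'n amb" assume "p \<in> {p \<in> slab_part s f. \<bar>snd p\<bar> = s}"
  then have p: "p \<in> slab_part s f" "\<bar>snd p\<bar> = s" by auto
  obtain U \<Phi> i where "half_slice_chart (slab_part s f) U \<Phi> i" "p \<in> U" "fst (\<Phi> p) $ i = s - \<bar>snd p\<bar>"
    by (rule half_chart_at[OF p(1)]) (rule that)
  then show "p \<in> boundary (slab_part s f)" unfolding boundary_def using p by auto
qed

lemma tangent_space_slab_part:
  fixes p :: "'n::finite amb"
  assumes p: "p \<in> slab_part s f"
  shows "tangent_space (slab_part s f) p = {v. grad_gap f p \<bullet> v = 0}"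
proof -
  have eq: "snd (frechet_derivative \<Phi> (at p) v) = 0 \<longleftrightarrow> grad_gap f p \<bullet> v = 0"
    if U: "p \<in> U" "slice_chart (slab_part s f) U \<Phi> \<or> (\<exists>i. half_slice_chart (slab_part s f) U \<Phi> i)"
    for U v and \<Phi> :: "'n amb \<Rightarrow> 'n amb"
  proof -
    have d: "diffeo_on U \<Phi>" using U(2) unfolding slice_chart_def half_slice_chart_def by blast
    have z: "snd (\<Phi> y) = 0" if "y \<in> U" "y \<in> slab_part s f" for y
      using U(2) that unfolding slice_chart_def half_slice_chart_def by blast
    have "\<exists>c. c \<noteq> 0 \<and> (\<forall>v. snd (frechet_derivative \<Phi> (at p) v) = c * (grad_gap f p \<bullet> v))"
      by (rule chart_gradient[OF f s p d U(1)]) (use z in blast)+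
    then obtain c where "c \<noteq> 0" "snd (frechet_derivative \<Phi> (at p) v) = c * (grad_gap f p \<bullet> v)" by blast
    then show ?thesis by simp
  qed
  obtain U \<Phi> i where c: "half_slice_chart (slab_part s f) U \<Phi> i" "p \<in> U" "fst (\<Phi> p) $ i = s - \<bar>snd p\<bar>"
    by (rule half_chart_at[OF p]) (rule that)
  show ?thesis
  proof (intro set_eqI iffI)
    fix v assume "v \<in> tangent_space (slab_part s f) p"
    then show "v \<in> {v. grad_gap f p \<bullet> v = 0}" unfolding tangent_space_def using eq by blast
  next
    fix v assume "v \<in> {v. grad_gap f p \<bullet> v = 0}"
    then show "v \<in> tangent_space (slab_part s f) p" unfolding tangent_space_def using eq c by blast
  qed
qed

end

section \<open>The rotational hypersurfaces are r-minimal\<close>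

lemma esym_const:
  assumes "finite B" "\<And>i. i \<in> B \<Longrightarrow> k i = \<kappa>"
  shows "esym j B k = real (card B choose j) * \<kappa> ^ j"
proof -
  have "esym j B k = (\<Sum>I | I \<subseteq> B \<and> card I = j. \<kappa> ^ j)"
    unfolding esym_def
  proof (rule sum.cong)
    fix I assume "I \<in> {I. I \<subseteq> B \<and> card I = j}"
    then have "(\<Prod>i\<in>I. k i) = (\<Prod>i\<in>I. \<kappa>)" using assms(2) by (intro prod.cong) auto
    then show "(\<Prod>i\<in>I. k i) = \<kappa> ^ j" using \<open>I \<in> {I. I \<subseteq> B \<and> card I = j}\<close> by simp
  qed simp
  then show ?thesis using n_subsets[OF assms(1), of j] by simp
qed

text \<open>The value of \<open>q\<close> is chosen so that the terms with and without the index \<open>i\<close> cancel.\<close>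

lemma mean_curvature_catenoid:
  fixes k :: "'n::finite \<Rightarrow> real" and r :: nat
  assumes r: "r + 1 < CARD('n)" and q: "q = (real CARD('n) - real r - 1) / (real r + 1)"
    and k: "k i = - q * \<kappa>" "\<And>j. j \<noteq> i \<Longrightarrow> k j = \<kappa>"
  shows "mean_curvature (r + 1) k = 0"
proof -
  let ?n = "CARD('n) - 1"
  have e: "esym j (UNIV - {i}) k = real (?n choose j) * \<kappa> ^ j" for j
    using esym_const[of "UNIV - {i}" k \<kappa> j] k(2) by simp
  have "Suc r * (?n choose Suc r) = (?n - r) * (?n choose r)"
    by (simp only: binomial_absorption binomial_absorb_comp)
  then have "real (Suc r) * real (?n choose Suc r) = real (?n - r) * real (?n choose r)"
    unfolding of_nat_mult[symmetric] by simp
  moreover have "real (?n - r) = real (Suc r) * q"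
    using r by (simp add: q of_nat_diff field_simps)
  ultimately have "real (Suc r) * real (?n choose Suc r) = real (Suc r) * (q * real (?n choose r))"
    by (simp only: mult.assoc)
  then have "real (?n choose Suc r) = q * real (?n choose r)"
    using mult_left_cancel[of "real (Suc r)"] by simp
  then have "esym (Suc r) UNIV k = 0"
    using esym_remove[of UNIV i r k] by (simp add: e k(1))
  then show ?thesis using mean_curvature_eq_0_iff[of "r + 1" k] r by simp
qed

text \<open>The two functions are the coefficients of the unit normal
  \<open>(- x / (sinh f sqrt (1 + f'\<^sup>2)), f' / sqrt (1 + f'\<^sup>2))\<close> of the rotational hypersurface.\<close>

lemma profile_normal_derivative:
  fixes f :: "real \<Rightarrow> real"
  assumes f: "profile_on q a J f" "open J" "t \<in> J"
  defines "S \<equiv> \<lambda>t. sqrt (1 + (deriv f t)\<^sup>2)"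
  defines "B \<equiv> q * (cosh (f t) / sinh (f t)) / S t"
  shows "((\<lambda>t. deriv f t * inverse (S t)) has_real_derivative B) (at t)"
    "((\<lambda>t. - inverse (sinh (f t) * S t)) has_real_derivative
      (B * deriv f t + cosh (f t) * deriv f t / (sinh (f t) * S t)) / sinh (f t)) (at t)"
proof -
  note pf = profile_onE[OF f(1)]
  define F where "F = deriv f t"
  define G where "G = q * (cosh (f t) / sinh (f t)) * (1 + F\<^sup>2)"
  have sh: "0 < sinh (f t)" using pf(1)[OF f(3)] by simp
  have S0: "0 < S t" and S2: "(S t)\<^sup>2 = 1 + F\<^sup>2"
    by (simp_all add: S_def F_def add_pos_nonneg)
  have dF: "(deriv f has_real_derivative G) (at t)"
    using pf(4)[OF f(2,3)] by (simp add: G_def F_def)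
  have df: "(f has_real_derivative F) (at t)" using pf(3)[OF f(3)] by (simp add: F_def)
  have "((\<lambda>t. 1 + (deriv f t)\<^sup>2) has_real_derivative 2 * F * G) (at t)"
    using dF by (auto intro!: derivative_eq_intros simp: F_def)
  then have "(S has_real_derivative (inverse (sqrt (1 + (deriv f t)\<^sup>2)) / 2) * (2 * F * G)) (at t)"
    unfolding S_def
    by (rule DERIV_chain2[where f = sqrt and g = "\<lambda>t. 1 + (deriv f t)\<^sup>2", rotated])
      (intro DERIV_real_sqrt add_pos_nonneg; simp)
  then have dS: "(S has_real_derivative F * G / S t) (at t)"
    by (rule DERIV_cong) (simp add: S_def inverse_eq_divide)
  have di: "((\<lambda>t. inverse (S t)) has_real_derivative - (F * G / S t / (S t)\<^sup>2)) (at t)"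
    by (rule DERIV_cong[OF DERIV_inverse_fun[OF dS]]) (use S0 in \<open>simp_all add: power2_eq_square inverse_eq_divide\<close>)
  have GB: "G = B * S t * (S t)\<^sup>2" using S0 by (simp add: G_def B_def S2)
  have "((\<lambda>t. deriv f t * inverse (S t)) has_real_derivative
      G * inverse (S t) + - (F * G / S t / (S t)\<^sup>2) * F) (at t)"
    by (rule DERIV_cong[OF DERIV_mult[OF dF di]]) (simp add: F_def)
  moreover have "G * inverse (S t) + - (F * G / S t / (S t)\<^sup>2) * F = B * ((S t)\<^sup>2 - F\<^sup>2)"
    using S0 by (simp add: GB field_simps power2_eq_square)
  ultimately show "((\<lambda>t. deriv f t * inverse (S t)) has_real_derivative B) (at t)"
    by (simp add: S2)
  have dsh: "((\<lambda>t. inverse (sinh (f t))) has_real_derivative - (cosh (f t) * F / (sinh (f t))\<^sup>2)) (at t)"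
  proof -
    have "((\<lambda>t. sinh (f t)) has_real_derivative cosh (f t) * F) (at t)"
      using df by (auto intro!: derivative_eq_intros)
    from DERIV_cong[OF DERIV_inverse_fun[OF this]] show ?thesis
      using sh by (simp add: power2_eq_square inverse_eq_divide)
  qed
  have "((\<lambda>t. - (inverse (sinh (f t)) * inverse (S t))) has_real_derivative
      - (- (cosh (f t) * F / (sinh (f t))\<^sup>2) * inverse (S t) + - (F * G / S t / (S t)\<^sup>2) * inverse (sinh (f t)))) (at t)"
    by (rule DERIV_cong[OF DERIV_minus[OF DERIV_mult[OF dsh di]]]) (simp add: mult_ac)
  moreover have "- (- (cosh (f t) * F / (sinh (f t))\<^sup>2) * inverse (S t) + - (F * G / S t / (S t)\<^sup>2) * inverse (sinh (f t)))
      = (B * F + cosh (f t) * F / (sinh (f t) * S t)) / sinh (f t)"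
    using S0 sh by (simp add: GB field_simps power2_eq_square)
  ultimately show "((\<lambda>t. - inverse (sinh (f t) * S t)) has_real_derivative
      (B * deriv f t + cosh (f t) * deriv f t / (sinh (f t) * S t)) / sinh (f t)) (at t)"
    unfolding F_def by (simp only: inverse_mult_distrib)
qed

text \<open>The principal directions are the horizontal ones orthogonal to \<open>x\<close>, with curvature
  \<open>\<kappa> = coth f / sqrt (1 + f'\<^sup>2)\<close>, and the meridian direction. The equation of the profile says that the
  curvature of the meridian is \<open>-q \<kappa>\<close>.\<close>

lemma r_minimal_slab_part:
  fixes r :: nat
  assumes r: "r + 1 < CARD('n::finite)" and q: "q = (real CARD('n) - real r - 1) / (real r + 1)"
    and f: "profile_on q a {-l<..<l} f" and s: "0 < s" "s < l"
  shows "r_minimal r (slab_part s f :: 'n amb set)"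
  unfolding r_minimal_def
proof
  fix p :: "'n amb" assume p: "p \<in> slab_part s f"
  note pf = profile_onE[OF f]
  have J: "open {-l<..<l}" by simp
  define S where "S t = sqrt (1 + (deriv f t)\<^sup>2)" for t
  define \<alpha> where "\<alpha> t = - inverse (sinh (f t) * S t)" for t
  define \<beta> where "\<beta> t = deriv f t * inverse (S t)" for t
  define N :: "'n amb \<Rightarrow> 'n amb" where "N p = (\<alpha> (snd p) *\<^sub>R fst p, \<beta> (snd p))" for p
  define U :: "'n amb set" where "U = snd -` {-l<..<l}"
  have oU: "open U" unfolding U_def by (intro open_vimage_snd J)
  have S0: "0 < S t" and S2: "(S t)\<^sup>2 = 1 + (deriv f t)\<^sup>2" for t
    by (simp_all add: S_def add_pos_nonneg)
  have sh: "0 < sinh (f t)" if "t \<in> {-l<..<l}" for t using pf(1)[OF that] by simp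
  have sS: "sinh (f t) * S t \<noteq> 0" if "t \<in> {-l<..<l}" for t using sh[OF that] S0[of t] by simp
  have S0': "S t \<noteq> 0" for t using S0[of t] by simp
  have N_Ck: "Ck_on k U N" for k
  proof -
    have fk: "Ck_on k {-l<..<l} f" and dk: "Ck_on k {-l<..<l} (deriv f)"
      using profile_Ck[OF f J] by blast+
    have sk: "Ck_on k {-l<..<l} (\<lambda>t. sinh (f t))"
      by (rule Ck_on_compose_real[OF J fk, of UNIV]) (use Ck_on_cosh_sinh in auto)
    have "Ck_on k {-l<..<l} (\<lambda>t. 1 + deriv f t * deriv f t)"
      by (intro Ck_on_add[OF J] Ck_on_const[OF J] Ck_on_mult[OF J] dk)
    then have Sk: "Ck_on k {-l<..<l} S"
      unfolding S_def power2_eq_square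
      by (rule Ck_on_compose_real[OF J _ Ck_on_sqrt]) (auto intro: add_pos_nonneg)
    have "Ck_on k {-l<..<l} \<alpha>"
      unfolding \<alpha>_def
      by (rule Ck_on_minus[OF J Ck_on_compose_real[OF J Ck_on_mult[OF J sk Sk] Ck_on_inverse]])
        (rule image_subsetI, use sS in auto)
    from Ck_on_compose_real[OF oU Ck_on_linear[OF oU bounded_linear_snd] this]
    have a: "Ck_on k U (\<lambda>p. \<alpha> (snd p))" by (auto simp: U_def)
    have "Ck_on k {-l<..<l} \<beta>"
      unfolding \<beta>_def
      by (rule Ck_on_mult[OF J dk Ck_on_compose_real[OF J Sk Ck_on_inverse]])
        (rule image_subsetI, simp add: S0')
    from Ck_on_compose_real[OF oU Ck_on_linear[OF oU bounded_linear_snd] this]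
    have b: "Ck_on k U (\<lambda>p. \<beta> (snd p))" by (auto simp: U_def)
    have lin: "bounded_linear (\<lambda>p::'n amb. (fst p, 0::real))"
      by (intro bounded_linear_Pair bounded_linear_fst bounded_linear_zero)
    have "Ck_on k U (\<lambda>p. \<alpha> (snd p) *\<^sub>R (fst p, 0::real) + \<beta> (snd p) *\<^sub>R (0, 1))"
      by (rule Ck_on_add[OF oU Ck_on_scaleR[OF oU a Ck_on_linear[OF oU lin]] Ck_on_scaleR[OF oU b Ck_on_const[OF oU]]])
    then show ?thesis by (simp add: N_def[abs_def])
  qed
  have on: "norm (fst y) < 1" "snd y \<in> {-l<..<l}" "conf (fst y) = 1 + cosh (f (snd y))"
    "conf (fst y) * norm (fst y) = sinh (f (snd y))" if "y \<in> slab_part s f" for y :: "'n amb"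
  proof -
    show y: "norm (fst y) < 1" and yl: "snd y \<in> {-l<..<l}" using slab_part_off_axis[OF f s(2) that] by blast+
    show c: "conf (fst y) = 1 + cosh (f (snd y))" using that by (simp add: slab_part_def gap_def)
    have "(conf (fst y) * norm (fst y))\<^sup>2 = conf (fst y) * (conf (fst y) - 2)"
      using conf_norm_sq[OF y] by (simp add: power2_eq_square mult_ac)
    also have "\<dots> = (sinh (f (snd y)))\<^sup>2" using hyperbolic_pythagoras[of "f (snd y)"]
      by (simp add: c power2_eq_square algebra_simps)
    finally show "conf (fst y) * norm (fst y) = sinh (f (snd y))"
      by (rule power2_eq_imp_eq) (use sh[OF yl] conf_ge_2[OF y] in auto)
  qed
  have unit: "unit_normal_on (slab_part s f) U N"
    unfolding unit_normal_on_def
  proof (intro conjI ballI oU)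
    show "smooth_on U N" using N_Ck by (simp add: smooth_on_def)
    fix y assume "y \<in> slab_part s f \<inter> U"
    then have y: "y \<in> slab_part s f" by simp
    note o = on[OF y]
    define X D h \<sigma> where "X = norm (fst y)" and "D = deriv f (snd y)" and "h = sinh (f (snd y))" and "\<sigma> = S (snd y)"
    have h0: "0 < h" "0 < \<sigma>" "\<sigma>\<^sup>2 = 1 + D\<^sup>2" using sh[OF o(2)] S0 S2 by (simp_all add: h_def \<sigma>_def D_def)
    have m: "metric y u v = (conf (fst y))\<^sup>2 * (fst u \<bullet> fst v) + snd u * snd v" for u v
      by (rule metric_conf)
    have "metric y (N y) (N y) = (conf (fst y) * X)\<^sup>2 / (h * \<sigma>)\<^sup>2 + D\<^sup>2 / \<sigma>\<^sup>2"
      unfolding m N_def \<alpha>_def \<beta>_def h_def[symmetric] \<sigma>_def[symmetric] D_def[symmetric]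
      by (simp add: power2_norm_eq_inner[symmetric] X_def power2_eq_square divide_inverse mult_ac)
    also have "\<dots> = (1 + D\<^sup>2) / \<sigma>\<^sup>2" unfolding X_def o(4) h_def[symmetric] using h0(1)
      by (simp add: power_mult_distrib add_divide_distrib)
    also have "\<dots> = 1" unfolding h0(3)[symmetric] using h0(2) by simp
    finally show "metric y (N y) (N y) = 1" .
    fix v assume "v \<in> tangent_space (slab_part s f) y"
    then have g: "grad_gap f y \<bullet> v = 0" using tangent_space_slab_part[OF f s y] by simp
    have "metric y (N y) v = - (grad_gap f y \<bullet> v) / (h * \<sigma>)"
      unfolding m N_def \<alpha>_def \<beta>_def grad_gap_def h_def[symmetric] \<sigma>_def[symmetric] D_def[symmetric]
      using h0 by (simp add: inner_prod_def field_simps)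
    then show "metric y (N y) v = 0" using g by simp
  qed
  define x t where "x = fst p" and "t = snd p"
  note o = on[OF p, folded x_def t_def]
  have x0: "x \<noteq> 0" using slab_part_off_axis[OF f s(2) p] by (simp add: x_def)
  define u where "u = x /\<^sub>R norm x"
  have u: "norm u = 1" "x = norm x *\<^sub>R u" using x0 by (simp_all add: u_def)
  \<comment> \<open>An arbitrary index, reserved for the meridian direction.\<close>
  define i0 :: 'n where "i0 = undefined"
  have "\<exists>Q. orthogonal_transformation Q \<and> Q (axis i0 (1::real)) = u"
  proof (rule orthogonal_transformation_exists[of "axis i0 (1::real)" u])
    show "norm (axis i0 (1::real)) = norm u" by (simp add: u(1))
    fix g assume "orthogonal_transformation g" "g (axis i0 (1::real)) = u"
    then show ?thesis by (intro exI[of _ g]) simp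
  qed
  then obtain Q where Q: "orthogonal_transformation Q" "Q (axis i0 (1::real)) = u" by blast
  define y where "y i = Q (axis i (1::real))" for i
  have y: "y i \<bullet> y j = (if i = j then 1 else 0)" for i j
    using Q(1) by (simp add: y_def orthogonal_transformation_def inner_axis_axis)
  have y0: "y i0 = u" by (simp add: y_def Q(2))
  define c D h C \<sigma> where "c = conf x" and "D = deriv f t" and "h = sinh (f t)" and "C = cosh (f t)" and "\<sigma> = S t"
  have c0: "0 < c" using conf_ge_2[OF o(1)] by (simp add: c_def)
  have pos: "0 < h" "0 < \<sigma>" "\<sigma>\<^sup>2 = 1 + D\<^sup>2" using sh[OF o(2)] S0 S2 by (simp_all add: h_def \<sigma>_def D_def)
  have nx: "norm x = h / c" using o(4) c0 by (simp add: c_def h_def field_simps)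
  have xu: "x = (h / c) *\<^sub>R u" using u(2) by (simp add: nx)
  define e where "e i = (if i = i0 then ((D / (c * \<sigma>)) *\<^sub>R u, 1 / \<sigma>) else ((1 / c) *\<^sub>R y i, 0))" for i
  define \<kappa> where "\<kappa> = C / (h * \<sigma>)"
  define k where "k i = (if i = i0 then - q * \<kappa> else \<kappa>)" for i
  have m: "metric p v w = c\<^sup>2 * (fst v \<bullet> fst w) + snd v * snd w" for v w
    using metric_conf[of p v w] by (simp add: c_def x_def)
  have uy: "u \<bullet> y i = 0" "y i \<bullet> u = 0" if "i \<noteq> i0" for i
    using y[of i0 i] y[of i i0] that by (simp_all add: y0)
  have uu: "u \<bullet> u = 1" using y[of i0 i0] by (simp add: y0)
  have tang: "e i \<in> tangent_space (slab_part s f) p" for i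
    unfolding tangent_space_slab_part[OF f s p] mem_Collect_eq grad_gap_def x_def[symmetric] t_def[symmetric]
      c_def[symmetric] h_def[symmetric] D_def[symmetric]
    using c0 pos by (cases "i = i0") (simp_all add: xu e_def inner_prod_def uu uy power2_eq_square)
  have orth: "metric p (e i) (e j) = (if i = j then 1 else 0)" for i j
  proof (cases "i = i0 \<and> j = i0")
    case True
    then have "metric p (e i) (e j) = (D\<^sup>2 + 1) / \<sigma>\<^sup>2"
      unfolding m using c0 pos(1,2) by (simp add: e_def uu power2_eq_square field_simps)
    also have "\<dots> = 1" unfolding add.commute[of "D\<^sup>2" 1] pos(3)[symmetric] using pos(2) by simp
    finally show ?thesis using True by simp
  next
    case False
    then show ?thesis unfolding m using c0 by (auto simp: e_def uy y power2_eq_square)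
  qed
  define B where "B = q * (C / h) / \<sigma>"
  define A where "A = (B * D + C * D / (h * \<sigma>)) / h"
  note nd = profile_normal_derivative[OF f J o(2)]
  have d\<beta>: "(\<beta> has_real_derivative B) (at t)" and d\<alpha>: "(\<alpha> has_real_derivative A) (at t)"
    using nd unfolding \<beta>_def[abs_def] \<alpha>_def[abs_def] S_def[abs_def] A_def B_def C_def h_def D_def \<sigma>_def S_def by simp_all
  have sn: "(snd has_derivative snd) (at p)" by (rule has_derivative_snd[OF has_derivative_ident])
  have fs: "(fst has_derivative fst) (at p)" by (rule has_derivative_fst[OF has_derivative_ident])
  have "((\<lambda>y. \<alpha> (snd y)) has_derivative (\<lambda>v. A * snd v)) (at p)"
    by (rule has_derivative_compose[OF sn]) (use d\<alpha> in \<open>simp add: has_field_derivative_def t_def\<close>)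
  from has_derivative_scaleR[OF this fs]
  have "((\<lambda>y. \<alpha> (snd y) *\<^sub>R fst y) has_derivative (\<lambda>v. \<alpha> t *\<^sub>R fst v + (A * snd v) *\<^sub>R x)) (at p)"
    by (simp add: t_def x_def)
  moreover have "((\<lambda>y. \<beta> (snd y)) has_derivative (\<lambda>v. B * snd v)) (at p)"
    by (rule has_derivative_compose[OF sn]) (use d\<beta> in \<open>simp add: has_field_derivative_def t_def\<close>)
  ultimately have "(N has_derivative (\<lambda>v. (\<alpha> t *\<^sub>R fst v + (A * snd v) *\<^sub>R x, B * snd v))) (at p)"
    unfolding N_def[abs_def] by (rule has_derivative_Pair)
  then have fd: "frechet_derivative N (at p) = (\<lambda>v. (\<alpha> t *\<^sub>R fst v + (A * snd v) *\<^sub>R x, B * snd v))"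
    by (rule frechet_derivative_eqI)
  have pH: "p \<in> HxR" using o(1) by (simp add: HxR_iff x_def)
  have xx: "c * (x \<bullet> x) = C - 1"
    using conf_norm_sq[OF o(1)] o(3) by (simp add: power2_norm_eq_inner c_def C_def)
  have chr: "christoffel p v (N p) = ((\<alpha> t * (C - 1)) *\<^sub>R fst v, 0)" for v
  proof -
    have "christoffel p v (N p) = ((c * \<alpha> t * (x \<bullet> x)) *\<^sub>R fst v, 0)"
      unfolding christoffel_conf[OF pH] x_def[symmetric] N_def t_def[symmetric] c_def[symmetric]
      by (simp add: inner_commute algebra_simps)
    then show ?thesis by (simp add: xx[symmetric] mult_ac)
  qed
  have cov: "cov_deriv N p v = ((\<alpha> t * C) *\<^sub>R fst v + (A * snd v) *\<^sub>R x, B * snd v)" for v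
    unfolding cov_deriv_def fd chr by (simp add: algebra_simps)
  have at: "\<alpha> t = - 1 / (h * \<sigma>)" by (simp add: \<alpha>_def h_def \<sigma>_def divide_inverse)
  have curv: "- cov_deriv N p (e i) = k i *\<^sub>R e i" for i
  proof (cases "i = i0")
    case True
    have "\<alpha> t * C * (D / (c * \<sigma>)) + A * (1 / \<sigma>) * (h / c) = q * \<kappa> * (D / (c * \<sigma>))"
      using c0 pos(1,2) by (simp add: at A_def B_def \<kappa>_def field_simps)
    then have "(\<alpha> t * C) *\<^sub>R fst (e i) + (A * snd (e i)) *\<^sub>R x = (q * \<kappa>) *\<^sub>R fst (e i)"
      using True by (simp add: e_def xu scaleR_add_left[symmetric])
    moreover have "B * snd (e i) = q * \<kappa> * snd (e i)" by (simp add: B_def \<kappa>_def)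
    ultimately show ?thesis unfolding cov using True by (simp add: k_def prod_eq_iff)
  next
    case False
    then show ?thesis unfolding cov by (simp add: k_def e_def at \<kappa>_def prod_eq_iff)
  qed
  have "mean_curvature (r + 1) k = 0"
    by (rule mean_curvature_catenoid[OF r q, where i = i0 and \<kappa> = \<kappa>]) (simp_all add: k_def)
  moreover have "principal_curvatures (slab_part s f) N p k"
    unfolding principal_curvatures_def using tang orth curv by blast
  moreover have "p \<in> U" using o(2) by (simp add: U_def t_def)
  ultimately show "\<exists>U N k. p \<in> U \<and> unit_normal_on (slab_part s f) U N \<and>
      principal_curvatures (slab_part s f) N p k \<and> mean_curvature (r + 1) k = 0"
    using unit by blast
qed

section \<open>Spheres about the axis and rotational hypersurfaces bounded by them\<close>

lemma hyp_dist_0: "norm x < 1 \<Longrightarrow> hyp_dist 0 x = arcosh (conf x - 1)"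
proof -
  assume "norm x < 1"
  then have "0 < 1 - (norm x)\<^sup>2" by (simp add: power_less_one_iff)
  then have "1 + 2 * (norm x)\<^sup>2 / (1 - (norm x)\<^sup>2) = conf x - 1" by (simp add: conf_def field_simps)
  moreover have "hyp_dist 0 x = arcosh (1 + 2 * (norm x)\<^sup>2 / (1 - (norm x)\<^sup>2))"
    by (simp add: hyp_dist_def)
  ultimately show ?thesis by (simp only:)
qed

lemma axis_sphere_radius_nonneg:
  fixes p :: "'n::finite amb"
  assumes "p \<in> axis_sphere m s"
  shows "0 \<le> m"
proof -
  obtain x :: "real^'n" where "norm x < 1" "hyp_dist 0 x = m" using assms by (auto simp: axis_sphere_def)
  then show ?thesis using conf_ge_2[of x] hyp_dist_0[of x] by auto
qed

lemma axis_sphere_iff: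
  fixes p :: "'n::finite amb"
  assumes "0 \<le> m"
  shows "p \<in> axis_sphere m s \<longleftrightarrow> norm (fst p) < 1 \<and> conf (fst p) - 1 = cosh m \<and> snd p = s"
proof -
  have "arcosh (conf x - 1) = m \<longleftrightarrow> conf x - 1 = cosh m" if "norm x < 1" for x :: "real^'n"
  proof
    assume "arcosh (conf x - 1) = m"
    then show "conf x - 1 = cosh m" using conf_ge_2[OF that] by auto
  next
    assume "conf x - 1 = cosh m"
    then show "arcosh (conf x - 1) = m" using assms by (simp add: arcosh_cosh_real)
  qed
  from this[of "fst p"] have eq: "arcosh (conf (fst p) - 1) = m \<longleftrightarrow> conf (fst p) - 1 = cosh m"
    if "norm (fst p) < 1" using that .
  have "p \<in> axis_sphere m s \<longleftrightarrow> norm (fst p) < 1 \<and> hyp_dist 0 (fst p) = m \<and> snd p = s"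
    by (cases p) (auto simp: axis_sphere_def)
  also have "\<dots> \<longleftrightarrow> norm (fst p) < 1 \<and> conf (fst p) - 1 = cosh m \<and> snd p = s"
    using eq hyp_dist_0[of "fst p"] by metis
  finally show ?thesis .
qed

lemma rotational_slab_part:
  assumes f: "profile_on q a {-l<..<l} f" and s: "s < l"
  shows "rotational (slab_part s f :: 'n::finite amb set)"
proof -
  note pf = profile_onE[OF f]
  have J: "open {-l<..<l}" by simp
  have eq: "slab_part s f = catenoid l f \<inter> {p :: 'n amb. \<bar>snd p\<bar> \<le> s}"
    unfolding slab_part_def by (subst catenoid_eq) (use pf(1) s in \<open>auto simp: abs_less_iff\<close>)
  have sub: "{-s..s} \<subseteq> {-l<..<l}" using s by auto
  show ?thesis
    unfolding rotational_def
  proof (intro exI conjI ballI)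
    show "is_interval {-s..s}" by (rule is_interval_cc)
    show "open {-l<..<l}" by (rule J)
    show "{-s..s} \<subseteq> {-l<..<l}" by (rule sub)
    show "smooth_on {-l<..<l} f" unfolding smooth_on_def using profile_Ck[OF f J] by blast
    show "0 < f t" if "t \<in> {-s..s}" for t using pf(1) sub that by blast
    show "(slab_part s f :: 'n amb set) = {(tanh (f t / 2) *\<^sub>R \<zeta>, t) |\<zeta> t. norm \<zeta> = 1 \<and> t \<in> {- s..s}}"
    proof (intro equalityI subsetI)
      fix p :: "'n amb" assume "p \<in> slab_part s f"
      then have p: "p \<in> catenoid l f" "\<bar>snd p\<bar> \<le> s" unfolding eq by auto
      then obtain \<zeta> t where \<zeta>: "p = (tanh (f t / 2) *\<^sub>R \<zeta>, t)" "norm \<zeta> = 1"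
        unfolding catenoid_def by blast
      then have "t \<in> {-s..s}" using p(2) by auto
      then show "p \<in> {(tanh (f t / 2) *\<^sub>R \<zeta>, t) |\<zeta> t. norm \<zeta> = 1 \<and> t \<in> {- s..s}}" using \<zeta> by blast
    next
      fix p :: "'n amb" assume "p \<in> {(tanh (f t / 2) *\<^sub>R \<zeta>, t) |\<zeta> t. norm \<zeta> = 1 \<and> t \<in> {- s..s}}"
      then obtain \<zeta> t where \<zeta>: "p = (tanh (f t / 2) *\<^sub>R \<zeta>, t)" "norm \<zeta> = 1" "t \<in> {-s..s}" by blast
      then have t: "\<bar>t\<bar> < l" "\<bar>snd p\<bar> \<le> s" using s by auto
      then have "p \<in> catenoid l f" unfolding catenoid_def using \<zeta>(1,2) by blast
      then show "p \<in> slab_part s f" unfolding eq using t by simp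
    qed
  qed
qed

lemma boundary_slab_part_spheres:
  assumes f: "profile_on q a {-l<..<l} f" and s: "0 < s" "s < l"
    and m: "f s = m" "f (- s) = m"
  shows "boundary (slab_part s f :: 'n::finite amb set) = axis_sphere m s \<union> axis_sphere m (- s)"
proof -
  have m0: "0 \<le> m" using profile_onE(1)[OF f, of s] s m(1) by simp
  show ?thesis
    unfolding boundary_slab_part[OF f s]
  proof (intro set_eqI)
    fix p :: "'n amb"
    show "p \<in> {p \<in> slab_part s f. \<bar>snd p\<bar> = s} \<longleftrightarrow> p \<in> axis_sphere m s \<union> axis_sphere m (- s)"
      unfolding Un_iff axis_sphere_iff[OF m0] slab_part_def mem_Collect_eq gap_def
      using s m by (auto simp: abs_if split: if_splits)
  qed
qed

text \<open>The two spheres are attained at the heights \<open>\<plusminus>t0\<close>, which hence belong to the interval of heights,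
  but not to its interior by \<open>boundary_inner_point\<close>. So the interval is \<open>{- t0..t0}\<close>.\<close>

lemma rotational_bounded_by_spheres:
  fixes S :: "'n::finite amb set"
  assumes n: "2 \<le> CARD('n)" and S: "rotational S" and t0: "0 < t0"
    and bd: "boundary S = axis_sphere m t0 \<union> axis_sphere m (- t0)"
    and ne: "axis_sphere m t0 \<noteq> ({} :: 'n amb set)" "axis_sphere m (- t0) \<noteq> ({} :: 'n amb set)"
  shows "compact S" "connected S" "\<exists>p\<in>S. snd p = t0" "\<exists>p\<in>S. snd p = - t0"
proof -
  obtain I J g where I: "is_interval I" "open J" "I \<subseteq> J" "smooth_on J g" "\<forall>t\<in>I. 0 < g t"
    and Seq: "S = {(tanh (g t / 2) *\<^sub>R \<zeta>, t) | \<zeta> t. norm \<zeta> = 1 \<and> t \<in> (I :: real set)}"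
    using S unfolding rotational_def by (elim exE conjE) (rule that)
  have SI: "y \<in> S \<longleftrightarrow> (\<exists>\<zeta> t. norm \<zeta> = 1 \<and> t \<in> I \<and> y = rot_point g \<zeta> t)" for y
    unfolding Seq rot_point_def by blast
  have dg: "(g has_real_derivative deriv g t) (at t)" if "t \<in> J" for t
    using smooth_on_has_derivative[OF I(4) that]
    by (metis DERIV_deriv_iff_real_differentiable differentiableI)
  have inner: "snd p \<notin> interior I" if "p \<in> boundary S" for p
  proof
    assume t: "snd p \<in> interior I"
    have "p \<in> S" using that by (simp add: boundary_def)
    then obtain \<zeta> t where \<zeta>: "norm \<zeta> = 1" "t \<in> I" "p = rot_point g \<zeta> t" unfolding SI by blast
    have gt: "0 < g t" using I(5) \<zeta>(2) by blast
    note rp = rot_point[of \<zeta> g t, OF \<zeta>(1) gt, folded \<zeta>(3)]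
    have "\<forall>t\<in>interior I. 0 < g t \<and> (g has_real_derivative deriv g t) (at t)"
      using I(3,5) dg interior_subset[of I] by blast
    moreover have "{y. norm (fst y) < 1 \<and> snd y \<in> interior I \<and> gap g y = 0} \<subseteq> S"
    proof
      fix y :: "'n amb" assume "y \<in> {y. norm (fst y) < 1 \<and> snd y \<in> interior I \<and> gap g y = 0}"
      then have y: "norm (fst y) < 1" "snd y \<in> I" "gap g y = 0" using interior_subset by auto
      have gy: "0 < g (snd y)" using I(5) y(2) by blast
      note g = gap_0_imp_rot_point[OF y(1,3) gy]
      have "norm (fst y /\<^sub>R norm (fst y)) = 1" using g(1) by simp
      then show "y \<in> S" unfolding SI using y(2) g(2) by blast
    qed
    ultimately have "p \<notin> boundary S"
      by (rule boundary_inner_point[OF _ open_interior rp(1) t rp(2)])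
    then show False using that by blast
  qed
  have end1: "t \<in> I \<and> t \<notin> interior I \<and> (\<exists>p\<in>S. snd p = t)"
    if t: "t = t0 \<or> t = - t0" for t
  proof -
    obtain p :: "'n amb" where p: "p \<in> axis_sphere m t" using ne t by blast
    then have pb: "p \<in> boundary S" and ps: "snd p = t" using t unfolding bd by (auto simp: axis_sphere_def)
    have "p \<in> S" using pb by (simp add: boundary_def)
    moreover from this have "t \<in> I" using ps unfolding SI by (auto simp: rot_point_def)
    ultimately show ?thesis using inner[OF pb] ps by blast
  qed
  note e1 = end1[OF disjI1[OF refl]] and e2 = end1[OF disjI2[OF refl]]
  show "\<exists>p\<in>S. snd p = t0" "\<exists>p\<in>S. snd p = - t0" using e1 e2 by blast+
  have conv: "c \<in> I" if "a \<in> I" "b \<in> I" "a \<le> c" "c \<le> b" for a b c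
    using mem_is_interval_1_I[OF I(1) that] .
  have "I = {- t0..t0}"
  proof (intro equalityI subsetI)
    fix t assume t: "t \<in> I"
    have "t \<le> t0"
    proof (rule ccontr)
      assume "\<not> t \<le> t0"
      moreover have "{- t0<..<t} \<subseteq> I" using conv[of "- t0" t] e2 t by auto
      then have "{- t0<..<t} \<subseteq> interior I" by (rule interior_maximal) simp
      moreover have "t0 \<in> {- t0<..<t}" using \<open>\<not> t \<le> t0\<close> t0 by simp
      ultimately show False using e1 by blast
    qed
    moreover have "- t0 \<le> t"
    proof (rule ccontr)
      assume "\<not> - t0 \<le> t"
      moreover have "{t<..<t0} \<subseteq> I" using conv[of t t0] e1 t by auto
      then have "{t<..<t0} \<subseteq> interior I" by (rule interior_maximal) simp
      moreover have "- t0 \<in> {t<..<t0}" using \<open>\<not> - t0 \<le> t\<close> t0 by simp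
      ultimately show False using e2 by blast
    qed
    ultimately show "t \<in> {- t0..t0}" by simp
  next
    fix t assume "t \<in> {- t0..t0}"
    then show "t \<in> I" using conv[of "- t0" t0 t] e1 e2 by auto
  qed
  then have Sim: "S = (\<lambda>(\<zeta>, t). rot_point g \<zeta> t) ` (sphere 0 1 \<times> {- t0..t0})"
  proof (intro set_eqI iffI)
    fix y assume "y \<in> S"
    then obtain \<zeta> t where \<zeta>: "norm \<zeta> = 1" "t \<in> I" "y = rot_point g \<zeta> t" unfolding SI by blast
    then have "(\<zeta>, t) \<in> sphere 0 1 \<times> {- t0..t0}" using \<open>I = {- t0..t0}\<close> by simp
    then show "y \<in> (\<lambda>(\<zeta>, t). rot_point g \<zeta> t) ` (sphere 0 1 \<times> {- t0..t0})"
      by (rule rev_image_eqI) (simp add: \<zeta>(3))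
  next
    fix y :: "'n amb" assume "y \<in> (\<lambda>(\<zeta>, t). rot_point g \<zeta> t) ` (sphere 0 1 \<times> {- t0..t0})"
    then obtain \<zeta> t where "norm \<zeta> = 1" "t \<in> I" "y = rot_point g \<zeta> t"
      using \<open>I = {- t0..t0}\<close> by (auto elim!: imageE)
    then show "y \<in> S" unfolding SI by blast
  qed
  have cg: "continuous_on J g"
    by (rule continuous_at_imp_continuous_on) (use dg DERIV_isCont in blast)
  have sub: "snd ` (sphere (0 :: real^'n) 1 \<times> {- t0..t0}) \<subseteq> J"
    using I(3) unfolding \<open>I = {- t0..t0}\<close> by (force simp del: atLeastAtMost_iff)
  have cs: "continuous_on (sphere (0 :: real^'n) 1 \<times> {- t0..t0}) snd"
    by (rule continuous_on_snd[OF continuous_on_id])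
  have cgs: "continuous_on (sphere 0 1 \<times> {- t0..t0}) (\<lambda>z::(real^'n) \<times> real. g (snd z))"
    by (rule continuous_on_compose2[OF cg cs sub])
  have cont: "continuous_on (sphere 0 1 \<times> {- t0..t0}) (\<lambda>(\<zeta>, t). rot_point g (\<zeta> :: real^'n) t)"
    unfolding rot_point_def case_prod_unfold
    by (intro continuous_on_Pair continuous_on_scaleR continuous_on_tanh continuous_on_divide cgs cs
        continuous_on_const continuous_on_fst continuous_on_id) auto
  show "compact S"
    unfolding Sim by (intro compact_continuous_image[OF cont] compact_Times) auto
  have "connected (sphere (0 :: real^'n) 1)"
    using connected_sphere[of "0 :: real^'n" 1] n by simp
  then show "connected S"
    unfolding Sim by (intro connected_continuous_image[OF cont] connected_Times) auto
qed

theorem theorem3p1: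
  fixes M :: "'n::finite amb set"
    and r :: nat
    and q T A M\<^sub>q t\<^sub>0 \<alpha> a\<^sub>0 m\<^sub>0 :: real
    and f :: "real \<Rightarrow> real \<Rightarrow> real"
    and L :: "real \<Rightarrow> real"
  assumes r: "1 \<le> r" "r + 1 < CARD('n)"
    and q: "q = (real CARD('n) - real r - 1) / (real r + 1)"
    and f_L: "\<And>a. 0 < a \<Longrightarrow> maximal_profile q a (L a) (f a)"
    and M\<^sub>q: "q < 1 \<Longrightarrow> M\<^sub>q = arcosh (sqrt (1 / (1 - q)))"
    and A: "q < 1 \<Longrightarrow> A \<in> {0<..<M\<^sub>q} \<and> (\<forall>a\<in>{0<..<M\<^sub>q} - {A}. lam q a M\<^sub>q < lam q A M\<^sub>q)"
    and T: "T = (if 1 \<le> q then pi * (real r + 1) / (2 * (real CARD('n) - real r - 1)) else lam q A M\<^sub>q)"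
    and t\<^sub>0: "t\<^sub>0 \<in> {0<..<T}"
    and \<alpha>: "0 < \<alpha>" "L \<alpha> = t\<^sub>0"
    and a\<^sub>0: "\<alpha> < a\<^sub>0" "f a\<^sub>0 t\<^sub>0 = m\<^sub>0" "\<forall>a\<in>{\<alpha><..} - {a\<^sub>0}. m\<^sub>0 < f a t\<^sub>0"
    and M: "compact M" "connected M" "hypersurface M" "r_minimal r M"
    and bdry: "boundary M \<subseteq> slice t\<^sub>0 \<union> slice (- t\<^sub>0)"
    and bdry_plus: "boundary M \<inter> slice t\<^sub>0 \<noteq> {}" "boundary M \<inter> slice t\<^sub>0 \<subseteq> axis_sphere m\<^sub>0 t\<^sub>0"
    and bdry_minus: "boundary M \<inter> slice (- t\<^sub>0) \<noteq> {}"
      "boundary M \<inter> slice (- t\<^sub>0) \<subseteq> axis_sphere m\<^sub>0 (- t\<^sub>0)"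
  shows "M = catenoid (L a\<^sub>0) (f a\<^sub>0) \<inter> {p. \<bar>snd p\<bar> \<le> t\<^sub>0} \<and>
    (\<forall>S :: 'n amb set.
       hypersurface S \<and> r_minimal r S \<and> rotational S \<and>
         boundary S = axis_sphere m\<^sub>0 t\<^sub>0 \<union> axis_sphere m\<^sub>0 (- t\<^sub>0)
       \<longleftrightarrow> S = catenoid (L a\<^sub>0) (f a\<^sub>0) \<inter> {p. \<bar>snd p\<bar> \<le> t\<^sub>0})"
proof -
  have t0: "0 < t\<^sub>0" using t\<^sub>0 by simp
  have a0: "0 < a\<^sub>0" using \<alpha>(1) a\<^sub>0(1) by simp
  have ne: "axis_sphere m\<^sub>0 t\<^sub>0 \<noteq> ({} :: 'n amb set)" "axis_sphere m\<^sub>0 (- t\<^sub>0) \<noteq> ({} :: 'n amb set)"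
    using bdry_plus bdry_minus by auto
  then obtain z :: "'n amb" where "z \<in> axis_sphere m\<^sub>0 t\<^sub>0" by blast
  then have m0: "0 \<le> m\<^sub>0" by (rule axis_sphere_radius_nonneg)
  \<comment> \<open>Stated for any hypersurface, since it is applied to \<open>M\<close> and again to rotational competitors.\<close>
  have key: "t\<^sub>0 < L a\<^sub>0 \<and> S = slab_part t\<^sub>0 (f a\<^sub>0)"
    if S: "compact S" "connected S" "hypersurface S" "r_minimal r S"
      "\<exists>p\<in>S. snd p = t\<^sub>0" "\<exists>p\<in>S. snd p = - t\<^sub>0"
      and b: "boundary S \<subseteq> axis_sphere m\<^sub>0 t\<^sub>0 \<union> axis_sphere m\<^sub>0 (- t\<^sub>0)"
    for S :: "'n amb set"
  proof -
    have bS: "conf (fst p) - 1 = cosh m\<^sub>0 \<and> \<bar>snd p\<bar> = t\<^sub>0" if "p \<in> boundary S" for p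
      using b that t0 by (auto simp: axis_sphere_iff[OF m0] dest!: subsetD)
    interpret sweep S r q t\<^sub>0 f L
      by unfold_locales (use r q f_L t0 S bS in auto)
    show ?thesis
      using unique_hypersurface[OF _ m0 \<alpha> a\<^sub>0] bS by blast
  qed
  have bM: "boundary M \<subseteq> axis_sphere m\<^sub>0 t\<^sub>0 \<union> axis_sphere m\<^sub>0 (- t\<^sub>0)"
    using bdry bdry_plus(2) bdry_minus(2) by blast
  have "\<exists>p\<in>M. snd p = t\<^sub>0" "\<exists>p\<in>M. snd p = - t\<^sub>0"
    using bdry_plus(1) bdry_minus(1) by (force simp: boundary_def slice_def)+
  from key[OF M this bM] have L0: "t\<^sub>0 < L a\<^sub>0" and M_eq: "M = slab_part t\<^sub>0 (f a\<^sub>0)" by blast+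
  have prof: "profile_on q a\<^sub>0 {- L a\<^sub>0<..<L a\<^sub>0} (f a\<^sub>0)"
    using f_L[OF a0] by (simp add: maximal_profile_def)
  have cat: "catenoid (L a\<^sub>0) (f a\<^sub>0) \<inter> {p. \<bar>snd p\<bar> \<le> t\<^sub>0} = (slab_part t\<^sub>0 (f a\<^sub>0) :: 'n amb set)"
    unfolding slab_part_def
    by (subst catenoid_eq) (use profile_onE(1)[OF prof] L0 in \<open>auto simp: abs_less_iff\<close>)
  have q0: "0 < q" using r by (simp add: q)
  have even: "f a\<^sub>0 (- t\<^sub>0) = m\<^sub>0"
    using profile_even[OF q0 a0 prof, of t\<^sub>0] L0 t0 a\<^sub>0(2) by simp
  have "hypersurface S \<and> r_minimal r S \<and> rotational S \<and>
         boundary S = axis_sphere m\<^sub>0 t\<^sub>0 \<union> axis_sphere m\<^sub>0 (- t\<^sub>0)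
       \<longleftrightarrow> S = slab_part t\<^sub>0 (f a\<^sub>0)" for S :: "'n amb set"
  proof
    assume "S = slab_part t\<^sub>0 (f a\<^sub>0)"
    then show "hypersurface S \<and> r_minimal r S \<and> rotational S \<and>
         boundary S = axis_sphere m\<^sub>0 t\<^sub>0 \<union> axis_sphere m\<^sub>0 (- t\<^sub>0)"
      using hypersurface_slab_part[OF prof t0 L0] r_minimal_slab_part[OF r(2) q prof t0 L0]
        rotational_slab_part[OF prof L0] boundary_slab_part_spheres[OF prof t0 L0 a\<^sub>0(2) even] by simp
  next
    assume S: "hypersurface S \<and> r_minimal r S \<and> rotational S \<and>
         boundary S = axis_sphere m\<^sub>0 t\<^sub>0 \<union> axis_sphere m\<^sub>0 (- t\<^sub>0)"
    have n: "2 \<le> CARD('n)" using r by simp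
    have rot: "rotational S" and bd: "boundary S = axis_sphere m\<^sub>0 t\<^sub>0 \<union> axis_sphere m\<^sub>0 (- t\<^sub>0)"
      using S by blast+
    note R = rotational_bounded_by_spheres[OF n rot t0 bd ne]
    show "S = slab_part t\<^sub>0 (f a\<^sub>0)" using key[OF R(1,2) _ _ R(3,4)] S by blast
  qed
  then show ?thesis unfolding cat using M_eq by blast
qed

end
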